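(* Let $\lambda\in\mathfrak h^*$. For $\varphi\in\operatorname{Hom}_U(L(\lambda),L(\lambda)\otimes F)$ write $\varphi(\overline{\mathbf 1}_\lambda)=\overline{\mathbf 1}_\lambda\otimes f_\varphi+\sum_{\mu<\lambda}v_\mu\otimes f_\mu$, where $v_\mu\in L(\lambda)[\mu]$ (a schematic expression: the component in $L(\lambda)[\mu]\otimes F$ may be a sum of such tensors). Then the map $\Theta:\operatorname{Hom}_U(L(\lambda),L(\lambda)\otimes F)\to F[0]$, $\varphi\mapsto f_\varphi$, is an embedding (injective linear map), and its image equals $F[0]^{K_\lambda+\widetilde K_\lambda}$.
   Context: Let $\Bbbk$ be the field obtained from $\mathbb C(q)$ by adjoining all fractional powers $q^{1/n}$, $n\in\mathbb N=\{1,2,3,\dots\}$. Let $(a_{ij})$ be an $r\times r$ Cartan matrix of finite type with realization $(\mathfrak h,\Pi,\Pi^\vee)$ over $\mathbb Q$: $\Pi=\{\alpha_1,\dots,\alpha_r\}\subset\mathfrak h^*$ are the simple roots, $\Pi^\vee=\{\alpha_1^\vee,\dots,\alpha_r^\vee\}\subset\mathfrak h$ the simple coroots, $a_{ij}=\langle\alpha_j,\alpha_i^\vee\rangle$; $u_1,\dots,u_r\in\mathfrak h$ are the simple coweights, $\langle\alpha_i,u_j\rangle=\delta_{ij}$. Let $(\cdot|\cdot)$ be the invariant scalar product on $\mathfrak h^*$ with $(\alpha|\alpha)=2$ for short roots, $d_i=(\alpha_i|\alpha_i)/2$ (so $d_ia_{ij}=d_ja_{ji}$), $[k]_i=\frac{q^{kd_i}-q^{-kd_i}}{q^{d_i}-q^{-d_i}}$,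 $[k]_i!=[1]_i\cdots[k]_i$. Let $Q_+=\sum_i\mathbb Z_{\ge0}\alpha_i$, and $\lambda\ge\mu$ iff $\lambda-\mu\in Q_+$. $U=\check U_q\mathfrak g$ is the $\Bbbk$-algebra generated by $t_i^{\pm1},e_i,f_i$ ($1\le i\le r$) with the $t_i$ commuting and: $t_ie_jt_i^{-1}=q^{d_i\delta_{ij}}e_j$, $t_if_jt_i^{-1}=q^{-d_i\delta_{ij}}f_j$, $e_if_j-f_je_i=\delta_{ij}\frac{k_i-k_i^{-1}}{q^{d_i}-q^{-d_i}}$ with $k_i=\prod_jt_j^{a_{ji}}$, and for $i\ne j$ the Serre relations $\sum_{m=0}^{1-a_{ij}}\frac{(-1)^m}{[m]_i!\,[1-a_{ij}-m]_i!}e_i^me_je_i^{1-a_{ij}-m}=0$ and the same with $f$ in place of $e$. It is a Hopf algebra: $\Delta(t_i)=t_i\otimes t_i$, $\Delta(e_i)=e_i\otimes1+k_i\otimes e_i$, $\Delta(f_i)=f_i\otimes k_i^{-1}+1\otimes f_i$; $\varepsilon(t_i)=1$, $\varepsilon(e_i)=\varepsilon(f_i)=0$; antipode $\sigma(t_i)=t_i^{-1}$, $\sigma(e_i)=-k_i^{-1}e_i$, $\sigma(f_i)=-f_ik_i$. $U^0,U^+,U^-$ are the subalgebras generated by the $t_i^{\pm1}$, the $e_i$, the $f_i$; $U=U^-U^0U^+$. $T$ is the group generated by the $t_i$. Each $\lambda\in\mathfrak h^*$ defines the character $q^\lambda:U^0\to\Bbbk$, $t_i\mapsto q^{d_i\langle\lambda,u_i\rangle}$.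 For a $U$-module $V$, $V[\mu]=\{v: tv=q^\mu(t)v\ \forall t\in T\}$. $M(\lambda)$ is the Verma module with highest weight vector $\mathbf 1_\lambda$ ($e_i\mathbf 1_\lambda=0$, $t\mathbf 1_\lambda=q^\lambda(t)\mathbf 1_\lambda$), free over $U^-$ on $\mathbf 1_\lambda$. With $U^\pm_+=\ker\varepsilon|_{U^\pm}$, let $x\mapsto(x)_0$ be the projection $U\to U^0$ along $U^-_+U+UU^+_+$. Put $\pi_\lambda(x\otimes y)=q^\lambda((\sigma(x)y)_0)$ for $x\in U^+$, $y\in U^-$, $K_\lambda=\{y\in U^-:\pi_\lambda(x\otimes y)=0\ \forall x\in U^+\}$, $\widetilde K_\lambda=\{x\in U^+:\pi_\lambda(x\otimes y)=0\ \forall y\in U^-\}$. $K_\lambda\mathbf 1_\lambda$ is the largest proper submodule of $M(\lambda)$; $L(\lambda)=M(\lambda)/K_\lambda\mathbf 1_\lambda$ is irreducible, and $\overline{\mathbf 1}_\lambda$ is the image of $\mathbf 1_\lambda$. $F=\Bbbk[G]_q$ is the quantized algebra of regular functions on the connected simply connected group $G$ with Cartan matrix $(a_{ij})$: the Hopf subalgebra of the dual Hopf algebra of $U$ spanned by matrix elements of the finite-dimensional modules $L(\mu)$, $\mu$ dominant integral. The left regular action of $U$ on $F$ is $(\overrightarrow{a}f)(x)=f(xa)$. $F[0]$ is the zero weight space for the left regular action, and $F[0]^{K}$ denotes the set of $f\in F[0]$ with $\overrightarrow{a}f=0$ for all $a\in K$; thus $F[0]^{K_\lambda+\widetilde K_\lambda}$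 consists of elements of $F[0]$ annihilated by both $K_\lambda$ and $\widetilde K_\lambda$. In $\operatorname{Hom}_U(L(\lambda),L(\lambda)\otimes F)$, $F$ carries the left regular action and $L(\lambda)\otimes F$ the action via $\Delta$. *)

theory Defs
  imports
    "HOL-Analysis.Finite_Cartesian_Product"
    "HOL-Algebra.Algebraic_Closure_Type"
    "HOL-Algebra.Generated_Rings"
    "HOL-Algebra.Generated_Groups"
    "HOL-Library.Poly_Mapping"
    "HOL-Library.Product_Plus"
    "HOL-Computational_Algebra.Fraction_Field"
begin

section \<open>The ground field\<close>

text \<open>\<^typ>\<open>rat \<Rightarrow>\<^sub>0 complex\<close> is the group algebra of the additive group of the rationals, that is,
  the ring of Laurent polynomials in all \<open>q\<^sup>1\<^sup>/\<^sup>n\<close>. Its fraction field is the union of the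
  fields of rational functions in \<open>q\<^sup>1\<^sup>/\<^sup>n\<close>, that is, \<open>\<complex>(q)\<close> with all \<open>q\<^sup>1\<^sup>/\<^sup>n\<close> adjoined.\<close>

type_synonym kk = "(rat \<Rightarrow>\<^sub>0 complex) fract"

definition qpow :: "rat \<Rightarrow> kk" where
  "qpow s = Fract (Poly_Mapping.single s 1) 1"

abbreviation Kring :: "kk ring" where
  "Kring \<equiv> ring_of_type_algebra"


section \<open>Cartan matrices of finite type and their realizations\<close>

definition finite_type_cartan :: "('i::finite \<Rightarrow> 'i \<Rightarrow> int) \<Rightarrow> bool" where
  "finite_type_cartan a \<longleftrightarrow>
     (\<forall>i. a i i = 2) \<and>
     (\<forall>i j. i \<noteq> j \<longrightarrow> a i j \<le> 0) \<and>
     (\<forall>i j. a i j = 0 \<longrightarrow> a j i = 0) \<and>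
     (\<exists>D :: 'i \<Rightarrow> real.
        (\<forall>i. D i > 0) \<and>
        (\<forall>i j. D i * of_int (a i j) = D j * of_int (a j i)) \<and>
        (\<forall>x :: real ^ 'i. x \<noteq> 0 \<longrightarrow> (\<Sum>i\<in>UNIV. \<Sum>j\<in>UNIV. D i * of_int (a i j) * x $ i * x $ j) > 0))"

text \<open>For a matrix of finite type the simple roots form a basis of \<open>\<hh>\<^sup>*\<close> and the simple coweights the
  dual basis of \<open>\<hh>\<close>. Both spaces are modelled by coordinates in these bases. Thus \<open>\<lambda> $ i\<close> is
  \<open>\<langle>\<lambda>, u\<^sub>i\<rangle>\<close>, and \<open>\<langle>\<alpha>\<^sub>j, \<alpha>\<^sub>i\<^sup>\<or>\<rangle> = a i j\<close> forces the formula for the coroots.\<close>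

type_synonym 'i weight = "rat ^ 'i"
type_synonym 'i coweight = "rat ^ 'i"

definition pairing :: "'i::finite weight \<Rightarrow> 'i coweight \<Rightarrow> rat" where
  "pairing l h = (\<Sum>i\<in>UNIV. l $ i * h $ i)"

definition simple_root :: "'i::finite \<Rightarrow> 'i weight" where
  "simple_root i = axis i 1"

definition simple_coweight :: "'i::finite \<Rightarrow> 'i coweight" where
  "simple_coweight i = axis i 1"

definition simple_coroot :: "('i::finite \<Rightarrow> 'i \<Rightarrow> int) \<Rightarrow> 'i \<Rightarrow> 'i coweight" where
  "simple_coroot a i = (\<chi> j. of_int (a i j))"

definition reflection :: "('i::finite \<Rightarrow> 'i \<Rightarrow> int) \<Rightarrow> 'i \<Rightarrow> 'i weight \<Rightarrow> 'i weight" where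
  "reflection a i l = l - pairing l (simple_coroot a i) *s simple_root i"

inductive_set roots :: "('i::finite \<Rightarrow> 'i \<Rightarrow> int) \<Rightarrow> 'i weight set" for a where
  simple: "simple_root i \<in> roots a"
| reflect: "b \<in> roots a \<Longrightarrow> reflection a i b \<in> roots a"

definition invariant_scalar_product ::
    "('i::finite \<Rightarrow> 'i \<Rightarrow> int) \<Rightarrow> ('i weight \<Rightarrow> 'i weight \<Rightarrow> rat) \<Rightarrow> bool" where
  "invariant_scalar_product a B \<longleftrightarrow>
     (\<forall>x y. B x y = B y x) \<and>
     (\<forall>x y z. B (x + y) z = B x z + B y z) \<and>
     (\<forall>c x y. B (c *s x) y = c * B x y) \<and>
     (\<forall>x. x \<noteq> 0 \<longrightarrow> B x x > 0) \<and>
     (\<forall>i x y. B (reflection a i x) (reflection a i y) = B x y)"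

text \<open>The matrix need not be indecomposable; a root is short if its length is minimal in its
  irreducible component, so every root of a simply laced component is short.\<close>

definition same_component ::
    "('i::finite \<Rightarrow> 'i \<Rightarrow> int) \<Rightarrow> ('i weight \<Rightarrow> 'i weight \<Rightarrow> rat) \<Rightarrow> ('i weight \<times> 'i weight) set" where
  "same_component a B = {(b, c). b \<in> roots a \<and> c \<in> roots a \<and> B b c \<noteq> 0}\<^sup>*"

definition short_root ::
    "('i::finite \<Rightarrow> 'i \<Rightarrow> int) \<Rightarrow> ('i weight \<Rightarrow> 'i weight \<Rightarrow> rat) \<Rightarrow> 'i weight \<Rightarrow> bool" where
  "short_root a B b \<longleftrightarrow>
     b \<in> roots a \<and> (\<forall>c. (b, c) \<in> same_component a B \<longrightarrow> B b b \<le> B c c)"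

definition root_cone :: "'i::finite weight set" where
  "root_cone = {l. \<exists>n :: 'i \<Rightarrow> nat. l = (\<Sum>i\<in>UNIV. of_nat (n i) *s simple_root i)}"

definition wt_le :: "'i::finite weight \<Rightarrow> 'i weight \<Rightarrow> bool" where
  "wt_le m l \<longleftrightarrow> l - m \<in> root_cone"

definition wt_less :: "'i::finite weight \<Rightarrow> 'i weight \<Rightarrow> bool" where
  "wt_less m l \<longleftrightarrow> wt_le m l \<and> m \<noteq> l"


section \<open>Free associative algebras\<close>

text \<open>The product on \<^typ>\<open>'a \<Rightarrow>\<^sub>0 'b\<close> is convolution with respect to the addition of \<^typ>\<open>'a\<close>.
  With concatenation as addition of lists, \<^typ>\<open>'g list \<Rightarrow>\<^sub>0 'b\<close> is the free associative algebra
  on the generators \<^typ>\<open>'g\<close>.\<close>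

instantiation list :: (type) monoid_add
begin

definition zero_list :: "'a list" where
  "zero_list = []"

definition plus_list :: "'a list \<Rightarrow> 'a list \<Rightarrow> 'a list" where
  "plus_list xs ys = xs @ ys"

instance
  by standard (simp_all add: zero_list_def plus_list_def)

end

datatype 'i gen = GT 'i | GTinv 'i | GE 'i | GF 'i

type_synonym 'i falg = "'i gen list \<Rightarrow>\<^sub>0 kk"
type_synonym 'i ualg = "'i falg set"
type_synonym 'i vermavec = "'i ualg set"
type_synonym 'i irrvec = "'i vermavec set"
type_synonym 'i ufun = "'i ualg \<Rightarrow> kk"

text \<open>Elements of tensor products are cosets of formal linear combinations of pairs.\<close>

type_synonym ('v, 'w) tens = "('v \<times> 'w \<Rightarrow>\<^sub>0 kk) set"
type_synonym 'i LFvec = "('i irrvec, 'i ufun) tens"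

definition gen :: "'i gen \<Rightarrow> 'i falg" where
  "gen g = Poly_Mapping.single [g] 1"

definition fscal :: "kk \<Rightarrow> 'i falg" where
  "fscal c = Poly_Mapping.single 0 c"

text \<open>The \<open>t\<^sub>j\<close> do not commute in the free algebra, so products over all \<open>j\<close> are taken along some fixed
  enumeration of the indices; the class in the quotient does not depend on it.\<close>

definition index_list :: "'i::finite list" where
  "index_list = (SOME js. distinct js \<and> set js = UNIV)"

definition gen_T_power :: "'i \<Rightarrow> int \<Rightarrow> 'i falg" where
  "gen_T_power j n = (if n \<ge> 0 then gen (GT j) ^ nat n else gen (GTinv j) ^ nat (- n))"

definition gen_K :: "('i::finite \<Rightarrow> 'i \<Rightarrow> int) \<Rightarrow> 'i \<Rightarrow> 'i falg" where
  "gen_K a i = prod_list (map (\<lambda>j. gen_T_power j (a j i)) index_list)"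

definition gen_Kinv :: "('i::finite \<Rightarrow> 'i \<Rightarrow> int) \<Rightarrow> 'i \<Rightarrow> 'i falg" where
  "gen_Kinv a i = prod_list (map (\<lambda>j. gen_T_power j (- a j i)) index_list)"


section \<open>Modules over a not necessarily commutative ring\<close>

text \<open>The record \<^typ>\<open>('u, 'v) module\<close> is used for left modules; its fields \<open>mult\<close> and \<open>one\<close>
  play no role and are left undefined.\<close>

definition quotient_module :: "('u, 'v) module \<Rightarrow> 'v set \<Rightarrow> ('u, 'v set) module" where
  "quotient_module V W =
     \<lparr>carrier = a_rcosets\<^bsub>V\<^esub> W, monoid.mult = undefined, one = undefined, zero = W, add = set_add V,
      module.smult = (\<lambda>u A. \<Union>x\<in>A. W +>\<^bsub>V\<^esub> (u \<odot>\<^bsub>V\<^esub> x))\<rparr>"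

definition module_homs ::
    "('u, 'm) ring_scheme \<Rightarrow> ('u, 'v) module \<Rightarrow> ('u, 'w) module \<Rightarrow> ('v \<Rightarrow> 'w) set" where
  "module_homs R V W =
     {h \<in> carrier V \<rightarrow>\<^sub>E carrier W.
        (\<forall>x\<in>carrier V. \<forall>y\<in>carrier V. h (x \<oplus>\<^bsub>V\<^esub> y) = h x \<oplus>\<^bsub>W\<^esub> h y) \<and>
        (\<forall>u\<in>carrier R. \<forall>x\<in>carrier V. h (u \<odot>\<^bsub>V\<^esub> x) = u \<odot>\<^bsub>W\<^esub> h x)}"

definition opposite_ring :: "'u ring \<Rightarrow> 'u ring" where
  "opposite_ring R = R\<lparr>monoid.mult := (\<lambda>x y. y \<otimes>\<^bsub>R\<^esub> x)\<rparr>"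


section \<open>The quantized enveloping algebra\<close>

locale quantum_datum =
  fixes a :: "'i::finite \<Rightarrow> 'i \<Rightarrow> int"
    and form :: "'i weight \<Rightarrow> 'i weight \<Rightarrow> rat"
  assumes finite_type: "finite_type_cartan a"
    and scalar_product: "invariant_scalar_product a form"
    and short_normalized: "short_root a form b \<Longrightarrow> form b b = 2"
begin

definition d :: "'i \<Rightarrow> rat" where
  "d i = form (simple_root i) (simple_root i) / 2"

definition qint :: "'i \<Rightarrow> nat \<Rightarrow> kk" where
  "qint i n = (qpow (of_nat n * d i) - qpow (- (of_nat n * d i))) / (qpow (d i) - qpow (- d i))"

definition qfact :: "'i \<Rightarrow> nat \<Rightarrow> kk" where
  "qfact i n = (\<Prod>m=1..n. qint i m)"

definition serre :: "('i \<Rightarrow> 'i gen) \<Rightarrow> 'i \<Rightarrow> 'i \<Rightarrow> 'i falg" where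
  "serre A i j =
     (let N = nat (1 - a i j) in
      \<Sum>m\<le>N. fscal ((- 1) ^ m / (qfact i m * qfact i (N - m)))
              * gen (A i) ^ m * gen (A j) * gen (A i) ^ (N - m))"

definition relators :: "'i falg set" where
  "relators =
     (\<Union>i. {gen (GT i) * gen (GTinv i) - 1, gen (GTinv i) * gen (GT i) - 1}) \<union>
     (\<Union>i j. {gen (GT i) * gen (GT j) - gen (GT j) * gen (GT i),
              gen (GT i) * gen (GE j) * gen (GTinv i)
                - fscal (qpow (if i = j then d i else 0)) * gen (GE j),
              gen (GT i) * gen (GF j) * gen (GTinv i)
                - fscal (qpow (- (if i = j then d i else 0))) * gen (GF j),
              gen (GE i) * gen (GF j) - gen (GF j) * gen (GE i)
                - (if i = j
                   then fscal (1 / (qpow (d i) - qpow (- d i))) * (gen_K a i - gen_Kinv a i)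
                   else 0)}) \<union>
     (\<Union>i. \<Union>j\<in>- {i}. {serre GE i j, serre GF i j})"

definition relator_ideal :: "'i falg set" where
  "relator_ideal = Idl\<^bsub>ring_of_type_algebra\<^esub> relators"

definition U :: "'i ualg ring" where
  "U = ring_of_type_algebra Quot relator_ideal"

definition cls :: "'i falg \<Rightarrow> 'i ualg" where
  "cls p = relator_ideal +>\<^bsub>ring_of_type_algebra\<^esub> p"

definition scal :: "kk \<Rightarrow> 'i ualg" where "scal c = cls (fscal c)"
definition t :: "'i \<Rightarrow> 'i ualg" where "t i = cls (gen (GT i))"
definition tinv :: "'i \<Rightarrow> 'i ualg" where "tinv i = cls (gen (GTinv i))"
definition e :: "'i \<Rightarrow> 'i ualg" where "e i = cls (gen (GE i))"
definition f :: "'i \<Rightarrow> 'i ualg" where "f i = cls (gen (GF i))"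
definition k :: "'i \<Rightarrow> 'i ualg" where "k i = cls (gen_K a i)"
definition kinv :: "'i \<Rightarrow> 'i ualg" where "kinv i = cls (gen_Kinv a i)"

definition subalgebra_gen :: "'i ualg set \<Rightarrow> 'i ualg set" where
  "subalgebra_gen S = generate_ring U (range scal \<union> S)"

definition U0 :: "'i ualg set" where "U0 = subalgebra_gen (range t \<union> range tinv)"
definition Upos :: "'i ualg set" where "Upos = subalgebra_gen (range e)"
definition Uneg :: "'i ualg set" where "Uneg = subalgebra_gen (range f)"

definition Tgroup :: "'i ualg set" where
  "Tgroup = generate U (range t)"

definition alg_homs :: "'i ualg ring \<Rightarrow> 'b ring \<Rightarrow> (kk \<Rightarrow> 'b) \<Rightarrow> ('i ualg \<Rightarrow> 'b) set" where
  "alg_homs D S \<iota> = {h \<in> ring_hom D S \<inter> extensional (carrier D). \<forall>c. h (scal c) = \<iota> c}"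

text \<open>Vector spaces over the ground field occur below only as underlying spaces of modules over
  the algebra, where \<^term>\<open>c :: kk\<close> acts as the scalar \<^term>\<open>scal c\<close> of the algebra.\<close>

definition ksubspaces :: "('i ualg, 'v) module \<Rightarrow> 'v set set" where
  "ksubspaces V =
     {W. W \<subseteq> carrier V \<and> \<zero>\<^bsub>V\<^esub> \<in> W \<and>
         (\<forall>x\<in>W. \<forall>y\<in>W. x \<oplus>\<^bsub>V\<^esub> y \<in> W) \<and> (\<forall>c. \<forall>x\<in>W. scal c \<odot>\<^bsub>V\<^esub> x \<in> W)}"

definition kspan :: "('i ualg, 'v) module \<Rightarrow> 'v set \<Rightarrow> 'v set" where
  "kspan V S = \<Inter>{W \<in> ksubspaces V. S \<subseteq> W}"

definition finite_dimensional :: "('i ualg, 'v) module \<Rightarrow> bool" where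
  "finite_dimensional V \<longleftrightarrow> (\<exists>S. finite S \<and> S \<subseteq> carrier V \<and> kspan V S = carrier V)"

definition klinear_forms :: "('i ualg, 'v) module \<Rightarrow> ('v \<Rightarrow> kk) set" where
  "klinear_forms V =
     {l \<in> extensional (carrier V).
        (\<forall>x\<in>carrier V. \<forall>y\<in>carrier V. l (x \<oplus>\<^bsub>V\<^esub> y) = l x + l y) \<and>
        (\<forall>c. \<forall>x\<in>carrier V. l (scal c \<odot>\<^bsub>V\<^esub> x) = c * l x)}"

definition Ureg :: "('i ualg, 'i ualg) module" where
  "Ureg = \<lparr>carrier = carrier U, monoid.mult = undefined, one = undefined, zero = \<zero>\<^bsub>U\<^esub>, add = add U,
           module.smult = monoid.mult U\<rparr>"


subsection \<open>Tensor products\<close>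

text \<open>The tensor product over the ground field of \<open>V\<close> and \<open>W\<close> is the space of formal linear
  combinations of pairs modulo the bilinearity relations.\<close>

definition formal :: "('i ualg, 'v) module \<Rightarrow> ('i ualg, 'w) module \<Rightarrow> ('v \<times> 'w \<Rightarrow>\<^sub>0 kk) set"
  where "formal V W = {P. Poly_Mapping.keys P \<subseteq> carrier V \<times> carrier W}"

inductive_set bilinear_rels ::
    "('i ualg, 'v) module \<Rightarrow> ('i ualg, 'w) module \<Rightarrow> ('v \<times> 'w \<Rightarrow>\<^sub>0 kk) set"
  for V :: "('i ualg, 'v) module" and W :: "('i ualg, 'w) module" where
  zero: "0 \<in> bilinear_rels V W"
| add: "P \<in> bilinear_rels V W \<Longrightarrow> Q \<in> bilinear_rels V W \<Longrightarrow> P + Q \<in> bilinear_rels V W"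
| add_left: "v \<in> carrier V \<Longrightarrow> v' \<in> carrier V \<Longrightarrow> w \<in> carrier W \<Longrightarrow>
    Poly_Mapping.single (v \<oplus>\<^bsub>V\<^esub> v', w) c
      - Poly_Mapping.single (v, w) c - Poly_Mapping.single (v', w) c \<in> bilinear_rels V W"
| add_right: "v \<in> carrier V \<Longrightarrow> w \<in> carrier W \<Longrightarrow> w' \<in> carrier W \<Longrightarrow>
    Poly_Mapping.single (v, w \<oplus>\<^bsub>W\<^esub> w') c
      - Poly_Mapping.single (v, w) c - Poly_Mapping.single (v, w') c \<in> bilinear_rels V W"
| scale_left: "v \<in> carrier V \<Longrightarrow> w \<in> carrier W \<Longrightarrow>
    Poly_Mapping.single (scal b \<odot>\<^bsub>V\<^esub> v, w) c - Poly_Mapping.single (v, w) (c * b) \<in> bilinear_rels V W"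
| scale_right: "v \<in> carrier V \<Longrightarrow> w \<in> carrier W \<Longrightarrow>
    Poly_Mapping.single (v, scal b \<odot>\<^bsub>W\<^esub> w) c - Poly_Mapping.single (v, w) (c * b) \<in> bilinear_rels V W"

definition tcls ::
    "('i ualg, 'v) module \<Rightarrow> ('i ualg, 'w) module \<Rightarrow> ('v \<times> 'w \<Rightarrow>\<^sub>0 kk) \<Rightarrow> ('v, 'w) tens"
  where "tcls V W P = (+) P ` bilinear_rels V W"

definition pure_tensor ::
    "('i ualg, 'v) module \<Rightarrow> ('i ualg, 'w) module \<Rightarrow> 'v \<Rightarrow> 'w \<Rightarrow> ('v, 'w) tens"
  where "pure_tensor V W v w = tcls V W (Poly_Mapping.single (v, w) 1)"

definition tensor_add ::
    "('i ualg, 'v) module \<Rightarrow> ('i ualg, 'w) module \<Rightarrow>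
     ('v, 'w) tens \<Rightarrow> ('v, 'w) tens \<Rightarrow> ('v, 'w) tens"
  where "tensor_add V W A Y = (\<Union>P\<in>A. \<Union>Q\<in>Y. tcls V W (P + Q))"

text \<open>The bilinear extension of \<open>(x \<otimes> y) \<cdot> (v \<otimes> w) = xv \<otimes> yw\<close>.\<close>

definition formal_act ::
    "('i ualg, 'v) module \<Rightarrow> ('i ualg, 'w) module \<Rightarrow>
     ('i ualg \<times> 'i ualg \<Rightarrow>\<^sub>0 kk) \<Rightarrow> ('v \<times> 'w \<Rightarrow>\<^sub>0 kk) \<Rightarrow> ('v \<times> 'w \<Rightarrow>\<^sub>0 kk)"
  where "formal_act V W P Q =
    (\<Sum>(x, y)\<in>Poly_Mapping.keys P. \<Sum>(v, w)\<in>Poly_Mapping.keys Q.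
       Poly_Mapping.single (x \<odot>\<^bsub>V\<^esub> v, y \<odot>\<^bsub>W\<^esub> w)
         (Poly_Mapping.lookup P (x, y) * Poly_Mapping.lookup Q (v, w)))"

definition tensor_act ::
    "('i ualg, 'v) module \<Rightarrow> ('i ualg, 'w) module \<Rightarrow>
     ('i ualg, 'i ualg) tens \<Rightarrow> ('v, 'w) tens \<Rightarrow> ('v, 'w) tens"
  where "tensor_act V W A Z = (\<Union>P\<in>A. \<Union>Q\<in>Z. tcls V W (formal_act V W P Q))"

abbreviation tensU :: "'i ualg \<Rightarrow> 'i ualg \<Rightarrow> ('i ualg, 'i ualg) tens"
  where "tensU \<equiv> pure_tensor Ureg Ureg"

definition UU :: "('i ualg, 'i ualg) tens ring" where
  "UU = \<lparr>carrier = tcls Ureg Ureg ` formal Ureg Ureg, monoid.mult = tensor_act Ureg Ureg,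
         one = tensU \<one>\<^bsub>U\<^esub> \<one>\<^bsub>U\<^esub>, zero = bilinear_rels Ureg Ureg, add = tensor_add Ureg Ureg\<rparr>"


subsection \<open>The Hopf algebra structure\<close>

text \<open>The algebra is generated by the \<open>t\<^sub>i, t\<^sub>i\<^sup>-\<^sup>1, e\<^sub>i, f\<^sub>i\<close>, so each structure map is the unique algebra
  homomorphism (into the opposite algebra for the antipode) with the given values on
  \<open>t\<^sub>i, e\<^sub>i, f\<^sub>i\<close>.\<close>

definition comult :: "'i ualg \<Rightarrow> ('i ualg, 'i ualg) tens" where
  "comult = (THE h. h \<in> alg_homs U UU (\<lambda>c. tensU (scal c) \<one>\<^bsub>U\<^esub>) \<and>
     (\<forall>i. h (t i) = tensU (t i) (t i) \<and>
          h (e i) = tensU (e i) \<one>\<^bsub>U\<^esub> \<oplus>\<^bsub>UU\<^esub> tensU (k i) (e i) \<and>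
          h (f i) = tensU (f i) (kinv i) \<oplus>\<^bsub>UU\<^esub> tensU \<one>\<^bsub>U\<^esub> (f i)))"

definition counit :: "'i ualg \<Rightarrow> kk" where
  "counit = (THE h. h \<in> alg_homs U Kring (\<lambda>c. c) \<and>
     (\<forall>i. h (t i) = 1 \<and> h (e i) = 0 \<and> h (f i) = 0))"

definition antipode :: "'i ualg \<Rightarrow> 'i ualg" where
  "antipode = (THE h. h \<in> alg_homs U (opposite_ring U) scal \<and>
     (\<forall>i. h (t i) = tinv i \<and>
          h (e i) = \<ominus>\<^bsub>U\<^esub> (kinv i \<otimes>\<^bsub>U\<^esub> e i) \<and>
          h (f i) = \<ominus>\<^bsub>U\<^esub> (f i \<otimes>\<^bsub>U\<^esub> k i)))"

definition tensor_module ::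
    "('i ualg, 'v) module \<Rightarrow> ('i ualg, 'w) module \<Rightarrow>
     ('i ualg, ('v, 'w) tens) module"
  where "tensor_module V W =
    \<lparr>carrier = tcls V W ` formal V W, monoid.mult = undefined, one = undefined,
     zero = bilinear_rels V W, add = tensor_add V W,
     module.smult = (\<lambda>u. tensor_act V W (comult u))\<rparr>"


subsection \<open>Characters, weight spaces, and the pairing\<close>

definition qchar :: "'i weight \<Rightarrow> 'i ualg \<Rightarrow> kk" where
  "qchar l = (THE h. h \<in> alg_homs (U\<lparr>carrier := U0\<rparr>) Kring (\<lambda>c. c) \<and>
     (\<forall>i. h (t i) = qpow (d i * pairing l (simple_coweight i))))"

definition wt_space :: "('i ualg, 'v) module \<Rightarrow> 'i weight \<Rightarrow> 'v set" where
  "wt_space V m = {v \<in> carrier V. \<forall>s\<in>Tgroup. s \<odot>\<^bsub>V\<^esub> v = scal (qchar m s) \<odot>\<^bsub>V\<^esub> v}"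

definition Upos_plus :: "'i ualg set" where
  "Upos_plus = {x \<in> Upos. counit x = 0}"

definition Uneg_plus :: "'i ualg set" where
  "Uneg_plus = {y \<in> Uneg. counit y = 0}"

definition proj0 :: "'i ualg \<Rightarrow> 'i ualg" where
  "proj0 x = (THE z. z \<in> U0 \<and>
     x \<ominus>\<^bsub>U\<^esub> z \<in> kspan Ureg ({y \<otimes>\<^bsub>U\<^esub> u | y u. y \<in> Uneg_plus \<and> u \<in> carrier U} \<union>
                          {u \<otimes>\<^bsub>U\<^esub> y | u y. u \<in> carrier U \<and> y \<in> Upos_plus}))"

definition pi_form :: "'i weight \<Rightarrow> 'i ualg \<Rightarrow> 'i ualg \<Rightarrow> kk" where
  "pi_form l x y = qchar l (proj0 (antipode x \<otimes>\<^bsub>U\<^esub> y))"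

definition Kneg :: "'i weight \<Rightarrow> 'i ualg set" where
  "Kneg l = {y \<in> Uneg. \<forall>x\<in>Upos. pi_form l x y = 0}"

definition Kpos :: "'i weight \<Rightarrow> 'i ualg set" where
  "Kpos l = {x \<in> Upos. \<forall>y\<in>Uneg. pi_form l x y = 0}"


subsection \<open>Highest weight modules\<close>

definition verma_ideal :: "'i weight \<Rightarrow> 'i ualg set" where
  "verma_ideal l = kspan Ureg
     ({u \<otimes>\<^bsub>U\<^esub> e i | u i. u \<in> carrier U} \<union>
      {u \<otimes>\<^bsub>U\<^esub> (s \<ominus>\<^bsub>U\<^esub> scal (qchar l s)) | u s. u \<in> carrier U \<and> s \<in> Tgroup})"

definition verma :: "'i weight \<Rightarrow> ('i ualg, 'i vermavec) module" where
  "verma l = quotient_module Ureg (verma_ideal l)"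

definition verma_vec :: "'i weight \<Rightarrow> 'i vermavec" where
  "verma_vec l = verma_ideal l +>\<^bsub>Ureg\<^esub> \<one>\<^bsub>U\<^esub>"

definition verma_rad :: "'i weight \<Rightarrow> 'i vermavec set" where
  "verma_rad l = (\<lambda>y. y \<odot>\<^bsub>verma l\<^esub> verma_vec l) ` Kneg l"

definition L :: "'i weight \<Rightarrow> ('i ualg, 'i irrvec) module" where
  "L l = quotient_module (verma l) (verma_rad l)"

definition L_vec :: "'i weight \<Rightarrow> 'i irrvec" where
  "L_vec l = verma_rad l +>\<^bsub>verma l\<^esub> verma_vec l"


subsection \<open>The quantized algebra of regular functions\<close>

definition dominant_integral :: "'i weight \<Rightarrow> bool" where
  "dominant_integral m \<longleftrightarrow> (\<forall>i. pairing m (simple_coroot a i) \<in> \<nat>)"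

definition Udual :: "('i ualg, 'i ufun) module" where
  "Udual =
     \<lparr>carrier = klinear_forms Ureg, monoid.mult = undefined, one = undefined,
      zero = (\<lambda>x\<in>carrier U. 0), add = (\<lambda>g h. \<lambda>x\<in>carrier U. g x + h x),
      module.smult = (\<lambda>u g. \<lambda>x\<in>carrier U. g (x \<otimes>\<^bsub>U\<^esub> u))\<rparr>"

definition matrix_element ::
    "('i ualg, 'v) module \<Rightarrow> ('v \<Rightarrow> kk) \<Rightarrow> 'v \<Rightarrow> 'i ualg \<Rightarrow> kk" where
  "matrix_element V l v = (\<lambda>x\<in>carrier U. l (x \<odot>\<^bsub>V\<^esub> v))"

text \<open>Only the vector space structure and the left regular action of \<open>U\<close> on the quantized function
  algebra are needed. The finite-dimensionality condition
  is automatic for dominant integral weights.\<close>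

definition Fmod :: "('i ualg, 'i ufun) module" where
  "Fmod = Udual\<lparr>carrier := kspan Udual
     {matrix_element (L m) l v | m l v.
        dominant_integral m \<and> finite_dimensional (L m) \<and>
        l \<in> klinear_forms (L m) \<and> v \<in> carrier (L m)}\<rparr>"

definition F0 :: "'i ufun set" where
  "F0 = wt_space Fmod 0"

definition F0_annihilated :: "'i ualg set \<Rightarrow> 'i ufun set" where
  "F0_annihilated S = {g \<in> F0. \<forall>x\<in>S. x \<odot>\<^bsub>Fmod\<^esub> g = \<zero>\<^bsub>Fmod\<^esub>}"


subsection \<open>The leading coefficient map\<close>

abbreviation LF :: "'i weight \<Rightarrow> ('i ualg, 'i LFvec) module" where
  "LF l \<equiv> tensor_module (L l) Fmod"

definition HomLF :: "'i weight \<Rightarrow> ('i irrvec \<Rightarrow> 'i LFvec) set" where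
  "HomLF l = module_homs U (L l) (LF l)"

definition hom_add ::
    "'i weight \<Rightarrow> ('i irrvec \<Rightarrow> 'i LFvec) \<Rightarrow> ('i irrvec \<Rightarrow> 'i LFvec) \<Rightarrow>
     'i irrvec \<Rightarrow> 'i LFvec" where
  "hom_add l \<phi> \<psi> = (\<lambda>v\<in>carrier (L l). \<phi> v \<oplus>\<^bsub>LF l\<^esub> \<psi> v)"

definition hom_scale :: "'i weight \<Rightarrow> kk \<Rightarrow> ('i irrvec \<Rightarrow> 'i LFvec) \<Rightarrow> 'i irrvec \<Rightarrow> 'i LFvec" where
  "hom_scale l c \<phi> = (\<lambda>v\<in>carrier (L l). scal c \<odot>\<^bsub>LF l\<^esub> \<phi> v)"

definition lower_part :: "'i weight \<Rightarrow> 'i LFvec set" where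
  "lower_part l = kspan (LF l)
     {pure_tensor (L l) Fmod v g | m v g. wt_less m l \<and> v \<in> wt_space (L l) m \<and> g \<in> carrier Fmod}"

definition leading_coeff :: "'i weight \<Rightarrow> ('i irrvec \<Rightarrow> 'i LFvec) \<Rightarrow> 'i ufun \<Rightarrow> bool" where
  "leading_coeff l \<phi> g \<longleftrightarrow> g \<in> carrier Fmod \<and>
     (\<exists>r\<in>lower_part l. \<phi> (L_vec l) = pure_tensor (L l) Fmod (L_vec l) g \<oplus>\<^bsub>LF l\<^esub> r)"

definition Theta :: "'i weight \<Rightarrow> ('i irrvec \<Rightarrow> 'i LFvec) \<Rightarrow> 'i ufun" where
  "Theta l \<phi> = (THE g. leading_coeff l \<phi> g)"

end

end

theory Submission
  imports Defs
begin

text \<open>Let \<open>\<xi>(x) = q\<^sup>\<lambda>((x)\<^sub>0)\<close>. It is killed by \<open>f\<^sub>iU\<close> and \<open>Ue\<^sub>i\<close>, and \<open>L(\<lambda>)\<close> is the quotient of \<open>U\<close> by the left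
  ideal \<open>{x. \<forall>u. \<xi>(ux) = 0}\<close>. A vector \<open>Z\<close> of \<open>L(\<lambda>) \<otimes> F\<close> is determined by its coordinates
  \<open>Z(u, z) = \<Sum> \<xi>(uv) g(z)\<close>, where \<open>Z = \<Sum> v \<otimes> g\<close> and \<open>u, z \<in> U\<close>, and the leading coefficient of a
  homomorphism \<open>\<phi>\<close> is \<open>z \<mapsto> Z(1, z)\<close> for \<open>Z = \<phi>(1\<^sub>\<lambda>)\<close>. From the comultiplication,
  \<open>(e\<^sub>iZ)(u, z) = Z(ue\<^sub>i, z) + Z(uk\<^sub>i, ze\<^sub>i)\<close> and \<open>(f\<^sub>iZ)(u, z) = Z(uf\<^sub>i, zk\<^sub>i\<^sup>-\<^sup>1) + Z(u, zf\<^sub>i)\<close>.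

  Hence the coordinates at \<open>u = 1\<close> of the vectors of a submodule determine all coordinates, and
  \<open>(yZ)(1, z) = Z(1, zy)\<close> for \<open>y \<in> U\<^sup>-\<close>, while \<open>Z(\<sigma>(x), z) = Z(1, zx)\<close> for \<open>x \<in> U\<^sup>+\<close> if all \<open>e\<^sub>i\<close> kill \<open>Z\<close>.
  The first two facts give injectivity, the last two show that the leading coefficient is annihilated
  by \<open>K\<^sub>\<lambda>\<close> and by the other radical. Conversely, the operators \<open>e\<^sub>i\<close> act locally nilpotently on \<open>F\<close>,
  so for an annihilated \<open>g\<close> the equations \<open>Z(\<sigma>(x), z) = g(zx)\<close> for \<open>x \<in> U\<^sup>+\<close> are finite-dimensional linear
  algebra in \<open>L(\<lambda>)\<close> and have a solution \<open>Z\<close>. It is a highest weight vector of weight \<open>\<lambda>\<close> killed by \<open>K\<^sub>\<lambda>\<close>,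
  and therefore the image of \<open>1\<^sub>\<lambda>\<close> under a homomorphism.

  That \<open>\<xi>\<close> is well defined amounts to the triangular decomposition. The free algebra acts from the right
  on the functions on words in the \<open>f\<^sub>i\<close>; all relations hold in this action except the Serre relations
  of the \<open>f\<^sub>i\<close>, which hold on the submodule generated by the function supported at the empty word, and \<open>\<xi>\<close>
  is a matrix element of this submodule.\<close>

subsection \<open>Group algebras and two-sided ideals\<close>

text \<open>\<open>counit\<close>, \<open>antipode\<close>, \<open>comult\<close>,
  \<open>qchar\<close> and \<open>proj0\<close> are definite descriptions, so each must be
  constructed before anything can be computed. The Hopf structure maps are built on the free
  algebra, where the values on generators suffice, and descend because they send relators into the
  relations. The laborious relators are the Serre elements. They are rewritten as iterated
  q-commutators of order N = 1 - a_ij, and N is exactly the order at which the unwanted terms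
  cancel: the mixed terms of the coproduct, and the commutators with the opposite generators. The
  second cancellation uses none of the Serre relations, so it is available in the module where those
  of the f_i fail.

  In the surjectivity part the tensor must be a finite sum that works for all z at once. The grading
  gives finiteness: e-words of length at least some n kill g, and e-words and f-words of different
  lengths are orthogonal. Uniformity in z comes from solving the linear system with coefficients
  linear in the right-hand side; the second tensor factors then become translates of g.\<close>

lemma qpow_0 [simp]: "qpow 0 = 1"
  by (simp add: qpow_def One_fract_def)

lemma qpow_add: "qpow (s + t) = qpow s * qpow t"
  by (simp add: qpow_def mult_single)

lemma qpow_eq_iff [simp]: "qpow s = qpow t \<longleftrightarrow> s = t"
proof -
  have "(Poly_Mapping.single s (1::complex) = Poly_Mapping.single t 1) \<longleftrightarrow> s = t"
    by (metis lookup_single_eq lookup_single_not_eq zero_neq_one)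
  then show ?thesis by (simp add: qpow_def eq_fract)
qed

lemma qpow_minus_cancel [simp]: "qpow s * qpow (- s) = 1" "qpow (- s) * qpow s = 1"
  by (simp_all flip: qpow_add)

lemma qpow_nonzero [simp]: "qpow s \<noteq> 0"
  using qpow_minus_cancel(1)[of s] by force

lemma qpow_eq_1_iff [simp]: "qpow s = 1 \<longleftrightarrow> s = 0"
  using qpow_eq_iff[of s 0] by simp

lemma qpow_power: "qpow s ^ n = qpow (of_nat n * s)"
  by (induction n) (simp_all add: qpow_add algebra_simps)

section \<open>Induction and linear extension over monoid algebras\<close>

lemma poly_mapping_additive_induct [case_names single add]:
  fixes x :: "'m \<Rightarrow>\<^sub>0 'k::comm_monoid_add"
  assumes "\<And>m c. P (Poly_Mapping.single m c)"
    and "\<And>x y. P x \<Longrightarrow> P y \<Longrightarrow> P (x + y)"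
  shows "P x"
proof (induction x rule: Poly_Mapping.update_induct)
  case const
  show ?case using assms(1)[of undefined 0] by simp
next
  case (update f a b)
  have "Poly_Mapping.update a b f = f + Poly_Mapping.single a b"
    by (rule poly_mapping_eqI)
      (use update in \<open>auto simp: lookup_update lookup_add lookup_single in_keys_iff when_def split: if_splits\<close>)
  with update assms show ?case by simp
qed

lemma poly_mapping_span_induct [consumes 1, case_names zero single add]:
  fixes x :: "'m \<Rightarrow>\<^sub>0 'k::comm_monoid_add"
  assumes "Poly_Mapping.keys x \<subseteq> S"
    and "P 0" "\<And>m c. m \<in> S \<Longrightarrow> P (Poly_Mapping.single m c)"
    and "\<And>x y. Poly_Mapping.keys x \<subseteq> S \<Longrightarrow> Poly_Mapping.keys y \<subseteq> S \<Longrightarrow> P x \<Longrightarrow> P y \<Longrightarrow> P (x + y)"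
  shows "P x"
proof -
  have "Poly_Mapping.keys x \<subseteq> S \<longrightarrow> P x"
  proof (induction x rule: Poly_Mapping.update_induct)
    case const
    show ?case using assms(2) by simp
  next
    case (update f a b)
    have eq: "Poly_Mapping.update a b f = f + Poly_Mapping.single a b"
      by (rule poly_mapping_eqI)
        (use update in \<open>auto simp: lookup_update lookup_add lookup_single in_keys_iff when_def split: if_splits\<close>)
    have keys: "Poly_Mapping.keys (Poly_Mapping.update a b f) = insert a (Poly_Mapping.keys f)"
      using update(2) by (auto simp: in_keys_iff lookup_update split: if_splits)
    show ?case
    proof
      assume "Poly_Mapping.keys (Poly_Mapping.update a b f) \<subseteq> S"
      then have S: "Poly_Mapping.keys f \<subseteq> S" "a \<in> S" by (auto simp: keys)
      show "P (Poly_Mapping.update a b f)"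
        unfolding eq by (rule assms(4)) (use S update assms(3) in auto)
    qed
  qed
  with assms(1) show ?thesis by simp
qed

text \<open>The map \<open>\<iota>\<close> carries the scalars into the target, because the targets
  are the field itself as well as noncommutative monoid algebras.\<close>

definition lin_ext :: "('k::zero \<Rightarrow> 'r) \<Rightarrow> ('m \<Rightarrow> 'r) \<Rightarrow> ('m \<Rightarrow>\<^sub>0 'k) \<Rightarrow> 'r::semiring_0" where
  "lin_ext \<iota> \<phi> x = (\<Sum>m\<in>Poly_Mapping.keys x. \<iota> (Poly_Mapping.lookup x m) * \<phi> m)"

lemma lin_ext_superset:
  assumes "finite S" "Poly_Mapping.keys x \<subseteq> S" "\<iota> 0 = 0"
  shows "lin_ext \<iota> \<phi> x = (\<Sum>m\<in>S. \<iota> (Poly_Mapping.lookup x m) * \<phi> m)"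
  unfolding lin_ext_def using assms
  by (intro sum.mono_neutral_left) (auto simp: in_keys_iff)

lemma lin_ext_single: "\<iota> 0 = 0 \<Longrightarrow> lin_ext \<iota> \<phi> (Poly_Mapping.single m c) = \<iota> c * \<phi> m"
  by (subst lin_ext_superset[of "{m}"]) auto

lemma lin_ext_zero [simp]: "lin_ext \<iota> \<phi> 0 = 0"
  by (simp add: lin_ext_def)

lemma lin_ext_add:
  fixes x y :: "'m \<Rightarrow>\<^sub>0 'k::monoid_add"
  assumes "\<iota> 0 = 0" "\<And>b c. \<iota> (b + c) = \<iota> b + \<iota> c"
  shows "lin_ext \<iota> \<phi> (x + y) = lin_ext \<iota> \<phi> x + lin_ext \<iota> \<phi> y"
proof -
  let ?S = "Poly_Mapping.keys x \<union> Poly_Mapping.keys y"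
  have "lin_ext \<iota> \<phi> (x + y) = (\<Sum>m\<in>?S. \<iota> (Poly_Mapping.lookup (x + y) m) * \<phi> m)"
    by (rule lin_ext_superset) (use assms keys_add[of x y] in auto)
  also have "\<dots> = (\<Sum>m\<in>?S. \<iota> (Poly_Mapping.lookup x m) * \<phi> m) + (\<Sum>m\<in>?S. \<iota> (Poly_Mapping.lookup y m) * \<phi> m)"
    by (simp add: lookup_add assms distrib_right sum.distrib)
  also have "\<dots> = lin_ext \<iota> \<phi> x + lin_ext \<iota> \<phi> y"
    by (subst (1 2) lin_ext_superset[of ?S]) (use assms in auto)
  finally show ?thesis .
qed

lemma lin_ext_mult:
  fixes x y :: "'m::monoid_add \<Rightarrow>\<^sub>0 'k::ring_1" and \<phi> :: "'m \<Rightarrow> 'r::ring_1"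
  assumes "\<iota> 0 = 0" "\<And>b c. \<iota> (b + c) = \<iota> b + \<iota> c"
    and "\<And>b c. \<iota> (b * c) = \<iota> b * \<iota> c" "\<And>c z. \<iota> c * z = z * \<iota> c"
    and "\<And>m n. \<phi> (m + n) = \<phi> m * \<phi> n"
  shows "lin_ext \<iota> \<phi> (x * y) = lin_ext \<iota> \<phi> x * lin_ext \<iota> \<phi> y"
proof (induction x rule: poly_mapping_additive_induct)
  case (single m c)
  show ?case
  proof (induction y rule: poly_mapping_additive_induct)
    case (single n b)
    have "\<iota> c * \<iota> b * (\<phi> m * \<phi> n) = \<iota> c * \<phi> m * (\<iota> b * \<phi> n)"
      by (metis assms(4) mult.assoc)
    then show ?case by (simp add: mult_single lin_ext_single assms(1-3,5))
  qed (simp add: distrib_left lin_ext_add assms(1,2))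
qed (simp add: distrib_right lin_ext_add assms(1,2))

definition smul :: "'k::comm_ring_1 \<Rightarrow> ('m::monoid_add \<Rightarrow>\<^sub>0 'k) \<Rightarrow> 'm \<Rightarrow>\<^sub>0 'k" (infixr "*\<^sub>k" 75) where
  "c *\<^sub>k x = Poly_Mapping.single 0 c * x"

text \<open>Scalars sit at the neutral element of the monoid, hence they are central even when the
  monoid is not commutative.\<close>

lemma single_0_commute:
  fixes x :: "'m::monoid_add \<Rightarrow>\<^sub>0 'k::comm_ring_1"
  shows "Poly_Mapping.single 0 c * x = x * Poly_Mapping.single 0 c"
  by (induction x rule: poly_mapping_additive_induct)
    (simp_all add: mult_single distrib_left distrib_right mult.commute)

lemma smul_mult_left [simp]: "(c *\<^sub>k x) * y = c *\<^sub>k (x * y)"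
  by (simp add: smul_def mult.assoc)

lemma smul_mult_right [simp]: "x * (c *\<^sub>k y) = c *\<^sub>k (x * y)"
  unfolding smul_def by (metis mult.assoc single_0_commute)

lemma smul_smul [simp]: "b *\<^sub>k (c *\<^sub>k x) = (b * c) *\<^sub>k x"
  by (simp add: smul_def mult_single flip: mult.assoc)

lemma smul_one [simp]: "1 *\<^sub>k x = x" by (simp add: smul_def)
lemma smul_zero [simp]: "0 *\<^sub>k x = 0" by (simp add: smul_def)
lemma smul_zero_right [simp]: "c *\<^sub>k 0 = 0" by (simp add: smul_def)
lemma smul_add_right: "c *\<^sub>k (x + y) = c *\<^sub>k x + c *\<^sub>k y" by (simp add: smul_def distrib_left)
lemma smul_diff_right: "c *\<^sub>k (x - y) = c *\<^sub>k x - c *\<^sub>k y" by (simp add: smul_def right_diff_distrib)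
lemma smul_minus_right [simp]: "c *\<^sub>k (- x) = - (c *\<^sub>k x)" by (simp add: smul_def)
lemma smul_minus_left [simp]: "(- c) *\<^sub>k x = - (c *\<^sub>k x)" by (simp add: smul_def single_uminus)
lemma smul_add_left: "(b + c) *\<^sub>k x = b *\<^sub>k x + c *\<^sub>k x" by (simp add: smul_def single_add distrib_right)
lemma smul_diff_left: "(b - c) *\<^sub>k x = b *\<^sub>k x - c *\<^sub>k x" by (simp add: smul_def single_diff left_diff_distrib)
lemma smul_sum: "c *\<^sub>k sum g S = (\<Sum>s\<in>S. c *\<^sub>k g s)" by (simp add: smul_def sum_distrib_left)
lemma smul_single: "c *\<^sub>k Poly_Mapping.single m b = Poly_Mapping.single m (c * b)"
  by (simp add: smul_def mult_single)
lemma lookup_smul [simp]: "Poly_Mapping.lookup (c *\<^sub>k x) m = c * Poly_Mapping.lookup x m"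
  by (induction x rule: poly_mapping_additive_induct)
    (simp_all add: smul_single lookup_single smul_add_right lookup_add algebra_simps when_def)

lemma keys_smul: "Poly_Mapping.keys (c *\<^sub>k x) \<subseteq> Poly_Mapping.keys x"
  by (auto simp: in_keys_iff)

text \<open>Calculations use representatives and congruences instead of cosets. The instances are
  the annihilator of the functions on words, the relation ideal of U, and the relations of the
  tensor square.\<close>

locale two_sided_ideal =
  fixes J :: "('m::monoid_add \<Rightarrow>\<^sub>0 kk) set"
  assumes zero_mem: "0 \<in> J"
    and add_mem: "x \<in> J \<Longrightarrow> y \<in> J \<Longrightarrow> x + y \<in> J"
    and mult_left_mem: "x \<in> J \<Longrightarrow> u * x \<in> J"
    and mult_right_mem: "x \<in> J \<Longrightarrow> x * u \<in> J"
begin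

definition cong :: "('m \<Rightarrow>\<^sub>0 kk) \<Rightarrow> ('m \<Rightarrow>\<^sub>0 kk) \<Rightarrow> bool" (infix "\<approx>" 50) where
  "x \<approx> y \<longleftrightarrow> x - y \<in> J"

lemma minus_mem: "x \<in> J \<Longrightarrow> - x \<in> J"
  using mult_left_mem[of x "-1"] by simp

lemma smul_mem: "x \<in> J \<Longrightarrow> c *\<^sub>k x \<in> J"
  by (simp add: smul_def mult_left_mem)

lemma diff_mem: "x \<in> J \<Longrightarrow> y \<in> J \<Longrightarrow> x - y \<in> J"
  using add_mem[of x "- y"] minus_mem by simp

lemma cong_refl [simp]: "x \<approx> x" by (simp add: cong_def zero_mem)
lemma cong_sym: "x \<approx> y \<Longrightarrow> y \<approx> x" using minus_mem[of "x - y"] by (simp add: cong_def)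
lemma cong_trans [trans]: "x \<approx> y \<Longrightarrow> y \<approx> z \<Longrightarrow> x \<approx> z"
  using add_mem[of "x - y" "y - z"] by (simp add: cong_def)
lemma cong_eq_trans [trans]: "x \<approx> y \<Longrightarrow> y = z \<Longrightarrow> x \<approx> z" by simp
lemma eq_cong_trans [trans]: "x = y \<Longrightarrow> y \<approx> z \<Longrightarrow> x \<approx> z" by simp
lemma cong_add: "x \<approx> x' \<Longrightarrow> y \<approx> y' \<Longrightarrow> x + y \<approx> x' + y'"
  using add_mem[of "x - x'" "y - y'"] by (simp add: cong_def algebra_simps)
lemma cong_diff: "x \<approx> x' \<Longrightarrow> y \<approx> y' \<Longrightarrow> x - y \<approx> x' - y'"
  using diff_mem[of "x - x'" "y - y'"] by (simp add: cong_def algebra_simps)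
lemma cong_minus: "x \<approx> x' \<Longrightarrow> - x \<approx> - x'"
  using minus_mem[of "x - x'"] by (simp add: cong_def)
lemma cong_smul: "x \<approx> x' \<Longrightarrow> c *\<^sub>k x \<approx> c *\<^sub>k x'"
  using smul_mem[of "x - x'" c] by (simp add: cong_def smul_diff_right)
lemma cong_mult_left: "x \<approx> x' \<Longrightarrow> u * x \<approx> u * x'"
  using mult_left_mem[of "x - x'" u] by (simp add: cong_def right_diff_distrib)
lemma cong_mult_right: "x \<approx> x' \<Longrightarrow> x * u \<approx> x' * u"
  using mult_right_mem[of "x - x'" u] by (simp add: cong_def left_diff_distrib)
lemma cong_mult: "x \<approx> x' \<Longrightarrow> y \<approx> y' \<Longrightarrow> x * y \<approx> x' * y'"
  by (rule cong_trans[OF cong_mult_right cong_mult_left])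
lemma cong_sum: "(\<And>s. s \<in> S \<Longrightarrow> g s \<approx> h s) \<Longrightarrow> sum g S \<approx> sum h S"
  by (induction S rule: infinite_finite_induct) (auto intro: cong_add)
lemma cong_0_iff: "x \<approx> 0 \<longleftrightarrow> x \<in> J" by (simp add: cong_def)
lemma cong_mem_iff: "x \<approx> y \<Longrightarrow> x \<in> J \<longleftrightarrow> y \<in> J"
  by (metis cong_0_iff cong_sym cong_trans)

end

subsection \<open>Iterated q-commutators and quantum Serre elements\<close>

text \<open>For \<open>\<delta>\<close> = d_i and \<open>c\<close> = a_ij the exponent at step m is
  (m \<alpha>_i + \<alpha>_j | \<alpha>_i), the inner product of \<alpha>_i with the weight of the
  previous term. This is the q-adjoint action of e_i iterated on e_j; order 1 - a_ij gives the Serre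
  element up to a scalar.\<close>

primrec qad :: "rat \<Rightarrow> int \<Rightarrow> ('m::monoid_add \<Rightarrow>\<^sub>0 kk) \<Rightarrow> ('m \<Rightarrow>\<^sub>0 kk) \<Rightarrow> nat \<Rightarrow> 'm \<Rightarrow>\<^sub>0 kk" where
  "qad \<delta> c E G 0 = G"
| "qad \<delta> c E G (Suc m) =
     E * qad \<delta> c E G m - qpow ((2 * of_nat m + of_int c) * \<delta>) *\<^sub>k (qad \<delta> c E G m * E)"

context two_sided_ideal
begin

definition qcommute :: "rat \<Rightarrow> ('m \<Rightarrow>\<^sub>0 kk) \<Rightarrow> ('m \<Rightarrow>\<^sub>0 kk) \<Rightarrow> bool" where
  "qcommute s x y \<longleftrightarrow> x * y \<approx> qpow s *\<^sub>k (y * x)"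

lemma qcommute_1 [simp]: "qcommute 0 1 x" "qcommute 0 x 1"
  by (simp_all add: qcommute_def)

lemma qcommute_flip:
  assumes "qcommute s x y" shows "qcommute (- s) y x"
proof -
  have "qpow (- s) *\<^sub>k (x * y) \<approx> qpow (- s) *\<^sub>k (qpow s *\<^sub>k (y * x))"
    using assms unfolding qcommute_def by (rule cong_smul)
  then show ?thesis by (simp add: qcommute_def cong_sym)
qed

lemma qcommute_left: "qcommute s x y \<Longrightarrow> x * (y * z) \<approx> qpow s *\<^sub>k (y * (x * z))"
  using cong_mult_right[of "x * y" "qpow s *\<^sub>k (y * x)" z] by (simp add: qcommute_def mult.assoc)

lemma qcommute_mult_right:
  assumes "qcommute s x y" "qcommute t x z"
  shows "qcommute (s + t) x (y * z)"
proof -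
  have "x * (y * z) \<approx> qpow s *\<^sub>k (y * (x * z))" by (rule qcommute_left[OF assms(1)])
  also have "\<dots> \<approx> qpow s *\<^sub>k (y * (qpow t *\<^sub>k (z * x)))"
    using assms(2) by (intro cong_smul cong_mult_left) (simp add: qcommute_def)
  finally show ?thesis by (simp add: qcommute_def qpow_add mult.assoc)
qed

lemma qcommute_mult_left:
  assumes "qcommute s x z" "qcommute t y z"
  shows "qcommute (s + t) (x * y) z"
  using qcommute_flip[OF qcommute_mult_right[OF qcommute_flip[OF assms(1)] qcommute_flip[OF assms(2)]]]
  by (simp add: add.commute)

lemma qcommute_power_right: "qcommute s x y \<Longrightarrow> qcommute (of_nat n * s) x (y ^ n)"
proof (induction n)
  case (Suc n)
  then show ?case using qcommute_mult_right[of s x y "of_nat n * s" "y ^ n"] by (simp add: algebra_simps)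
qed simp

lemma qcommute_power_left: "qcommute s x y \<Longrightarrow> qcommute (of_nat n * s) (x ^ n) y"
  using qcommute_flip[OF qcommute_power_right[OF qcommute_flip]] by fastforce

lemma qcommute_smul_right: "qcommute s x y \<Longrightarrow> qcommute s x (c *\<^sub>k y)"
  using cong_smul[of "x * y" "qpow s *\<^sub>k (y * x)" c] by (simp add: qcommute_def mult.commute)

lemma qcommute_smul_left: "qcommute s x y \<Longrightarrow> qcommute s (c *\<^sub>k x) y"
  using qcommute_flip[OF qcommute_smul_right[OF qcommute_flip]] by fastforce

lemma qcommute_add_right: "qcommute s x y \<Longrightarrow> qcommute s x z \<Longrightarrow> qcommute s x (y + z)"
  using cong_add[of "x * y" "qpow s *\<^sub>k (y * x)" "x * z" "qpow s *\<^sub>k (z * x)"] by (simp add: qcommute_def smul_add_right distrib_left distrib_right)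

lemma qcommute_diff_right: "qcommute s x y \<Longrightarrow> qcommute s x z \<Longrightarrow> qcommute s x (y - z)"
  using cong_diff[of "x * y" "qpow s *\<^sub>k (y * x)" "x * z" "qpow s *\<^sub>k (z * x)"]
  by (simp add: qcommute_def smul_diff_right left_diff_distrib right_diff_distrib)

lemma qcommute_qad_right:
  assumes "qcommute s x E" "qcommute t x G"
  shows "qcommute (of_nat m * s + t) x (qad \<delta> c E G m)"
proof (induction m)
  case (Suc m)
  have "qcommute (s + (of_nat m * s + t)) x (E * qad \<delta> c E G m)"
    by (rule qcommute_mult_right[OF assms(1) Suc])
  moreover have "qcommute ((of_nat m * s + t) + s) x (qad \<delta> c E G m * E)"
    by (rule qcommute_mult_right[OF Suc assms(1)])
  ultimately show ?case
    using qcommute_diff_right qcommute_smul_right by (simp add: algebra_simps)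
qed (simp add: assms)

lemma qcommute_qad_left:
  assumes "qcommute s E x" "qcommute t G x"
  shows "qcommute (of_nat m * s + t) (qad \<delta> c E G m) x"
  using qcommute_flip[OF qcommute_qad_right[OF qcommute_flip[OF assms(1)] qcommute_flip[OF assms(2)], of m]]
  by (simp add: add.commute)

lemma qad_cong:
  assumes "E \<approx> E'" "G \<approx> G'" shows "qad \<delta> c E G m \<approx> qad \<delta> c E' G' m"
  by (induction m) (auto intro!: assms cong_diff cong_smul cong_mult)

text \<open>In both products of the next commutator, pulling the factors \<open>\<kappa>\<close> and
  \<open>\<kappa>'\<close> to the front costs the same power of q, so the commutator keeps its
  shape. The exponent \<open>t\<close> occurs twice because the form is symmetric. This is what
  handles elements such as a power of k_i times e_i in the antipode and the coproduct.\<close>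

lemma qad_scale:
  assumes "qcommute s \<kappa> E" "qcommute t \<kappa> G" "qcommute t \<kappa>' E" "qcommute 0 \<kappa> \<kappa>'"
  shows "\<exists>r. qad \<delta> c (\<kappa> * E) (\<kappa>' * G) m \<approx> qpow r *\<^sub>k (\<kappa> ^ m * \<kappa>' * qad \<delta> c E G m)"
proof (induction m)
  case 0
  show ?case by (rule exI[of _ 0]) simp
next
  case (Suc m)
  then obtain r where r: "qad \<delta> c (\<kappa> * E) (\<kappa>' * G) m \<approx> qpow r *\<^sub>k (\<kappa> ^ m * \<kappa>' * qad \<delta> c E G m)" by blast
  let ?x = "qad \<delta> c E G m" and ?k = "\<kappa> ^ m * \<kappa>'" and ?u = "of_nat m * s + t"
    and ?v = "qpow ((2 * of_nat m + of_int c) * \<delta>)"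
  have kE: "qcommute (- ?u) E ?k"
    using qcommute_mult_left[OF qcommute_power_left[OF assms(1)] assms(3), of m] by (rule qcommute_flip)
  have kx: "qcommute (- ?u) ?x \<kappa>"
    using qcommute_qad_right[OF assms(1,2), of m] by (rule qcommute_flip)
  have kk: "qcommute 0 ?k \<kappa>"
    using qcommute_mult_left[of 0 "\<kappa> ^ m" \<kappa> 0 \<kappa>'] qcommute_flip[OF assms(4)]
    by (simp add: qcommute_def power_commutes)
  have 1: "(\<kappa> * E) * (?k * ?x) \<approx> qpow (- ?u) *\<^sub>k (\<kappa> ^ Suc m * \<kappa>' * (E * ?x))"
    using cong_mult_left[OF qcommute_left[OF kE, of ?x], of \<kappa>] by (simp add: mult.assoc)
  have "(?k * ?x) * (\<kappa> * E) \<approx> qpow (- ?u) *\<^sub>k (?k * \<kappa> * (?x * E))"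
    using cong_mult_left[OF qcommute_left[OF kx, of E], of ?k] by (simp add: mult.assoc)
  also have "\<dots> \<approx> qpow (- ?u) *\<^sub>k (\<kappa> * ?k * (?x * E))"
    using kk by (intro cong_smul cong_mult_right) (simp add: qcommute_def)
  finally have 2: "(?k * ?x) * (\<kappa> * E) \<approx> qpow (- ?u) *\<^sub>k (\<kappa> ^ Suc m * \<kappa>' * (?x * E))"
    by (simp add: mult.assoc)
  have "qad \<delta> c (\<kappa> * E) (\<kappa>' * G) (Suc m)
      \<approx> (\<kappa> * E) * (qpow r *\<^sub>k (?k * ?x)) - ?v *\<^sub>k ((qpow r *\<^sub>k (?k * ?x)) * (\<kappa> * E))"
    unfolding qad.simps by (intro cong_diff cong_smul cong_mult_left cong_mult_right r)
  also have "\<dots> = qpow r *\<^sub>k ((\<kappa> * E) * (?k * ?x)) - (?v * qpow r) *\<^sub>k ((?k * ?x) * (\<kappa> * E))" by simp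
  also have "\<dots> \<approx> qpow r *\<^sub>k (qpow (- ?u) *\<^sub>k (\<kappa> ^ Suc m * \<kappa>' * (E * ?x)))
      - (?v * qpow r) *\<^sub>k (qpow (- ?u) *\<^sub>k (\<kappa> ^ Suc m * \<kappa>' * (?x * E)))"
    by (intro cong_diff cong_smul 1 2)
  also have "\<dots> = qpow (r - ?u) *\<^sub>k (\<kappa> ^ Suc m * \<kappa>' * qad \<delta> c E G (Suc m))"
  proof -
    have "qpow (r - ?u) = qpow r * qpow (- ?u)"
      using qpow_add[of r "- ?u"] by (simp only: diff_conv_add_uminus)
    then show ?thesis by (simp add: smul_diff_right right_diff_distrib ac_simps)
  qed
  finally show ?case by blast
qed

end

text \<open>The mixed coefficients in the expansion of an iterated q-commutator of sums of q-commuting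
  elements, a variant of Gauss's recursion. All of them contain the factor \<open>1 - A Q\<^sup>m\<^sup>-\<^sup>1\<close>, which
  vanishes at the order of the quantum Serre relation; this is why the structure maps of the Hopf
  algebra respect that relation.\<close>

fun qcoeff :: "'k::comm_ring_1 \<Rightarrow> 'k \<Rightarrow> nat \<Rightarrow> nat \<Rightarrow> 'k" where
  "qcoeff Q A 0 0 = 1"
| "qcoeff Q A 0 (Suc r) = 0"
| "qcoeff Q A (Suc m) 0 = (1 - A * Q ^ m) * qcoeff Q A m 0"
| "qcoeff Q A (Suc m) (Suc r) = (1 - A * Q ^ (m + Suc r)) * qcoeff Q A m (Suc r) + Q ^ (m - r) * qcoeff Q A m r"

text \<open>The q-Pochhammer symbol (Q;Q)_n, from which the Gauss binomial coefficients are
  formed.\<close>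

definition qpoch :: "'k::comm_ring_1 \<Rightarrow> nat \<Rightarrow> 'k" where
  "qpoch Q n = (\<Prod>s=1..n. 1 - Q ^ s)"

lemma qpoch_0 [simp]: "qpoch Q 0 = 1" by (simp add: qpoch_def)
lemma qpoch_Suc [simp]: "qpoch Q (Suc n) = qpoch Q n * (1 - Q ^ Suc n)" by (simp add: qpoch_def)

lemma qcoeff_above: "m < r \<Longrightarrow> qcoeff Q A m r = 0"
  by (induction Q A m r rule: qcoeff.induct) auto

text \<open>So \<open>qcoeff Q A m r\<close> is the Gauss binomial coefficient times the product of
  1 - A Q^s for r \<le> s < m. The denominators are multiplied out, since Q may be a root of unity
  at this generality.\<close>

lemma qcoeff_closed:
  "r \<le> m \<Longrightarrow> qcoeff Q A m r * (qpoch Q r * qpoch Q (m - r)) = qpoch Q m * (\<Prod>s=r..<m. 1 - A * Q ^ s)"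
proof (induction Q A m r rule: qcoeff.induct)
  case (3 Q A m)
  then show ?case by (simp add: algebra_simps)
next
  case (4 Q A m r)
  show ?case
  proof (cases "r = m")
    case True
    then show ?thesis using "4.IH"(2) by (simp add: qcoeff_above algebra_simps)
  next
    case False
    with "4.prems" have rm: "Suc r \<le> m" by simp
    then obtain n where m: "m = Suc r + n" using le_Suc_ex by blast
    let ?P = "\<Prod>s=Suc r..<m. 1 - A * Q ^ s"
    have P: "(\<Prod>s=r..<m. 1 - A * Q ^ s) = (1 - A * Q ^ r) * ?P"
      using rm by (simp add: prod.atLeast_Suc_lessThan)
    have ih1: "qcoeff Q A m (Suc r) * (qpoch Q (Suc r) * qpoch Q n) = qpoch Q m * ?P"
      using "4.IH"(1) rm by (simp add: m)
    have ih2: "qcoeff Q A m r * (qpoch Q r * qpoch Q (Suc n)) = qpoch Q m * ((1 - A * Q ^ r) * ?P)"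
      using "4.IH"(2) rm P by (simp add: m)
    have "qcoeff Q A (Suc m) (Suc r) * (qpoch Q (Suc r) * qpoch Q (Suc n))
      = (1 - A * Q ^ (m + Suc r)) * (1 - Q ^ Suc n) * (qcoeff Q A m (Suc r) * (qpoch Q (Suc r) * qpoch Q n))
        + Q ^ Suc n * (1 - Q ^ Suc r) * (qcoeff Q A m r * (qpoch Q r * qpoch Q (Suc n)))"
      by (simp add: m algebra_simps)
    also have "\<dots> = qpoch Q m * ?P * ((1 - A * Q ^ (m + Suc r)) * (1 - Q ^ Suc n)
        + Q ^ Suc n * (1 - Q ^ Suc r) * (1 - A * Q ^ r))"
      unfolding ih1 ih2 by (simp add: algebra_simps)
    \<comment> \<open>Pascal's rule for Gauss binomials with the extra parameter A; recall m = r + 1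
      + n, and A = 0 gives the classical rule.\<close>
    also have "(1 - A * Q ^ (m + Suc r)) * (1 - Q ^ Suc n) + Q ^ Suc n * (1 - Q ^ Suc r) * (1 - A * Q ^ r)
       = (1 - Q ^ Suc m) * (1 - A * Q ^ m)"
      by (simp add: m power_add algebra_simps)
    finally show ?thesis using rm by (simp add: m prod.atLeastLessThan_Suc algebra_simps)
  qed
qed auto

text \<open>The factor with s = m - 1 vanishes and lies in the range of the product because r < m;
  the Pochhammer symbols can be cancelled since Q is not a root of unity.\<close>

lemma qcoeff_eq_0:
  fixes Q A :: "'k::idom"
  assumes "r < m" "A * Q ^ (m - 1) = 1" "\<And>s. s > 0 \<Longrightarrow> Q ^ s \<noteq> 1"
  shows "qcoeff Q A m r = 0"
proof -
  have nz: "qpoch Q n \<noteq> 0" for n using assms(3) by (auto simp: qpoch_def)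
  have "(\<Prod>s=r..<m. 1 - A * Q ^ s) = 0"
    using assms(1,2) by (intro prod_zero bexI[of _ "m - 1"]) auto
  then have "qcoeff Q A m r * (qpoch Q r * qpoch Q (m - r)) = 0"
    using qcoeff_closed[of r m Q A] assms(1) by (simp only: less_imp_le mult_zero_right)
  with nz show ?thesis by simp
qed

lemma qcoeff_diag: "qcoeff Q A m m = 1"
  by (induction m) (auto simp: qcoeff_above)

context two_sided_ideal
begin

text \<open>Think of p, g as the first and y, h as the second summand of a coproduct. Bracketing a
  mixed term with p costs the factor 1 - A Q^(m + r), and bracketing it with y raises r at the cost
  of Q^(m - r): precisely the recursion of \<open>qcoeff\<close>.\<close>

lemma qad_sum_expand:
  assumes "qcommute (2 * \<delta>) y p" "qcommute (of_int c * \<delta>) y g" "qcommute (of_int c * \<delta>) h p"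
  shows "qad \<delta> c (p + y) (g + h) m
    \<approx> qad \<delta> c p g m + (\<Sum>r\<le>m. qcoeff (qpow (2 * \<delta>)) (qpow (2 * of_int c * \<delta>)) m r *\<^sub>k (p ^ (m - r) * qad \<delta> c y h r))"
proof (induction m)
  case 0
  show ?case by simp
next
  case (Suc m)
  define Q where "Q = qpow (2 * \<delta>)"
  define A where "A = qpow (2 * of_int c * \<delta>)"
  define v where "v = qpow ((2 * of_nat m + of_int c) * \<delta>)"
  define S where "S = (\<Sum>r\<le>m. qcoeff Q A m r *\<^sub>k (p ^ (m - r) * qad \<delta> c y h r))"
  let ?P = "qad \<delta> c p g" and ?Y = "qad \<delta> c y h"
  have IH: "qad \<delta> c (p + y) (g + h) m \<approx> ?P m + S"
    using Suc unfolding S_def Q_def A_def .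
  \<comment> \<open>The power of q by which y passes the m-th commutator of p and g is the one built
    into the next commutator, so this contribution disappears.\<close>
  have yP: "y * ?P m - v *\<^sub>k (?P m * y) \<approx> 0"
  proof -
    have "qcommute (of_nat m * (2 * \<delta>) + of_int c * \<delta>) y (?P m)"
      by (rule qcommute_qad_right[OF assms(1,2)])
    then have "y * ?P m \<approx> v *\<^sub>k (?P m * y)" by (simp add: qcommute_def v_def algebra_simps)
    then show ?thesis by (simp add: cong_def)
  qed
  have term_p: "p * (p ^ (m - r) * ?Y r) - v *\<^sub>k ((p ^ (m - r) * ?Y r) * p)
      \<approx> (1 - A * Q ^ (m + r)) *\<^sub>k (p ^ (Suc m - r) * ?Y r)" if "r \<le> m" for r
  proof -
    have power_left_commute: "p ^ n * (p * z) = p * (p ^ n * z)" for n z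
      by (metis mult.assoc power_commutes)
    have "qcommute (of_nat r * (2 * \<delta>) + of_int c * \<delta>) (?Y r) p"
      by (rule qcommute_qad_left[OF assms(1,3)])
    then have "?Y r * p \<approx> qpow (of_nat r * (2 * \<delta>) + of_int c * \<delta>) *\<^sub>k (p * ?Y r)" by (simp add: qcommute_def)
    then have "v *\<^sub>k (p ^ (m - r) * (?Y r * p)) \<approx>
       v *\<^sub>k (p ^ (m - r) * (qpow (of_nat r * (2 * \<delta>) + of_int c * \<delta>) *\<^sub>k (p * ?Y r)))"
      by (intro cong_smul cong_mult_left)
    also have "\<dots> = (v * qpow (of_nat r * (2 * \<delta>) + of_int c * \<delta>)) *\<^sub>k (p ^ Suc (m - r) * ?Y r)"
      by (simp add: mult.assoc power_left_commute)
    also have "v * qpow (of_nat r * (2 * \<delta>) + of_int c * \<delta>) = A * Q ^ (m + r)"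
      by (simp add: v_def A_def Q_def qpow_power algebra_simps flip: qpow_add)
    finally have "p ^ Suc (m - r) * ?Y r - v *\<^sub>k (p ^ (m - r) * (?Y r * p))
        \<approx> p ^ Suc (m - r) * ?Y r - (A * Q ^ (m + r)) *\<^sub>k (p ^ Suc (m - r) * ?Y r)"
      by (intro cong_diff cong_refl)
    then show ?thesis using that by (simp add: smul_diff_left mult.assoc Suc_diff_le)
  qed
  have term_y: "y * (p ^ (m - r) * ?Y r) - v *\<^sub>k ((p ^ (m - r) * ?Y r) * y)
      \<approx> Q ^ (m - r) *\<^sub>k (p ^ (m - r) * ?Y (Suc r))" if "r \<le> m" for r
  proof -
    have "qcommute (of_nat (m - r) * (2 * \<delta>)) y (p ^ (m - r))"
      by (rule qcommute_power_right[OF assms(1)])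
    then have "y * (p ^ (m - r) * ?Y r) \<approx> Q ^ (m - r) *\<^sub>k (p ^ (m - r) * (y * ?Y r))"
      using qcommute_left by (simp add: Q_def qpow_power)
    then have diff: "y * (p ^ (m - r) * ?Y r) - v *\<^sub>k ((p ^ (m - r) * ?Y r) * y)
      \<approx> Q ^ (m - r) *\<^sub>k (p ^ (m - r) * (y * ?Y r)) - v *\<^sub>k ((p ^ (m - r) * ?Y r) * y)"
      by (intro cong_diff cong_refl)
    have v: "v = Q ^ (m - r) * qpow ((2 * of_nat r + of_int c) * \<delta>)"
      using that by (simp add: v_def Q_def qpow_power of_nat_diff algebra_simps flip: qpow_add)
    from diff show ?thesis by (simp add: v smul_diff_right right_diff_distrib mult.assoc)
  qed
  have split: "(p + y) * (?P m + S) - v *\<^sub>k ((?P m + S) * (p + y))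
     = ?P (Suc m) + (y * ?P m - v *\<^sub>k (?P m * y)) + (p * S - v *\<^sub>k (S * p)) + (y * S - v *\<^sub>k (S * y))"
    by (simp add: v_def algebra_simps smul_add_right smul_diff_right)
  have Sp: "p * S - v *\<^sub>k (S * p) \<approx> (\<Sum>r\<le>m. (qcoeff Q A m r * (1 - A * Q ^ (m + r))) *\<^sub>k (p ^ (Suc m - r) * ?Y r))"
  proof -
    have "p * S - v *\<^sub>k (S * p) = (\<Sum>r\<le>m. qcoeff Q A m r *\<^sub>k (p * (p ^ (m - r) * ?Y r) - v *\<^sub>k ((p ^ (m - r) * ?Y r) * p)))"
      by (simp add: S_def sum_distrib_left sum_distrib_right smul_sum smul_diff_right sum_subtractf mult.commute)
    also have "\<dots> \<approx> (\<Sum>r\<le>m. qcoeff Q A m r *\<^sub>k ((1 - A * Q ^ (m + r)) *\<^sub>k (p ^ (Suc m - r) * ?Y r)))"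
      by (intro cong_sum cong_smul term_p) simp
    finally show ?thesis by simp
  qed
  have Sy: "y * S - v *\<^sub>k (S * y) \<approx> (\<Sum>r\<le>m. (qcoeff Q A m r * Q ^ (m - r)) *\<^sub>k (p ^ (m - r) * ?Y (Suc r)))"
  proof -
    have "y * S - v *\<^sub>k (S * y) = (\<Sum>r\<le>m. qcoeff Q A m r *\<^sub>k (y * (p ^ (m - r) * ?Y r) - v *\<^sub>k ((p ^ (m - r) * ?Y r) * y)))"
      by (simp add: S_def sum_distrib_left sum_distrib_right smul_sum smul_diff_right sum_subtractf mult.commute)
    also have "\<dots> \<approx> (\<Sum>r\<le>m. qcoeff Q A m r *\<^sub>k (Q ^ (m - r) *\<^sub>k (p ^ (m - r) * ?Y (Suc r))))"
      by (intro cong_sum cong_smul term_y) simp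
    finally show ?thesis by simp
  qed
  let ?f = "\<lambda>r. (qcoeff Q A m r * (1 - A * Q ^ (m + r))) *\<^sub>k (p ^ (Suc m - r) * ?Y r)"
  \<comment> \<open>The added summand is zero by \<open>qcoeff_above\<close>; it makes the index
    ranges agree after the shift.\<close>
  have "(\<Sum>r\<le>m. ?f r) = (\<Sum>r\<le>Suc m. ?f r)" by (simp add: qcoeff_above)
  also have "\<dots> = ?f 0 + (\<Sum>r\<le>m. ?f (Suc r))" by (rule sum.atMost_Suc_shift)
  finally have combine: "(\<Sum>r\<le>m. ?f r) + (\<Sum>r\<le>m. (qcoeff Q A m r * Q ^ (m - r)) *\<^sub>k (p ^ (m - r) * ?Y (Suc r)))
      = (\<Sum>r\<le>Suc m. qcoeff Q A (Suc m) r *\<^sub>k (p ^ (Suc m - r) * ?Y r))"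
    by (subst sum.atMost_Suc_shift) (simp add: sum.distrib smul_add_left mult.commute)
  have "qad \<delta> c (p + y) (g + h) (Suc m) \<approx> (p + y) * (?P m + S) - v *\<^sub>k ((?P m + S) * (p + y))"
    unfolding qad.simps v_def by (intro cong_diff cong_smul cong_mult_left cong_mult_right IH)
  also have "\<dots> = ?P (Suc m) + (y * ?P m - v *\<^sub>k (?P m * y)) + (p * S - v *\<^sub>k (S * p)) + (y * S - v *\<^sub>k (S * y))"
    by (rule split)
  also have "\<dots> \<approx> ?P (Suc m) + 0 + (\<Sum>r\<le>m. ?f r)
      + (\<Sum>r\<le>m. (qcoeff Q A m r * Q ^ (m - r)) *\<^sub>k (p ^ (m - r) * ?Y (Suc r)))"
    by (intro cong_add cong_refl yP Sp Sy)
  also have "\<dots> = ?P (Suc m) + (\<Sum>r\<le>Suc m. qcoeff Q A (Suc m) r *\<^sub>k (p ^ (Suc m - r) * ?Y r))"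
    by (simp only: combine add.assoc add_0)
  finally show ?case by (simp only: Q_def A_def)
qed

text \<open>At N = 1 - c every coefficient with r < N contains the vanishing factor 1 - A Q^(N - 1),
  so only the two pure terms survive: the Serre polynomial is additive on such sums.\<close>

lemma qad_sum:
  assumes "qcommute (2 * \<delta>) y p" "qcommute (of_int c * \<delta>) y g" "qcommute (of_int c * \<delta>) h p"
    and "\<delta> \<noteq> 0" "int N = 1 - c" "N > 0"
  shows "qad \<delta> c (p + y) (g + h) N \<approx> qad \<delta> c p g N + qad \<delta> c y h N"
proof -
  let ?Q = "qpow (2 * \<delta>)" and ?A = "qpow (2 * of_int c * \<delta>)"
  \<comment> \<open>The exponent of A Q^(N - 1) is 2 (c + N - 1) \<delta> = 0.\<close>
  have "2 * of_int c * \<delta> + of_nat (N - 1) * (2 * \<delta>) = (2 * \<delta>) * (of_int (c + int N - 1))"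
    using assms(6) by (simp add: of_nat_diff algebra_simps)
  then have A: "?A * ?Q ^ (N - 1) = 1"
    using assms(5) by (simp add: qpow_power flip: qpow_add)
  have Q: "?Q ^ s \<noteq> 1" if "s > 0" for s using that assms(4) by (simp add: qpow_power)
  have "(\<Sum>r\<le>N. qcoeff ?Q ?A N r *\<^sub>k (p ^ (N - r) * qad \<delta> c y h r))
     = (\<Sum>r\<in>{N}. qcoeff ?Q ?A N r *\<^sub>k (p ^ (N - r) * qad \<delta> c y h r))"
    using qcoeff_eq_0[OF _ A Q] by (intro sum.mono_neutral_right) auto
  also have "\<dots> = qad \<delta> c y h N" by (simp add: qcoeff_diag)
  finally show ?thesis using qad_sum_expand[OF assms(1-3), of N] by simp
qed

end

section \<open>Explicit coefficients of the iterated q-commutator\<close>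

definition qnum :: "rat \<Rightarrow> nat \<Rightarrow> kk" where
  "qnum \<delta> n = (qpow (of_nat n * \<delta>) - qpow (- (of_nat n * \<delta>))) / (qpow \<delta> - qpow (- \<delta>))"

definition qfactorial :: "rat \<Rightarrow> nat \<Rightarrow> kk" where
  "qfactorial \<delta> n = (\<Prod>m=1..n. qnum \<delta> m)"

lemma qfactorial_0 [simp]: "qfactorial \<delta> 0 = 1" by (simp add: qfactorial_def)
lemma qfactorial_Suc: "qfactorial \<delta> (Suc n) = qfactorial \<delta> n * qnum \<delta> (Suc n)"
  by (simp add: qfactorial_def)

lemma qnum_nonzero: "\<delta> \<noteq> 0 \<Longrightarrow> n > 0 \<Longrightarrow> qnum \<delta> n \<noteq> 0"
  by (simp add: qnum_def eq_neg_iff_add_eq_0 flip: mult_2)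

lemma qfactorial_nonzero: "\<delta> \<noteq> 0 \<Longrightarrow> qfactorial \<delta> n \<noteq> 0"
  by (auto simp: qfactorial_def qnum_nonzero)

lemma qnum_pascal:
  "qnum \<delta> (m + n) = qpow (- (of_nat n * \<delta>)) * qnum \<delta> m + qpow (of_nat m * \<delta>) * qnum \<delta> n"
  unfolding qnum_def times_divide_eq_right add_divide_distrib[symmetric]
  by (rule arg_cong[of _ _ "\<lambda>z. z / _"]) (simp add: algebra_simps flip: qpow_add)

text \<open>The coefficient of E^(m - s) G E^s: a signed q-binomial coefficient multiplied by q^(s
  (m - 1 + c) \<delta>), as \<open>qad_coeff_closed\<close> makes precise.\<close>

fun qad_coeff :: "rat \<Rightarrow> int \<Rightarrow> nat \<Rightarrow> nat \<Rightarrow> kk" where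
  "qad_coeff \<delta> c 0 0 = 1"
| "qad_coeff \<delta> c 0 (Suc s) = 0"
| "qad_coeff \<delta> c (Suc m) 0 = qad_coeff \<delta> c m 0"
| "qad_coeff \<delta> c (Suc m) (Suc s) =
     qad_coeff \<delta> c m (Suc s) - qpow ((2 * of_nat m + of_int c) * \<delta>) * qad_coeff \<delta> c m s"

lemma qad_coeff_above: "m < s \<Longrightarrow> qad_coeff \<delta> c m s = 0"
  by (induction \<delta> c m s rule: qad_coeff.induct) auto

lemma qad_coeff_closed:
  "s \<le> m \<Longrightarrow> qad_coeff \<delta> c m s * (qfactorial \<delta> s * qfactorial \<delta> (m - s)) =
     (- 1) ^ s * qpow (of_nat s * (of_nat m - 1 + of_int c) * \<delta>) * qfactorial \<delta> m"
proof (induction \<delta> c m s rule: qad_coeff.induct)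
  case (3 \<delta> c m)
  then show ?case by (auto simp: qfactorial_Suc)
next
  case (4 \<delta> c m s)
  from "4.prems" obtain n where m: "m = s + n" using le_Suc_ex by auto
  let ?F = "qfactorial \<delta>"
  define w where "w = qpow (of_nat (Suc s) * (of_nat m + of_int c) * \<delta>)"
  have ih2: "qad_coeff \<delta> c m s * (?F s * ?F n) = (- 1) ^ s * qpow (of_nat s * (of_nat m - 1 + of_int c) * \<delta>) * ?F m"
    using "4.IH"(2) by (simp add: m)
  have ih1: "qad_coeff \<delta> c m (Suc s) * (?F (Suc s) * ?F n)
      = - ((- 1) ^ s * qpow (of_nat (Suc s) * (of_nat m - 1 + of_int c) * \<delta>) * ?F m * qnum \<delta> n)"
  proof (cases n)
    case 0
    then show ?thesis by (simp add: qad_coeff_above m qnum_def)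
  next
    case (Suc n')
    then have "Suc s \<le> m" "m - Suc s = n'" by (simp_all add: m)
    then have "qad_coeff \<delta> c m (Suc s) * (?F (Suc s) * ?F n')
      = - ((- 1) ^ s * qpow (of_nat (Suc s) * (of_nat m - 1 + of_int c) * \<delta>) * ?F m)"
      using "4.IH"(1) by simp
    then have "qad_coeff \<delta> c m (Suc s) * (?F (Suc s) * ?F n') * qnum \<delta> n
      = - ((- 1) ^ s * qpow (of_nat (Suc s) * (of_nat m - 1 + of_int c) * \<delta>) * ?F m) * qnum \<delta> n"
      by simp
    then show ?thesis by (simp add: Suc qfactorial_Suc algebra_simps)
  qed
  have w1: "qpow (of_nat (Suc s) * (of_nat m - 1 + of_int c) * \<delta>) = w * qpow (- (of_nat (Suc s) * \<delta>))"
    by (simp add: w_def algebra_simps flip: qpow_add)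
  have w2: "qpow ((2 * of_nat m + of_int c) * \<delta>) * qpow (of_nat s * (of_nat m - 1 + of_int c) * \<delta>)
      = w * qpow (of_nat n * \<delta>)"
    by (simp add: w_def m algebra_simps flip: qpow_add)
  have "qad_coeff \<delta> c (Suc m) (Suc s) * (?F (Suc s) * ?F n)
    = qad_coeff \<delta> c m (Suc s) * (?F (Suc s) * ?F n)
      - qpow ((2 * of_nat m + of_int c) * \<delta>) * qnum \<delta> (Suc s) * (qad_coeff \<delta> c m s * (?F s * ?F n))"
    by (simp add: qfactorial_Suc algebra_simps)
  also have "\<dots> = - ((- 1) ^ s * ?F m * (qpow (of_nat (Suc s) * (of_nat m - 1 + of_int c) * \<delta>) * qnum \<delta> n
      + (qpow ((2 * of_nat m + of_int c) * \<delta>) * qpow (of_nat s * (of_nat m - 1 + of_int c) * \<delta>)) * qnum \<delta> (Suc s)))"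
    unfolding ih1 ih2 by (simp add: algebra_simps)
  also have "\<dots> = - ((- 1) ^ s * ?F m * w * (qpow (- (of_nat (Suc s) * \<delta>)) * qnum \<delta> n + qpow (of_nat n * \<delta>) * qnum \<delta> (Suc s)))"
    unfolding w1 w2 by (simp add: algebra_simps)
  also have "qpow (- (of_nat (Suc s) * \<delta>)) * qnum \<delta> n + qpow (of_nat n * \<delta>) * qnum \<delta> (Suc s) = qnum \<delta> (Suc m)"
    using qnum_pascal[of \<delta> n "Suc s"] by (simp add: m add.commute)
  finally show ?case by (simp add: m w_def qfactorial_Suc algebra_simps)
qed auto

lemma qad_expand:
  "qad \<delta> c E G m = (\<Sum>s\<le>m. qad_coeff \<delta> c m s *\<^sub>k (E ^ (m - s) * G * E ^ s))"
proof (induction m)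
  case (Suc m)
  let ?v = "qpow ((2 * of_nat m + of_int c) * \<delta>)" and ?h = "qad_coeff \<delta> c"
  have "E * qad \<delta> c E G m = (\<Sum>s\<le>m. ?h m s *\<^sub>k (E ^ (Suc m - s) * G * E ^ s))"
    unfolding Suc by (simp add: sum_distrib_left mult.assoc Suc_diff_le)
  also have "\<dots> = (\<Sum>s\<le>Suc m. ?h m s *\<^sub>k (E ^ (Suc m - s) * G * E ^ s))"
    by (simp add: qad_coeff_above)
  also have "\<dots> = ?h m 0 *\<^sub>k (E ^ Suc m * G) + (\<Sum>s\<le>m. ?h m (Suc s) *\<^sub>k (E ^ (m - s) * G * E ^ Suc s))"
    by (subst sum.atMost_Suc_shift) simp
  finally have 1: "E * qad \<delta> c E G m = \<dots>" .
  have 2: "qad \<delta> c E G m * E = (\<Sum>s\<le>m. ?h m s *\<^sub>k (E ^ (m - s) * G * E ^ Suc s))"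
    unfolding Suc by (simp add: sum_distrib_right mult.assoc power_commutes)
  have "qad \<delta> c E G (Suc m) = ?h (Suc m) 0 *\<^sub>k (E ^ Suc m * G)
     + (\<Sum>s\<le>m. ?h (Suc m) (Suc s) *\<^sub>k (E ^ (m - s) * G * E ^ Suc s))"
    unfolding qad.simps 1 2
    by (simp add: smul_diff_left sum_subtractf smul_sum del: power_Suc)
  then show ?case by (subst sum.atMost_Suc_shift) simp
qed simp

text \<open>At N = 1 - c the power of q in \<open>qad_coeff_closed\<close> is trivial and plain
  signed q-binomials remain. Reversing the order of summation produces the sign (- 1)^N.\<close>

lemma qad_eq_serre_sum:
  assumes "\<delta> \<noteq> 0" "int N = 1 - c"
  shows "(\<Sum>m\<le>N. ((- 1) ^ m / (qfactorial \<delta> m * qfactorial \<delta> (N - m))) *\<^sub>k (E ^ m * G * E ^ (N - m)))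
      = ((- 1) ^ N / qfactorial \<delta> N) *\<^sub>k qad \<delta> c E G N"
proof -
  have "rat_of_nat N - 1 + of_int c = of_int (int N - 1 + c)" by simp
  also have "\<dots> = 0" using assms(2) by simp
  finally have e: "rat_of_nat N - 1 + of_int c = 0" .
  have h: "qad_coeff \<delta> c N s = (- 1) ^ s * qfactorial \<delta> N / (qfactorial \<delta> s * qfactorial \<delta> (N - s))"
    if "s \<le> N" for s
  proof -
    have "qad_coeff \<delta> c N s * (qfactorial \<delta> s * qfactorial \<delta> (N - s)) = (- 1) ^ s * qfactorial \<delta> N"
      using qad_coeff_closed[OF that, of \<delta> c] by (simp only: e mult_zero_right mult_zero_left qpow_0 mult_1_right)
    then show ?thesis using qfactorial_nonzero[OF assms(1)] by (simp add: eq_divide_eq)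
  qed
  have "((- 1) ^ N / qfactorial \<delta> N) *\<^sub>k qad \<delta> c E G N
     = (\<Sum>s\<le>N. ((- 1) ^ N / qfactorial \<delta> N * qad_coeff \<delta> c N s) *\<^sub>k (E ^ (N - s) * G * E ^ s))"
    by (simp add: qad_expand smul_sum)
  also have "\<dots> = (\<Sum>s\<le>N. ((- 1) ^ (N - s) / (qfactorial \<delta> s * qfactorial \<delta> (N - s))) *\<^sub>k (E ^ (N - s) * G * E ^ s))"
  proof (intro sum.cong refl arg_cong2[of _ _ _ _ smul])
    fix s assume "s \<in> {..N}"
    then have sN: "s \<le> N" by simp
    then have "(- 1 :: kk) ^ N = (- 1) ^ (N - s) * (- 1) ^ s"
      by (simp flip: power_add)
    then have "(- 1 :: kk) ^ N * (- 1) ^ s = (- 1) ^ (N - s)"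
      by (simp add: mult.assoc flip: power_mult_distrib)
    then show "(- 1) ^ N / qfactorial \<delta> N * qad_coeff \<delta> c N s
        = (- 1) ^ (N - s) / (qfactorial \<delta> s * qfactorial \<delta> (N - s))"
      using qfactorial_nonzero[OF assms(1), of N] by (simp add: h[OF sN])
  qed
  also have "\<dots> = (\<Sum>m\<le>N. ((- 1) ^ m / (qfactorial \<delta> m * qfactorial \<delta> (N - m))) *\<^sub>k (E ^ m * G * E ^ (N - m)))"
    by (rule sum.reindex_bij_witness[of _ "\<lambda>m. N - m" "\<lambda>m. N - m"]) (auto simp: mult.commute)
  finally show ?thesis by simp
qed

section \<open>Commutation of Serre elements with the opposite generators\<close>

context two_sided_ideal
begin

text \<open>Only G fails to commute with F, so the commutator with F remains E^m times a combination
  of K and K'. Each further bracket multiplies the coefficients of K and K' by one factor, and both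
  products contain a zero at order N.\<close>

lemma qad_commute_target:
  assumes EF: "E * F \<approx> F * E" and GF: "G * F - F * G \<approx> \<kappa> *\<^sub>k (K - K')"
    and KE: "qcommute (of_int c * \<delta>) K E" and KE': "qcommute (- (of_int c * \<delta>)) K' E"
    and N: "int N = 1 - c" "N > 0"
  shows "qad \<delta> c E G N * F \<approx> F * qad \<delta> c E G N"
proof -
  let ?Q = "\<lambda>m. qpow (2 * of_nat m * \<delta>)" and ?R = "\<lambda>m. qpow ((2 * of_nat m + 2 * of_int c) * \<delta>)"
    and ?x = "qad \<delta> c E G"
  have step: "?x m * F - F * ?x m \<approx>
     E ^ m * (\<kappa> * (\<Prod>l<m. 1 - ?R l)) *\<^sub>k K - E ^ m * (\<kappa> * (\<Prod>l<m. 1 - ?Q l)) *\<^sub>k K'" for m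
  proof (induction m)
    case 0
    then show ?case using GF by (simp add: smul_diff_right)
  next
    case (Suc m)
    let ?v = "qpow ((2 * of_nat m + of_int c) * \<delta>)"
      and ?a = "\<kappa> * (\<Prod>l<m. 1 - ?R l)" and ?b = "\<kappa> * (\<Prod>l<m. 1 - ?Q l)"
    define D where "D = ?x m * F - F * ?x m"
    have D: "D \<approx> E ^ m * ?a *\<^sub>k K - E ^ m * ?b *\<^sub>k K'"
      using Suc by (simp only: D_def)
    have "?x (Suc m) * F - F * ?x (Suc m)
        = E * (?x m * F) - ?v *\<^sub>k (?x m * (E * F)) - (F * E) * ?x m + ?v *\<^sub>k (F * (?x m * E))"
      by (simp add: algebra_simps smul_diff_right)
    also have "\<dots> \<approx> E * (?x m * F) - ?v *\<^sub>k (?x m * (F * E)) - (E * F) * ?x m + ?v *\<^sub>k (F * (?x m * E))"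
      by (intro cong_add cong_diff cong_smul cong_mult_left cong_mult_right cong_refl EF cong_sym[OF EF])
    also have "\<dots> = E * D - ?v *\<^sub>k (D * E)"
      by (simp add: D_def algebra_simps smul_diff_right)
    also have "\<dots> \<approx> E * (E ^ m * ?a *\<^sub>k K - E ^ m * ?b *\<^sub>k K') - ?v *\<^sub>k ((E ^ m * ?a *\<^sub>k K - E ^ m * ?b *\<^sub>k K') * E)"
      by (intro cong_diff cong_smul cong_mult_left cong_mult_right D)
    also have "\<dots> = E ^ Suc m * ?a *\<^sub>k K - E ^ Suc m * ?b *\<^sub>k K' - (?v * ?a) *\<^sub>k (E ^ m * (K * E)) + (?v * ?b) *\<^sub>k (E ^ m * (K' * E))"
      by (simp add: algebra_simps smul_diff_right)
    also have "\<dots> \<approx> E ^ Suc m * ?a *\<^sub>k K - E ^ Suc m * ?b *\<^sub>k K' - (?v * ?a) *\<^sub>k (E ^ m * (qpow (of_int c * \<delta>) *\<^sub>k (E * K)))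
        + (?v * ?b) *\<^sub>k (E ^ m * (qpow (- (of_int c * \<delta>)) *\<^sub>k (E * K')))"
      using KE KE' unfolding qcommute_def by (intro cong_add cong_diff cong_smul cong_mult_left cong_refl)
    also have "\<dots> = E ^ Suc m * (?a * (1 - ?v * qpow (of_int c * \<delta>))) *\<^sub>k K
         - E ^ Suc m * (?b * (1 - ?v * qpow (- (of_int c * \<delta>)))) *\<^sub>k K'"
    proof -
      have pc: "E ^ m * (E * z) = E * (E ^ m * z)" for z
        by (metis mult.assoc power_commutes)
      show ?thesis by (simp add: pc mult.assoc smul_diff_left right_diff_distrib mult.left_commute[of _ ?v] mult.commute[of ?v])
    qed
    also have "?v * qpow (of_int c * \<delta>) = ?R m" by (simp add: algebra_simps flip: qpow_add)
    also have "?v * qpow (- (of_int c * \<delta>)) = ?Q m" by (simp add: algebra_simps flip: qpow_add)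
    finally show ?case by (simp add: mult.assoc)
  qed
  \<comment> \<open>The zeros sit at opposite ends: at l = N - 1 for K, where the exponent is 2 (N -
    1 + c) \<delta> = 0, and at l = 0 for K'.\<close>
  have "(2 * of_nat (N - 1) + 2 * of_int c) * \<delta> = 2 * of_int (int N - 1 + c) * \<delta>"
    using N(2) by (simp add: of_nat_diff)
  then have R: "?R (N - 1) = 1" using N(1) by simp
  have "(\<Prod>l<N. 1 - ?R l) = 0" using N(2) R by (intro prod_zero bexI[of _ "N - 1"]) auto
  moreover have "(\<Prod>l<N. 1 - ?Q l) = 0" using N(2) by (intro prod_zero bexI[of _ 0]) auto
  ultimately have "?x N * F - F * ?x N \<approx> 0"
    using step[of N] by (simp only: mult_zero_right smul_zero diff_self)
  then show ?thesis by (simp add: cong_def)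
qed

text \<open>Here each of the N factors E contributes. The commutator of the (m + 1)-st term with F
  collapses to the m-th term times K' with coefficient \<gamma>_0 + ... + \<gamma>_m, and for m + 1
  = N the \<gamma>_l cancel in pairs.\<close>

lemma qad_commute_source:
  assumes EF: "E * F - F * E \<approx> \<kappa> *\<^sub>k (K - K')" and GF: "G * F \<approx> F * G"
    and K: "qcommute (2 * \<delta>) K E" "qcommute (of_int c * \<delta>) K G"
    and K': "qcommute (- (2 * \<delta>)) K' E" "qcommute (- (of_int c * \<delta>)) K' G"
    and N: "int N = 1 - c" "N > 0"
  shows "qad \<delta> c E G N * F \<approx> F * qad \<delta> c E G N"
proof -
  let ?x = "qad \<delta> c E G"
  define w where "w m = (2 * of_nat m + of_int c) * \<delta>" for m
  define \<gamma> where "\<gamma> m = \<kappa> * (qpow (w m) - qpow (- w m))" for m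
  \<comment> \<open>The weight of the m-th term equals the exponent of the bracket, so the two
    contributions of K cancel and only K' is left.\<close>
  have H: "\<kappa> *\<^sub>k (K - K') * ?x m - qpow (w m) *\<^sub>k (?x m * \<kappa> *\<^sub>k (K - K')) \<approx> \<gamma> m *\<^sub>k (?x m * K')" for m
  proof -
    have 1: "K * ?x m \<approx> qpow (w m) *\<^sub>k (?x m * K)"
      using qcommute_qad_right[OF K, of m] by (simp add: qcommute_def w_def algebra_simps)
    have 2: "K' * ?x m \<approx> qpow (- w m) *\<^sub>k (?x m * K')"
      using qcommute_qad_right[OF K', of m] by (simp add: qcommute_def w_def algebra_simps)
    have "\<kappa> *\<^sub>k (K - K') * ?x m - qpow (w m) *\<^sub>k (?x m * \<kappa> *\<^sub>k (K - K'))
       = \<kappa> *\<^sub>k (K * ?x m) - \<kappa> *\<^sub>k (K' * ?x m) - (\<kappa> * qpow (w m)) *\<^sub>k (?x m * (K - K'))"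
      by (simp add: left_diff_distrib right_diff_distrib smul_diff_right mult.commute)
    also have "\<dots> \<approx> \<kappa> *\<^sub>k (qpow (w m) *\<^sub>k (?x m * K)) - \<kappa> *\<^sub>k (qpow (- w m) *\<^sub>k (?x m * K')) - (\<kappa> * qpow (w m)) *\<^sub>k (?x m * (K - K'))"
      by (intro cong_diff cong_smul 1 2 cong_refl)
    also have "\<dots> = \<gamma> m *\<^sub>k (?x m * K')"
      by (simp add: \<gamma>_def right_diff_distrib smul_diff_left smul_diff_right)
    finally show ?thesis .
  qed
  have expand: "?x (Suc m) * F - F * ?x (Suc m) \<approx> E * D - qpow (w m) *\<^sub>k (D * E) + \<gamma> m *\<^sub>k (?x m * K')"
    if "D = ?x m * F - F * ?x m" for m D
  proof -
    have "?x (Suc m) * F - F * ?x (Suc m) = E * D - qpow (w m) *\<^sub>k (D * E)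
        + ((E * F - F * E) * ?x m - qpow (w m) *\<^sub>k (?x m * (E * F - F * E)))"
      by (simp add: that w_def algebra_simps smul_diff_right)
    also have "\<dots> \<approx> E * D - qpow (w m) *\<^sub>k (D * E)
        + (\<kappa> *\<^sub>k (K - K') * ?x m - qpow (w m) *\<^sub>k (?x m * \<kappa> *\<^sub>k (K - K')))"
      by (intro cong_diff cong_add cong_smul cong_mult_left cong_mult_right EF cong_refl)
    also have "\<dots> \<approx> E * D - qpow (w m) *\<^sub>k (D * E) + \<gamma> m *\<^sub>k (?x m * K')"
      by (intro cong_add cong_refl H)
    finally show ?thesis .
  qed
  have step: "?x (Suc m) * F - F * ?x (Suc m) \<approx> (\<Sum>l\<le>m. \<gamma> l) *\<^sub>k (?x m * K')" for m
  proof (induction m)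
    case 0
    define D where "D = ?x 0 * F - F * ?x 0"
    have D: "D \<approx> 0" using GF by (simp add: D_def cong_def)
    have "?x (Suc 0) * F - F * ?x (Suc 0) \<approx> E * D - qpow (w 0) *\<^sub>k (D * E) + \<gamma> 0 *\<^sub>k (?x 0 * K')"
      by (rule expand[OF D_def])
    also have "\<dots> \<approx> E * 0 - qpow (w 0) *\<^sub>k (0 * E) + \<gamma> 0 *\<^sub>k (?x 0 * K')"
      by (intro cong_add cong_diff cong_smul cong_mult_left cong_mult_right D cong_refl)
    finally show ?case by simp
  next
    case (Suc m)
    define D where "D = ?x (Suc m) * F - F * ?x (Suc m)"
    define \<epsilon> where "\<epsilon> = (\<Sum>l\<le>m. \<gamma> l)"
    have D: "D \<approx> \<epsilon> *\<^sub>k (?x m * K')" using Suc by (simp only: D_def \<epsilon>_def)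
    \<comment> \<open>Moving K' past E lowers the exponent of step m + 1 to that of step m, so that
      the bracket with E reproduces \<open>?x (Suc m)\<close>.\<close>
    have v: "qpow (w (Suc m)) * qpow (- (2 * \<delta>)) = qpow (w m)"
      by (simp add: w_def algebra_simps flip: qpow_add)
    have "E * D - qpow (w (Suc m)) *\<^sub>k (D * E)
       \<approx> E * \<epsilon> *\<^sub>k (?x m * K') - qpow (w (Suc m)) *\<^sub>k (\<epsilon> *\<^sub>k (?x m * K') * E)"
      by (intro cong_diff cong_smul cong_mult_left cong_mult_right D)
    also have "\<dots> = \<epsilon> *\<^sub>k (E * ?x m * K') - (qpow (w (Suc m)) * \<epsilon>) *\<^sub>k (?x m * (K' * E))"
      by (simp add: mult.assoc)
    also have "\<dots> \<approx> \<epsilon> *\<^sub>k (E * ?x m * K') - (qpow (w (Suc m)) * \<epsilon>) *\<^sub>k (?x m * (qpow (- (2 * \<delta>)) *\<^sub>k (E * K')))"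
      using K'(1) unfolding qcommute_def by (intro cong_diff cong_smul cong_mult_left cong_refl)
    also have "\<dots> = \<epsilon> *\<^sub>k (E * ?x m * K') - (\<epsilon> * (qpow (w (Suc m)) * qpow (- (2 * \<delta>)))) *\<^sub>k (?x m * (E * K'))"
      by (simp add: ac_simps)
    also have "\<dots> = \<epsilon> *\<^sub>k (?x (Suc m) * K')"
      unfolding v by (simp add: w_def left_diff_distrib smul_diff_right mult.assoc)
    finally have ED: "E * D - qpow (w (Suc m)) *\<^sub>k (D * E) \<approx> \<epsilon> *\<^sub>k (?x (Suc m) * K')" .
    have "?x (Suc (Suc m)) * F - F * ?x (Suc (Suc m))
        \<approx> E * D - qpow (w (Suc m)) *\<^sub>k (D * E) + \<gamma> (Suc m) *\<^sub>k (?x (Suc m) * K')"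
      by (rule expand[OF D_def])
    also have "\<dots> \<approx> \<epsilon> *\<^sub>k (?x (Suc m) * K') + \<gamma> (Suc m) *\<^sub>k (?x (Suc m) * K')"
      by (intro cong_add ED cong_refl)
    finally show ?case by (simp only: \<epsilon>_def smul_add_left sum.atMost_Suc)
  qed
  \<comment> \<open>Since N - 1 + c = 0, the exponents w_0, ..., w_(N-1) are symmetric about 0,
    which makes \<gamma> antisymmetric.\<close>
  have w_anti: "w (N - 1 - l) = - w l" if "l \<le> N - 1" for l
  proof -
    have "w (N - 1 - l) + w l = 2 * of_int (int N - 1 + c) * \<delta>"
      using that N(2) by (simp add: w_def of_nat_diff algebra_simps)
    then show ?thesis using N(1) by (simp add: eq_neg_iff_add_eq_0)
  qed
  have "(\<Sum>l\<le>N-1. \<gamma> l) = (\<Sum>l\<le>N-1. \<gamma> (N - 1 - l))"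
    by (rule sum.reindex_bij_witness[of _ "\<lambda>m. N - 1 - m" "\<lambda>m. N - 1 - m"])
      (auto simp del: diff_diff_left)
  also have "\<dots> = (\<Sum>l\<le>N-1. - \<gamma> l)"
  proof (rule sum.cong)
    fix l assume "l \<in> {..N - 1}"
    then have "w (N - 1 - l) = - w l" using w_anti by simp
    then show "\<gamma> (N - 1 - l) = - \<gamma> l"
      unfolding \<gamma>_def by (simp only: minus_minus) (simp add: algebra_simps)
  qed simp
  finally have "(\<Sum>l\<le>N-1. \<gamma> l) + (\<Sum>l\<le>N-1. \<gamma> l) = 0" by (simp add: sum_negf)
  then have "2 * (\<Sum>l\<le>N-1. \<gamma> l) = 0" by simp
  \<comment> \<open>Antisymmetry only shows that twice the sum vanishes; characteristic zero
    finishes the argument.\<close>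
  moreover have "(2::kk) \<noteq> 0"
  proof -
    have "(of_nat 2 :: rat \<Rightarrow>\<^sub>0 complex) \<noteq> 0" by (simp only: of_nat_eq_0_iff)
    then have "Fract (of_nat 2 :: rat \<Rightarrow>\<^sub>0 complex) 1 \<noteq> Fract 0 1"
      by (metis eq_fract(1) mult.right_neutral zero_neq_one)
    then show ?thesis using of_nat_fract[of 2, where ?'a = "rat \<Rightarrow>\<^sub>0 complex"] by (metis Zero_fract_def of_nat_numeral)
  qed
  ultimately have "(\<Sum>l\<le>N-1. \<gamma> l) = 0" by simp
  then have "?x N * F - F * ?x N \<approx> 0" using step[of "N - 1"] N(2) by simp
  then show ?thesis by (simp add: cong_def)
qed

end

subsection \<open>Spans of triangular monomials\<close>

inductive_set lspan :: "('m::monoid_add \<Rightarrow>\<^sub>0 kk) set \<Rightarrow> ('m \<Rightarrow>\<^sub>0 kk) set" for S where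
  zero: "0 \<in> lspan S"
| step: "s \<in> S \<Longrightarrow> x \<in> lspan S \<Longrightarrow> c *\<^sub>k s + x \<in> lspan S"

lemma lspan_base: "s \<in> S \<Longrightarrow> s \<in> lspan S"
  using lspan.step[OF _ lspan.zero, of s S 1] by simp

lemma lspan_add: "x \<in> lspan S \<Longrightarrow> y \<in> lspan S \<Longrightarrow> x + y \<in> lspan S"
  by (induction rule: lspan.induct) (auto simp: add.assoc intro: lspan.step)

lemma lspan_smul: "x \<in> lspan S \<Longrightarrow> c *\<^sub>k x \<in> lspan S"
  by (induction rule: lspan.induct) (auto simp: smul_add_right intro: lspan.intros)

definition word :: "'g list \<Rightarrow> 'g list \<Rightarrow>\<^sub>0 kk" where
  "word u = Poly_Mapping.single u 1"

lemma word_Nil [simp]: "word [] = 1"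
  by (simp add: word_def flip: zero_list_def)

lemma word_append: "word (u @ v) = word u * word v"
  by (simp add: word_def mult_single plus_list_def)

lemma gen_eq_word: "gen g = word [g]" by (simp add: gen_def word_def)

lemma word_Cons: "word (g # u) = gen g * word u"
  using word_append[of "[g]" u] by (simp add: gen_eq_word)

lemma fscal_mult: "fscal c * x = c *\<^sub>k x" by (simp add: fscal_def smul_def)
lemma fscal_eq: "fscal c = c *\<^sub>k 1" by (simp flip: fscal_mult)
lemma single_eq_smul_word: "Poly_Mapping.single u c = c *\<^sub>k word u"
  by (simp add: word_def smul_single)

lemma free_algebra_induct [case_names word add]:
  fixes x :: "'g list \<Rightarrow>\<^sub>0 kk"
  assumes "\<And>c u. P (c *\<^sub>k word u)" "\<And>x y. P x \<Longrightarrow> P y \<Longrightarrow> P (x + y)"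
  shows "P x"
  by (rule poly_mapping_additive_induct[of P]) (use assms in \<open>auto simp: single_eq_smul_word\<close>)

lemma generator_induct [case_names one gen smul add]:
  fixes x :: "'i falg"
  assumes "P 1" "\<And>g x. P x \<Longrightarrow> P (gen g * x)" "\<And>c x. P x \<Longrightarrow> P (c *\<^sub>k x)" "\<And>x y. P x \<Longrightarrow> P y \<Longrightarrow> P (x + y)"
  shows "P x"
proof (induction x rule: free_algebra_induct)
  case (word c u)
  have "P (word u)" by (induction u) (auto simp: word_Cons assms(1,2))
  then show ?case by (rule assms(3))
qed (rule assms(4))

lemma generator_induct_right [case_names one gen smul add]:
  fixes x :: "'i falg"
  assumes "P 1" "\<And>g x. P x \<Longrightarrow> P (x * gen g)" "\<And>c x. P x \<Longrightarrow> P (c *\<^sub>k x)" "\<And>x y. P x \<Longrightarrow> P y \<Longrightarrow> P (x + y)"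
  shows "P x"
proof (induction x rule: free_algebra_induct)
  case (word c u)
  have "P (word u)"
    by (induction u rule: rev_induct) (auto simp: word_append assms(1) simp flip: gen_eq_word intro: assms(2))
  then show ?case by (rule assms(3))
qed (rule assms(4))

abbreviation fword :: "'i list \<Rightarrow> 'i falg" where "fword js \<equiv> word (map GF js)"
abbreviation eword :: "'i list \<Rightarrow> 'i falg" where "eword js \<equiv> word (map GE js)"

definition tmon :: "('i::finite \<Rightarrow> int) \<Rightarrow> 'i falg" where
  "tmon n = prod_list (map (\<lambda>j. gen_T_power j (n j)) index_list)"

lemma index_list: "distinct (index_list :: 'i::finite list)" "set (index_list :: 'i list) = UNIV"
proof -
  obtain js :: "'i list" where "set js = UNIV" "distinct js"
    using finite_distinct_list[OF finite, of UNIV] by blast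
  then have "distinct (index_list :: 'i list) \<and> set (index_list :: 'i list) = UNIV"
    unfolding index_list_def
    using someI[of "\<lambda>js :: 'i list. distinct js \<and> set js = UNIV" js] by blast
  then show "distinct (index_list :: 'i list)" "set (index_list :: 'i list) = UNIV" by auto
qed

lemma gen_T_power_0 [simp]: "gen_T_power j 0 = 1" by (simp add: gen_T_power_def)
lemma gen_T_power_1: "gen_T_power j 1 = gen (GT j)" by (simp add: gen_T_power_def)
lemma gen_T_power_minus_1: "gen_T_power j (- 1) = gen (GTinv j)" by (simp add: gen_T_power_def)

lemma prod_list_single_support:
  fixes h :: "'j \<Rightarrow> 'r::monoid_mult"
  assumes "distinct js" "\<And>j. j \<noteq> i \<Longrightarrow> h j = 1"
  shows "prod_list (map h js) = (if i \<in> set js then h i else 1)"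
  using assms(1) by (induction js) (auto simp: assms(2), metis assms(2) mult_1_left)

lemma tmon_single: "tmon (\<lambda>j. if j = i then n else 0) = gen_T_power i n"
proof -
  have "prod_list (map (\<lambda>j. gen_T_power j (if j = i then n else 0)) index_list) = gen_T_power i (if i = i then n else 0)"
    by (subst prod_list_single_support[where i = i]) (simp_all add: index_list)
  then show ?thesis by (simp add: tmon_def)
qed

lemma tmon_0 [simp]: "tmon (\<lambda>j. 0) = 1"
  using tmon_single[of undefined 0] by simp

lemma gen_K_eq: "gen_K a i = tmon (\<lambda>j. a j i)" "gen_Kinv a i = tmon (\<lambda>j. - a j i)"
  by (simp_all add: gen_K_def gen_Kinv_def tmon_def)

context two_sided_ideal
begin

lemma qcommute_inverse:
  assumes "x * x' \<approx> 1" "x' * x \<approx> 1" "qcommute s x y"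
  shows "qcommute (- s) x' y"
proof -
  have "x' * y = x' * y * 1" by simp
  also have "\<dots> \<approx> x' * y * (x * x')" by (intro cong_mult_left cong_sym[OF assms(1)])
  also have "\<dots> = x' * (y * x) * x'" by (simp add: mult.assoc)
  also have "\<dots> \<approx> x' * (qpow (- s) *\<^sub>k (x * y)) * x'"
    using qcommute_flip[OF assms(3)] by (intro cong_mult_left cong_mult_right) (simp add: qcommute_def)
  also have "\<dots> = qpow (- s) *\<^sub>k ((x' * x) * (y * x'))" by (simp add: mult.assoc)
  also have "\<dots> \<approx> qpow (- s) *\<^sub>k (1 * (y * x'))" by (intro cong_smul cong_mult_right assms(2))
  finally show ?thesis by (simp add: qcommute_def)
qed

lemma qcommute_prod_list:
  assumes "\<And>j. j \<in> set js \<Longrightarrow> qcommute (s j) (h j) y"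
  shows "qcommute (\<Sum>j\<leftarrow>js. s j) (prod_list (map h js)) y"
  using assms by (induction js) (auto intro: qcommute_mult_left)

lemma prod_list_mult_cong:
  assumes "\<And>j j'. g j * h j' \<approx> h j' * g j"
  shows "prod_list (map g js) * prod_list (map h js) \<approx> prod_list (map (\<lambda>j. g j * h j) js)"
proof (induction js)
  case (Cons j js)
  have "qcommute 0 (prod_list (map g js)) (h j)"
    using qcommute_prod_list[of js "\<lambda>_. 0" g "h j"] assms by (simp add: qcommute_def sum_list_triv)
  then have c: "prod_list (map g js) * (h j * z) \<approx> h j * (prod_list (map g js) * z)" for z
    using qcommute_left by fastforce
  have "prod_list (map g (j # js)) * prod_list (map h (j # js))
     = g j * (prod_list (map g js) * (h j * prod_list (map h js)))" by (simp add: mult.assoc)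
  also have "\<dots> \<approx> g j * (h j * (prod_list (map g js) * prod_list (map h js)))"
    by (intro cong_mult_left c)
  also have "\<dots> \<approx> g j * (h j * prod_list (map (\<lambda>j. g j * h j) js))"
    by (intro cong_mult_left Cons)
  finally show ?case by (simp add: mult.assoc)
qed simp

end

section \<open>Cartan data and relators\<close>

context quantum_datum
begin

lemma d_pos: "d i > 0"
  using scalar_product by (auto simp: d_def invariant_scalar_product_def simple_root_def axis_eq_0_iff)

lemma d_nonzero [simp]: "d i \<noteq> 0" using d_pos[of i] by simp

lemma cartan_diag [simp]: "a i i = 2" using finite_type by (simp add: finite_type_cartan_def)
lemma cartan_le: "i \<noteq> j \<Longrightarrow> a i j \<le> 0" using finite_type by (simp add: finite_type_cartan_def)

text \<open>The reflection s_i is an isometry with s_i \<alpha>_i = - \<alpha>_i, whence (\<alpha>_i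
  | \<alpha>_j) = - (\<alpha>_i | \<alpha>_j) + 2 d_i a_ij. Symmetry of the form then gives d_i a_ij
  = d_j a_ji.\<close>

lemma form_simple_roots: "form (simple_root i) (simple_root j) = d i * of_int (a i j)"
proof -
  have pair: "pairing (simple_root l) (simple_coroot a i) = of_int (a i l)" for l
  proof -
    have "(\<Sum>m\<in>UNIV. simple_root l $ m * simple_coroot a i $ m)
        = (\<Sum>m\<in>UNIV. if m = l then of_int (a i l) else 0)"
      by (intro sum.cong refl) (auto simp: simple_root_def simple_coroot_def axis_def)
    then show ?thesis by (simp add: pairing_def)
  qed
  note sp = scalar_product[unfolded invariant_scalar_product_def]
  have sym: "form x y = form y x" for x y using sp by blast
  have add: "form (x + y) z = form x z + form y z" for x y z using sp by blast
  have scale: "form (c *s x) y = c * form x y" for c x y using sp by blast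
  have refl: "form (reflection a i x) (reflection a i y) = form x y" for x y using sp by blast
  have diff: "form (x - c *s y) z = form x z - c * form y z" for x y z c
  proof -
    have "x - c *s y = x + (- c) *s y" by (simp add: vec_eq_iff)
    then have "form (x - c *s y) z = form x z + (- c) * form y z" by (simp only: add scale)
    then show ?thesis by simp
  qed
  have diff': "form z (x - c *s y) = form z x - c * form z y" for x y z c
    using diff[of x c y z] by (simp add: sym)
  have "form (simple_root i) (simple_root j)
     = form (simple_root i - 2 *s simple_root i) (simple_root j - of_int (a i j) *s simple_root i)"
    using refl[of "simple_root i" "simple_root j"] by (simp add: reflection_def pair)
  also have "\<dots> = - form (simple_root i) (simple_root j) + 2 * of_int (a i j) * d i"
    by (simp add: diff diff' d_def algebra_simps)
  finally show ?thesis by simp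
qed

lemma symmetrized: "d i * of_int (a i j) = d j * of_int (a j i)"
proof -
  have "form (simple_root i) (simple_root j) = form (simple_root j) (simple_root i)"
    using scalar_product unfolding invariant_scalar_product_def by blast
  then show ?thesis by (simp add: form_simple_roots)
qed

text \<open>Split off from the Serre elements because these relations hold on all functions on
  words, whereas the Serre relations of the f_i hold only on a submodule.\<close>

definition base_relators :: "'i falg set" where
  "base_relators =
     (\<Union>i. {gen (GT i) * gen (GTinv i) - 1, gen (GTinv i) * gen (GT i) - 1}) \<union>
     (\<Union>i j. {gen (GT i) * gen (GT j) - gen (GT j) * gen (GT i),
              gen (GT i) * gen (GE j) * gen (GTinv i)
                - fscal (qpow (if i = j then d i else 0)) * gen (GE j),
              gen (GT i) * gen (GF j) * gen (GTinv i)
                - fscal (qpow (- (if i = j then d i else 0))) * gen (GF j),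
              gen (GE i) * gen (GF j) - gen (GF j) * gen (GE i)
                - (if i = j
                   then fscal (1 / (qpow (d i) - qpow (- d i))) * (gen_K a i - gen_Kinv a i)
                   else 0)})"

definition serre_exponent :: "'i \<Rightarrow> 'i \<Rightarrow> nat" where
  "serre_exponent i j = nat (1 - a i j)"

lemma serre_exponent:
  assumes "i \<noteq> j" shows "int (serre_exponent i j) = 1 - a i j" "serre_exponent i j > 0"
  using cartan_le[OF assms] by (auto simp: serre_exponent_def)

lemma serre_eq_sum:
  "serre A i j = (\<Sum>m\<le>serre_exponent i j.
     ((- 1) ^ m / (qfactorial (d i) m * qfactorial (d i) (serre_exponent i j - m)))
       *\<^sub>k (gen (A i) ^ m * gen (A j) * gen (A i) ^ (serre_exponent i j - m)))"
  by (simp add: serre_def serre_exponent_def fscal_mult qfact_def qint_def qfactorial_def qnum_def mult.assoc Let_def)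

lemma serre_eq_qad:
  assumes "i \<noteq> j"
  shows "serre A i j = ((- 1) ^ serre_exponent i j / qfactorial (d i) (serre_exponent i j))
      *\<^sub>k qad (d i) (a i j) (gen (A i)) (gen (A j)) (serre_exponent i j)"
  unfolding serre_eq_sum using serre_exponent[OF assms] by (intro qad_eq_serre_sum) auto

lemma qad_eq_serre:
  assumes "i \<noteq> j"
  shows "\<exists>c. qad (d i) (a i j) (gen (A i)) (gen (A j)) (serre_exponent i j) = c *\<^sub>k serre A i j"
proof -
  let ?N = "serre_exponent i j"
  have "(qfactorial (d i) ?N / (- 1) ^ ?N) *\<^sub>k serre A i j = qad (d i) (a i j) (gen (A i)) (gen (A j)) ?N"
    unfolding serre_eq_qad[OF assms] by (simp add: qfactorial_nonzero)
  then show ?thesis by metis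
qed

lemma relators_eq: "relators = base_relators \<union> (\<Union>i. \<Union>j\<in>- {i}. {serre GE i j, serre GF i j})"
  by (simp add: relators_def base_relators_def)

definition word_weight :: "('i \<Rightarrow> int) \<Rightarrow> 'i list \<Rightarrow> rat" where
  "word_weight n js = (\<Sum>j\<leftarrow>js. of_int (n j) * d j)"

lemma word_weight_simps [simp]:
  "word_weight n [] = 0" "word_weight n (j # js) = of_int (n j) * d j + word_weight n js"
  "word_weight n (js @ ks) = word_weight n js + word_weight n ks"
  by (simp_all add: word_weight_def)

end

text \<open>Two ideals instantiate this: the relation ideal of U, and the annihilator of the
  functions on words, which need not contain the Serre elements of the f_i.\<close>

locale quantum_ideal = quantum_datum a form + two_sided_ideal J
  for a :: "'i::finite \<Rightarrow> 'i \<Rightarrow> int" and form :: "'i weight \<Rightarrow> 'i weight \<Rightarrow> rat" and J :: "'i falg set" +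
  assumes base_subset: "base_relators \<subseteq> J"
begin

lemma T_inv: "gen (GT i) * gen (GTinv i) \<approx> 1" "gen (GTinv i) * gen (GT i) \<approx> 1"
  using base_subset by (auto simp: cong_def base_relators_def)

lemma T_comm: "gen (GT i) * gen (GT j) \<approx> gen (GT j) * gen (GT i)"
proof -
  have "gen (GT i) * gen (GT j) - gen (GT j) * gen (GT i) \<in> J"
    using base_subset unfolding base_relators_def by blast
  then show ?thesis by (simp only: cong_def)
qed

lemma T_conj:
  assumes "gen (GT i) * x * gen (GTinv i) \<approx> qpow s *\<^sub>k x"
  shows "qcommute s (gen (GT i)) x"
proof -
  have "gen (GT i) * x = gen (GT i) * x * 1" by simp
  also have "\<dots> \<approx> gen (GT i) * x * (gen (GTinv i) * gen (GT i))" by (intro cong_mult_left cong_sym[OF T_inv(2)])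
  also have "\<dots> = (gen (GT i) * x * gen (GTinv i)) * gen (GT i)" by (simp add: mult.assoc)
  also have "\<dots> \<approx> (qpow s *\<^sub>k x) * gen (GT i)" by (intro cong_mult_right assms)
  finally show ?thesis by (simp add: qcommute_def)
qed

lemma T_E: "qcommute (if i = j then d i else 0) (gen (GT i)) (gen (GE j))"
  and T_F: "qcommute (- (if i = j then d i else 0)) (gen (GT i)) (gen (GF j))"
proof -
  have "gen (GT i) * gen (GE j) * gen (GTinv i) - fscal (qpow (if i = j then d i else 0)) * gen (GE j) \<in> J"
    "gen (GT i) * gen (GF j) * gen (GTinv i) - fscal (qpow (- (if i = j then d i else 0))) * gen (GF j) \<in> J"
    using base_subset unfolding base_relators_def by blast+
  then show "qcommute (if i = j then d i else 0) (gen (GT i)) (gen (GE j))"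
    "qcommute (- (if i = j then d i else 0)) (gen (GT i)) (gen (GF j))"
    by (intro T_conj; simp only: cong_def fscal_mult)+
qed

lemma T_power_qcommute:
  assumes "qcommute s (gen (GT j)) x" shows "qcommute (of_int n * s) (gen_T_power j n) x"
proof (cases "n \<ge> 0")
  case True
  then show ?thesis using qcommute_power_left[OF assms, of "nat n"] by (simp add: gen_T_power_def)
next
  case False
  then show ?thesis
    using qcommute_power_left[OF qcommute_inverse[OF T_inv assms], of "nat (- n)"] by (simp add: gen_T_power_def)
qed

lemma T_powers_commute: "qcommute 0 (gen_T_power i m) (gen_T_power j n)"
proof -
  have 1: "qcommute 0 (gen (GT j)) (gen (GT i))" for i j using T_comm by (simp add: qcommute_def)
  have "qcommute 0 (gen_T_power j n) (gen (GT i))" using T_power_qcommute[OF 1, of n j i] by simp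
  then have "qcommute 0 (gen (GT i)) (gen_T_power j n)" using qcommute_flip[of 0] by simp
  from T_power_qcommute[OF this, of m] show ?thesis by simp
qed

lemma T_power_Suc: "gen_T_power j n * gen (GT j) \<approx> gen_T_power j (n + 1)"
proof (cases "n \<ge> 0")
  case True
  then have "nat (n + 1) = Suc (nat n)" by simp
  then show ?thesis using True by (simp add: gen_T_power_def power_commutes)
next
  case False
  then obtain l where l: "n = - int (Suc l)" by (metis not_le neg_int_cases Suc_pred')
  have e: "gen_T_power j (n + 1) = gen (GTinv j) ^ l"
    by (cases l) (simp_all add: gen_T_power_def l nat_add_distrib)
  have "gen_T_power j n = gen (GTinv j) ^ l * gen (GTinv j)"
    by (simp add: gen_T_power_def l nat_add_distrib power_commutes)
  then have "gen_T_power j n * gen (GT j) = gen (GTinv j) ^ l * (gen (GTinv j) * gen (GT j))"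
    by (simp add: mult.assoc)
  also have "\<dots> \<approx> gen (GTinv j) ^ l * 1" by (intro cong_mult_left T_inv)
  finally show ?thesis by (simp add: e)
qed

lemma T_power_pred: "gen_T_power j n * gen (GTinv j) \<approx> gen_T_power j (n - 1)"
proof -
  have "gen_T_power j n * gen (GTinv j) \<approx> gen_T_power j (n - 1) * gen (GT j) * gen (GTinv j)"
    using T_power_Suc[of j "n - 1"] by (intro cong_mult_right) (simp add: cong_sym)
  also have "\<dots> \<approx> gen_T_power j (n - 1) * 1" unfolding mult.assoc by (intro cong_mult_left T_inv)
  finally show ?thesis by simp
qed

lemma T_power_add: "gen_T_power j n * gen_T_power j m \<approx> gen_T_power j (n + m)"
proof -
  have 1: "gen_T_power j n * gen (GT j) ^ l \<approx> gen_T_power j (n + int l)" for l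
  proof (induction l)
    case (Suc l)
    have "gen_T_power j n * gen (GT j) ^ Suc l = (gen_T_power j n * gen (GT j) ^ l) * gen (GT j)"
      by (simp add: mult.assoc power_commutes)
    also have "\<dots> \<approx> gen_T_power j (n + int l) * gen (GT j)" by (intro cong_mult_right Suc)
    also have "\<dots> \<approx> gen_T_power j (n + int l + 1)" by (rule T_power_Suc)
    finally show ?case by (simp add: ac_simps)
  qed simp
  have 2: "gen_T_power j n * gen (GTinv j) ^ l \<approx> gen_T_power j (n - int l)" for l
  proof (induction l)
    case (Suc l)
    have "gen_T_power j n * gen (GTinv j) ^ Suc l = (gen_T_power j n * gen (GTinv j) ^ l) * gen (GTinv j)"
      by (simp add: mult.assoc power_commutes)
    also have "\<dots> \<approx> gen_T_power j (n - int l) * gen (GTinv j)" by (intro cong_mult_right Suc)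
    also have "\<dots> \<approx> gen_T_power j (n - int l - 1)" by (rule T_power_pred)
    finally show ?case by (simp add: algebra_simps)
  qed simp
  show ?thesis
  proof (cases "m \<ge> 0")
    case True
    then show ?thesis using 1[of "nat m"] by (simp add: gen_T_power_def)
  next
    case False
    then show ?thesis using 2[of "nat (- m)"] by (simp add: gen_T_power_def[of j m])
  qed
qed

lemma tmon_add: "tmon m * tmon n \<approx> tmon (\<lambda>j. m j + n j)"
proof -
  have "tmon m * tmon n \<approx> prod_list (map (\<lambda>j. gen_T_power j (m j) * gen_T_power j (n j)) index_list)"
    unfolding tmon_def by (rule prod_list_mult_cong) (use T_powers_commute in \<open>simp add: qcommute_def\<close>)
  also have "\<dots> \<approx> prod_list (map (\<lambda>j. gen_T_power j (m j + n j)) js)" if "js = index_list" for js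
    unfolding that[symmetric] by (induction js) (auto intro: cong_mult T_power_add)
  finally show ?thesis by (simp add: tmon_def)
qed

lemma tmon_commute: "tmon m * tmon n \<approx> tmon n * tmon m"
proof -
  have "tmon m * tmon n \<approx> tmon (\<lambda>j. m j + n j)" by (rule tmon_add)
  also have "\<dots> = tmon (\<lambda>j. n j + m j)" by (simp add: add.commute)
  also have "\<dots> \<approx> tmon n * tmon m" by (rule cong_sym[OF tmon_add])
  finally show ?thesis .
qed

lemma tmon_inv: "tmon n * tmon (\<lambda>j. - n j) \<approx> 1" "tmon (\<lambda>j. - n j) * tmon n \<approx> 1"
  using tmon_add[of n "\<lambda>j. - n j"] tmon_add[of "\<lambda>j. - n j" n] by simp_all

lemma tmon_qcommute:
  assumes "\<And>j. qcommute (s j) (gen (GT j)) x"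
  shows "qcommute (\<Sum>j\<in>UNIV. of_int (n j) * s j) (tmon n) x"
proof -
  have "qcommute (\<Sum>j\<leftarrow>index_list. of_int (n j) * s j) (tmon n) x"
    unfolding tmon_def by (intro qcommute_prod_list T_power_qcommute assms)
  also have "(\<Sum>j\<leftarrow>index_list. of_int (n j) * s j) = (\<Sum>j\<in>UNIV. of_int (n j) * s j)"
    using sum_list_distinct_conv_sum_set[OF index_list(1), of "\<lambda>j. of_int (n j) * s j"]
    by (simp add: index_list(2))
  finally show ?thesis .
qed

lemma tmon_E: "qcommute (of_int (n l) * d l) (tmon n) (gen (GE l))"
proof -
  have "(\<Sum>j\<in>UNIV. of_int (n j) * (if j = l then d j else 0)) = of_int (n l) * d l"
    by (simp add: if_distrib[of "(*) _"] cong: if_cong)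
  then show ?thesis using tmon_qcommute[OF T_E, of n l] by simp
qed

lemma tmon_F: "qcommute (- (of_int (n l) * d l)) (tmon n) (gen (GF l))"
proof -
  have "(\<Sum>j\<in>UNIV. of_int (n j) * - (if j = l then d j else 0)) = - (of_int (n l) * d l)"
    by (simp add: if_distrib[of "(*) _"] if_distrib[of uminus] cong: if_cong)
  then show ?thesis using tmon_qcommute[OF T_F, of n l] by simp
qed

lemma tmon_eword: "qcommute (word_weight n js) (tmon n) (eword js)"
  by (induction js) (auto simp: word_Cons intro: qcommute_mult_right tmon_E)

lemma tmon_fword: "qcommute (- word_weight n js) (tmon n) (fword js)"
proof (induction js)
  case (Cons j js)
  from qcommute_mult_right[OF tmon_F[of n j] Cons] show ?case by (simp add: word_Cons)
qed simp

lemma K_E: "qcommute (d i * of_int (a i l)) (gen_K a i) (gen (GE l))"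
  and K_F: "qcommute (- (d i * of_int (a i l))) (gen_K a i) (gen (GF l))"
  and Kinv_E: "qcommute (- (d i * of_int (a i l))) (gen_Kinv a i) (gen (GE l))"
  and Kinv_F: "qcommute (d i * of_int (a i l)) (gen_Kinv a i) (gen (GF l))"
  using tmon_E[of "\<lambda>j. a j i" l] tmon_F[of "\<lambda>j. a j i" l] tmon_E[of "\<lambda>j. - a j i" l] tmon_F[of "\<lambda>j. - a j i" l]
  by (simp_all add: gen_K_eq symmetrized[of i l] mult.commute)

definition EF_coeff :: "'i \<Rightarrow> kk" where
  "EF_coeff i = 1 / (qpow (d i) - qpow (- d i))"

lemma E_F: "gen (GE i) * gen (GF j) - gen (GF j) * gen (GE i)
    \<approx> (if i = j then EF_coeff i *\<^sub>k (gen_K a i - gen_Kinv a i) else 0)"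
proof -
  have "gen (GE i) * gen (GF j) - gen (GF j) * gen (GE i)
     - (if i = j then fscal (1 / (qpow (d i) - qpow (- d i))) * (gen_K a i - gen_Kinv a i) else 0) \<in> J"
    using base_subset unfolding base_relators_def by blast
  then show ?thesis by (cases "i = j") (simp_all add: cong_def EF_coeff_def fscal_mult)
qed

lemma E_F_commute: "i \<noteq> j \<Longrightarrow> gen (GE i) * gen (GF j) \<approx> gen (GF j) * gen (GE i)"
  using E_F[of i j] by (simp add: cong_def)

text \<open>If l = j the opposite generator meets the target of the q-commutator, if l = i its
  repeated factor, and otherwise nothing. As only the base relations enter, this can be used to
  prove the Serre relations of the e_i in a module.\<close>

lemma serre_E_F:
  assumes "i \<noteq> j" shows "serre GE i j * gen (GF l) \<approx> gen (GF l) * serre GE i j"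
proof -
  have "qad (d i) (a i j) (gen (GE i)) (gen (GE j)) (serre_exponent i j) * gen (GF l)
     \<approx> gen (GF l) * qad (d i) (a i j) (gen (GE i)) (gen (GE j)) (serre_exponent i j)" (is "?x * _ \<approx> _")
  proof -
    consider "l = j" | "l = i" | "l \<noteq> i" "l \<noteq> j" by blast
    then show ?thesis
    proof cases
      case 1
      show ?thesis unfolding 1
        by (rule qad_commute_target[OF E_F_commute[OF assms], of "gen (GE j)" "EF_coeff j" "gen_K a j" "gen_Kinv a j"])
          (use E_F[of j j] K_E[of j i] Kinv_E[of j i] serre_exponent[OF assms]
            in \<open>simp_all add: symmetrized[of j i] mult.commute\<close>)
    next
      case 2
      show ?thesis unfolding 2
        by (rule qad_commute_source[of _ _ "EF_coeff i" "gen_K a i" "gen_Kinv a i"])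
          (use E_F[of i i] K_E[of i i] K_E[of i j] Kinv_E[of i i] Kinv_E[of i j] serre_exponent[OF assms]
            E_F_commute[of j i] assms in \<open>simp_all add: mult.commute\<close>)
    next
      case 3
      have "qcommute 0 (gen (GE i)) (gen (GF l))" "qcommute 0 (gen (GE j)) (gen (GF l))"
        using E_F_commute 3 by (simp_all add: qcommute_def)
      from qcommute_qad_left[OF this] show ?thesis by (simp add: qcommute_def)
    qed
  qed
  from cong_smul[OF this] show ?thesis unfolding serre_eq_qad[OF assms] by simp
qed

text \<open>The same argument with K and its inverse exchanged. It makes the vanishing of the Serre
  elements of the f_i stable under the e_i.\<close>

lemma serre_F_E:
  assumes "i \<noteq> j" shows "serre GF i j * gen (GE l) \<approx> gen (GE l) * serre GF i j"
proof -
  have F_E: "gen (GF l) * gen (GE l) - gen (GE l) * gen (GF l) \<approx> EF_coeff l *\<^sub>k (gen_Kinv a l - gen_K a l)" for l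
    using cong_minus[OF E_F[of l l]] by (simp add: smul_diff_right)
  have F_E_commute: "gen (GF l) * gen (GE m) \<approx> gen (GE m) * gen (GF l)" if "l \<noteq> m" for l m
    using cong_sym[OF E_F_commute[of m l]] that by blast
  have "qad (d i) (a i j) (gen (GF i)) (gen (GF j)) (serre_exponent i j) * gen (GE l)
     \<approx> gen (GE l) * qad (d i) (a i j) (gen (GF i)) (gen (GF j)) (serre_exponent i j)"
  proof -
    consider "l = j" | "l = i" | "l \<noteq> i" "l \<noteq> j" by blast
    then show ?thesis
    proof cases
      case 1
      show ?thesis unfolding 1
        by (rule qad_commute_target[OF F_E_commute[OF assms] F_E])
          (use K_F[of j i] Kinv_F[of j i] serre_exponent[OF assms]
            in \<open>simp_all add: symmetrized[of j i] mult.commute\<close>)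
    next
      case 2
      show ?thesis unfolding 2
        by (rule qad_commute_source[OF F_E F_E_commute])
          (use K_F[of i i] K_F[of i j] Kinv_F[of i i] Kinv_F[of i j] serre_exponent[OF assms]
            assms in \<open>simp_all add: mult.commute\<close>)
    next
      case 3
      have "qcommute 0 (gen (GF i)) (gen (GE l))" "qcommute 0 (gen (GF j)) (gen (GE l))"
        using F_E_commute 3 by (simp_all add: qcommute_def)
      from qcommute_qad_left[OF this] show ?thesis by (simp add: qcommute_def)
    qed
  qed
  from cong_smul[OF this] show ?thesis unfolding serre_eq_qad[OF assms] by simp
qed

lemma tmon_serre_F: "i \<noteq> j \<Longrightarrow> \<exists>s. qcommute s (tmon n) (serre GF i j)"
  unfolding serre_eq_qad using qcommute_smul_right[OF qcommute_qad_right[OF tmon_F tmon_F]] by blast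

section \<open>Spanning by triangular monomials\<close>

definition triangular :: "'i falg set" where
  "triangular = {x. \<exists>y\<in>lspan {fword ms * tmon n * eword ks | ms n ks. True}. x \<approx> y}"

lemma triangular_base: "fword ms * tmon n * eword ks \<in> triangular"
proof -
  have "fword ms * tmon n * eword ks \<in> lspan {fword ms * tmon n * eword ks | ms n ks. True}"
    by (rule lspan_base) blast
  then show ?thesis unfolding triangular_def using cong_refl by blast
qed

lemma triangular_zero: "0 \<in> triangular"
  unfolding triangular_def using lspan.zero cong_refl by blast

lemma triangular_cong: "x \<approx> y \<Longrightarrow> y \<in> triangular \<Longrightarrow> x \<in> triangular"
  unfolding triangular_def using cong_trans by blast

lemma triangular_add: "x \<in> triangular \<Longrightarrow> y \<in> triangular \<Longrightarrow> x + y \<in> triangular"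
  unfolding triangular_def using cong_add lspan_add by blast

lemma triangular_smul: "x \<in> triangular \<Longrightarrow> c *\<^sub>k x \<in> triangular"
  unfolding triangular_def using cong_smul lspan_smul by blast

lemma triangular_mult_left:
  assumes "\<And>ms n ks. g * (fword ms * tmon n * eword ks) \<in> triangular" "x \<in> triangular"
  shows "g * x \<in> triangular"
proof -
  have base: "g * y \<in> triangular" if "y \<in> lspan {fword ms * tmon n * eword ks | ms n ks. True}" for y
    using that
  proof (induction rule: lspan.induct)
    case zero
    show ?case by (simp add: triangular_zero)
  next
    case (step s x c)
    then show ?case using assms(1) by (auto simp: distrib_left intro!: triangular_add triangular_smul)
  qed
  from assms(2) obtain y where "y \<in> lspan {fword ms * tmon n * eword ks | ms n ks. True}" "x \<approx> y"
    by (auto simp: triangular_def)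
  then show ?thesis using base cong_mult_left triangular_cong by blast
qed

lemma triangular_tmon: "x \<in> triangular \<Longrightarrow> tmon m * x \<in> triangular"
proof (erule triangular_mult_left[rotated])
  fix ms n ks
  have "tmon m * (fword ms * tmon n * eword ks) = tmon m * (fword ms * (tmon n * eword ks))"
    by (simp add: mult.assoc)
  also have "\<dots> \<approx> qpow (- word_weight m ms) *\<^sub>k (fword ms * (tmon m * (tmon n * eword ks)))"
    by (rule qcommute_left[OF tmon_fword])
  also have "\<dots> \<approx> qpow (- word_weight m ms) *\<^sub>k (fword ms * (tmon (\<lambda>j. m j + n j) * eword ks))"
    by (simp only: mult.assoc[symmetric, of "tmon m"]) (intro cong_smul cong_mult_left cong_mult_right tmon_add)
  finally show "tmon m * (fword ms * tmon n * eword ks) \<in> triangular"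
    using triangular_cong triangular_smul[OF triangular_base] by (simp add: mult.assoc)
qed

lemma triangular_F: "x \<in> triangular \<Longrightarrow> gen (GF i) * x \<in> triangular"
  using triangular_mult_left[of "gen (GF i)"] triangular_base[of "i # _"] by (simp add: word_Cons mult.assoc)

text \<open>Induction on the f-word: passing its first letter leaves a torus element acting on a
  shorter monomial, which \<open>triangular_tmon\<close> covers.\<close>

lemma triangular_E: "x \<in> triangular \<Longrightarrow> gen (GE i) * x \<in> triangular"
proof (erule triangular_mult_left[rotated])
  fix ms n ks
  show "gen (GE i) * (fword ms * tmon n * eword ks) \<in> triangular"
  proof (induction ms)
    case Nil
    have "gen (GE i) * (tmon n * eword ks) \<approx> qpow (- (of_int (n i) * d i)) *\<^sub>k (tmon n * (gen (GE i) * eword ks))"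
      by (rule qcommute_left[OF qcommute_flip[OF tmon_E]])
    then show ?case
      using triangular_cong triangular_smul[OF triangular_base[of "[]" n "i # ks"]] by (simp add: word_Cons mult.assoc)
  next
    case (Cons j ms)
    let ?y = "fword ms * tmon n * eword ks"
    have H: "(if i = j then EF_coeff i *\<^sub>k (gen_K a i - gen_Kinv a i) else 0) * ?y \<in> triangular"
    proof -
      have "EF_coeff i *\<^sub>k (gen_K a i * ?y) + (- EF_coeff i) *\<^sub>k (gen_Kinv a i * ?y) \<in> triangular"
        unfolding gen_K_eq by (intro triangular_add triangular_smul triangular_tmon triangular_base)
      then show ?thesis by (cases "i = j") (simp_all add: triangular_zero left_diff_distrib smul_diff_right)
    qed
    have "gen (GE i) * (fword (j # ms) * tmon n * eword ks)
        = gen (GF j) * (gen (GE i) * ?y) + (gen (GE i) * gen (GF j) - gen (GF j) * gen (GE i)) * ?y"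
      by (simp add: word_Cons algebra_simps)
    also have "\<dots> \<approx> gen (GF j) * (gen (GE i) * ?y)
        + (if i = j then EF_coeff i *\<^sub>k (gen_K a i - gen_Kinv a i) else 0) * ?y"
      by (intro cong_add cong_refl cong_mult_right E_F)
    finally show ?case
      using triangular_cong triangular_add[OF triangular_F[OF Cons] H] by blast
  qed
qed

text \<open>The set contains 1 and is stable under left multiplication by every generator. Only
  spanning is asserted; the independence that the proof uses comes from functionals.\<close>

lemma triangular_UNIV: "x \<in> triangular"
proof (induction x rule: generator_induct)
  case one
  show ?case using triangular_base[of "[]" "\<lambda>_. 0" "[]"] by simp
next
  case (gen g x)
  have "gen (GT i) * x \<in> triangular" "gen (GTinv i) * x \<in> triangular" for i
    using triangular_tmon[OF gen, of "\<lambda>j. if j = i then 1 else 0"]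
      triangular_tmon[OF gen, of "\<lambda>j. if j = i then - 1 else 0"]
    by (simp_all only: tmon_single gen_T_power_1 gen_T_power_minus_1)
  then show ?case using triangular_E[OF gen] triangular_F[OF gen] by (cases g) simp_all
qed (auto intro: triangular_smul triangular_add)

end

context quantum_datum
begin

subsection \<open>The dual of a Verma module\<close>

text \<open>The free algebra acts from the right on functions on words. This is the full dual of the
  module with highest weight \<open>l\<close> that is free over the free algebra on the \<open>f\<^sub>i\<close>: a word stands for
  the corresponding monomial applied to the highest weight vector.\<close>

definition word_exponent :: "'i weight \<Rightarrow> 'i \<Rightarrow> 'i list \<Rightarrow> rat" where
  "word_exponent l i w = d i * (l $ i) - word_weight (\<lambda>j. if j = i then 1 else 0) w"

text \<open>The eigenvalue of (k_i - k_i^{-1}) / (q^{d_i} - q^{-d_i}) on the monomial of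
  \<open>w\<close>, where k_i, the product of the t_j^{a_ji}, acts by q^h.\<close>

definition commutator_value :: "'i weight \<Rightarrow> 'i \<Rightarrow> 'i list \<Rightarrow> kk" where
  "commutator_value l i w =
     (let h = \<Sum>j\<in>UNIV. of_int (a j i) * word_exponent l j w
      in 1 / (qpow (d i) - qpow (- d i)) * (qpow h - qpow (- h)))"

text \<open>The value of \<open>\<theta>\<close> at e_i applied to the monomial of the word: e_i
  passes the first letter, and if the letter is f_i the commutator adds a scalar multiple of the
  remaining word. The highest weight vector is killed.\<close>

primrec raise :: "'i weight \<Rightarrow> 'i \<Rightarrow> 'i list \<Rightarrow> ('i list \<Rightarrow> kk) \<Rightarrow> kk" where
  "raise l i [] \<theta> = 0"
| "raise l i (j # w) \<theta> = raise l i w (\<lambda>w'. \<theta> (j # w')) + (if i = j then \<theta> w * commutator_value l i w else 0)"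

primrec gen_act :: "'i weight \<Rightarrow> 'i gen \<Rightarrow> ('i list \<Rightarrow> kk) \<Rightarrow> 'i list \<Rightarrow> kk" where
  "gen_act l (GT i) \<theta> = (\<lambda>w. \<theta> w * qpow (word_exponent l i w))"
| "gen_act l (GTinv i) \<theta> = (\<lambda>w. \<theta> w * qpow (- word_exponent l i w))"
| "gen_act l (GE i) \<theta> = (\<lambda>w. raise l i w \<theta>)"
| "gen_act l (GF i) \<theta> = (\<lambda>w. \<theta> (i # w))"

definition word_act :: "'i weight \<Rightarrow> 'i gen list \<Rightarrow> ('i list \<Rightarrow> kk) \<Rightarrow> 'i list \<Rightarrow> kk" where
  "word_act l u \<theta> = foldl (\<lambda>\<theta> g. gen_act l g \<theta>) \<theta> u"

definition ract :: "'i weight \<Rightarrow> 'i falg \<Rightarrow> ('i list \<Rightarrow> kk) \<Rightarrow> 'i list \<Rightarrow> kk" where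
  "ract l x \<theta> w = lin_ext (\<lambda>c. c) (\<lambda>u. word_act l u \<theta> w) x"

lemma raise_linear:
  "raise l i w (\<lambda>w. c * \<theta> w + c' * \<theta>' w) = c * raise l i w \<theta> + c' * raise l i w \<theta>'"
  by (induction w arbitrary: \<theta> \<theta>') (auto simp: algebra_simps)

lemma gen_act_linear:
  "gen_act l g (\<lambda>w. c * \<theta> w + c' * \<theta>' w) = (\<lambda>w. c * gen_act l g \<theta> w + c' * gen_act l g \<theta>' w)"
  by (cases g) (auto simp: raise_linear algebra_simps)

lemma word_act_linear:
  "word_act l u (\<lambda>w. c * \<theta> w + c' * \<theta>' w) = (\<lambda>w. c * word_act l u \<theta> w + c' * word_act l u \<theta>' w)"
  unfolding word_act_def by (induction u arbitrary: \<theta> \<theta>') (auto simp: gen_act_linear)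

lemma ract_word: "ract l (word u) \<theta> = word_act l u \<theta>"
  by (rule ext) (simp add: ract_def word_def lin_ext_single)

lemma ract_smul: "ract l (c *\<^sub>k x) \<theta> w = c * ract l x \<theta> w"
  unfolding ract_def
  by (induction x rule: poly_mapping_additive_induct)
    (simp_all add: smul_single smul_add_right lin_ext_single lin_ext_add algebra_simps)

lemma ract_add: "ract l (x + y) \<theta> w = ract l x \<theta> w + ract l y \<theta> w"
  unfolding ract_def by (rule lin_ext_add) auto

lemma ract_zero [simp]: "ract l 0 \<theta> w = 0" by (simp add: ract_def)

lemma ract_zero_fun [simp]: "ract l 0 \<theta> = (\<lambda>w. 0)" by (rule ext) simp

lemma ract_diff: "ract l (x - y) \<theta> w = ract l x \<theta> w - ract l y \<theta> w"
  using ract_add[of l "x - y" y \<theta> w] by simp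

lemma ract_linear:
  "ract l x (\<lambda>w. c * \<theta> w + c' * \<theta>' w) = (\<lambda>w. c * ract l x \<theta> w + c' * ract l x \<theta>' w)"
  by (induction x rule: free_algebra_induct)
    (auto simp: ract_add ract_smul ract_word word_act_linear algebra_simps fun_eq_iff)

lemma ract_zero_right [simp]: "ract l x (\<lambda>w. 0) = (\<lambda>w. 0)"
  using ract_linear[of l x 0 undefined 0 undefined] by simp

lemma ract_scale: "ract l x (\<lambda>w. c * \<theta> w) w = c * ract l x \<theta> w"
  using ract_linear[of l x c \<theta> 0 undefined] by (simp add: fun_eq_iff)

lemma ract_mult: "ract l (x * y) \<theta> = ract l y (ract l x \<theta>)"
proof (induction x rule: free_algebra_induct)
  case (word c u)
  have "ract l (word u * y) \<theta> = ract l y (word_act l u \<theta>)"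
    by (induction y rule: free_algebra_induct)
      (auto simp: fun_eq_iff ract_smul ract_add distrib_left ract_word word_act_def simp flip: word_append)
  then show ?case by (simp add: fun_eq_iff ract_smul ract_word ract_scale)
next
  case (add x x')
  have "ract l (x + x') \<theta> = (\<lambda>w. 1 * ract l x \<theta> w + 1 * ract l x' \<theta> w)"
    by (simp add: fun_eq_iff ract_add)
  then show ?case using add by (simp only: ract_linear) (simp add: fun_eq_iff ract_add distrib_right)
qed

lemma ract_1 [simp]: "ract l 1 \<theta> = \<theta>"
  using ract_word[of l "[]" \<theta>] by (simp add: word_act_def)

lemma ract_gen: "ract l (gen g) \<theta> = gen_act l g \<theta>"
  by (simp add: gen_eq_word ract_word word_act_def)

definition annihilator :: "'i weight \<Rightarrow> 'i falg set" where
  "annihilator l = {x. \<forall>\<theta>. ract l x \<theta> = (\<lambda>w. 0)}"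

lemma annihilator_ideal: "two_sided_ideal (annihilator l)"
  by standard (auto simp: annihilator_def ract_add ract_mult intro!: ext)

text \<open>\<open>raise l j w\<close> evaluates its argument only at words obtained from
  \<open>w\<close> by deleting one letter j, and these have weight lower by n_j d_j.\<close>

lemma raise_twist:
  "raise l j w (\<lambda>w'. \<theta> w' * qpow (s - word_weight n w'))
     = raise l j w \<theta> * qpow (s + of_int (n j) * d j - word_weight n w)"
proof (induction w arbitrary: \<theta> s)
  case (Cons k w)
  have e: "s - (of_int (n k) * d k + x) = (s - of_int (n k) * d k) - x" for x
    by simp
  show ?case
    by (simp only: raise.simps word_weight_simps e Cons) (simp add: algebra_simps)
qed simp

lemma ract_gen_T_power:
  "ract l (gen_T_power i n) \<theta> w = \<theta> w * qpow (of_int n * word_exponent l i w)"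
proof -
  have 1: "ract l (gen (GT i) ^ m) \<theta> w = \<theta> w * qpow (of_nat m * word_exponent l i w)" for m \<theta>
    by (induction m arbitrary: \<theta>) (auto simp: ract_mult ract_gen qpow_add algebra_simps)
  have 2: "ract l (gen (GTinv i) ^ m) \<theta> w = \<theta> w * qpow (- (of_nat m * word_exponent l i w))" for m \<theta>
    by (induction m arbitrary: \<theta>) (auto simp: ract_mult ract_gen algebra_simps simp flip: qpow_add)
  show ?thesis by (simp add: gen_T_power_def 1 2)
qed

lemma ract_tmon:
  "ract l (tmon n) \<theta> w = \<theta> w * qpow (\<Sum>j\<in>UNIV. of_int (n j) * word_exponent l j w)"
proof -
  have "ract l (prod_list (map (\<lambda>j. gen_T_power j (n j)) js)) \<theta> w
      = \<theta> w * qpow (\<Sum>j\<leftarrow>js. of_int (n j) * word_exponent l j w)" for js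
    by (induction js arbitrary: \<theta>) (auto simp: ract_mult ract_gen_T_power qpow_add algebra_simps)
  also have "(\<Sum>j\<leftarrow>index_list. of_int (n j) * word_exponent l j w) = (\<Sum>j\<in>UNIV. of_int (n j) * word_exponent l j w)"
    using sum_list_distinct_conv_sum_set[OF index_list(1), of "\<lambda>j. of_int (n j) * word_exponent l j w"]
    by (simp add: index_list(2))
  finally show ?thesis by (simp add: tmon_def)
qed

lemma ract_commutator:
  "ract l (fscal (1 / (qpow (d i) - qpow (- d i))) * (gen_K a i - gen_Kinv a i)) \<theta> w
    = \<theta> w * commutator_value l i w"
  by (simp add: fscal_mult ract_smul ract_diff gen_K_eq ract_tmon commutator_value_def Let_def
      sum_negf algebra_simps diff_divide_distrib)

lemma annihilator_base: "base_relators \<subseteq> annihilator l"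
proof -
  have T: "gen (GT i) * gen (GTinv i) - 1 \<in> annihilator l" "gen (GTinv i) * gen (GT i) - 1 \<in> annihilator l" for i
    by (auto simp: annihilator_def fun_eq_iff ract_diff ract_mult ract_gen algebra_simps)
  have TT: "gen (GT i) * gen (GT j) - gen (GT j) * gen (GT i) \<in> annihilator l" for i j
    by (auto simp: annihilator_def fun_eq_iff ract_diff ract_mult ract_gen algebra_simps)
  have TE: "gen (GT i) * gen (GE j) * gen (GTinv i) - fscal (qpow (if i = j then d i else 0)) * gen (GE j) \<in> annihilator l" for i j
  proof -
    let ?n = "\<lambda>j. if j = i then 1 else 0 :: int"
    have "raise l j w (\<lambda>w. \<theta> w * qpow (word_exponent l i w)) * qpow (- word_exponent l i w)
        = qpow (of_int (?n j) * d j) * raise l j w \<theta>" for w \<theta>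
    proof -
      have "raise l j w (\<lambda>w. \<theta> w * qpow (word_exponent l i w))
         = raise l j w \<theta> * qpow (d i * l $ i + of_int (?n j) * d j - word_weight ?n w)"
        unfolding word_exponent_def by (rule raise_twist)
      then have "raise l j w (\<lambda>w. \<theta> w * qpow (word_exponent l i w)) * qpow (- word_exponent l i w)
         = raise l j w \<theta> * (qpow (d i * l $ i + of_int (?n j) * d j - word_weight ?n w) * qpow (- word_exponent l i w))"
        by simp
      also have "qpow (d i * l $ i + of_int (?n j) * d j - word_weight ?n w) * qpow (- word_exponent l i w)
         = qpow (of_int (?n j) * d j)"
        by (simp add: word_exponent_def flip: qpow_add)
      finally show ?thesis by (simp add: mult.commute)
    qed
    moreover have "of_int (?n j) * d j = (if i = j then d i else 0)" by simp
    ultimately show ?thesis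
      by (simp only: annihilator_def mem_Collect_eq fun_eq_iff ract_diff ract_mult ract_gen fscal_mult ract_smul gen_act.simps) simp
  qed
  have TF: "gen (GT i) * gen (GF j) * gen (GTinv i) - fscal (qpow (- (if i = j then d i else 0))) * gen (GF j) \<in> annihilator l" for i j
  proof -
    have "\<theta> (j # w) * qpow (word_exponent l i (j # w)) * qpow (- word_exponent l i w)
       = qpow (- (if i = j then d i else 0)) * \<theta> (j # w)" for w \<theta>
    proof -
      have "word_exponent l i (j # w) + - word_exponent l i w = - (if i = j then d i else 0)"
        by (simp add: word_exponent_def)
      then have "qpow (word_exponent l i (j # w)) * qpow (- word_exponent l i w) = qpow (- (if i = j then d i else 0))"
        by (simp only: flip: qpow_add)
      then show ?thesis by (simp only: mult.assoc) (simp only: mult.commute)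
    qed
    then show ?thesis
      by (simp only: annihilator_def mem_Collect_eq fun_eq_iff ract_diff ract_mult ract_gen fscal_mult ract_smul gen_act.simps) simp
  qed
  \<comment> \<open>This relation is the recursion of \<open>raise\<close>.\<close>
  have EF: "gen (GE i) * gen (GF j) - gen (GF j) * gen (GE i)
      - (if i = j then fscal (1 / (qpow (d i) - qpow (- d i))) * (gen_K a i - gen_Kinv a i) else 0) \<in> annihilator l" for i j
  proof (cases "i = j")
    case True
    have "ract l (gen (GE i) * gen (GF j)) \<theta> w - ract l (gen (GF j) * gen (GE i)) \<theta> w = \<theta> w * commutator_value l i w" for \<theta> w
      using True by (simp add: ract_mult ract_gen)
    then show ?thesis
      using True by (simp only: annihilator_def mem_Collect_eq fun_eq_iff ract_diff if_True ract_commutator diff_self simp_thms)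
  next
    case False
    then show ?thesis
      by (simp add: annihilator_def fun_eq_iff ract_diff ract_mult ract_gen)
  qed
  show ?thesis unfolding base_relators_def using T TT TE TF EF by blast
qed

lemma annihilator_quantum_ideal: "quantum_ideal a form (annihilator l)"
  by (intro quantum_ideal.intro annihilator_ideal quantum_ideal_axioms.intro annihilator_base quantum_datum_axioms)

lemma ract_cong: "x - y \<in> annihilator l \<Longrightarrow> ract l x \<theta> = ract l y \<theta>"
  by (auto simp: annihilator_def ract_diff fun_eq_iff)

text \<open>Modulo the annihilator the element commutes with every f_m, and evaluation at the empty
  word is zero because each term ends in some e. Letters are therefore stripped off one at a
  time.\<close>

lemma annihilator_serre_E:
  assumes "i \<noteq> j" shows "serre GE i j \<in> annihilator l"
proof -
  interpret R: quantum_ideal a form "annihilator l" by (rule annihilator_quantum_ideal)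
  have "ract l (qad \<delta> c (gen (GE i)) (gen (GE j)) m) \<theta> [] = 0" for \<delta> c m \<theta>
    by (induction m arbitrary: \<theta>) (auto simp: ract_gen ract_diff ract_smul ract_mult)
  then have Nil: "ract l (serre GE i j) \<theta> [] = 0" for \<theta>
    by (simp add: serre_eq_qad[OF assms] ract_smul)
  have "ract l (serre GE i j) \<theta> w = 0" for \<theta> w
  proof (induction w arbitrary: \<theta>)
    case (Cons m w)
    have "ract l (serre GE i j) \<theta> (m # w) = ract l (serre GE i j * gen (GF m)) \<theta> w"
      by (simp add: ract_mult ract_gen)
    also have "\<dots> = ract l (gen (GF m) * serre GE i j) \<theta> w"
      using R.serre_E_F[OF assms, of m] by (simp add: R.cong_def ract_cong)
    also have "\<dots> = 0" by (simp add: ract_mult Cons)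
    finally show ?case .
  qed (simp add: Nil)
  then show ?thesis by (auto simp: annihilator_def)
qed

section \<open>The submodule generated by the vacuum\<close>

definition vacuum :: "'i list \<Rightarrow> kk" where
  "vacuum w = (if w = [] then 1 else 0)"

text \<open>The functions that vanish on the two-sided ideal generated by the Serre elements in the
  free algebra on the f_i, that is, those factoring through the quotient of the free module by the
  Serre relations.\<close>

definition serre_null :: "'i weight \<Rightarrow> ('i list \<Rightarrow> kk) set" where
  "serre_null l = {\<theta>. \<forall>js i j. i \<noteq> j \<longrightarrow> ract l (fword js * serre GF i j) \<theta> = (\<lambda>w. 0)}"

lemma serre_nullD: "\<theta> \<in> serre_null l \<Longrightarrow> i \<noteq> j \<Longrightarrow> ract l (serre GF i j) (ract l (fword js) \<theta>) = (\<lambda>w. 0)"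
  by (auto simp: serre_null_def ract_mult)

lemma serre_null_F:
  assumes "\<theta> \<in> serre_null l" shows "ract l (gen (GF m)) \<theta> \<in> serre_null l"
proof -
  have "ract l (fword js * serre GF i j) (ract l (gen (GF m)) \<theta>) = (\<lambda>w. 0)" if "i \<noteq> j" for i j js
    using serre_nullD[OF assms that, of "m # js"] by (simp add: word_Cons ract_mult)
  then show ?thesis by (simp add: serre_null_def)
qed

lemma ract_qcommute_zero:
  assumes "two_sided_ideal.qcommute (annihilator l) s x y" "ract l y \<theta> = (\<lambda>w. 0)"
  shows "ract l y (ract l x \<theta>) = (\<lambda>w. 0)"
proof -
  interpret R: quantum_ideal a form "annihilator l" by (rule annihilator_quantum_ideal)
  have "ract l (x * y) \<theta> = ract l (qpow s *\<^sub>k (y * x)) \<theta>"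
    using assms(1) by (intro ract_cong) (simp add: R.qcommute_def R.cong_def)
  then show ?thesis using assms(2) by (simp add: ract_mult fun_eq_iff ract_smul)
qed

lemma serre_null_tmon:
  assumes "\<theta> \<in> serre_null l" shows "ract l (tmon n) \<theta> \<in> serre_null l"
proof -
  interpret R: quantum_ideal a form "annihilator l" by (rule annihilator_quantum_ideal)
  have "ract l (fword js * serre GF i j) (ract l (tmon n) \<theta>) = (\<lambda>w. 0)" if ij: "i \<noteq> j" for js i j
  proof -
    obtain s where "R.qcommute s (tmon n) (serre GF i j)" using R.tmon_serre_F[OF ij] by blast
    from R.qcommute_mult_right[OF R.tmon_fword this]
    show ?thesis by (rule ract_qcommute_zero) (use assms ij in \<open>auto simp: serre_null_def\<close>)
  qed
  then show ?thesis by (simp add: serre_null_def)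
qed

text \<open>Induction on the f-word in front of the Serre element: e_m passes its letters at the
  cost of torus elements, and finally passes the Serre element by \<open>serre_F_E\<close>.\<close>

lemma serre_null_E:
  assumes "\<theta> \<in> serre_null l" shows "ract l (gen (GE m)) \<theta> \<in> serre_null l"
proof -
  interpret R: quantum_ideal a form "annihilator l" by (rule annihilator_quantum_ideal)
  have "ract l (serre GF i j) (ract l (fword js) (ract l (gen (GE m)) \<theta>)) = (\<lambda>w. 0)" if ij: "i \<noteq> j" for js i j
    using assms
  proof (induction js arbitrary: \<theta>)
    case Nil
    have "ract l (serre GF i j) (ract l (gen (GE m)) \<theta>) = ract l (serre GF i j * gen (GE m)) \<theta>"
      using R.cong_sym[OF R.serre_F_E[OF ij, of m]] by (simp add: R.cong_def ract_cong flip: ract_mult)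
    also have "\<dots> = (\<lambda>w. 0)"
      using serre_nullD[OF Nil ij, of "[]"] by (simp add: ract_mult)
    finally show ?case by simp
  next
    case (Cons k js)
    let ?H = "if m = k then R.EF_coeff m *\<^sub>k (gen_K a m - gen_Kinv a m) else 0"
    let ?S = "ract l (fword js * serre GF i j)"
    have "ract l (gen (GE m) * gen (GF k)) \<theta> = ract l (gen (GF k) * gen (GE m) + ?H) \<theta>"
      using R.E_F[of m k] by (intro ract_cong) (simp only: R.cong_def diff_diff_eq)
    then have "ract l (gen (GF k)) (ract l (gen (GE m)) \<theta>)
       = (\<lambda>w. 1 * ract l (gen (GE m)) (ract l (gen (GF k)) \<theta>) w + 1 * ract l ?H \<theta> w)"
      by (simp only: ract_mult[symmetric]) (rule ext, simp only: ract_add mult_1)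
    then have "ract l (fword (k # js)) (ract l (gen (GE m)) \<theta>)
       = ract l (fword js) (\<lambda>w. 1 * ract l (gen (GE m)) (ract l (gen (GF k)) \<theta>) w + 1 * ract l ?H \<theta> w)"
      by (simp only: list.map word_Cons ract_mult)
    then have "ract l (serre GF i j) (ract l (fword (k # js)) (ract l (gen (GE m)) \<theta>))
       = (\<lambda>w. ?S (ract l (gen (GE m)) (ract l (gen (GF k)) \<theta>)) w + ?S (ract l ?H \<theta>) w)"
      by (simp only: ract_mult[symmetric] ract_linear) (simp add: ract_mult)
    moreover have "?S (ract l (gen (GE m)) (ract l (gen (GF k)) \<theta>)) = (\<lambda>w. 0)"
      using Cons.IH[OF serre_null_F[OF Cons.prems]] by (simp add: ract_mult)
    moreover have "?S (ract l ?H \<theta>) = (\<lambda>w. 0)"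
    proof (cases "m = k")
      case True
      have "ract l ?H \<theta> = (\<lambda>w. R.EF_coeff m * ract l (gen_K a m) \<theta> w + (- R.EF_coeff m) * ract l (gen_Kinv a m) \<theta> w)"
        using True by (simp add: fun_eq_iff ract_smul ract_diff algebra_simps)
      moreover have "?S (ract l (gen_K a m) \<theta>) = (\<lambda>w. 0)" "?S (ract l (gen_Kinv a m) \<theta>) = (\<lambda>w. 0)"
        using serre_null_tmon[OF Cons.prems] ij unfolding gen_K_eq serre_null_def by blast+
      ultimately show ?thesis by (simp only: ract_linear) simp
    qed (simp add: ract_zero_fun)
    ultimately show ?case by simp
  qed
  then show ?thesis by (simp add: serre_null_def ract_mult)
qed

lemma serre_null_act: "\<theta> \<in> serre_null l \<Longrightarrow> ract l (word u) \<theta> \<in> serre_null l"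
proof (induction u arbitrary: \<theta>)
  case (Cons g u)
  have "ract l (gen (GT i)) \<theta> \<in> serre_null l" "ract l (gen (GTinv i)) \<theta> \<in> serre_null l" for i
    using serre_null_tmon[OF Cons.prems, of "\<lambda>j. if j = i then 1 else 0"]
      serre_null_tmon[OF Cons.prems, of "\<lambda>j. if j = i then - 1 else 0"]
    by (simp_all only: tmon_single gen_T_power_1 gen_T_power_minus_1)
  then have "ract l (gen g) \<theta> \<in> serre_null l"
    using serre_null_E[OF Cons.prems] serre_null_F[OF Cons.prems] by (cases g) simp_all
  from Cons.IH[OF this] show ?case by (simp add: word_Cons ract_mult)
qed simp

lemma vacuum_F: "ract l (gen (GF m)) vacuum = (\<lambda>w. 0)"
  by (simp add: ract_gen vacuum_def)

text \<open>Every term begins with some f, and the first letter is the one that acts first, sending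
  the vacuum to zero.\<close>

lemma vacuum_serre_null: "vacuum \<in> serre_null l"
proof -
  have "ract l (qad \<delta> c (gen (GF i)) (gen (GF j)) m) vacuum = (\<lambda>w. 0)" for \<delta> c m i j
  proof (induction m)
    case (Suc m)
    then show ?case by (auto simp: vacuum_F ract_diff ract_smul ract_mult intro!: ext)
  qed (simp add: vacuum_F)
  then have S: "ract l (serre GF i j) vacuum w = 0" if "i \<noteq> j" for i j w
    by (simp add: serre_eq_qad[OF that] ract_smul)
  have "ract l (fword js * serre GF i j) vacuum = (\<lambda>w. 0)" if "i \<noteq> j" for i j js
    by (cases js) (auto simp: S that word_Cons ract_mult vacuum_F)
  then show ?thesis by (simp add: serre_null_def)
qed

text \<open>\<open>vev l x\<close> is \<open>q\<^sup>l((x)\<^sub>0)\<close>, the coefficient of the highest weight vector of the Verma module in the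
  image of that vector under \<open>x\<close>.\<close>

definition vev :: "'i weight \<Rightarrow> 'i falg \<Rightarrow> kk" where
  "vev l x = ract l x vacuum []"

lemma vev_add: "vev l (x + y) = vev l x + vev l y" by (simp add: vev_def ract_add)
lemma vev_diff: "vev l (x - y) = vev l x - vev l y" by (simp add: vev_def ract_diff)
lemma vev_smul: "vev l (c *\<^sub>k x) = c * vev l x" by (simp add: vev_def ract_smul)
lemma vev_0 [simp]: "vev l 0 = 0" by (simp add: vev_def)
lemma vev_1 [simp]: "vev l 1 = 1" by (simp add: vev_def vacuum_def)
lemma vev_F: "vev l (gen (GF i) * x) = 0" by (simp add: vev_def ract_mult vacuum_F)
lemma vev_E: "vev l (x * gen (GE i)) = 0" by (simp add: vev_def ract_mult ract_gen)

definition tchar :: "'i weight \<Rightarrow> ('i \<Rightarrow> int) \<Rightarrow> kk" where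
  "tchar l n = qpow (\<Sum>j\<in>UNIV. of_int (n j) * (d j * l $ j))"

lemma tchar_nonzero [simp]: "tchar l n \<noteq> 0" by (simp add: tchar_def)

lemma word_exponent_Nil [simp]: "word_exponent l j [] = d j * l $ j"
  by (simp add: word_exponent_def)

lemma vev_tmon_right: "vev l (x * tmon n) = tchar l n * vev l x"
  by (simp add: vev_def ract_mult ract_tmon tchar_def mult.commute)

lemma vev_tmon_left: "vev l (tmon n * x) = tchar l n * vev l x"
proof -
  have "ract l (tmon n) vacuum = (\<lambda>w. tchar l n * vacuum w)"
    by (auto simp: fun_eq_iff ract_tmon vacuum_def tchar_def)
  then show ?thesis by (simp add: vev_def ract_mult ract_scale)
qed

text \<open>A relator either annihilates all functions or is a Serre element of the f_i; the latter
  kill the orbit of the vacuum, which stays inside \<open>serre_null l\<close>.\<close>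

lemma vev_relator:
  assumes "r \<in> relators" shows "vev l (x * r * y) = 0"
proof -
  interpret R: quantum_ideal a form "annihilator l" by (rule annihilator_quantum_ideal)
  have "ract l r (ract l x vacuum) = (\<lambda>w. 0)"
  proof (cases "r \<in> annihilator l")
    case False
    then have "r \<notin> base_relators" using annihilator_base by blast
    then obtain i j where "j \<noteq> i" "r = serre GE i j \<or> r = serre GF i j"
      using assms by (auto simp: relators_eq)
    with False annihilator_serre_E have r: "r = serre GF i j" "i \<noteq> j" by auto
    show ?thesis
    proof (induction x rule: free_algebra_induct)
      case (word c u)
      have "ract l r (ract l (word u) vacuum) = (\<lambda>w. 0)"
        using serre_nullD[OF serre_null_act[OF vacuum_serre_null] r(2), of l "[]"] r(1) by simp
      moreover have "ract l (c *\<^sub>k word u) vacuum = (\<lambda>w. c * ract l (word u) vacuum w)"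
        by (rule ext) (rule ract_smul)
      ultimately show ?case by (simp only:) (rule ext, simp only: ract_scale mult_zero_right)
    next
      case (add x y)
      have "ract l (x + y) vacuum = (\<lambda>w. 1 * ract l x vacuum w + 1 * ract l y vacuum w)"
        by (rule ext) (simp only: ract_add mult_1)
      with add show ?case by (simp only: ract_linear) simp
    qed
  qed (simp add: annihilator_def)
  then show ?thesis by (simp add: vev_def ract_mult)
qed

end

subsection \<open>The quantized enveloping algebra and its counit and antipode\<close>

lemma type_algebra_simps [simp]:
  "carrier (ring_of_type_algebra :: 'r::ring_1 ring) = UNIV"
  "x \<otimes>\<^bsub>ring_of_type_algebra\<^esub> y = x * (y::'r)" "x \<oplus>\<^bsub>ring_of_type_algebra\<^esub> y = x + y"
  "\<one>\<^bsub>ring_of_type_algebra\<^esub> = (1::'r)" "\<zero>\<^bsub>ring_of_type_algebra\<^esub> = (0::'r)"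
  by (simp_all add: ring_of_type_algebra_def)

lemma ring_type_algebra: "ring (ring_of_type_algebra :: 'r::ring_1 ring)"
proof -
  have "\<exists>y. x + y = 0" for x :: 'r using add.right_inverse by blast
  then show ?thesis
    unfolding ring_of_type_algebra_def using add.right_inverse
    by unfold_locales (auto simp: algebra_simps Units_def)
qed

lemma two_sided_ideal_of_ideal:
  assumes "ideal J (ring_of_type_algebra :: ('m::monoid_add \<Rightarrow>\<^sub>0 kk) ring)"
  shows "two_sided_ideal J"
proof -
  interpret ideal J "ring_of_type_algebra :: ('m \<Rightarrow>\<^sub>0 kk) ring" by fact
  show ?thesis
    using additive_subgroup.zero_closed[OF additive_subgroup_axioms]
      additive_subgroup.a_closed[OF additive_subgroup_axioms] I_l_closed I_r_closed
    by unfold_locales auto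
qed

lemma ideal_of_two_sided_ideal:
  assumes "two_sided_ideal J"
  shows "ideal J (ring_of_type_algebra :: ('m::monoid_add \<Rightarrow>\<^sub>0 kk) ring)"
proof -
  interpret two_sided_ideal J by fact
  interpret R: ring "ring_of_type_algebra :: ('m \<Rightarrow>\<^sub>0 kk) ring" by (rule ring_type_algebra)
  have inv: "\<ominus>\<^bsub>ring_of_type_algebra\<^esub> x = - x" for x :: "'m \<Rightarrow>\<^sub>0 kk"
    using R.minus_equality[of "- x" x] by simp
  have "subgroup J (add_monoid (ring_of_type_algebra :: ('m \<Rightarrow>\<^sub>0 kk) ring))"
    by (rule R.add.subgroupI) (use zero_mem in \<open>auto simp: inv add_mem minus_mem\<close>)
  then show ?thesis
    by (rule idealI[OF ring_type_algebra]) (auto simp: mult_left_mem mult_right_mem)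
qed

section \<open>Homomorphisms and the anti-automorphism of the free algebra\<close>

definition free_hom :: "('k::zero \<Rightarrow> 'r::semiring_1) \<Rightarrow> ('g \<Rightarrow> 'r) \<Rightarrow> ('g list \<Rightarrow>\<^sub>0 'k) \<Rightarrow> 'r" where
  "free_hom \<iota> \<gamma> = lin_ext \<iota> (\<lambda>u. prod_list (map \<gamma> u))"

locale scalar_embedding =
  fixes \<iota> :: "kk \<Rightarrow> 'r::ring_1"
  assumes scalar_add: "\<iota> (b + c) = \<iota> b + \<iota> c" and scalar_mult: "\<iota> (b * c) = \<iota> b * \<iota> c"
    and scalar_1: "\<iota> 1 = 1" and scalar_commute: "\<iota> c * z = z * \<iota> c"
begin

lemma scalar_0: "\<iota> 0 = 0" using scalar_add[of 0 0] by simp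

lemma free_hom_add: "free_hom \<iota> \<gamma> (x + y) = free_hom \<iota> \<gamma> x + free_hom \<iota> \<gamma> y"
  unfolding free_hom_def by (rule lin_ext_add) (simp_all add: scalar_0 scalar_add)

lemma free_hom_mult: "free_hom \<iota> \<gamma> (x * y) = free_hom \<iota> \<gamma> x * free_hom \<iota> \<gamma> y"
  unfolding free_hom_def
  by (rule lin_ext_mult) (fact scalar_0 scalar_add scalar_mult scalar_commute | simp add: plus_list_def)+

lemma free_hom_word: "free_hom \<iota> \<gamma> (word u) = prod_list (map \<gamma> u)"
  by (simp add: free_hom_def word_def lin_ext_single scalar_0 scalar_1)

lemma free_hom_1: "free_hom \<iota> \<gamma> 1 = 1" using free_hom_word[of \<gamma> "[]"] by simp
lemma free_hom_gen: "free_hom \<iota> \<gamma> (gen g) = \<gamma> g" by (simp add: gen_eq_word free_hom_word)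
lemma free_hom_scalar: "free_hom \<iota> \<gamma> (c *\<^sub>k 1) = \<iota> c"
  by (simp add: smul_def free_hom_def lin_ext_single scalar_0 zero_list_def)
lemma free_hom_smul: "free_hom \<iota> \<gamma> (c *\<^sub>k x) = \<iota> c * free_hom \<iota> \<gamma> x"
  using free_hom_mult[of \<gamma> "c *\<^sub>k 1" x] by (simp add: free_hom_scalar)
lemma free_hom_0: "free_hom \<iota> \<gamma> 0 = 0" using free_hom_add[of \<gamma> 0 0] by simp
lemma free_hom_diff: "free_hom \<iota> \<gamma> (x - y) = free_hom \<iota> \<gamma> x - free_hom \<iota> \<gamma> y"
  using free_hom_add[of \<gamma> "x - y" y] by simp
lemma free_hom_power: "free_hom \<iota> \<gamma> (x ^ n) = free_hom \<iota> \<gamma> x ^ n"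
  by (induction n) (simp_all add: free_hom_1 free_hom_mult)
lemma free_hom_prod_list: "free_hom \<iota> \<gamma> (prod_list (map h js)) = prod_list (map (\<lambda>j. free_hom \<iota> \<gamma> (h j)) js)"
  by (induction js) (simp_all add: free_hom_1 free_hom_mult)
lemma free_hom_sum: "free_hom \<iota> \<gamma> (sum h S) = (\<Sum>s\<in>S. free_hom \<iota> \<gamma> (h s))"
  by (induction S rule: infinite_finite_induct) (simp_all add: free_hom_0 free_hom_add)

end

lemma scalar_embedding_id: "scalar_embedding (\<lambda>c. c)"
  by standard (simp_all add: mult.commute)

lemma scalar_embedding_single: "scalar_embedding (\<lambda>c. c *\<^sub>k (1 :: 'm::monoid_add \<Rightarrow>\<^sub>0 kk))"
  by standard (simp_all add: smul_add_left mult.commute)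

lemma free_hom_qad:
  fixes \<gamma> :: "'g \<Rightarrow> ('m::monoid_add \<Rightarrow>\<^sub>0 kk)"
  shows "free_hom (\<lambda>c. c *\<^sub>k 1) \<gamma> (qad \<delta> c E G m)
    = qad \<delta> c (free_hom (\<lambda>c. c *\<^sub>k 1) \<gamma> E) (free_hom (\<lambda>c. c *\<^sub>k 1) \<gamma> G) m"
proof -
  interpret scalar_embedding "\<lambda>c. c *\<^sub>k (1 :: 'm \<Rightarrow>\<^sub>0 kk)" by (rule scalar_embedding_single)
  show ?thesis by (induction m) (simp_all add: free_hom_diff free_hom_mult free_hom_smul)
qed

text \<open>Turns the antipode, an anti-homomorphism, into an algebra homomorphism preceded by the
  reversal of words.\<close>

definition reversal :: "'i falg \<Rightarrow> 'i falg" where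
  "reversal = lin_ext (\<lambda>c. c *\<^sub>k 1) (\<lambda>u. word (rev u))"

lemma reversal_add: "reversal (x + y) = reversal x + reversal y"
  unfolding reversal_def by (rule lin_ext_add) (simp_all add: smul_add_left)

lemma reversal_smul_word: "reversal (c *\<^sub>k word u) = c *\<^sub>k word (rev u)"
  by (simp add: reversal_def word_def smul_single lin_ext_single)

lemma reversal_smul: "reversal (c *\<^sub>k x) = c *\<^sub>k reversal x"
  by (induction x rule: free_algebra_induct)
    (simp_all add: reversal_smul_word reversal_add smul_add_right)

lemma reversal_word: "reversal (word u) = word (rev u)" using reversal_smul_word[of 1 u] by simp

lemma reversal_mult: "reversal (x * y) = reversal y * reversal x"
proof (induction x rule: free_algebra_induct)
  case (word c u)
  show ?case
    by (induction y rule: free_algebra_induct)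
      (simp_all add: reversal_smul reversal_word reversal_add distrib_left distrib_right mult.commute smul_add_right
        flip: word_append)
qed (simp add: reversal_add distrib_left distrib_right)

lemma reversal_1: "reversal 1 = 1" using reversal_word[of "[]"] by simp
lemma reversal_gen: "reversal (gen g) = gen g" by (simp add: gen_eq_word reversal_word)
lemma reversal_0: "reversal 0 = 0" using reversal_add[of 0 0] by simp
lemma reversal_diff: "reversal (x - y) = reversal x - reversal y"
  using reversal_add[of "x - y" y] by simp
lemma reversal_power: "reversal (x ^ n) = reversal x ^ n"
  by (induction n) (simp_all add: reversal_1 reversal_mult power_commutes)
lemma reversal_sum: "reversal (sum h S) = (\<Sum>s\<in>S. reversal (h s))"
  by (induction S rule: infinite_finite_induct) (simp_all add: reversal_0 reversal_add)

definition word_span :: "'g set \<Rightarrow> ('g list \<Rightarrow>\<^sub>0 kk) set" where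
  "word_span G = {x. Poly_Mapping.keys x \<subseteq> lists G}"

lemma word_span_smul: "x \<in> word_span G \<Longrightarrow> c *\<^sub>k x \<in> word_span G"
  using keys_smul[of c x] by (auto simp: word_span_def)

lemma word_span_add: "x \<in> word_span G \<Longrightarrow> y \<in> word_span G \<Longrightarrow> x + y \<in> word_span G"
  using keys_add[of x y] by (auto simp: word_span_def)

lemma word_span_zero: "0 \<in> word_span G" by (simp add: word_span_def)

lemma word_span_minus: "x \<in> word_span G \<Longrightarrow> - x \<in> word_span G"
  by (simp add: word_span_def)

lemma word_span_diff: "x \<in> word_span G \<Longrightarrow> y \<in> word_span G \<Longrightarrow> x - y \<in> word_span G"
  using word_span_add[of x G "- y"] word_span_minus[of y] by simp

lemma word_span_mult: "x \<in> word_span G \<Longrightarrow> y \<in> word_span G \<Longrightarrow> x * y \<in> word_span G"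
  using keys_mult[of x y] by (fastforce simp: word_span_def plus_list_def)

lemma word_in_word_span: "u \<in> lists G \<Longrightarrow> word u \<in> word_span G"
  by (simp add: word_span_def word_def)

lemma word_span_1: "1 \<in> word_span G" using word_in_word_span[of "[]" G] by simp

lemma gen_in_word_span: "g \<in> G \<Longrightarrow> gen g \<in> word_span G"
  by (simp add: gen_eq_word word_in_word_span)

lemma word_span_induct [consumes 1, case_names zero word add]:
  assumes "x \<in> word_span G" "P 0" "\<And>c u. u \<in> lists G \<Longrightarrow> P (c *\<^sub>k word u)"
    and "\<And>x y. x \<in> word_span G \<Longrightarrow> y \<in> word_span G \<Longrightarrow> P x \<Longrightarrow> P y \<Longrightarrow> P (x + y)"
  shows "P x"
  by (rule poly_mapping_span_induct[of x "lists G" P]) 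
    (use assms in \<open>auto simp: word_span_def single_eq_smul_word\<close>)

section \<open>The quotient algebra and its universal property\<close>

context quantum_datum
begin

lemma relator_ideal_two_sided: "two_sided_ideal relator_ideal"
  unfolding relator_ideal_def
  by (intro two_sided_ideal_of_ideal ring.genideal_ideal ring_type_algebra) simp

lemma relators_subset: "relators \<subseteq> relator_ideal"
  unfolding relator_ideal_def by (intro ring.genideal_self ring_type_algebra) simp

lemma relator_ideal_least: "two_sided_ideal J \<Longrightarrow> relators \<subseteq> J \<Longrightarrow> relator_ideal \<subseteq> J"
  unfolding relator_ideal_def
  by (intro ring.genideal_minimal ring_type_algebra ideal_of_two_sided_ideal)

sublocale I: quantum_ideal a form relator_ideal
proof (intro quantum_ideal.intro relator_ideal_two_sided quantum_ideal_axioms.intro quantum_datum_axioms)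
  show "base_relators \<subseteq> relator_ideal"
    using relators_subset by (auto simp: relators_eq)
qed

abbreviation ucong :: "'i falg \<Rightarrow> 'i falg \<Rightarrow> bool" (infix "\<doteq>" 50) where
  "x \<doteq> y \<equiv> I.cong x y"

lemma serre_mem:
  assumes "i \<noteq> j" shows "serre GE i j \<in> relator_ideal" "serre GF i j \<in> relator_ideal"
proof -
  have "{serre GE i j, serre GF i j} \<subseteq> relators"
  proof
    fix r assume "r \<in> {serre GE i j, serre GF i j}"
    then have "r \<in> (\<Union>j\<in>- {i}. {serre GE i j, serre GF i j})"
      using assms by (intro UN_I[of j]) auto
    then show "r \<in> relators" unfolding relators_eq by (intro UnI2 UN_I[of i UNIV]) simp_all
  qed
  then show "serre GE i j \<in> relator_ideal" "serre GF i j \<in> relator_ideal"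
    using relators_subset by auto
qed

lemma U_simps [simp]: "zero U = relator_ideal" by (simp add: U_def FactRing_def)

lemma ring_U: "ring U"
  unfolding U_def by (intro ideal.quotient_is_ring ideal_of_two_sided_ideal relator_ideal_two_sided)

sublocale U: ring U by (rule ring_U)

lemma cls_hom: "cls \<in> ring_hom ring_of_type_algebra U"
  using ideal.rcos_ring_hom[OF ideal_of_two_sided_ideal[OF relator_ideal_two_sided]]
  unfolding U_def cls_def by (simp add: eta_contract_eq)

lemma cls_closed [simp]: "cls x \<in> carrier U" using ring_hom_closed[OF cls_hom] by simp
lemma cls_mult: "cls (x * y) = cls x \<otimes>\<^bsub>U\<^esub> cls y" using cls_hom by (simp add: ring_hom_def)
lemma cls_add: "cls (x + y) = cls x \<oplus>\<^bsub>U\<^esub> cls y" using cls_hom by (simp add: ring_hom_def)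
lemma cls_1: "cls 1 = \<one>\<^bsub>U\<^esub>" using cls_hom by (simp add: ring_hom_def)

lemma cls_eq: "cls x = (\<lambda>h. h + x) ` relator_ideal"
  unfolding cls_def a_r_coset_def' by auto

lemma cls_eq_iff: "cls x = cls y \<longleftrightarrow> x \<doteq> y"
proof
  assume "cls x = cls y"
  moreover have "x \<in> cls x" using I.zero_mem by (force simp: cls_eq)
  ultimately obtain h where "h \<in> relator_ideal" "x = h + y" by (auto simp: cls_eq)
  then show "x \<doteq> y" by (simp add: I.cong_def)
next
  assume "x \<doteq> y"
  have sub: "cls x \<subseteq> cls y" if "x \<doteq> y" for x y
  proof
    fix z assume "z \<in> cls x"
    then obtain h where "h \<in> relator_ideal" "z = h + x" by (auto simp: cls_eq)
    then have "h + (x - y) \<in> relator_ideal" "z = (h + (x - y)) + y"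
      using that by (auto simp: I.cong_def I.add_mem)
    then show "z \<in> cls y" unfolding cls_eq by (intro image_eqI[of _ _ "h + (x - y)"])
  qed
  show "cls x = cls y" using sub \<open>x \<doteq> y\<close> I.cong_sym by blast
qed

lemma cls_0: "cls 0 = \<zero>\<^bsub>U\<^esub>" by (auto simp: cls_eq)

lemma carrier_U: "carrier U = range cls"
proof -
  have "carrier U = (\<Union>x. {cls x})" by (simp add: U_def FactRing_def A_RCOSETS_def' cls_def)
  then show ?thesis by auto
qed

lemma carrier_UE: assumes "u \<in> carrier U" obtains x where "u = cls x"
  using assms carrier_U by auto

lemma cls_minus: "cls (- x) = \<ominus>\<^bsub>U\<^esub> cls x"
  using U.minus_equality[of "cls (- x)" "cls x"] by (simp add: cls_0[simplified] flip: cls_add)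

lemma cls_diff: "cls (x - y) = cls x \<ominus>\<^bsub>U\<^esub> cls y"
  using cls_add[of x "- y"] by (simp add: a_minus_def cls_minus)

lemma cls_smul: "cls (c *\<^sub>k x) = scal c \<otimes>\<^bsub>U\<^esub> cls x"
  by (simp add: scal_def fscal_eq flip: cls_mult)

lemma scal_closed [simp]: "scal c \<in> carrier U" by (simp add: scal_def)

lemma scal_eq: "scal c = cls (c *\<^sub>k 1)" by (simp add: scal_def fscal_eq)

lemma subalgebra_gen_eq: "subalgebra_gen (cls ` gen ` G) = cls ` word_span G"
proof
  have "cls (c *\<^sub>k 1) \<in> cls ` word_span G" for c
    by (intro imageI word_span_smul word_span_1)
  then have gens: "range scal \<union> cls ` gen ` G \<subseteq> cls ` word_span G"
    by (auto simp: scal_eq gen_in_word_span)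
  show "subalgebra_gen (cls ` gen ` G) \<subseteq> cls ` word_span G"
  proof
    fix z assume "z \<in> subalgebra_gen (cls ` gen ` G)"
    then have "z \<in> generate_ring U (range scal \<union> cls ` gen ` G)" by (simp add: subalgebra_gen_def)
    then show "z \<in> cls ` word_span G"
    proof (induction rule: generate_ring.induct)
      case one
      show ?case unfolding cls_1[symmetric] by (intro imageI word_span_1)
    next
      case (incl h)
      then show ?case using gens by blast
    next
      case (a_inv h)
      then obtain x where "h = cls x" "x \<in> word_span G" by blast
      then show ?case by (simp only: cls_minus[symmetric] imageI word_span_minus)
    next
      case (eng_add h1 h2)
      then obtain x y where "h1 = cls x" "x \<in> word_span G" "h2 = cls y" "y \<in> word_span G" by blast
      then show ?case by (simp only: cls_add[symmetric] imageI word_span_add)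
    next
      case (eng_mult h1 h2)
      then obtain x y where "h1 = cls x" "x \<in> word_span G" "h2 = cls y" "y \<in> word_span G" by blast
      then show ?case by (simp only: cls_mult[symmetric] imageI word_span_mult)
    qed
  qed
  show "cls ` word_span G \<subseteq> subalgebra_gen (cls ` gen ` G)"
  proof (rule image_subsetI)
    fix x assume "x \<in> word_span G"
    then show "cls x \<in> subalgebra_gen (cls ` gen ` G)"
    proof (induction rule: word_span_induct)
      case zero
      show ?case unfolding cls_0 subalgebra_gen_def by (rule U.zero_in_generate)
    next
      case (word c u)
      have "cls (word u) \<in> subalgebra_gen (cls ` gen ` G)"
        using word
        by (induction u)
          (auto simp: subalgebra_gen_def cls_1 word_Cons cls_mult generate_ring.one
            intro!: generate_ring.eng_mult intro: generate_ring.incl)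
      then show ?case unfolding cls_smul subalgebra_gen_def
        by (intro generate_ring.eng_mult) (auto intro: generate_ring.incl)
    next
      case (add x y)
      then show ?case unfolding cls_add subalgebra_gen_def by (intro generate_ring.eng_add)
    qed
  qed
qed

abbreviation torus_gens :: "'i gen set" where "torus_gens \<equiv> range GT \<union> range GTinv"

lemma U0_eq: "U0 = cls ` word_span torus_gens"
proof -
  have "range t \<union> range tinv = cls ` gen ` torus_gens"
    by (auto simp: t_def tinv_def)
  then show ?thesis unfolding U0_def by (simp only: subalgebra_gen_eq)
qed

lemma Upos_eq: "Upos = cls ` word_span (range GE)"
proof -
  have "range e = cls ` gen ` range GE" by (auto simp: e_def)
  then show ?thesis unfolding Upos_def by (simp only: subalgebra_gen_eq)
qed

lemma Uneg_eq: "Uneg = cls ` word_span (range GF)"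
proof -
  have "range f = cls ` gen ` range GF" by (auto simp: f_def)
  then show ?thesis unfolding Uneg_def by (simp only: subalgebra_gen_eq)
qed

lemma lists_range: "lists (range h) = range (map h)"
  by (auto simp: lists_image)

text \<open>The existence half of the universal property; with \<open>alg_hom_unique\<close> it
  evaluates the definite descriptions of the counit, the antipode and the coproduct.\<close>

lemma hom_lift:
  assumes "\<And>x y. x \<doteq> y \<Longrightarrow> H x = H y"
    and "\<And>x. H x \<in> carrier S" "\<And>x y. H (x * y) = H x \<otimes>\<^bsub>S\<^esub> H y" "\<And>x y. H (x + y) = H x \<oplus>\<^bsub>S\<^esub> H y"
    and "H 1 = \<one>\<^bsub>S\<^esub>" "\<And>c. H (c *\<^sub>k 1) = \<iota> c"
  obtains h where "h \<in> alg_homs U S \<iota>" "\<And>x. h (cls x) = H x"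
proof -
  define h where "h = (\<lambda>u\<in>carrier U. H (SOME x. u = cls x))"
  have h: "h (cls x) = H x" for x
  proof -
    have "cls x = cls (SOME y. cls x = cls y)" by (rule someI[of _ x]) simp
    then have "H (SOME y. cls x = cls y) = H x"
      by (intro assms(1)) (simp add: cls_eq_iff I.cong_sym)
    then show ?thesis by (simp add: h_def)
  qed
  have "h \<in> ring_hom U S"
    by (rule ring_hom_memI) (auto elim!: carrier_UE simp: h assms simp flip: cls_mult cls_add cls_1)
  then have "h \<in> alg_homs U S \<iota>"
    by (simp add: alg_homs_def h scal_eq assms(6)) (simp add: h_def)
  then show ?thesis using h that by blast
qed

lemma alg_hom_unique:
  assumes "Group.monoid S" "h \<in> alg_homs U S \<iota>" "h' \<in> alg_homs U S \<iota>"
    and "\<And>i. h (t i) = h' (t i)" "\<And>i. h (e i) = h' (e i)" "\<And>i. h (f i) = h' (f i)"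
  shows "h = h'"
proof -
  interpret S: Group.monoid S by fact
  have hom: "h \<in> ring_hom U S" "h' \<in> ring_hom U S" using assms(2,3) by (auto simp: alg_homs_def)
  note simps = ring_hom_mult[OF hom(1)] ring_hom_mult[OF hom(2)] ring_hom_add[OF hom(1)] ring_hom_add[OF hom(2)]
    ring_hom_one[OF hom(1)] ring_hom_one[OF hom(2)]
  have carr: "h (cls x) \<in> carrier S" "h' (cls x) \<in> carrier S" for x
    using ring_hom_closed[OF hom(1)] ring_hom_closed[OF hom(2)] by auto
  have scal: "h (scal c) = h' (scal c)" for c using assms(2,3) by (auto simp: alg_homs_def)
  \<comment> \<open>The definitions prescribe no value at t_i^{-1}: it is forced, since
    \<open>h (tinv i)\<close> is a left inverse and \<open>h' (tinv i)\<close> a right inverse of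
    the same element.\<close>
  have tinv: "h (tinv i) = h' (tinv i)" for i
  proof -
    have "t i \<otimes>\<^bsub>U\<^esub> tinv i = \<one>\<^bsub>U\<^esub>" "tinv i \<otimes>\<^bsub>U\<^esub> t i = \<one>\<^bsub>U\<^esub>"
      using I.T_inv[of i] by (simp_all add: t_def tinv_def cls_eq_iff flip: cls_mult cls_1)
    moreover have "t i \<in> carrier U" "tinv i \<in> carrier U" by (simp_all add: t_def tinv_def)
    ultimately have 1: "h (tinv i) \<otimes>\<^bsub>S\<^esub> h (t i) = \<one>\<^bsub>S\<^esub>" "h (t i) \<otimes>\<^bsub>S\<^esub> h' (tinv i) = \<one>\<^bsub>S\<^esub>"
      using simps assms(4) by metis+
    then show ?thesis
      using S.inv_unique[OF 1] carr by (simp add: t_def tinv_def)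
  qed
  have gen: "h (cls (gen g)) = h' (cls (gen g))" for g
    using assms(4-6) tinv by (cases g) (auto simp: t_def e_def f_def tinv_def)
  have "h (cls x) = h' (cls x)" for x
    by (induction x rule: generator_induct)
      (auto simp: cls_1 cls_add cls_mult cls_smul simps gen scal)
  then show ?thesis
    using assms(2,3) by (intro extensionalityI[of h "carrier U" h']) (auto simp: alg_homs_def elim!: carrier_UE)
qed

end

interpretation id_embedding: scalar_embedding "\<lambda>c. c"
  by (rule scalar_embedding_id)

interpretation single_embedding: scalar_embedding "\<lambda>c. c *\<^sub>k (1 :: 'm::monoid_add \<Rightarrow>\<^sub>0 kk)"
  by (rule scalar_embedding_single)

lemma monoid_type_algebra: "Group.monoid (ring_of_type_algebra :: 'r::ring_1 ring)"
  by (rule ring.is_monoid[OF ring_type_algebra])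

section \<open>Counit and antipode\<close>

definition counit_gen :: "'i gen \<Rightarrow> kk" where
  "counit_gen g = (case g of GT _ \<Rightarrow> 1 | GTinv _ \<Rightarrow> 1 | GE _ \<Rightarrow> 0 | GF _ \<Rightarrow> 0)"

definition free_counit :: "'i falg \<Rightarrow> kk" where
  "free_counit = free_hom (\<lambda>c. c) counit_gen"

definition antipode_gen :: "('i::finite \<Rightarrow> 'i \<Rightarrow> int) \<Rightarrow> 'i gen \<Rightarrow> 'i falg" where
  "antipode_gen a g = (case g of GT i \<Rightarrow> gen (GTinv i) | GTinv i \<Rightarrow> gen (GT i)
      | GE i \<Rightarrow> - (gen_Kinv a i * gen (GE i)) | GF i \<Rightarrow> - (gen (GF i) * gen_K a i))"

definition free_antipode :: "('i::finite \<Rightarrow> 'i \<Rightarrow> int) \<Rightarrow> 'i falg \<Rightarrow> 'i falg" where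
  "free_antipode a x = free_hom (\<lambda>c. c *\<^sub>k 1) (antipode_gen a) (reversal x)"

lemmas free_counit_simps =
  id_embedding.free_hom_add[where \<gamma> = counit_gen, folded free_counit_def]
  id_embedding.free_hom_mult[where \<gamma> = counit_gen, folded free_counit_def]
  id_embedding.free_hom_diff[where \<gamma> = counit_gen, folded free_counit_def]
  id_embedding.free_hom_smul[where \<gamma> = counit_gen, folded free_counit_def]
  id_embedding.free_hom_1[where \<gamma> = counit_gen, folded free_counit_def]
  id_embedding.free_hom_0[where \<gamma> = counit_gen, folded free_counit_def]
  id_embedding.free_hom_gen[where \<gamma> = counit_gen, folded free_counit_def]
  id_embedding.free_hom_power[where \<gamma> = counit_gen, folded free_counit_def]
  id_embedding.free_hom_prod_list[where \<gamma> = counit_gen, folded free_counit_def]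
  id_embedding.free_hom_word[where \<gamma> = counit_gen, folded free_counit_def]

lemma free_counit_tmon:
  fixes n :: "'i::finite \<Rightarrow> int"
  shows "free_counit (tmon n) = 1"
proof -
  have "free_counit (gen_T_power j m) = 1" for j :: 'i and m
    by (simp add: gen_T_power_def free_counit_simps counit_gen_def)
  then have "map (\<lambda>j. free_counit (gen_T_power j (n j))) js = replicate (length js) 1" for js
    by (induction js) simp_all
  then show ?thesis by (simp add: tmon_def free_counit_simps)
qed

lemma free_antipode_add: "free_antipode a (x + y) = free_antipode a x + free_antipode a y"
  by (simp add: free_antipode_def reversal_add single_embedding.free_hom_add)
lemma free_antipode_mult: "free_antipode a (x * y) = free_antipode a y * free_antipode a x"
  by (simp add: free_antipode_def reversal_mult single_embedding.free_hom_mult)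
lemma free_antipode_diff: "free_antipode a (x - y) = free_antipode a x - free_antipode a y"
  by (simp add: free_antipode_def reversal_diff single_embedding.free_hom_diff)
lemma free_antipode_smul: "free_antipode a (c *\<^sub>k x) = c *\<^sub>k free_antipode a x"
  by (simp add: free_antipode_def reversal_smul single_embedding.free_hom_smul)
lemma free_antipode_1: "free_antipode a 1 = 1"
  by (simp add: free_antipode_def reversal_1 single_embedding.free_hom_1)
lemma free_antipode_0: "free_antipode a 0 = 0"
  by (simp add: free_antipode_def reversal_0 single_embedding.free_hom_0)
lemma free_antipode_gen: "free_antipode a (gen g) = antipode_gen a g"
  by (simp add: free_antipode_def reversal_gen single_embedding.free_hom_gen)
lemma free_antipode_power: "free_antipode a (x ^ n) = free_antipode a x ^ n"
  by (simp add: free_antipode_def reversal_power single_embedding.free_hom_power)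
lemma free_antipode_sum: "free_antipode a (sum h S) = (\<Sum>s\<in>S. free_antipode a (h s))"
  by (simp add: free_antipode_def reversal_sum single_embedding.free_hom_sum)

lemmas free_antipode_simps = free_antipode_add free_antipode_mult free_antipode_diff free_antipode_smul
  free_antipode_1 free_antipode_0 free_antipode_gen free_antipode_power

lemma free_antipode_T_power: "free_antipode a (gen_T_power j n) = gen_T_power j (- n)"
  by (auto simp: gen_T_power_def free_antipode_simps antipode_gen_def)

context quantum_datum
begin

lemma hom_kernel_cong:
  assumes "two_sided_ideal {x. H x = 0}" "\<And>r. r \<in> relators \<Longrightarrow> H r = 0" "\<And>x y. H (x - y) = H x - H y" "x \<doteq> y"
  shows "H x = (H y :: 'b::ab_group_add)"
proof -
  have "relator_ideal \<subseteq> {x. H x = 0}" using assms(1,2) by (intro relator_ideal_least) auto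
  then have "H (x - y) = 0" using assms(4) by (auto simp: I.cong_def)
  then show ?thesis using assms(3) by simp
qed

lemma relator_cases:
  assumes "r \<in> relators"
  obtains (TT') i where "r = gen (GT i) * gen (GTinv i) - 1"
  | (T'T) i where "r = gen (GTinv i) * gen (GT i) - 1"
  | (TT) i j where "r = gen (GT i) * gen (GT j) - gen (GT j) * gen (GT i)"
  | (TE) i j where "r = gen (GT i) * gen (GE j) * gen (GTinv i) - qpow (if i = j then d i else 0) *\<^sub>k gen (GE j)"
  | (TF) i j where "r = gen (GT i) * gen (GF j) * gen (GTinv i) - qpow (- (if i = j then d i else 0)) *\<^sub>k gen (GF j)"
  | (EF) i j where "r = gen (GE i) * gen (GF j) - gen (GF j) * gen (GE i)
      - (if i = j then I.EF_coeff i *\<^sub>k (gen_K a i - gen_Kinv a i) else 0)"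
  | (SE) i j where "i \<noteq> j" "r = serre GE i j"
  | (SF) i j where "i \<noteq> j" "r = serre GF i j"
proof -
  have "r \<in> base_relators \<or> (\<exists>i j. i \<noteq> j \<and> (r = serre GE i j \<or> r = serre GF i j))"
  proof -
    have "r \<in> base_relators \<or> r \<in> (\<Union>i. \<Union>j\<in>- {i}. {serre GE i j, serre GF i j})"
      using assms by (simp only: relators_eq Un_iff)
    then show ?thesis
    proof
      assume "r \<in> (\<Union>i. \<Union>j\<in>- {i}. {serre GE i j, serre GF i j})"
      then obtain i j where "j \<in> - {i}" "r \<in> {serre GE i j, serre GF i j}" by (elim UN_E)
      then show ?thesis by (intro disjI2 exI[of _ i] exI[of _ j]) auto
    qed simp
  qed
  then consider "r \<in> base_relators" | i j where "i \<noteq> j" "r = serre GE i j \<or> r = serre GF i j" by blast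
  then show ?thesis
  proof cases
    case 1
    then show ?thesis
      unfolding base_relators_def fscal_mult I.EF_coeff_def[symmetric] Un_iff UN_iff insert_iff empty_iff
      using TT' T'T TT TE TF EF by (elim disjE exE bexE) blast+
  qed (use SE SF in blast)
qed

lemma free_counit_relator:
  assumes "r \<in> relators" shows "free_counit r = 0"
proof -
  have S: "free_counit (serre A i j) = 0" if ij: "i \<noteq> j" and A: "\<And>i. counit_gen (A i) = 0" for A i j
  proof -
    obtain m where "serre_exponent i j = Suc m" using serre_exponent(2)[OF ij] gr0_conv_Suc by auto
    then have "free_counit (qad (d i) (a i j) (gen (A i)) (gen (A j)) (serre_exponent i j)) = 0"
      by (simp add: free_counit_simps A)
    then show ?thesis by (simp only: serre_eq_qad[OF ij] free_counit_simps mult_zero_right)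
  qed
  show ?thesis
    using assms
    by (cases rule: relator_cases)
      (auto simp: free_counit_simps counit_gen_def gen_K_eq free_counit_tmon S)
qed

lemma counit_cls: "counit (cls x) = free_counit x"
proof -
  have cong: "free_counit x = free_counit y" if "x \<doteq> y" for x y
  proof (rule hom_kernel_cong[OF _ free_counit_relator _ that])
    show "two_sided_ideal {x. free_counit x = 0}" by standard (simp_all add: free_counit_simps)
    show "free_counit (x - y) = free_counit x - free_counit y" for x y :: "'i falg"
      by (simp only: free_counit_simps)
  qed
  obtain h where h: "h \<in> alg_homs U Kring (\<lambda>c. c)" "\<And>x. h (cls x) = free_counit x"
    by (rule hom_lift[of free_counit Kring "\<lambda>c. c"]) (simp_all add: cong free_counit_simps)
  have "counit = h"
    unfolding counit_def
  proof (rule the_equality)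
    show "h \<in> alg_homs U Kring (\<lambda>c. c) \<and> (\<forall>i. h (t i) = 1 \<and> h (e i) = 0 \<and> h (f i) = 0)"
      by (simp add: h t_def e_def f_def free_counit_simps counit_gen_def)
  next
    fix h' assume "h' \<in> alg_homs U Kring (\<lambda>c. c) \<and> (\<forall>i. h' (t i) = 1 \<and> h' (e i) = 0 \<and> h' (f i) = 0)"
    then show "h' = h"
      by (intro alg_hom_unique[OF monoid_type_algebra _ h(1)])
        (auto simp: h t_def e_def f_def free_counit_simps counit_gen_def)
  qed
  then show ?thesis by (simp add: h)
qed

text \<open>Only a congruence, because the anti-homomorphism reverses the fixed order of the
  t_j.\<close>

lemma free_antipode_tmon: "free_antipode a (tmon n) \<doteq> tmon (\<lambda>j. - n j)"
proof -
  have "free_antipode a (prod_list (map (\<lambda>j. gen_T_power j (n j)) js)) \<doteq> prod_list (map (\<lambda>j. gen_T_power j (- n j)) js)" for js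
  proof (induction js)
    case Nil
    then show ?case by (simp add: free_antipode_1)
  next
    case (Cons j js)
    let ?P = "prod_list (map (\<lambda>j. gen_T_power j (- n j)) js)"
    have "I.qcommute (\<Sum>j\<leftarrow>js. 0) ?P (gen_T_power j (- n j))"
      by (intro I.qcommute_prod_list I.T_powers_commute)
    then have c: "?P * gen_T_power j (- n j) \<doteq> gen_T_power j (- n j) * ?P" by (simp add: I.qcommute_def)
    show ?case
      using I.cong_trans[OF I.cong_mult_right[OF Cons] c]
      by (simp add: free_antipode_mult free_antipode_T_power)
  qed
  then show ?thesis by (simp add: tmon_def)
qed

text \<open>The images of the generators carry torus factors; \<open>qad_scale\<close> extracts them
  and leaves a multiple of the original Serre element.\<close>

lemma qad_scaled_serre_mem:
  assumes "i \<noteq> j" "serre A i j \<in> relator_ideal"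
    and "I.qcommute s \<kappa> (gen (A i))" "I.qcommute s' \<kappa> (gen (A j))" "I.qcommute s' \<kappa>' (gen (A i))" "I.qcommute 0 \<kappa> \<kappa>'"
  shows "qad (d i) (a i j) (\<kappa> * gen (A i)) (\<kappa>' * gen (A j)) (serre_exponent i j) \<in> relator_ideal"
proof -
  obtain r where r: "qad (d i) (a i j) (\<kappa> * gen (A i)) (\<kappa>' * gen (A j)) (serre_exponent i j)
      \<doteq> qpow r *\<^sub>k (\<kappa> ^ serre_exponent i j * \<kappa>' * qad (d i) (a i j) (gen (A i)) (gen (A j)) (serre_exponent i j))"
    using I.qad_scale[OF assms(3-6)] by blast
  have "qad (d i) (a i j) (gen (A i)) (gen (A j)) (serre_exponent i j) \<in> relator_ideal"
    using qad_eq_serre[OF assms(1), of A] assms(2) I.smul_mem by auto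
  then show ?thesis using I.cong_mem_iff[OF r] I.smul_mem I.mult_left_mem by simp
qed

lemma K_K_commute: "I.qcommute 0 (gen_K a i) (gen_K a j)" "I.qcommute 0 (gen_Kinv a i) (gen_Kinv a j)"
  "I.qcommute 0 (gen_K a i) (gen_Kinv a j)"
  using I.tmon_commute by (simp_all add: gen_K_eq I.qcommute_def)

text \<open>Reversal exchanges the exponents m and N - m, whose coefficients in the Serre polynomial
  differ only by the global sign (- 1)^N.\<close>

lemma free_antipode_serre:
  assumes "i \<noteq> j"
  shows "\<exists>c. free_antipode a (serre A i j)
    = c *\<^sub>k qad (d i) (a i j) (antipode_gen a (A i)) (antipode_gen a (A j)) (serre_exponent i j)"
proof -
  let ?N = "serre_exponent i j" and ?E = "antipode_gen a (A i)" and ?G = "antipode_gen a (A j)"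
  define c where "c m = (- 1) ^ m / (qfactorial (d i) m * qfactorial (d i) (?N - m))" for m
  have "free_antipode a (serre A i j) = (\<Sum>m\<le>?N. c m *\<^sub>k (?E ^ (?N - m) * ?G * ?E ^ m))"
    by (simp add: serre_eq_sum c_def free_antipode_sum free_antipode_simps mult.assoc)
  also have "\<dots> = (\<Sum>m\<le>?N. c (?N - m) *\<^sub>k (?E ^ m * ?G * ?E ^ (?N - m)))"
    by (rule sum.reindex_bij_witness[of _ "\<lambda>m. ?N - m" "\<lambda>m. ?N - m"]) auto
  also have "\<dots> = (\<Sum>m\<le>?N. (- 1) ^ ?N *\<^sub>k (c m *\<^sub>k (?E ^ m * ?G * ?E ^ (?N - m))))"
  proof (rule sum.cong)
    fix m assume "m \<in> {..?N}"
    then have m: "m \<le> ?N" by simp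
    then have "(- 1 :: kk) ^ ?N = (- 1) ^ (?N - m) * (- 1) ^ m" by (simp flip: power_add)
    then have "(- 1 :: kk) ^ ?N * (- 1) ^ m = (- 1) ^ (?N - m)"
      by (simp add: mult.assoc flip: power_mult_distrib)
    then have "c (?N - m) = (- 1) ^ ?N * c m" using m by (simp add: c_def mult.commute)
    then show "c (?N - m) *\<^sub>k (?E ^ m * ?G * ?E ^ (?N - m)) = (- 1) ^ ?N *\<^sub>k (c m *\<^sub>k (?E ^ m * ?G * ?E ^ (?N - m)))"
      by simp
  qed simp
  also have "\<dots> = (- 1) ^ ?N *\<^sub>k (((- 1) ^ ?N / qfactorial (d i) ?N) *\<^sub>k qad (d i) (a i j) ?E ?G ?N)"
    unfolding smul_sum[symmetric] c_def
    using serre_exponent[OF assms] by (subst qad_eq_serre_sum) auto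
  finally show ?thesis by auto
qed

lemma T_conj_iff:
  "I.qcommute s (gen (GT i)) x \<Longrightarrow> gen (GT i) * x * gen (GTinv i) - qpow s *\<^sub>k x \<in> relator_ideal"
proof -
  assume "I.qcommute s (gen (GT i)) x"
  then have "gen (GT i) * x * gen (GTinv i) \<doteq> qpow s *\<^sub>k (x * gen (GT i)) * gen (GTinv i)"
    by (intro I.cong_mult_right) (simp add: I.qcommute_def)
  also have "\<dots> = qpow s *\<^sub>k (x * (gen (GT i) * gen (GTinv i)))" by (simp add: mult.assoc)
  also have "\<dots> \<doteq> qpow s *\<^sub>k (x * 1)" by (intro I.cong_smul I.cong_mult_left I.T_inv)
  finally show ?thesis by (simp add: I.cong_def)
qed

lemma T_tmon_commute: "I.qcommute 0 (gen (GT i)) (tmon n)"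
  using I.tmon_commute[of "\<lambda>j. if j = i then 1 else 0" n]
  by (simp only: tmon_single gen_T_power_1 I.qcommute_def qpow_0 smul_one)

lemma free_antipode_relator:
  assumes "r \<in> relators" shows "free_antipode a r \<in> relator_ideal"
  using assms
proof (cases rule: relator_cases)
  case (TT' i)
  then show ?thesis using I.T_inv[of i] by (simp add: free_antipode_simps antipode_gen_def I.cong_def)
next
  case (T'T i)
  then show ?thesis using I.T_inv[of i] by (simp add: free_antipode_simps antipode_gen_def I.cong_def)
next
  case (TT i j)
  have "gen (GTinv j) * gen (GTinv i) \<doteq> gen (GTinv i) * gen (GTinv j)"
    using I.T_powers_commute[of j "- 1" i "- 1"]
    by (simp only: gen_T_power_minus_1 I.qcommute_def qpow_0 smul_one)
  with TT show ?thesis by (simp add: free_antipode_simps antipode_gen_def I.cong_def)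
next
  case (TE i j)
  have "I.qcommute (0 + (if i = j then d i else 0)) (gen (GT i)) ((- 1) *\<^sub>k (gen_Kinv a j * gen (GE j)))"
    unfolding gen_K_eq by (intro I.qcommute_smul_right I.qcommute_mult_right T_tmon_commute I.T_E)
  from T_conj_iff[OF this] show ?thesis
    unfolding TE by (simp add: free_antipode_simps antipode_gen_def mult.assoc del: if_cancel split del: if_split)
next
  case (TF i j)
  have "I.qcommute (- (if i = j then d i else 0) + 0) (gen (GT i)) ((- 1) *\<^sub>k (gen (GF j) * gen_K a j))"
    unfolding gen_K_eq by (intro I.qcommute_smul_right I.qcommute_mult_right T_tmon_commute I.T_F)
  from T_conj_iff[OF this] show ?thesis
    unfolding TF by (simp add: free_antipode_simps antipode_gen_def mult.assoc del: if_cancel split del: if_split)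
next
  case (EF i j)
  let ?b = "d i * of_int (a i j)"
  let ?H = "if i = j then I.EF_coeff i *\<^sub>k (gen_K a i - gen_Kinv a i) else 0"
  \<comment> \<open>Both products are brought to the form k_i^{-1} ... k_j. The two powers of q
    arising on the way are inverse to each other because d_i a_ij is symmetric.\<close>
  have "I.qcommute (0 + ?b) (gen_K a j) (gen_Kinv a i * gen (GE i))"
    using I.qcommute_mult_right[OF K_K_commute(3)[of j i] I.K_E[of j i]] symmetrized[of i j] by simp
  then have 1: "gen_K a j * (gen_Kinv a i * gen (GE i)) \<doteq> qpow ?b *\<^sub>k (gen_Kinv a i * gen (GE i) * gen_K a j)"
    by (simp add: I.qcommute_def)
  have 2: "gen (GF j) * (gen_Kinv a i * z) \<doteq> qpow (- ?b) *\<^sub>k (gen_Kinv a i * (gen (GF j) * z))" for z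
    by (rule I.qcommute_left[OF I.qcommute_flip[OF I.Kinv_F]])
  have "free_antipode a (gen (GE i) * gen (GF j)) = gen (GF j) * (gen_K a j * (gen_Kinv a i * gen (GE i)))"
    by (simp add: free_antipode_simps antipode_gen_def mult.assoc)
  also have "\<dots> \<doteq> gen (GF j) * qpow ?b *\<^sub>k (gen_Kinv a i * gen (GE i) * gen_K a j)"
    by (intro I.cong_mult_left 1)
  also have "\<dots> = qpow ?b *\<^sub>k (gen (GF j) * (gen_Kinv a i * (gen (GE i) * gen_K a j)))"
    by (simp add: mult.assoc)
  also have "\<dots> \<doteq> qpow ?b *\<^sub>k (qpow (- ?b) *\<^sub>k (gen_Kinv a i * (gen (GF j) * (gen (GE i) * gen_K a j))))"
    by (intro I.cong_smul 2)
  finally have 3: "free_antipode a (gen (GE i) * gen (GF j)) \<doteq> gen_Kinv a i * (gen (GF j) * (gen (GE i) * gen_K a j))"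
    by simp
  have 4: "free_antipode a (gen (GF j) * gen (GE i)) = gen_Kinv a i * (gen (GE i) * (gen (GF j) * gen_K a j))"
    by (simp add: free_antipode_simps antipode_gen_def mult.assoc)
  have "free_antipode a (gen (GE i) * gen (GF j)) - free_antipode a (gen (GF j) * gen (GE i))
     \<doteq> gen_Kinv a i * (gen (GF j) * (gen (GE i) * gen_K a j)) - gen_Kinv a i * (gen (GE i) * (gen (GF j) * gen_K a j))"
    unfolding 4 by (intro I.cong_diff 3 I.cong_refl)
  also have "\<dots> = - (gen_Kinv a i * (gen (GE i) * gen (GF j) - gen (GF j) * gen (GE i)) * gen_K a j)"
    by (simp add: algebra_simps)
  also have "\<dots> \<doteq> - (gen_Kinv a i * ?H * gen_K a j)"
    by (intro I.cong_minus I.cong_mult_left I.cong_mult_right I.E_F)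
  \<comment> \<open>Torus elements commute, so for i = j the conjugation by k_i is trivial.\<close>
  also have "\<dots> \<doteq> - ?H"
  proof (rule I.cong_minus, cases "i = j")
    case True
    have *: "gen_Kinv a i * tmon n * gen_K a i \<doteq> tmon n" for n
    proof -
      have "gen_Kinv a i * tmon n * gen_K a i \<doteq> tmon n * gen_Kinv a i * gen_K a i"
        unfolding gen_K_eq by (intro I.cong_mult_right I.tmon_commute)
      also have "\<dots> = tmon n * (gen_Kinv a i * gen_K a i)" by (simp add: mult.assoc)
      also have "\<dots> \<doteq> tmon n * 1" unfolding gen_K_eq by (intro I.cong_mult_left I.tmon_inv)
      finally show ?thesis by simp
    qed
    have "I.EF_coeff i *\<^sub>k (gen_Kinv a i * gen_K a i * gen_K a i) - I.EF_coeff i *\<^sub>k (gen_Kinv a i * gen_Kinv a i * gen_K a i)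
      \<doteq> I.EF_coeff i *\<^sub>k gen_K a i - I.EF_coeff i *\<^sub>k gen_Kinv a i"
      using *[of "\<lambda>j. a j i"] *[of "\<lambda>j. - a j i"]
      by (intro I.cong_diff I.cong_smul) (simp_all only: gen_K_eq)
    then show "gen_Kinv a i * ?H * gen_K a j \<doteq> ?H"
      using True by (simp add: smul_diff_right right_diff_distrib left_diff_distrib)
  qed simp
  finally have 5: "free_antipode a (gen (GE i) * gen (GF j)) - free_antipode a (gen (GF j) * gen (GE i)) \<doteq> - ?H" .
  have 6: "free_antipode a ?H \<doteq> - ?H"
  proof (cases "i = j")
    case True
    have "I.EF_coeff i *\<^sub>k (free_antipode a (gen_K a i) - free_antipode a (gen_Kinv a i)) \<doteq> I.EF_coeff i *\<^sub>k (gen_Kinv a i - gen_K a i)"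
      using free_antipode_tmon[of "\<lambda>j. a j i"] free_antipode_tmon[of "\<lambda>j. - a j i"]
      by (intro I.cong_smul I.cong_diff) (simp_all add: gen_K_eq)
    then show ?thesis using True by (simp add: free_antipode_simps smul_diff_right)
  qed (simp add: free_antipode_simps)
  have "free_antipode a r = free_antipode a (gen (GE i) * gen (GF j)) - free_antipode a (gen (GF j) * gen (GE i)) - free_antipode a ?H"
    unfolding EF by (simp only: free_antipode_diff)
  also have "\<dots> \<doteq> - ?H - (- ?H)" by (intro I.cong_diff 5 6)
  finally show ?thesis by (simp add: I.cong_0_iff)
next
  case (SE i j)
  obtain c where c: "free_antipode a (serre GE i j)
    = c *\<^sub>k qad (d i) (a i j) (antipode_gen a (GE i)) (antipode_gen a (GE j)) (serre_exponent i j)"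
    using free_antipode_serre[OF SE(1)] by blast
  have "qad (d i) (a i j) ((- 1) *\<^sub>k gen_Kinv a i * gen (GE i)) ((- 1) *\<^sub>k gen_Kinv a j * gen (GE j)) (serre_exponent i j) \<in> relator_ideal"
    using symmetrized[of i j] I.Kinv_E[of j i]
    by (intro qad_scaled_serre_mem[OF SE(1) serre_mem(1)[OF SE(1)],
          where s = "- (d i * of_int (a i i))" and s' = "- (d i * of_int (a i j))"] I.qcommute_smul_left I.qcommute_smul_right
      I.Kinv_E K_K_commute) simp
  then show ?thesis unfolding SE c by (intro I.smul_mem) (simp add: antipode_gen_def)
next
  case (SF i j)
  obtain c where c: "free_antipode a (serre GF i j)
    = c *\<^sub>k qad (d i) (a i j) (antipode_gen a (GF i)) (antipode_gen a (GF j)) (serre_exponent i j)"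
    using free_antipode_serre[OF SF(1)] by blast
  \<comment> \<open>The sign of the antipode together with the power of q that moves k_l to the left
    of f_l.\<close>
  define z where "z l = - qpow (d l * of_int (a l l))" for l
  have F: "antipode_gen a (GF l) \<doteq> z l *\<^sub>k gen_K a l * gen (GF l)" for l
    using I.cong_minus[OF I.qcommute_flip[OF I.K_F[of l l], unfolded I.qcommute_def]]
    by (simp add: antipode_gen_def z_def)
  have "qad (d i) (a i j) (z i *\<^sub>k gen_K a i * gen (GF i)) (z j *\<^sub>k gen_K a j * gen (GF j)) (serre_exponent i j) \<in> relator_ideal"
    using symmetrized[of i j] I.K_F[of j i]
    by (intro qad_scaled_serre_mem[OF SF(1) serre_mem(2)[OF SF(1)],
          where s = "- (d i * of_int (a i i))" and s' = "- (d i * of_int (a i j))"] I.qcommute_smul_left I.qcommute_smul_right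
      I.K_F K_K_commute) simp
  then have "qad (d i) (a i j) (antipode_gen a (GF i)) (antipode_gen a (GF j)) (serre_exponent i j) \<in> relator_ideal"
    using I.cong_mem_iff[OF I.qad_cong[OF F F]] by blast
  then show ?thesis unfolding SF c by (rule I.smul_mem)
qed

lemma free_antipode_cong:
  assumes "x \<doteq> y" shows "free_antipode a x \<doteq> free_antipode a y"
proof -
  have "two_sided_ideal {x. free_antipode a x \<in> relator_ideal}"
    by standard (simp_all add: free_antipode_simps I.zero_mem I.add_mem I.mult_left_mem I.mult_right_mem)
  then have "relator_ideal \<subseteq> {x. free_antipode a x \<in> relator_ideal}"
    using free_antipode_relator by (intro relator_ideal_least) auto
  then show ?thesis using assms by (auto simp: I.cong_def free_antipode_diff[symmetric])
qed

lemma opposite_ring_simps [simp]: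
  "carrier (opposite_ring R) = carrier R" "x \<otimes>\<^bsub>opposite_ring R\<^esub> y = y \<otimes>\<^bsub>R\<^esub> x"
  "x \<oplus>\<^bsub>opposite_ring R\<^esub> y = x \<oplus>\<^bsub>R\<^esub> y" "\<one>\<^bsub>opposite_ring R\<^esub> = \<one>\<^bsub>R\<^esub>"
  by (simp_all add: opposite_ring_def)

lemma monoid_opposite_U: "Group.monoid (opposite_ring U)"
  by (rule monoidI) (auto simp: U.m_assoc)

lemma antipode_cls: "antipode (cls x) = cls (free_antipode a x)"
proof -
  obtain h where h: "h \<in> alg_homs U (opposite_ring U) scal" "\<And>x. h (cls x) = cls (free_antipode a x)"
    by (rule hom_lift[of "\<lambda>x. cls (free_antipode a x)" "opposite_ring U" scal])
      (simp_all add: cls_eq_iff free_antipode_cong free_antipode_simps cls_mult cls_add cls_1 scal_eq)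
  have vals: "h (t i) = tinv i" "h (e i) = \<ominus>\<^bsub>U\<^esub> (kinv i \<otimes>\<^bsub>U\<^esub> e i)" "h (f i) = \<ominus>\<^bsub>U\<^esub> (f i \<otimes>\<^bsub>U\<^esub> k i)" for i
    by (simp_all add: h t_def tinv_def e_def f_def k_def kinv_def free_antipode_gen antipode_gen_def cls_minus cls_mult)
  have "antipode = h"
    unfolding antipode_def
  proof (rule the_equality)
    fix h' assume "h' \<in> alg_homs U (opposite_ring U) scal \<and> (\<forall>i. h' (t i) = tinv i \<and>
       h' (e i) = \<ominus>\<^bsub>U\<^esub> (kinv i \<otimes>\<^bsub>U\<^esub> e i) \<and> h' (f i) = \<ominus>\<^bsub>U\<^esub> (f i \<otimes>\<^bsub>U\<^esub> k i))"
    then show "h' = h"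
      by (intro alg_hom_unique[OF monoid_opposite_U _ h(1)]) (auto simp: vals)
  qed (auto simp: h(1) vals)
  then show ?thesis by (simp add: h)
qed

end

context quantum_datum
begin

subsection \<open>The projection onto the Cartan part\<close>

lemma vev_cong: "x \<doteq> y \<Longrightarrow> vev l x = vev l y"
proof -
  assume xy: "x \<doteq> y"
  \<comment> \<open>The kernel of \<open>vev l\<close> need not be an ideal; this is the largest
    two-sided ideal inside it.\<close>
  have "two_sided_ideal {x. \<forall>u v. vev l (u * x * v) = 0}"
  proof
    fix x y u assume "x \<in> {x. \<forall>u v. vev l (u * x * v) = 0}"
    then show "u * x \<in> {x. \<forall>u v. vev l (u * x * v) = 0}" "x * u \<in> {x. \<forall>u v. vev l (u * x * v) = 0}"
      by (simp_all add: mult.assoc[symmetric]) (simp_all add: mult.assoc)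
  qed (simp_all add: distrib_left distrib_right vev_add)
  then have "relator_ideal \<subseteq> {x. \<forall>u v. vev l (u * x * v) = 0}"
    using vev_relator by (intro relator_ideal_least) auto
  then have "vev l (1 * (x - y) * 1) = 0" using xy unfolding I.cong_def by blast
  then show ?thesis by (simp add: vev_diff)
qed

abbreviation torus_span :: "'i falg set" where "torus_span \<equiv> word_span torus_gens"

lemma vev_T_right: "vev l (x * gen (GT i)) = qpow (d i * l $ i) * vev l x"
  and vev_T_left: "vev l (gen (GT i) * x) = qpow (d i * l $ i) * vev l x"
  and vev_Tinv_right: "vev l (x * gen (GTinv i)) = qpow (- (d i * l $ i)) * vev l x"
  and vev_Tinv_left: "vev l (gen (GTinv i) * x) = qpow (- (d i * l $ i)) * vev l x"
proof -
  have 1: "tmon (\<lambda>j. if j = i then 1 else 0) = gen (GT i)" "tmon (\<lambda>j. if j = i then - 1 else 0) = gen (GTinv i)"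
    by (simp_all only: tmon_single gen_T_power_1 gen_T_power_minus_1)
  have 2: "tchar l (\<lambda>j. if j = i then 1 else 0) = qpow (d i * l $ i)"
    "tchar l (\<lambda>j. if j = i then - 1 else 0) = qpow (- (d i * l $ i))"
    by (simp_all add: tchar_def if_distrib[of of_int] if_distrib[of "\<lambda>c. c * _"] cong: if_cong)
  show "vev l (x * gen (GT i)) = qpow (d i * l $ i) * vev l x" "vev l (gen (GT i) * x) = qpow (d i * l $ i) * vev l x"
    "vev l (x * gen (GTinv i)) = qpow (- (d i * l $ i)) * vev l x" "vev l (gen (GTinv i) * x) = qpow (- (d i * l $ i)) * vev l x"
    using vev_tmon_right[of l x] vev_tmon_left[of l _ x] 1 2 by metis+
qed

lemma vev_torus_right: "y \<in> torus_span \<Longrightarrow> vev l (x * y) = vev l x * vev l y"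
proof (induction arbitrary: x rule: word_span_induct)
  case (word c u)
  have "vev l (x * word u) = vev l x * vev l (word u)"
    using word
  proof (induction u arbitrary: x rule: rev_induct)
    case (snoc g u)
    have g: "g \<in> torus_gens" "u \<in> lists torus_gens" using snoc.prems by auto
    then have "vev l (z * gen g) = vev l z * vev l (gen g)" for z
      using vev_T_right[of l z] vev_T_right[of l 1] vev_Tinv_right[of l z] vev_Tinv_right[of l 1] by auto
    then show ?case using snoc.IH[OF g(2)] by (simp add: word_append mult.assoc[symmetric] flip: gen_eq_word)
  qed simp
  then show ?case by (simp add: vev_smul)
qed (simp_all add: distrib_left vev_add algebra_simps)

text \<open>The restriction of \<open>vev l\<close> to the torus is multiplicative, hence a witness
  for the definite description. Uniqueness holds because a homomorphism is determined at t_i^{-1} by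
  its value at t_i.\<close>

lemma qchar_cls:
  assumes "x \<in> torus_span" shows "qchar l (cls x) = vev l x"
proof -
  let ?U0 = "U\<lparr>carrier := U0\<rparr>"
  define h where "h = (\<lambda>u\<in>U0. vev l (SOME x. u = cls x))"
  have h: "h (cls x) = vev l x" if "x \<in> torus_span" for x
  proof -
    have "cls x = cls (SOME y. cls x = cls y)" by (rule someI[of _ x]) simp
    then have "vev l (SOME y. cls x = cls y) = vev l x"
      by (intro vev_cong) (simp add: cls_eq_iff I.cong_sym)
    then show ?thesis using that by (simp add: h_def U0_eq)
  qed
  have scal: "c *\<^sub>k 1 \<in> torus_span" for c by (intro word_span_smul word_span_1)
  have gens: "gen (GT i) \<in> torus_span" "gen (GTinv i) \<in> torus_span" for i
    by (auto intro: gen_in_word_span)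
  have hom: "h \<in> ring_hom ?U0 Kring"
  proof (rule ring_hom_memI)
    fix u v assume "u \<in> carrier ?U0" "v \<in> carrier ?U0"
    then obtain x y where "u = cls x" "x \<in> torus_span" "v = cls y" "y \<in> torus_span" by (auto simp: U0_eq)
    then show "h (u \<otimes>\<^bsub>?U0\<^esub> v) = h u \<otimes>\<^bsub>Kring\<^esub> h v" "h (u \<oplus>\<^bsub>?U0\<^esub> v) = h u \<oplus>\<^bsub>Kring\<^esub> h v"
      by (simp_all add: h word_span_mult word_span_add vev_torus_right vev_add flip: cls_mult cls_add)
  next
    have "h (cls 1) = 1" using h[OF word_span_1] by simp
    then show "h \<one>\<^bsub>?U0\<^esub> = \<one>\<^bsub>Kring\<^esub>" by (simp add: cls_1)
  qed simp
  have T: "h (t i) = qpow (d i * pairing l (simple_coweight i))" for i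
  proof -
    have "pairing l (simple_coweight i) = (\<Sum>j\<in>UNIV. if j = i then l $ i else 0)"
      unfolding pairing_def by (intro sum.cong) (auto simp: simple_coweight_def axis_def)
    then show ?thesis using vev_T_right[of l 1 i] by (simp add: t_def h gens)
  qed
  have "qchar l = h"
    unfolding qchar_def
  proof (rule the_equality)
    show "h \<in> alg_homs ?U0 Kring (\<lambda>c. c) \<and> (\<forall>i. h (t i) = qpow (d i * pairing l (simple_coweight i)))"
      using hom T by (simp add: alg_homs_def scal_eq h scal vev_smul) (simp add: h_def)
  next
    fix h' assume h': "h' \<in> alg_homs ?U0 Kring (\<lambda>c. c) \<and> (\<forall>i. h' (t i) = qpow (d i * pairing l (simple_coweight i)))"
    then have hom': "h' \<in> ring_hom ?U0 Kring" and scal': "h' (scal c) = c" for c by (auto simp: alg_homs_def)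
    have in_U0: "cls x \<in> U0" if "x \<in> torus_span" for x using that by (simp add: U0_eq)
    have mult': "h' (cls (x * y)) = h' (cls x) * h' (cls y)" if "x \<in> torus_span" "y \<in> torus_span" for x y
      using ring_hom_mult[OF hom', of "cls x" "cls y"] that by (simp add: in_U0 cls_mult)
    have add': "h' (cls (x + y)) = h' (cls x) + h' (cls y)" if "x \<in> torus_span" "y \<in> torus_span" for x y
      using ring_hom_add[OF hom', of "cls x" "cls y"] that by (simp add: in_U0 cls_add)
    have one': "h' (cls 1) = 1" using ring_hom_one[OF hom'] by (simp add: cls_1)
    have T': "h' (cls (gen (GT i))) = h (cls (gen (GT i)))" for i using h' T by (simp add: t_def)
    have Tinv': "h' (cls (gen (GTinv i))) = h (cls (gen (GTinv i)))" for i
    proof -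
      have "cls (gen (GT i) * gen (GTinv i)) = cls 1" using I.T_inv by (simp add: cls_eq_iff)
      then have 1: "h' (cls (gen (GT i))) * h' (cls (gen (GTinv i))) = 1"
        by (simp flip: mult'[OF gens] add: one')
      have "vev l (gen (GT i)) * vev l (gen (GTinv i)) = 1"
        using vev_T_right[of l 1 i] vev_Tinv_right[of l 1 i] by simp
      then have "h (cls (gen (GT i))) * h (cls (gen (GTinv i))) = 1" by (simp add: h gens)
      with 1 show ?thesis unfolding T' by (metis mult_cancel_left mult_zero_left zero_neq_one)
    qed
    have "h' (cls x) = h (cls x)" if "x \<in> torus_span" for x
      using that
    proof (induction rule: word_span_induct)
      case zero
      have "h' (cls 0) = h' (cls 0) + h' (cls 0)"
        using add'[OF word_span_zero word_span_zero] by (simp only: add_0)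
      then have "h' (cls 0) = 0" by (metis add_cancel_right_right)
      then show ?case using h[OF word_span_zero] by simp
    next
      case (word c u)
      have "h' (cls (word u)) = h (cls (word u))" using word
      proof (induction u rule: rev_induct)
        case (snoc g u)
        have g: "g \<in> torus_gens" "u \<in> lists torus_gens" using snoc.prems by auto
        have "h' (cls (gen g)) = h (cls (gen g))" using g(1) T' Tinv' by auto
        then show ?case
          using snoc.IH[OF g(2)] mult'[OF word_in_word_span[OF g(2)] gen_in_word_span[OF g(1)]]
            h[OF word_in_word_span[OF g(2)]] h[OF gen_in_word_span[OF g(1)]]
            h[OF word_span_mult[OF word_in_word_span[OF g(2)] gen_in_word_span[OF g(1)]]]
            vev_torus_right[OF gen_in_word_span[OF g(1)]]
          by (simp add: word_append flip: gen_eq_word)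
      qed (simp add: one' h word_span_1)
      moreover have "h' (cls (c *\<^sub>k word u)) = c * h' (cls (word u))"
        using mult'[OF scal[of c] word_in_word_span[OF word]] scal'[of c] by (simp add: scal_eq)
      moreover have "h (cls (c *\<^sub>k word u)) = c * h (cls (word u))"
        using word_in_word_span[OF word] by (simp add: h word_span_smul vev_smul)
      ultimately show ?case by simp
    next
      case (add x y)
      then show ?case by (simp add: add' h word_span_add vev_add)
    qed
    then have "h' u = h u" if "u \<in> U0" for u using that by (auto simp: U0_eq)
    then show "h' = h"
      using h' by (intro extensionalityI[of h' U0 h]) (auto simp: alg_homs_def h_def)
  qed
  then show ?thesis using h[OF assms] by simp
qed

lemma tmon_in_torus_span: "tmon n \<in> torus_span"
proof -
  have "gen g ^ m \<in> torus_span" if "g \<in> torus_gens" for g m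
    using that by (induction m) (auto intro: word_span_1 word_span_mult gen_in_word_span)
  then have "gen_T_power j m \<in> torus_span" for j m
    by (simp add: gen_T_power_def)
  then have "prod_list (map (\<lambda>j. gen_T_power j (n j)) js) \<in> torus_span" for js
    by (induction js) (auto intro: word_span_1 word_span_mult)
  then show ?thesis by (simp add: tmon_def)
qed

lemma vev_tmon: "vev l (tmon n) = tchar l n"
  using vev_tmon_right[of l 1 n] by simp

lemma qchar_tmon: "qchar l (cls (tmon n)) = tchar l n"
  by (simp add: qchar_cls tmon_in_torus_span vev_tmon)

text \<open>Dedekind's argument, for the characters \<open>l \<mapsto> q\<^sup>l(t)\<close> of the additive group of weights.\<close>

lemma tchar_independent:
  assumes "finite S" "\<And>l. (\<Sum>n\<in>S. c n * tchar l n) = 0" "n \<in> S"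
  shows "c n = 0"
  using assms
proof (induction S arbitrary: c n rule: finite_induct)
  case (insert m S)
  have mult: "tchar (l + l') n = tchar l n * tchar l' n" for l l' n
    by (simp add: tchar_def distrib_left sum.distrib flip: qpow_add)
  have c0: "c n = 0" if n: "n \<in> S" for n
  proof -
    have "n \<noteq> m" using n insert.hyps by auto
    then obtain j where j: "n j \<noteq> m j" by blast
    define l0 :: "'i weight" where "l0 = axis j 1"
    have "(\<Sum>i\<in>UNIV. of_int (n i) * (d i * l0 $ i)) = of_int (n j) * d j" for n
    proof -
      have "(\<Sum>i\<in>UNIV. of_int (n i) * (d i * l0 $ i)) = (\<Sum>i\<in>UNIV. if i = j then of_int (n j) * d j else 0)"
        by (intro sum.cong) (auto simp: l0_def axis_def)
      then show ?thesis by simp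
    qed
    then have neq: "tchar l0 n \<noteq> tchar l0 m" using j by (simp add: tchar_def)
    have "(\<Sum>n\<in>S. (c n * (tchar l0 n - tchar l0 m)) * tchar l n) = 0" for l
    proof -
      have "(\<Sum>n\<in>insert m S. c n * tchar (l + l0) n) - tchar l0 m * (\<Sum>n\<in>insert m S. c n * tchar l n) = 0"
        by (simp only: insert.prems(1) mult_zero_right diff_self)
      also have "(\<Sum>n\<in>insert m S. c n * tchar (l + l0) n) - tchar l0 m * (\<Sum>n\<in>insert m S. c n * tchar l n)
        = (\<Sum>n\<in>insert m S. (c n * (tchar l0 n - tchar l0 m)) * tchar l n)"
        by (simp only: sum_distrib_left sum_subtractf[symmetric] mult) (simp only: algebra_simps)
      finally show ?thesis using insert.hyps by simp
    qed
    from insert.IH[of "\<lambda>n. c n * (tchar l0 n - tchar l0 m)", OF this n] neq show ?thesis by simp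
  qed
  then have "(\<Sum>n\<in>S. c n * tchar 0 n) = 0" by simp
  then have "c m * tchar 0 m = 0" using insert.prems(1)[of 0] insert.hyps by simp
  then show ?case using c0 insert.prems(2) by auto
qed simp

lemma lspan_range_eq_sum:
  "x \<in> lspan (range g) \<Longrightarrow> \<exists>S c. finite S \<and> x = (\<Sum>n\<in>S. c n *\<^sub>k g n)"
proof (induction rule: lspan.induct)
  case zero
  show ?case by (intro exI[of _ "{}"]) simp
next
  case (step s x b)
  then obtain S c m where S: "finite S" "x = (\<Sum>n\<in>S. c n *\<^sub>k g n)" and s: "s = g m" by auto
  define c' where "c' n = (if n \<in> S then c n else 0) + (if n = m then b else 0)" for n
  have "(\<Sum>n\<in>insert m S. c' n *\<^sub>k g n) = (\<Sum>n\<in>insert m S. (if n \<in> S then c n else 0) *\<^sub>k g n) + (\<Sum>n\<in>insert m S. (if n = m then b else 0) *\<^sub>k g n)"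
    by (simp add: c'_def smul_add_left sum.distrib)
  also have "(\<Sum>n\<in>insert m S. (if n \<in> S then c n else 0) *\<^sub>k g n) = x"
    unfolding S(2) using S(1) by (intro sum.mono_neutral_cong_right) auto
  also have "(\<Sum>n\<in>insert m S. (if n = m then b else 0) *\<^sub>k g n) = (\<Sum>n\<in>{m}. b *\<^sub>k g n)"
    using S(1) by (intro sum.mono_neutral_cong_right) auto
  finally have "b *\<^sub>k s + x = (\<Sum>n\<in>insert m S. c' n *\<^sub>k g n)" by (simp add: s add.commute)
  then show ?case using S(1) by blast
qed

lemma torus_word_tmon: "u \<in> lists torus_gens \<Longrightarrow> \<exists>n. word u \<doteq> tmon n"
proof (induction u rule: list.induct)
  case Nil
  show ?case by (intro exI[of _ "\<lambda>_. 0"]) simp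
next
  case (Cons g u)
  then have "g \<in> torus_gens" "u \<in> lists torus_gens" by simp_all
  then obtain n i where n: "word u \<doteq> tmon n" and i: "g = GT i \<or> g = GTinv i"
    using Cons.IH by blast
  then obtain m where m: "gen g = tmon m"
    using tmon_single[of i 1] tmon_single[of i "- 1"] gen_T_power_1[of i] gen_T_power_minus_1[of i] by metis
  have "word (g # u) \<doteq> tmon m * tmon n" unfolding word_Cons m by (intro I.cong_mult_left n)
  also have "\<dots> \<doteq> tmon (\<lambda>j. m j + n j)" by (rule I.tmon_add)
  finally show ?case by blast
qed

lemma torus_span_tmon: "x \<in> torus_span \<Longrightarrow> \<exists>y\<in>lspan (range tmon). x \<doteq> y"
proof (induction rule: word_span_induct)
  case (word c u)
  have "\<exists>n. word u \<doteq> tmon n" using torus_word_tmon[OF word] .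
  then obtain n where "word u \<doteq> tmon n" by blast
  then have "c *\<^sub>k word u \<doteq> c *\<^sub>k tmon n" by (rule I.cong_smul)
  moreover have "c *\<^sub>k tmon n \<in> lspan (range tmon)" by (intro lspan_smul lspan_base) simp
  ultimately show ?case by blast
next
  case zero
  show ?case using lspan.zero I.cong_refl by blast
next
  case (add x y)
  then show ?case using I.cong_add lspan_add by blast
qed

text \<open>A combination of torus monomials is detected by letting the weight vary, through the
  independence of the characters. This yields the uniqueness of \<open>proj0\<close>.\<close>

lemma torus_span_eq_0:
  assumes "x \<in> torus_span" "\<And>l. vev l x = 0" shows "x \<doteq> 0"
proof -
  obtain y where y: "y \<in> lspan (range tmon)" "x \<doteq> y" using torus_span_tmon[OF assms(1)] by blast
  then obtain S c where S: "finite S" "y = (\<Sum>n\<in>S. c n *\<^sub>k tmon n)" using lspan_range_eq_sum[OF y(1)] by blast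
  have sum: "vev l (\<Sum>n\<in>S. h n) = (\<Sum>n\<in>S. vev l (h n))" for l h
    by (induction S rule: infinite_finite_induct) (simp_all add: vev_add)
  have "(\<Sum>n\<in>S. c n * tchar l n) = 0" for l
    using vev_cong[OF y(2), of l] assms(2)[of l] by (simp add: S(2) sum vev_smul vev_tmon)
  from tchar_independent[OF S(1) this] have "y = 0" by (simp add: S(2))
  then show ?thesis using y(2) by simp
qed

section \<open>The complement of the torus part\<close>

abbreviation f_span :: "'i falg set" where "f_span \<equiv> word_span (range GF)"
abbreviation e_span :: "'i falg set" where "e_span \<equiv> word_span (range GE)"

lemma fword_in_f_span: "fword js \<in> f_span" and eword_in_e_span: "eword js \<in> e_span"
  by (auto intro!: word_in_word_span)

lemma f_span_induct [consumes 1, case_names zero word add]: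
  assumes "y \<in> f_span" "P 0" "\<And>c js. P (c *\<^sub>k fword js)"
    and "\<And>x y. x \<in> f_span \<Longrightarrow> y \<in> f_span \<Longrightarrow> P x \<Longrightarrow> P y \<Longrightarrow> P (x + y)"
  shows "P y"
  using assms(1) by (induction rule: word_span_induct) (auto simp: lists_range intro: assms)

lemma e_span_induct [consumes 1, case_names zero word add]:
  assumes "y \<in> e_span" "P 0" "\<And>c js. P (c *\<^sub>k eword js)"
    and "\<And>x y. x \<in> e_span \<Longrightarrow> y \<in> e_span \<Longrightarrow> P x \<Longrightarrow> P y \<Longrightarrow> P (x + y)"
  shows "P y"
  using assms(1) by (induction rule: word_span_induct) (auto simp: lists_range intro: assms)

lemma vev_f_span: "y \<in> f_span \<Longrightarrow> vev l (y * u) = free_counit y * vev l u"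
proof (induction rule: f_span_induct)
  case (word c js)
  have "vev l (fword js * u) = free_counit (fword js) * vev l u"
    by (cases js) (simp_all add: word_Cons mult.assoc vev_F free_counit_simps counit_gen_def)
  then show ?case by (simp add: vev_smul free_counit_simps)
qed (simp_all add: vev_add distrib_right free_counit_simps)

lemma vev_e_span: "x \<in> e_span \<Longrightarrow> vev l (u * x) = free_counit x * vev l u"
proof (induction rule: e_span_induct)
  case (word c js)
  have "vev l (u * eword js) = free_counit (eword js) * vev l u"
    by (cases js rule: rev_cases)
      (simp_all add: word_append vev_E free_counit_simps counit_gen_def mult.assoc[symmetric] flip: gen_eq_word)
  then show ?case by (simp add: vev_smul free_counit_simps)
qed (simp_all add: vev_add distrib_left distrib_right free_counit_simps)

abbreviation augmented :: "'i ualg set" where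
  "augmented \<equiv> kspan Ureg ({y \<otimes>\<^bsub>U\<^esub> u | y u. y \<in> Uneg_plus \<and> u \<in> carrier U} \<union>
                          {u \<otimes>\<^bsub>U\<^esub> y | u y. u \<in> carrier U \<and> y \<in> Upos_plus})"

lemma Ureg_simps [simp]:
  "carrier Ureg = carrier U" "\<zero>\<^bsub>Ureg\<^esub> = \<zero>\<^bsub>U\<^esub>" "x \<oplus>\<^bsub>Ureg\<^esub> y = x \<oplus>\<^bsub>U\<^esub> y" "x \<odot>\<^bsub>Ureg\<^esub> y = x \<otimes>\<^bsub>U\<^esub> y"
  by (simp_all add: Ureg_def)

lemma kspan_base: "x \<in> S \<Longrightarrow> x \<in> kspan V S" by (auto simp: kspan_def)
lemma kspan_minimal: "W \<in> ksubspaces V \<Longrightarrow> S \<subseteq> W \<Longrightarrow> kspan V S \<subseteq> W" by (auto simp: kspan_def)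
lemma kspan_zero: "\<zero>\<^bsub>V\<^esub> \<in> kspan V S" by (auto simp: kspan_def ksubspaces_def)
lemma kspan_add: "x \<in> kspan V S \<Longrightarrow> y \<in> kspan V S \<Longrightarrow> x \<oplus>\<^bsub>V\<^esub> y \<in> kspan V S"
  by (auto simp: kspan_def ksubspaces_def)
lemma kspan_smul: "x \<in> kspan V S \<Longrightarrow> scal c \<odot>\<^bsub>V\<^esub> x \<in> kspan V S"
  by (auto simp: kspan_def ksubspaces_def)

lemma cls_image_ksubspace:
  assumes "0 \<in> Z" "\<And>x y. x \<in> Z \<Longrightarrow> y \<in> Z \<Longrightarrow> x + y \<in> Z" "\<And>c x. x \<in> Z \<Longrightarrow> c *\<^sub>k x \<in> Z"
  shows "cls ` Z \<in> ksubspaces Ureg"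
proof -
  have 1: "u \<oplus>\<^bsub>U\<^esub> v \<in> cls ` Z" if uv: "u \<in> cls ` Z" "v \<in> cls ` Z" for u v
  proof -
    obtain x y where "u = cls x" "v = cls y" "x \<in> Z" "y \<in> Z" using uv by blast
    then show ?thesis by (simp only: cls_add[symmetric] imageI assms(2))
  qed
  have 2: "scal c \<otimes>\<^bsub>U\<^esub> u \<in> cls ` Z" if u: "u \<in> cls ` Z" for c u
  proof -
    obtain x where "u = cls x" "x \<in> Z" using u by blast
    then show ?thesis by (simp only: cls_smul[symmetric] imageI assms(3))
  qed
  have 3: "\<zero>\<^bsub>U\<^esub> \<in> cls ` Z" unfolding cls_0[symmetric] by (rule imageI[OF assms(1)])
  show ?thesis
    unfolding ksubspaces_def Ureg_simps mem_Collect_eq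
    by (intro conjI ballI allI 1 2 3 image_subsetI cls_closed)
qed

lemma augmented_vev: "cls x \<in> augmented \<Longrightarrow> vev l x = 0"
proof -
  let ?W = "cls ` {x. vev l x = 0}"
  have "?W \<in> ksubspaces Ureg" by (rule cls_image_ksubspace) (auto simp: vev_add vev_smul)
  moreover have "{y \<otimes>\<^bsub>U\<^esub> u | y u. y \<in> Uneg_plus \<and> u \<in> carrier U} \<subseteq> ?W"
    by (auto simp: Uneg_plus_def Uneg_eq counit_cls vev_f_span simp flip: cls_mult elim!: carrier_UE)
  moreover have "{u \<otimes>\<^bsub>U\<^esub> y | u y. u \<in> carrier U \<and> y \<in> Upos_plus} \<subseteq> ?W"
    by (auto simp: Upos_plus_def Upos_eq counit_cls vev_e_span simp flip: cls_mult elim!: carrier_UE)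
  ultimately have "augmented \<subseteq> ?W" by (intro kspan_minimal) auto
  moreover assume "cls x \<in> augmented"
  ultimately obtain y where "cls x = cls y" "vev l y = 0" by auto
  then show ?thesis using vev_cong by (auto simp: cls_eq_iff)
qed

text \<open>A triangular monomial with a nonempty f-word or e-word lies in the augmented part, so
  only its torus monomials remain.\<close>

lemma augmented_complement: "\<exists>z\<in>torus_span. cls (x - z) \<in> augmented"
proof -
  have base: "\<exists>z\<in>torus_span. cls (fword ms * tmon n * eword ks - z) \<in> augmented" for ms n ks
  proof -
    have 1: "cls (fword (m # ms) * x) \<in> augmented" for m ms x
    proof -
      have "cls (fword (m # ms)) \<in> Uneg_plus"
        using fword_in_f_span[of "m # ms"]
        by (simp add: Uneg_plus_def Uneg_eq counit_cls free_counit_simps counit_gen_def)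
      then show ?thesis unfolding cls_mult by (intro kspan_base UnI1 CollectI exI conjI) (rule refl | assumption | rule cls_closed)+
    qed
    have 2: "cls (x * eword (m # ms)) \<in> augmented" for m ms x
    proof -
      have "cls (eword (m # ms)) \<in> Upos_plus"
        using eword_in_e_span[of "m # ms"]
        by (simp add: Upos_plus_def Upos_eq counit_cls free_counit_simps counit_gen_def)
      then show ?thesis unfolding cls_mult by (intro kspan_base UnI2 CollectI exI conjI) (rule refl | assumption | rule cls_closed)+
    qed
    show ?thesis
    proof (cases "ms = [] \<and> ks = []")
      case True
      have "cls 0 \<in> augmented" using kspan_zero[of Ureg] by (simp add: cls_0)
      then show ?thesis using True tmon_in_torus_span[of n] by (intro bexI[of _ "tmon n"]) simp_all
    next
      case False
      then have "cls (fword ms * tmon n * eword ks) \<in> augmented"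
        proof (cases ms)
          case Nil
          with False obtain k' ks' where "ks = k' # ks'" by (cases ks) auto
          then show ?thesis by (simp only: 2)
        next
          case (Cons m' ms')
          then show ?thesis by (simp only: mult.assoc 1)
        qed
      then show ?thesis by (intro bexI[of _ 0]) (simp_all add: word_span_zero)
    qed
  qed
  have span: "\<exists>z\<in>torus_span. cls (y - z) \<in> augmented" if "y \<in> lspan {fword ms * tmon n * eword ks | ms n ks. True}" for y
    using that
  proof (induction rule: lspan.induct)
    case zero
    have "cls 0 \<in> augmented" using kspan_zero[of Ureg] by (simp add: cls_0)
    then show ?case by (intro bexI[of _ 0]) (simp_all add: word_span_zero)
  next
    case (step s y c)
    then obtain z z' where z: "z \<in> torus_span" "cls (s - z) \<in> augmented" "z' \<in> torus_span" "cls (y - z') \<in> augmented"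
      using base by blast
    have "cls (c *\<^sub>k (s - z) + (y - z')) \<in> augmented"
      using kspan_add[OF kspan_smul[OF z(2), of c] z(4)] by (simp add: cls_add cls_smul)
    moreover have "c *\<^sub>k (s - z) + (y - z') = (c *\<^sub>k s + y) - (c *\<^sub>k z + z')" by (simp add: smul_diff_right)
    ultimately show ?case using z by (intro bexI[of _ "c *\<^sub>k z + z'"]) (auto intro: word_span_add word_span_smul)
  qed
  obtain y where y: "y \<in> lspan {fword ms * tmon n * eword ks | ms n ks. True}" "x \<doteq> y"
    using I.triangular_UNIV[of x] unfolding I.triangular_def mem_Collect_eq by (elim bexE)
  obtain z where z: "z \<in> torus_span" "cls (y - z) \<in> augmented" using span[OF y(1)] by (elim bexE)
  have "cls (x - z) = cls (y - z)"
    using y(2) by (simp add: cls_eq_iff I.cong_diff)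
  with z show ?thesis by (intro bexI[of _ z]) simp_all
qed

text \<open>Existence of the projection is triangular spanning. Two candidates differ by a torus
  element in the augmented part, on which \<open>vev\<close> vanishes for every weight, so the
  candidates coincide. Thus \<open>vev l\<close> is the functional in the definition of
  \<open>pi_form\<close>.\<close>

lemma qchar_proj0: "qchar l (proj0 (cls x)) = vev l x"
proof -
  obtain z where z: "z \<in> torus_span" "cls (x - z) \<in> augmented" using augmented_complement by blast
  have "proj0 (cls x) = cls z"
    unfolding proj0_def
  proof (rule the_equality)
    show "cls z \<in> U0 \<and> cls x \<ominus>\<^bsub>U\<^esub> cls z \<in> augmented" using z by (simp add: U0_eq cls_diff)
  next
    fix z' assume "z' \<in> U0 \<and> cls x \<ominus>\<^bsub>U\<^esub> z' \<in> augmented"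
    then obtain y where y: "z' = cls y" "y \<in> torus_span" "cls (x - y) \<in> augmented"
      by (auto simp: U0_eq cls_diff)
    have "y - z \<doteq> 0"
      using augmented_vev[OF y(3)] augmented_vev[OF z(2)] y(2) z(1)
      by (intro torus_span_eq_0 word_span_diff) (auto simp: vev_diff)
    then show "z' = cls z" by (simp add: y(1) cls_eq_iff I.cong_def)
  qed
  moreover have "vev l x = vev l z" using augmented_vev[OF z(2), of l] by (simp add: vev_diff)
  ultimately show ?thesis by (simp add: qchar_cls z(1))
qed

lemma pi_form_cls: "pi_form l (cls x) (cls y) = vev l (free_antipode a x * y)"
  by (simp add: pi_form_def antipode_cls qchar_proj0 flip: cls_mult)

end

context quantum_datum
begin

subsection \<open>Verma modules and their irreducible quotients\<close>

definition left_ideal :: "'i falg set \<Rightarrow> bool" where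
  "left_ideal K \<longleftrightarrow> 0 \<in> K \<and> (\<forall>x\<in>K. \<forall>y\<in>K. x + y \<in> K) \<and> (\<forall>u. \<forall>x\<in>K. u * x \<in> K)"

lemma left_idealD:
  assumes "left_ideal K"
  shows "0 \<in> K" "x \<in> K \<Longrightarrow> y \<in> K \<Longrightarrow> x + y \<in> K" "x \<in> K \<Longrightarrow> u * x \<in> K" "x \<in> K \<Longrightarrow> c *\<^sub>k x \<in> K"
    "x \<in> K \<Longrightarrow> - x \<in> K" "x \<in> K \<Longrightarrow> y \<in> K \<Longrightarrow> x - y \<in> K"
proof -
  have 1: "x \<in> K \<Longrightarrow> y \<in> K \<Longrightarrow> x + y \<in> K" "x \<in> K \<Longrightarrow> u * x \<in> K" for x y u
    using assms by (auto simp: left_ideal_def)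
  have 2: "x \<in> K \<Longrightarrow> - x \<in> K" for x using 1(2)[of x "- 1"] by simp
  show "0 \<in> K" "x \<in> K \<Longrightarrow> y \<in> K \<Longrightarrow> x + y \<in> K" "x \<in> K \<Longrightarrow> u * x \<in> K" "x \<in> K \<Longrightarrow> c *\<^sub>k x \<in> K"
    "x \<in> K \<Longrightarrow> - x \<in> K" "x \<in> K \<Longrightarrow> y \<in> K \<Longrightarrow> x - y \<in> K"
    using assms 1 2 1(1)[of x "- y"] by (auto simp: left_ideal_def smul_def)
qed

text \<open>All modules in sight except the function algebra are cyclic; \<open>presents V \<rho> K\<close> identifies \<open>V\<close>
  with the quotient of the free algebra by the left ideal \<open>K\<close>.\<close>

definition presents :: "('i ualg, 'v) module \<Rightarrow> ('i falg \<Rightarrow> 'v) \<Rightarrow> 'i falg set \<Rightarrow> bool" where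
  "presents V \<rho> K \<longleftrightarrow> left_ideal K \<and> carrier V = range \<rho> \<and> (\<forall>x y. \<rho> x = \<rho> y \<longleftrightarrow> x - y \<in> K) \<and>
     (\<forall>x y. \<rho> x \<oplus>\<^bsub>V\<^esub> \<rho> y = \<rho> (x + y)) \<and> \<zero>\<^bsub>V\<^esub> = \<rho> 0 \<and> (\<forall>u x. cls u \<odot>\<^bsub>V\<^esub> \<rho> x = \<rho> (u * x))"

lemma presentsD:
  assumes "presents V \<rho> K"
  shows "left_ideal K" "carrier V = range \<rho>" "\<rho> x = \<rho> y \<longleftrightarrow> x - y \<in> K"
    "\<rho> x \<oplus>\<^bsub>V\<^esub> \<rho> y = \<rho> (x + y)" "\<zero>\<^bsub>V\<^esub> = \<rho> 0" "cls u \<odot>\<^bsub>V\<^esub> \<rho> x = \<rho> (u * x)" "scal c \<odot>\<^bsub>V\<^esub> \<rho> x = \<rho> (c *\<^sub>k x)"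
  using assms by (auto simp: presents_def scal_eq)

lemma presents_Ureg: "presents Ureg cls relator_ideal"
  unfolding presents_def left_ideal_def Ureg_simps
  by (simp add: I.zero_mem I.add_mem I.mult_left_mem carrier_U cls_eq_iff I.cong_def cls_add cls_mult cls_0[simplified])

lemma presents_quotient:
  assumes V: "presents V \<rho> K" and K': "left_ideal K'" "K \<subseteq> K'" and W: "W = \<rho> ` K'"
  shows "presents (quotient_module V W) (\<lambda>x. W +>\<^bsub>V\<^esub> \<rho> x) K'"
proof -
  note VD = presentsD[OF V] and KD = left_idealD[OF K'(1)]
  have coset: "W +>\<^bsub>V\<^esub> \<rho> x = \<rho> ` (\<lambda>k. k + x) ` K'" for x
    unfolding a_r_coset_def' W by (auto simp: VD(4))
  have eq: "W +>\<^bsub>V\<^esub> \<rho> x = W +>\<^bsub>V\<^esub> \<rho> y \<longleftrightarrow> x - y \<in> K'" for x y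
  proof
    assume "W +>\<^bsub>V\<^esub> \<rho> x = W +>\<^bsub>V\<^esub> \<rho> y"
    moreover have "\<rho> (0 + x) \<in> W +>\<^bsub>V\<^esub> \<rho> x" unfolding coset by (intro imageI KD(1))
    ultimately obtain k where k: "k \<in> K'" "\<rho> x = \<rho> (k + y)" unfolding coset by auto
    then have "x - (k + y) \<in> K'" using K'(2) VD(3) by auto
    from KD(2)[OF this k(1)] show "x - y \<in> K'" by simp
  next
    have sub: "W +>\<^bsub>V\<^esub> \<rho> x \<subseteq> W +>\<^bsub>V\<^esub> \<rho> y" if "x - y \<in> K'" for x y
    proof
      fix v assume "v \<in> W +>\<^bsub>V\<^esub> \<rho> x"
      then obtain k where k: "k \<in> K'" "v = \<rho> (k + x)" unfolding coset by auto
      have "v = \<rho> ((k + (x - y)) + y)" by (simp add: k(2))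
      then show "v \<in> W +>\<^bsub>V\<^esub> \<rho> y" unfolding coset using KD(2)[OF k(1) that] by blast
    qed
    assume xy: "x - y \<in> K'"
    from KD(5)[OF xy] have "y - x \<in> K'" by simp
    then show "W +>\<^bsub>V\<^esub> \<rho> x = W +>\<^bsub>V\<^esub> \<rho> y" using sub xy by blast
  qed
  have carr: "carrier (quotient_module V W) = range (\<lambda>x. W +>\<^bsub>V\<^esub> \<rho> x)"
    by (auto simp: quotient_module_def A_RCOSETS_def' VD(2))
  have add: "(W +>\<^bsub>V\<^esub> \<rho> x) \<oplus>\<^bsub>quotient_module V W\<^esub> (W +>\<^bsub>V\<^esub> \<rho> y) = W +>\<^bsub>V\<^esub> \<rho> (x + y)" for x y
  proof -
    have "(W +>\<^bsub>V\<^esub> \<rho> x) <+>\<^bsub>V\<^esub> (W +>\<^bsub>V\<^esub> \<rho> y) = {\<rho> ((k + x) + (k' + y)) | k k'. k \<in> K' \<and> k' \<in> K'}"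
      unfolding set_add_def' coset by (auto simp: VD(4))
    also have "\<dots> = \<rho> ` (\<lambda>k. k + (x + y)) ` K'"
    proof (intro equalityI subsetI)
      fix v assume "v \<in> {\<rho> ((k + x) + (k' + y)) | k k'. k \<in> K' \<and> k' \<in> K'}"
      then obtain k k' where "k \<in> K'" "k' \<in> K'" "v = \<rho> ((k + x) + (k' + y))" by blast
      then have "k + k' \<in> K'" "v = \<rho> ((k + k') + (x + y))" using KD(2) by (simp_all add: algebra_simps)
      then show "v \<in> \<rho> ` (\<lambda>k. k + (x + y)) ` K'" by blast
    next
      fix v assume "v \<in> \<rho> ` (\<lambda>k. k + (x + y)) ` K'"
      then obtain k where "k \<in> K'" "v = \<rho> ((k + x) + (0 + y))" by (auto simp: add.assoc)
      then show "v \<in> {\<rho> ((k + x) + (k' + y)) | k k'. k \<in> K' \<and> k' \<in> K'}" using KD(1) by blast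
    qed
    finally show ?thesis by (simp add: quotient_module_def coset)
  qed
  have zero: "\<zero>\<^bsub>quotient_module V W\<^esub> = W +>\<^bsub>V\<^esub> \<rho> 0"
    unfolding coset by (simp add: quotient_module_def W image_image)
  have smult: "cls u \<odot>\<^bsub>quotient_module V W\<^esub> (W +>\<^bsub>V\<^esub> \<rho> x) = W +>\<^bsub>V\<^esub> \<rho> (u * x)" for u x
  proof -
    have "W +>\<^bsub>V\<^esub> (cls u \<odot>\<^bsub>V\<^esub> v) = W +>\<^bsub>V\<^esub> \<rho> (u * x)" if v: "v \<in> W +>\<^bsub>V\<^esub> \<rho> x" for v
    proof -
      obtain k where k: "k \<in> K'" "v = \<rho> (k + x)" using v unfolding coset by auto
      show ?thesis unfolding k(2) VD(6) eq using KD(3)[OF k(1), of u] by (simp add: distrib_left)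
    qed
    moreover have "\<rho> (0 + x) \<in> W +>\<^bsub>V\<^esub> \<rho> x" unfolding coset by (intro imageI KD(1))
    ultimately have "(\<Union>v\<in>W +>\<^bsub>V\<^esub> \<rho> x. W +>\<^bsub>V\<^esub> (cls u \<odot>\<^bsub>V\<^esub> v)) = W +>\<^bsub>V\<^esub> \<rho> (u * x)" by blast
    then show ?thesis by (simp add: quotient_module_def)
  qed
  show ?thesis unfolding presents_def using K'(1) carr eq add zero smult by blast
qed

lemma T_inverse: "inv\<^bsub>U\<^esub> (t i) = tinv i"
proof -
  have "t i \<otimes>\<^bsub>U\<^esub> tinv i = \<one>\<^bsub>U\<^esub>" "tinv i \<otimes>\<^bsub>U\<^esub> t i = \<one>\<^bsub>U\<^esub>"
    using I.T_inv[of i] by (simp_all add: t_def tinv_def cls_eq_iff flip: cls_mult cls_1)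
  then show ?thesis using U.inv_unique'[of "t i" "tinv i"] by (simp add: t_def tinv_def)
qed

lemma Tgroup_tmon: "s \<in> Tgroup \<Longrightarrow> \<exists>n. s = cls (tmon n)"
  unfolding Tgroup_def
proof (induction rule: generate.induct)
  case one
  show ?case by (intro exI[of _ "\<lambda>_. 0"]) (simp add: cls_1)
next
  case (incl h)
  then show ?case using tmon_single[of _ 1] gen_T_power_1 by (metis t_def rangeE)
next
  case (inv h)
  then show ?case using tmon_single[of _ "- 1"] gen_T_power_minus_1 T_inverse by (metis tinv_def rangeE)
next
  case (eng h1 h2)
  then obtain m n where "h1 = cls (tmon m)" "h2 = cls (tmon n)" by blast
  then have "h1 \<otimes>\<^bsub>U\<^esub> h2 = cls (tmon (\<lambda>j. m j + n j))"
    using I.tmon_add[of m n] by (simp add: cls_eq_iff flip: cls_mult)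
  then show ?case by blast
qed

lemma T_in_Tgroup: "t i \<in> Tgroup"
  unfolding Tgroup_def by (rule generate.incl) simp

section \<open>Kernels of the Verma and irreducible modules\<close>

definition verma_kernel :: "'i weight \<Rightarrow> 'i falg set" where
  "verma_kernel l = {x. cls x \<in> verma_ideal l}"

lemma verma_ideal_subset: "verma_ideal l \<subseteq> carrier U"
  unfolding verma_ideal_def
proof (rule kspan_minimal)
  show "carrier U \<in> ksubspaces Ureg" using U.zero_closed by (simp add: ksubspaces_def)
  show "{u \<otimes>\<^bsub>U\<^esub> e i |u i. u \<in> carrier U} \<union> {u \<otimes>\<^bsub>U\<^esub> (s \<ominus>\<^bsub>U\<^esub> scal (qchar l s)) |u s. u \<in> carrier U \<and> s \<in> Tgroup}
    \<subseteq> carrier U"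
    using Tgroup_tmon by (fastforce simp: e_def)
qed

lemma verma_ideal_eq: "verma_ideal l = cls ` verma_kernel l"
proof -
  have "v \<in> cls ` verma_kernel l" if v: "v \<in> verma_ideal l" for v
  proof -
    obtain x where "v = cls x" using subsetD[OF verma_ideal_subset v] by (rule carrier_UE)
    with v show ?thesis by (auto simp: verma_kernel_def)
  qed
  then show ?thesis by (auto simp: verma_kernel_def)
qed

lemma verma_kernel_E: "u * gen (GE i) \<in> verma_kernel l"
  unfolding verma_kernel_def verma_ideal_def mem_Collect_eq cls_mult
  by (intro kspan_base UnI1 CollectI exI conjI) (auto simp: e_def)

lemma verma_kernel_T: "s \<in> Tgroup \<Longrightarrow> s = cls y \<Longrightarrow> u * (y - qchar l s *\<^sub>k 1) \<in> verma_kernel l"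
  unfolding verma_kernel_def verma_ideal_def mem_Collect_eq cls_mult cls_diff
  by (intro kspan_base UnI2 CollectI exI conjI) (auto simp: scal_eq)

text \<open>\<open>verma_ideal\<close> is defined as a linear span, so stability under left
  multiplication has to be read off from its spanning set.\<close>

lemma verma_kernel_left_ideal: "left_ideal (verma_kernel l)"
proof -
  let ?S = "{u \<otimes>\<^bsub>U\<^esub> e i |u i. u \<in> carrier U} \<union> {u \<otimes>\<^bsub>U\<^esub> (s \<ominus>\<^bsub>U\<^esub> scal (qchar l s)) |u s. u \<in> carrier U \<and> s \<in> Tgroup}"
  have 0: "0 \<in> verma_kernel l"
    using kspan_zero[of Ureg] by (simp add: verma_kernel_def verma_ideal_def cls_0)
  have add: "x + y \<in> verma_kernel l" if "x \<in> verma_kernel l" "y \<in> verma_kernel l" for x y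
    using that kspan_add[of _ Ureg] by (simp add: verma_kernel_def verma_ideal_def cls_add)
  have smul: "c *\<^sub>k x \<in> verma_kernel l" if "x \<in> verma_kernel l" for c x
    using that kspan_smul[of _ Ureg] by (simp add: verma_kernel_def verma_ideal_def cls_smul)
  have "u * x \<in> verma_kernel l" if x: "x \<in> verma_kernel l" for u x
  proof -
    let ?W = "cls ` {x. u * x \<in> verma_kernel l}"
    have "?W \<in> ksubspaces Ureg"
      by (rule cls_image_ksubspace) (auto simp: distrib_left 0 add smul)
    moreover have "?S \<subseteq> ?W"
    proof
      fix v assume "v \<in> ?S"
      then consider w i where "w \<in> carrier U" "v = w \<otimes>\<^bsub>U\<^esub> e i"
        | w s where "w \<in> carrier U" "s \<in> Tgroup" "v = w \<otimes>\<^bsub>U\<^esub> (s \<ominus>\<^bsub>U\<^esub> scal (qchar l s))" by blast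
      then show "v \<in> ?W"
      proof cases
        case 1
        then obtain y where "w = cls y" by (blast elim: carrier_UE)
        then have "v = cls (y * gen (GE i))" using 1 by (simp add: cls_mult e_def)
        then show ?thesis using verma_kernel_E[of "u * y" i l] by (auto simp: mult.assoc)
      next
        case 2
        then obtain y z where y: "w = cls y" "s = cls z" using Tgroup_tmon by (blast elim: carrier_UE)
        then have "v = cls (y * (z - qchar l s *\<^sub>k 1))" using 2 by (simp add: cls_mult cls_diff scal_eq)
        then show ?thesis using verma_kernel_T[OF 2(2) y(2), of "u * y" l] by (simp add: mult.assoc)
      qed
    qed
    ultimately have "verma_ideal l \<subseteq> ?W" unfolding verma_ideal_def by (rule kspan_minimal)
    then obtain y where y: "u * y \<in> verma_kernel l" "cls x = cls y" using x by (auto simp: verma_kernel_def)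
    then have "cls (u * x) = cls (u * y)" by (simp add: cls_mult)
    then show ?thesis using y(1) by (simp add: verma_kernel_def)
  qed
  then show ?thesis using 0 add by (simp add: left_ideal_def)
qed

lemma relator_ideal_verma: "relator_ideal \<subseteq> verma_kernel l"
proof
  fix x assume "x \<in> relator_ideal"
  then have "cls x = cls 0" by (simp add: cls_eq_iff I.cong_0_iff)
  then show "x \<in> verma_kernel l"
    using left_idealD(1)[OF verma_kernel_left_ideal] by (simp add: verma_kernel_def)
qed

definition verma_proj :: "'i weight \<Rightarrow> 'i falg \<Rightarrow> 'i vermavec" where
  "verma_proj l x = verma_ideal l +>\<^bsub>Ureg\<^esub> cls x"

lemma presents_verma: "presents (verma l) (verma_proj l) (verma_kernel l)"
  unfolding verma_def verma_proj_def
  by (rule presents_quotient[OF presents_Ureg verma_kernel_left_ideal relator_ideal_verma verma_ideal_eq])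

lemma verma_vec_eq: "verma_vec l = verma_proj l 1"
  by (simp add: verma_vec_def verma_proj_def cls_1)

definition radical :: "'i weight \<Rightarrow> 'i falg set" where
  "radical l = {x. \<forall>u. vev l (u * x) = 0}"

lemma radical_left_ideal: "left_ideal (radical l)"
  by (auto simp: left_ideal_def radical_def distrib_left vev_add simp flip: mult.assoc)

lemma verma_kernel_radical: "verma_kernel l \<subseteq> radical l"
proof
  fix x assume x: "x \<in> verma_kernel l"
  note rad = left_idealD[OF radical_left_ideal]
  have "cls ` radical l \<in> ksubspaces Ureg"
    by (rule cls_image_ksubspace) (auto intro: rad)
  moreover have "{u \<otimes>\<^bsub>U\<^esub> e i |u i. u \<in> carrier U} \<subseteq> cls ` radical l"
    by (auto simp: e_def radical_def mult.assoc[symmetric] vev_E simp flip: cls_mult elim!: carrier_UE)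
  moreover have "{u \<otimes>\<^bsub>U\<^esub> (s \<ominus>\<^bsub>U\<^esub> scal (qchar l s)) |u s. u \<in> carrier U \<and> s \<in> Tgroup} \<subseteq> cls ` radical l"
  proof clarify
    fix u s assume us: "u \<in> carrier U" "s \<in> Tgroup"
    then obtain y n where y: "u = cls y" "s = cls (tmon n)" using Tgroup_tmon by (blast elim: carrier_UE)
    have "u \<otimes>\<^bsub>U\<^esub> (s \<ominus>\<^bsub>U\<^esub> scal (qchar l s)) = cls (y * (tmon n - tchar l n *\<^sub>k 1))"
      by (simp add: y cls_mult cls_diff scal_eq qchar_tmon)
    moreover have "y * (tmon n - tchar l n *\<^sub>k 1) \<in> radical l"
      by (simp add: radical_def right_diff_distrib vev_diff vev_smul vev_tmon_right mult.assoc[symmetric])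
    ultimately show "u \<otimes>\<^bsub>U\<^esub> (s \<ominus>\<^bsub>U\<^esub> scal (qchar l s)) \<in> cls ` radical l" by simp
  qed
  ultimately have "verma_ideal l \<subseteq> cls ` radical l"
    unfolding verma_ideal_def by (intro kspan_minimal Un_least)
  then obtain y where y: "y \<in> radical l" "x \<doteq> y" using x by (auto simp: verma_kernel_def cls_eq_iff)
  have "vev l (u * x) = 0" for u
    using vev_cong[OF I.cong_mult_left[OF y(2)]] y(1) by (simp add: radical_def)
  then show "x \<in> radical l" by (simp add: radical_def)
qed

text \<open>Built letter by letter from the t_i, which are known to lie in \<open>Tgroup\<close>;
  the inverses follow by cancelling.\<close>

lemma verma_tmon_scalar: "u * tmon n - tchar l n *\<^sub>k u \<in> verma_kernel l"
proof -
  have T: "u * gen_T_power i m - qpow (of_int m * (d i * l $ i)) *\<^sub>k u \<in> verma_kernel l" for u i m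
  proof -
    note K = left_idealD[OF verma_kernel_left_ideal[of l]]
    have q: "qchar l (t i) = qpow (d i * l $ i)"
      using qchar_cls[of "gen (GT i)" l] vev_T_right[of l 1 i]
      by (simp add: t_def gen_in_word_span)
    have 1: "u * gen (GT i) - qpow (d i * l $ i) *\<^sub>k u \<in> verma_kernel l" for u
      using verma_kernel_T[OF T_in_Tgroup[of i] t_def, where u = u and l = l] by (simp add: q right_diff_distrib)
    have 2: "u * gen (GTinv i) - qpow (- (d i * l $ i)) *\<^sub>k u \<in> verma_kernel l" for u
    proof -
      have "(- qpow (- (d i * l $ i))) *\<^sub>k (u * gen (GTinv i) * gen (GT i) - qpow (d i * l $ i) *\<^sub>k (u * gen (GTinv i))) \<in> verma_kernel l"
        by (intro K(4) 1)
      then have 3: "u * gen (GTinv i) - qpow (- (d i * l $ i)) *\<^sub>k (u * gen (GTinv i) * gen (GT i)) \<in> verma_kernel l"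
        by (simp add: smul_diff_right)
      have "u * gen (GTinv i) * gen (GT i) - u \<in> relator_ideal"
        using I.mult_left_mem[of "gen (GTinv i) * gen (GT i) - 1" u] I.T_inv(2)[of i]
        by (simp add: I.cong_def right_diff_distrib mult.assoc)
      then have "qpow (- (d i * l $ i)) *\<^sub>k (u * gen (GTinv i) * gen (GT i) - u) \<in> verma_kernel l"
        using relator_ideal_verma by (intro K(4)) auto
      from K(2)[OF 3 this] show ?thesis by (simp add: smul_diff_right)
    qed
    have pow: "u * g ^ m - c ^ m *\<^sub>k u \<in> verma_kernel l" if g: "\<And>u. u * g - c *\<^sub>k u \<in> verma_kernel l" for u g c m
    proof (induction m arbitrary: u)
      case (Suc m)
      from K(2)[OF Suc[of "u * g"] K(4)[OF g[of u], of "c ^ m"]] show ?case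
        by (simp add: mult.assoc smul_diff_right mult.commute[of c])
    qed (simp add: K(1))
    show ?thesis
    proof (cases "m \<ge> 0")
      case True
      then show ?thesis using pow[OF 1, of u "nat m"] by (simp add: gen_T_power_def qpow_power)
    next
      case False
      then show ?thesis using pow[OF 2, of u "nat (- m)"] by (simp add: gen_T_power_def qpow_power)
    qed
  qed
  have "u * prod_list (map (\<lambda>j. gen_T_power j (n j)) js) - qpow (\<Sum>j\<leftarrow>js. of_int (n j) * (d j * l $ j)) *\<^sub>k u \<in> verma_kernel l" for js u
  proof (induction js arbitrary: u)
    case Nil
    then show ?case using left_idealD(1)[OF verma_kernel_left_ideal] by simp
  next
    case (Cons j js)
    let ?c = "qpow (\<Sum>j\<leftarrow>js. of_int (n j) * (d j * l $ j))"
    have "?c *\<^sub>k (u * gen_T_power j (n j) - qpow (of_int (n j) * (d j * l $ j)) *\<^sub>k u) \<in> verma_kernel l"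
      by (intro left_idealD(4)[OF verma_kernel_left_ideal] T)
    from left_idealD(2)[OF verma_kernel_left_ideal Cons[of "u * gen_T_power j (n j)"] this] show ?case
      by (simp add: mult.assoc smul_diff_right qpow_add mult.commute)
  qed
  from this[of u index_list]
  show ?thesis
    using sum_list_distinct_conv_sum_set[OF index_list(1), of "\<lambda>j. of_int (n j) * (d j * l $ j)"]
    by (simp add: tmon_def tchar_def index_list(2))
qed

lemma lspan_complement:
  assumes "y \<in> lspan S" "left_ideal K" "\<And>s. s \<in> S \<Longrightarrow> \<exists>z\<in>Z. s - z \<in> K"
    and "0 \<in> Z" "\<And>z z'. z \<in> Z \<Longrightarrow> z' \<in> Z \<Longrightarrow> z + z' \<in> Z" "\<And>c z. z \<in> Z \<Longrightarrow> c *\<^sub>k z \<in> Z"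
  shows "\<exists>z\<in>Z. y - z \<in> K"
  using assms(1)
proof (induction rule: lspan.induct)
  case zero
  show ?case using assms(4) left_idealD(1)[OF assms(2)] by (intro bexI[of _ 0]) simp_all
next
  case (step s y c)
  from assms(3)[OF step(1)] step(3) obtain z z' where z: "z \<in> Z" "s - z \<in> K" "z' \<in> Z" "y - z' \<in> K" by blast
  have "c *\<^sub>k (s - z) + (y - z') \<in> K" by (intro left_idealD[OF assms(2)] z)
  moreover have "c *\<^sub>k (s - z) + (y - z') = (c *\<^sub>k s + y) - (c *\<^sub>k z + z')" by (simp add: smul_diff_right)
  ultimately show ?case using z assms(5,6) by (intro bexI[of _ "c *\<^sub>k z + z'"]) auto
qed

text \<open>Modulo the kernel a trailing e is zero and a trailing torus monomial is a scalar, which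
  reduces triangular monomials to f-words.\<close>

lemma verma_f_span: "\<exists>y\<in>f_span. x - y \<in> verma_kernel l"
proof -
  note K = left_idealD[OF verma_kernel_left_ideal[of l]]
  have base: "\<exists>y\<in>f_span. s - y \<in> verma_kernel l" if s': "s \<in> {fword ms * tmon n * eword ks | ms n ks. True}" for s
  proof -
    obtain ms n ks where s: "s = fword ms * tmon n * eword ks" using s' by blast
    show ?thesis
    proof (cases ks rule: rev_cases)
      case Nil
      then show ?thesis using verma_tmon_scalar[of "fword ms" n l] word_span_smul[OF fword_in_f_span] s
        by (intro bexI[of _ "tchar l n *\<^sub>k fword ms"]) simp_all
    next
      case (snoc ks' k)
      have "s = (fword ms * tmon n * eword ks') * gen (GE k)" by (simp add: s snoc word_append gen_eq_word mult.assoc)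
      then show ?thesis using verma_kernel_E by (intro bexI[of _ 0]) (simp_all add: word_span_zero)
    qed
  qed
  obtain x' where x': "x' \<in> lspan {fword ms * tmon n * eword ks | ms n ks. True}" "x \<doteq> x'"
    using I.triangular_UNIV[of x] unfolding I.triangular_def mem_Collect_eq by (elim bexE)
  have "\<exists>y\<in>f_span. x' - y \<in> verma_kernel l"
    by (rule lspan_complement[OF x'(1) verma_kernel_left_ideal base])
      (assumption | rule word_span_zero word_span_add word_span_smul)+
  then obtain y where y: "y \<in> f_span" "x' - y \<in> verma_kernel l" by (elim bexE)
  have "(x - x') + (x' - y) \<in> verma_kernel l"
    using x'(2) relator_ideal_verma by (intro K(2) y(2)) (auto simp: I.cong_def)
  then show ?thesis using y(1) by (intro bexI[of _ y]) simp_all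
qed

text \<open>The left-hand behaviour of \<open>vev l\<close>. It persists for u \<mapsto>
  \<open>vev l (u * x)\<close> and for the coordinates of tensors in their first argument.\<close>

definition highest_functional :: "'i weight \<Rightarrow> ('i falg \<Rightarrow> kk) \<Rightarrow> bool" where
  "highest_functional l h \<longleftrightarrow> (\<forall>x y. h (x + y) = h x + h y) \<and> (\<forall>c x. h (c *\<^sub>k x) = c * h x) \<and>
     (\<forall>x y. x \<doteq> y \<longrightarrow> h x = h y) \<and> (\<forall>i u. h (gen (GF i) * u) = 0) \<and> (\<forall>n u. h (tmon n * u) = tchar l n * h u)"

lemma antipode_E: "gen (GE i) \<doteq> - (gen_K a i * free_antipode a (gen (GE i)))"
proof -
  have "gen_K a i * gen_Kinv a i * gen (GE i) \<doteq> 1 * gen (GE i)"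
    unfolding gen_K_eq by (intro I.cong_mult_right I.tmon_inv)
  then show ?thesis by (simp add: free_antipode_gen antipode_gen_def mult.assoc I.cong_sym)
qed

lemma tmon_antipode_E: "I.qcommute (of_int (n i) * d i) (tmon n) (free_antipode a (gen (GE i)))"
proof -
  have "I.qcommute 0 (tmon n) (gen_Kinv a i)" using I.tmon_commute by (simp add: gen_K_eq I.qcommute_def)
  from I.qcommute_smul_right[OF I.qcommute_mult_right[OF this I.tmon_E], where c = "- 1"]
  show ?thesis by (simp add: free_antipode_gen antipode_gen_def)
qed

lemma tmon_antipode_eword: "I.qcommute (word_weight n ks) (tmon n) (free_antipode a (eword ks))"
proof (induction ks)
  case Nil
  then show ?case by (simp add: free_antipode_1)
next
  case (Cons k ks)
  from I.qcommute_mult_right[OF Cons tmon_antipode_E[of n k]] show ?case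
    by (simp add: word_Cons free_antipode_mult add.commute)
qed

text \<open>The antipode preserves U^+ only up to torus factors. They are collected on the left,
  where highest functionals turn them into nonzero scalars.\<close>

lemma eword_antipode: "\<exists>c n. eword ks \<doteq> c *\<^sub>k (tmon n * free_antipode a (eword (rev ks)))"
proof (induction ks)
  case Nil
  show ?case by (intro exI[of _ 1] exI[of _ "\<lambda>_. 0"]) (simp add: free_antipode_1)
next
  case (Cons k ks)
  then obtain c n where IH: "eword ks \<doteq> c *\<^sub>k (tmon n * free_antipode a (eword (rev ks)))" by blast
  let ?S = "free_antipode a (gen (GE k))" and ?R = "free_antipode a (eword (rev ks))"
  have S: "?S * (tmon n * ?R) \<doteq> qpow (- (of_int (n k) * d k)) *\<^sub>k (tmon n * (?S * ?R))"
    by (rule I.qcommute_left[OF I.qcommute_flip[OF tmon_antipode_E]])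
  have "eword (k # ks) = gen (GE k) * eword ks" by (simp add: word_Cons)
  also have "\<dots> \<doteq> - (gen_K a k * ?S) * (c *\<^sub>k (tmon n * ?R))"
    by (intro I.cong_mult antipode_E IH)
  also have "\<dots> = (- c) *\<^sub>k (gen_K a k * (?S * (tmon n * ?R)))" by (simp add: mult.assoc)
  also have "\<dots> \<doteq> (- c) *\<^sub>k (gen_K a k * (qpow (- (of_int (n k) * d k)) *\<^sub>k (tmon n * (?S * ?R))))"
    by (intro I.cong_smul I.cong_mult_left S)
  also have "\<dots> = (- c * qpow (- (of_int (n k) * d k))) *\<^sub>k (gen_K a k * tmon n * (?S * ?R))"
    by (simp add: mult.assoc)
  also have "\<dots> \<doteq> (- c * qpow (- (of_int (n k) * d k))) *\<^sub>k (tmon (\<lambda>j. a j k + n j) * (?S * ?R))"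
    unfolding gen_K_eq by (intro I.cong_smul I.cong_mult_right I.tmon_add)
  also have "?S * ?R = free_antipode a (eword (rev (k # ks)))"
    by (simp add: word_append gen_eq_word free_antipode_mult)
  finally show ?case by blast
qed

text \<open>By triangular spanning such a functional is determined by its values on e-words, and
  these reduce to antipodes of e-words. All later identities in L(\<lambda>) and in the tensor
  product are tested on these elements.\<close>

lemma highest_functional_eq_0:
  assumes h: "highest_functional l h" and S: "\<And>ks. h (free_antipode a (eword ks)) = 0"
  shows "h u = 0"
proof -
  note hD = h[unfolded highest_functional_def]
  have e: "h (eword ks) = 0" for ks
  proof -
    obtain c n where "eword ks \<doteq> c *\<^sub>k (tmon n * free_antipode a (eword (rev ks)))" using eword_antipode by blast
    then show ?thesis using hD S by simp
  qed
  have base: "h (fword ms * tmon n * eword ks) = 0" for ms n ks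
    by (cases ms) (use hD e in \<open>auto simp: word_Cons mult.assoc\<close>)
  have vanish: "h y = 0" if "y \<in> lspan {fword ms * tmon n * eword ks | ms n ks. True}" for y
    using that
  proof (induction rule: lspan.induct)
    case zero
    have "h (0 *\<^sub>k 0) = 0 * h 0" using hD by blast
    then show ?case by simp
  next
    case (step s x c)
    then show ?case using hD base by auto
  qed
  obtain y where y: "y \<in> lspan {fword ms * tmon n * eword ks | ms n ks. True}" "u \<doteq> y"
    using I.triangular_UNIV[of u] unfolding I.triangular_def mem_Collect_eq by (elim bexE)
  have "\<forall>x y. x \<doteq> y \<longrightarrow> h x = h y" using hD by (elim conjE)
  then have "h u = h y" using y(2) by (elim allE impE)
  then show ?thesis using vanish[OF y(1)] by simp
qed

lemma highest_functional_vev: "highest_functional l (\<lambda>u. vev l (u * x))"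
  unfolding highest_functional_def
  by (auto simp: distrib_right vev_add vev_smul mult.assoc vev_F vev_tmon_left intro: vev_cong I.cong_mult_right)

lemma radical_iff: "x \<in> radical l \<longleftrightarrow> (\<forall>ks. vev l (free_antipode a (eword ks) * x) = 0)"
  using highest_functional_eq_0[OF highest_functional_vev] by (auto simp: radical_def)

lemma e_span_vanishing:
  assumes "\<And>x y. h (x + y) = h x + (h y :: kk)" "\<And>c x. h (c *\<^sub>k x) = c * h x"
  shows "(\<forall>x\<in>e_span. h x = 0) \<longleftrightarrow> (\<forall>ks. h (eword ks) = 0)"
proof
  assume ks: "\<forall>ks. h (eword ks) = 0"
  have h0: "h 0 = 0" using assms(2)[of 0 0] by simp
  have "h x = 0" if "x \<in> e_span" for x
    using that by (induction rule: e_span_induct) (simp_all add: assms ks h0)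
  then show "\<forall>x\<in>e_span. h x = 0" by blast
qed (use eword_in_e_span in blast)

text \<open>\<open>pi_form\<close> tests only against antipodes of elements of U^+; by
  \<open>radical_iff\<close> this amounts to testing against all of U.\<close>

lemma Kneg_eq: "Kneg l = cls ` (f_span \<inter> radical l)"
proof -
  have rad: "(\<forall>x\<in>e_span. vev l (free_antipode a x * y) = 0) \<longleftrightarrow> y \<in> radical l" for y
    unfolding radical_iff
    by (rule e_span_vanishing) (simp_all add: free_antipode_simps distrib_right vev_add vev_smul)
  have Kneg: "Kneg l = {v \<in> cls ` f_span. \<forall>x\<in>e_span. pi_form l (cls x) v = 0}"
    unfolding Kneg_def Uneg_eq Upos_eq by simp
  show ?thesis
  proof (intro equalityI subsetI)
    fix v assume "v \<in> Kneg l"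
    then obtain y where y: "v = cls y" "y \<in> f_span" "\<forall>x\<in>e_span. pi_form l (cls x) (cls y) = 0"
      unfolding Kneg by blast
    then have "y \<in> radical l" unfolding pi_form_cls rad by simp
    with y show "v \<in> cls ` (f_span \<inter> radical l)" by blast
  next
    fix v assume "v \<in> cls ` (f_span \<inter> radical l)"
    then obtain y where y: "v = cls y" "y \<in> f_span" "y \<in> radical l" by blast
    then have "\<forall>x\<in>e_span. pi_form l (cls x) (cls y) = 0" unfolding pi_form_cls rad by simp
    with y show "v \<in> Kneg l" unfolding Kneg by blast
  qed
qed

text \<open>Every element of the radical is congruent to one of U^- modulo the Verma kernel, and
  since that kernel lies in the radical, the representative does too.\<close>

lemma verma_rad_eq: "verma_rad l = verma_proj l ` radical l"
proof -
  note V = presentsD[OF presents_verma[of l]]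
  have "verma_rad l = verma_proj l ` (f_span \<inter> radical l)"
    unfolding verma_rad_def Kneg_eq verma_vec_eq image_image V(6) by simp
  also have "\<dots> = verma_proj l ` radical l"
  proof (intro equalityI subsetI)
    fix v assume "v \<in> verma_proj l ` radical l"
    then obtain x where x: "v = verma_proj l x" "x \<in> radical l" by blast
    obtain y where y: "y \<in> f_span" "x - y \<in> verma_kernel l" using verma_f_span[of x l] by (elim bexE)
    have "x - y \<in> radical l" using y(2) verma_kernel_radical by auto
    from left_idealD(6)[OF radical_left_ideal x(2) this] have "y \<in> radical l" by simp
    then show "v \<in> verma_proj l ` (f_span \<inter> radical l)"
      using y V(3)[of x y] by (intro image_eqI[of _ _ y]) (auto simp: x(1))
  qed auto
  finally show ?thesis .
qed

definition L_proj :: "'i weight \<Rightarrow> 'i falg \<Rightarrow> 'i irrvec" where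
  "L_proj l x = verma_rad l +>\<^bsub>verma l\<^esub> verma_proj l x"

lemma presents_L: "presents (L l) (L_proj l) (radical l)"
  unfolding L_def L_proj_def
  by (rule presents_quotient[OF presents_verma radical_left_ideal verma_kernel_radical verma_rad_eq])

lemma L_vec_eq: "L_vec l = L_proj l 1"
  by (simp add: L_vec_def L_proj_def verma_vec_eq)

end

section \<open>Degree in the f_i and orthogonality\<close>

context quantum_datum
begin

definition f_degree :: "nat \<Rightarrow> 'i falg set" where
  "f_degree n = lspan {fword ms | ms. length ms = n}"

lemma f_degree_fword: "fword ms \<in> f_degree (length ms)"
  unfolding f_degree_def by (rule lspan_base) blast

lemma f_degree_closed:
  "0 \<in> f_degree n" "z \<in> f_degree n \<Longrightarrow> z' \<in> f_degree n \<Longrightarrow> z + z' \<in> f_degree n" "z \<in> f_degree n \<Longrightarrow> c *\<^sub>k z \<in> f_degree n"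
  unfolding f_degree_def by (auto intro: lspan.zero lspan_add lspan_smul)

lemma f_degree_F: "y \<in> f_degree n \<Longrightarrow> gen (GF j) * y \<in> f_degree (Suc n)"
  unfolding f_degree_def
proof (induction rule: lspan.induct)
  case zero
  show ?case by (simp add: lspan.zero)
next
  case (step s x c)
  then obtain ms where "s = fword ms" "length ms = n" by blast
  then have "gen (GF j) * s \<in> {fword ms | ms. length ms = Suc n}"
    by (auto simp: word_Cons intro!: exI[of _ "j # ms"])
  then show ?case using step.IH by (simp add: distrib_left lspan.step)
qed

text \<open>The case distinction corrects the truncated subtraction: e_i sends the highest weight
  vector to 0, not to another vector of degree 0.\<close>

lemma E_lowers_degree_word: "\<exists>y\<in>f_degree (length ms - 1). gen (GE i) * fword ms - (if ms = [] then 0 else y) \<in> verma_kernel l"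
proof (induction ms)
  case Nil
  have "gen (GE i) \<in> verma_kernel l" using verma_kernel_E[of 1 i l] by simp
  then show ?case using f_degree_closed(1) by auto
next
  case (Cons j ms)
  note K = left_idealD[OF verma_kernel_left_ideal[of l]]
  have torus: "\<exists>y\<in>f_degree (length ms). tmon n * fword ms - y \<in> verma_kernel l" for n
  proof -
    let ?c = "qpow (- word_weight n ms)"
    have "tmon n * fword ms - ?c *\<^sub>k (fword ms * tmon n) \<in> relator_ideal"
      using I.tmon_fword[of n ms] by (simp add: I.qcommute_def I.cong_def)
    then have 1: "tmon n * fword ms - ?c *\<^sub>k (fword ms * tmon n) \<in> verma_kernel l"
      using relator_ideal_verma by auto
    have 2: "?c *\<^sub>k (fword ms * tmon n - tchar l n *\<^sub>k fword ms) \<in> verma_kernel l"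
      by (intro K(4) verma_tmon_scalar)
    have "tmon n * fword ms - ?c *\<^sub>k (tchar l n *\<^sub>k fword ms) \<in> verma_kernel l"
      using K(2)[OF 1 2] by (simp only: smul_diff_right) (simp add: algebra_simps)
    then show ?thesis by (rule bexI) (intro f_degree_closed(3) f_degree_fword)
  qed
  define H where "H = (if i = j then I.EF_coeff i *\<^sub>k (gen_K a i - gen_Kinv a i) else 0)"
  have "\<exists>y\<in>f_degree (length ms). H * fword ms - y \<in> verma_kernel l"
  proof (cases "i = j")
    case True
    obtain y y' where y: "y \<in> f_degree (length ms)" "gen_K a i * fword ms - y \<in> verma_kernel l"
      "y' \<in> f_degree (length ms)" "gen_Kinv a i * fword ms - y' \<in> verma_kernel l"
      unfolding gen_K_eq using torus[of "\<lambda>j. a j i"] torus[of "\<lambda>j. - a j i"] by (elim bexE)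
    let ?z = "I.EF_coeff i *\<^sub>k y + (- I.EF_coeff i) *\<^sub>k y'"
    have "I.EF_coeff i *\<^sub>k (gen_K a i * fword ms - y) - I.EF_coeff i *\<^sub>k (gen_Kinv a i * fword ms - y') \<in> verma_kernel l"
      by (intro K y)
    then have "H * fword ms - ?z \<in> verma_kernel l"
      using True by (simp add: H_def smul_diff_right left_diff_distrib algebra_simps)
    moreover have "?z \<in> f_degree (length ms)" by (intro f_degree_closed y)
    ultimately show ?thesis by (rule bexI)
  next
    case False
    then show ?thesis using f_degree_closed(1) K(1) by (intro bexI[of _ 0]) (simp_all add: H_def)
  qed
  then obtain z where z: "z \<in> f_degree (length ms)" "H * fword ms - z \<in> verma_kernel l" by (elim bexE)
  from Cons obtain y where y: "y \<in> f_degree (length ms - 1)"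
    "gen (GE i) * fword ms - (if ms = [] then 0 else y) \<in> verma_kernel l" by (elim bexE)
  let ?y = "if ms = [] then 0 else y"
  have Fy: "gen (GF j) * ?y \<in> f_degree (length ms)"
    using f_degree_F[OF y(1)] f_degree_closed(1) by auto
  have "gen (GE i) * gen (GF j) - gen (GF j) * gen (GE i) - H \<in> relator_ideal"
    using I.E_F[of i j] by (simp only: H_def I.cong_def)
  then have "(gen (GE i) * gen (GF j) - gen (GF j) * gen (GE i) - H) * fword ms \<in> verma_kernel l"
    by (intro subsetD[OF relator_ideal_verma] I.mult_right_mem)
  from K(2)[OF K(2)[OF this z(2)] K(3)[OF y(2), of "gen (GF j)"]]
  have "gen (GE i) * fword (j # ms) - (gen (GF j) * ?y + z) \<in> verma_kernel l"
    by (simp add: word_Cons algebra_simps)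
  then show ?case using f_degree_closed(2)[OF Fy z(1)] by (intro bexI[of _ "gen (GF j) * ?y + z"]) simp_all
qed

lemma E_lowers_degree:
  assumes "y \<in> f_degree n"
  shows "\<exists>z\<in>(if n = 0 then {0} else f_degree (n - 1)). gen (GE i) * y - z \<in> verma_kernel l"
proof -
  note K = left_idealD[OF verma_kernel_left_ideal[of l]]
  let ?Z = "if n = 0 then {0} else f_degree (n - 1)"
  have Z: "0 \<in> ?Z" "\<And>z z'. z \<in> ?Z \<Longrightarrow> z' \<in> ?Z \<Longrightarrow> z + z' \<in> ?Z" "\<And>c z. z \<in> ?Z \<Longrightarrow> c *\<^sub>k z \<in> ?Z"
    using f_degree_closed by (auto split: if_splits)
  show ?thesis
    using assms unfolding f_degree_def[of n]
  proof (induction rule: lspan.induct)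
    case zero
    show ?case using Z(1) K(1) by (intro bexI[of _ 0]) simp_all
  next
    case (step s x c)
    then obtain ms where ms: "s = fword ms" "length ms = n" by blast
    obtain y where y: "y \<in> f_degree (length ms - 1)"
      "gen (GE i) * fword ms - (if ms = [] then 0 else y) \<in> verma_kernel l"
      using E_lowers_degree_word[of ms i l] by (elim bexE)
    from step.IH obtain z where z: "z \<in> ?Z" "gen (GE i) * x - z \<in> verma_kernel l" by (elim bexE)
    let ?y = "if ms = [] then 0 else y"
    have "c *\<^sub>k (gen (GE i) * fword ms - ?y) + (gen (GE i) * x - z) \<in> verma_kernel l"
      by (intro K y z)
    then have "gen (GE i) * (c *\<^sub>k s + x) - (c *\<^sub>k ?y + z) \<in> verma_kernel l"
      by (simp add: ms smul_diff_right algebra_simps)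
    moreover have "?y \<in> ?Z" using y(1) ms(2) by auto
    ultimately show ?case using Z z(1) by (intro bexI[of _ "c *\<^sub>k ?y + z"]) blast+
  qed
qed

lemma eword_lowers_degree:
  "y \<in> f_degree n \<Longrightarrow> \<exists>z\<in>(if length ks > n then {0} else f_degree (n - length ks)). eword ks * y - z \<in> verma_kernel l"
proof (induction ks arbitrary: n y rule: rev_induct)
  case Nil
  then show ?case using left_idealD(1)[OF verma_kernel_left_ideal] by (intro bexI[of _ y]) simp_all
next
  case (snoc k ks)
  note K = left_idealD[OF verma_kernel_left_ideal[of l]]
  obtain z where z: "z \<in> (if n = 0 then {0} else f_degree (n - 1))" "gen (GE k) * y - z \<in> verma_kernel l"
    using E_lowers_degree[OF snoc.prems, of k l] by (elim bexE)
  have 1: "eword (ks @ [k]) * y - eword ks * z \<in> verma_kernel l"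
    using K(3)[OF z(2), of "eword ks"]
    by (simp add: word_append gen_eq_word mult.assoc right_diff_distrib)
  show ?case
  proof (cases "n = 0")
    case True
    then show ?thesis using 1 z(1) by (intro bexI[of _ 0]) simp_all
  next
    case False
    then have "z \<in> f_degree (n - 1)" using z(1) by simp
    from snoc.IH[OF this] obtain z' where z': "z' \<in> (if length ks > n - 1 then {0} else f_degree (n - 1 - length ks))"
      "eword ks * z - z' \<in> verma_kernel l" by (elim bexE)
    have "eword (ks @ [k]) * y - z' \<in> verma_kernel l" using K(2)[OF 1 z'(2)] by simp
    moreover have "z' \<in> (if length (ks @ [k]) > n then {0} else f_degree (n - length (ks @ [k])))"
      using z'(1) False by (auto split: if_splits)
    ultimately show ?thesis by (rule bexI)
  qed
qed

lemma vev_f_degree: "y \<in> f_degree n \<Longrightarrow> n > 0 \<Longrightarrow> vev l y = 0"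
  unfolding f_degree_def
proof (induction rule: lspan.induct)
  case (step s x c)
  then obtain ms where "s = fword ms" "length ms = n" by blast
  with step obtain j ms' where "s = fword (j # ms')" by (cases ms) auto
  then show ?case using step by (simp add: vev_add vev_smul word_Cons vev_F)
qed simp

lemma vev_verma_kernel: "x \<in> verma_kernel l \<Longrightarrow> vev l x = 0"
  using verma_kernel_radical[of l] by (auto simp: radical_def dest!: subsetD spec[of _ 1])

text \<open>A longer e-word kills the vector; a shorter one leaves f-words of positive degree, which
  \<open>vev\<close> kills.\<close>

lemma vev_eword_fword: "length ks \<noteq> length ms \<Longrightarrow> vev l (eword ks * fword ms) = 0"
proof -
  assume neq: "length ks \<noteq> length ms"
  obtain z where z: "z \<in> (if length ks > length ms then {0} else f_degree (length ms - length ks))"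
    "eword ks * fword ms - z \<in> verma_kernel l"
    using eword_lowers_degree[OF f_degree_fword, of ms ks l] by (elim bexE)
  have "vev l z = 0" using z(1) neq vev_f_degree[of z "length ms - length ks"] by (auto split: if_splits)
  then show ?thesis using vev_verma_kernel[OF z(2)] by (simp add: vev_diff)
qed

lemma antipode_eword: "\<exists>c n. free_antipode a (eword ks) \<doteq> c *\<^sub>k (tmon n * eword (rev ks))"
proof (induction ks)
  case Nil
  show ?case by (intro exI[of _ 1] exI[of _ "\<lambda>_. 0"]) (simp add: free_antipode_1)
next
  case (Cons k ks)
  then obtain c n where IH: "free_antipode a (eword ks) \<doteq> c *\<^sub>k (tmon n * eword (rev ks))" by blast
  define w where "w = qpow (- word_weight (\<lambda>j. - a j k) (rev ks))"
  have "free_antipode a (eword (k # ks)) = free_antipode a (eword ks) * - (gen_Kinv a k * gen (GE k))"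
    by (simp add: word_Cons free_antipode_mult free_antipode_gen antipode_gen_def)
  also have "\<dots> \<doteq> (c *\<^sub>k (tmon n * eword (rev ks))) * - (gen_Kinv a k * gen (GE k))"
    by (intro I.cong_mult_right IH)
  also have "\<dots> = (- c) *\<^sub>k (tmon n * (eword (rev ks) * (gen_Kinv a k * gen (GE k))))"
    by (simp add: mult.assoc)
  also have "\<dots> \<doteq> (- c) *\<^sub>k (tmon n * (w *\<^sub>k (gen_Kinv a k * (eword (rev ks) * gen (GE k)))))"
    unfolding gen_K_eq w_def by (intro I.cong_smul I.cong_mult_left I.qcommute_left I.qcommute_flip I.tmon_eword)
  also have "\<dots> = (- c * w) *\<^sub>k (tmon n * gen_Kinv a k * (eword (rev ks) * gen (GE k)))" by (simp add: mult.assoc)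
  also have "\<dots> \<doteq> (- c * w) *\<^sub>k (tmon (\<lambda>j. n j + - a j k) * (eword (rev ks) * gen (GE k)))"
    unfolding gen_K_eq by (intro I.cong_smul I.cong_mult_right I.tmon_add)
  also have "eword (rev ks) * gen (GE k) = eword (rev (k # ks))" by (simp add: word_append gen_eq_word)
  finally show ?case by blast
qed

lemma vev_antipode_fword: "length ks \<noteq> length ms \<Longrightarrow> vev l (free_antipode a (eword ks) * fword ms) = 0"
proof -
  assume neq: "length ks \<noteq> length ms"
  obtain c n where c: "free_antipode a (eword ks) \<doteq> c *\<^sub>k (tmon n * eword (rev ks))" using antipode_eword by blast
  from vev_cong[OF I.cong_mult_right[OF c, of "fword ms"], of l] neq
  show ?thesis by (simp add: vev_smul mult.assoc vev_tmon_left vev_eword_fword)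
qed

subsection \<open>The function algebra\<close>

lemma Udual_simps:
  "carrier Udual = klinear_forms Ureg" "\<zero>\<^bsub>Udual\<^esub> = (\<lambda>x\<in>carrier U. 0)"
  "g \<oplus>\<^bsub>Udual\<^esub> h = (\<lambda>x\<in>carrier U. g x + h x)" "u \<odot>\<^bsub>Udual\<^esub> g = (\<lambda>x\<in>carrier U. g (x \<otimes>\<^bsub>U\<^esub> u))"
  by (simp_all add: Udual_def)

lemma klinear_Ureg_iff:
  "g \<in> klinear_forms Ureg \<longleftrightarrow> g \<in> extensional (carrier U) \<and>
     (\<forall>x y. g (cls (x + y)) = g (cls x) + g (cls y)) \<and> (\<forall>c x. g (cls (c *\<^sub>k x)) = c * g (cls x))"
  by (auto simp: klinear_forms_def carrier_U cls_add cls_smul)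

definition matrix_elements :: "'i ufun set" where
  "matrix_elements = {matrix_element (L m) l v | m l v.
        dominant_integral m \<and> finite_dimensional (L m) \<and> l \<in> klinear_forms (L m) \<and> v \<in> carrier (L m)}"

lemma Fmod_simps:
  "carrier Fmod = kspan Udual matrix_elements" "\<zero>\<^bsub>Fmod\<^esub> = (\<lambda>x\<in>carrier U. 0)"
  "g \<oplus>\<^bsub>Fmod\<^esub> h = (\<lambda>x\<in>carrier U. g x + h x)" "u \<odot>\<^bsub>Fmod\<^esub> g = (\<lambda>x\<in>carrier U. g (x \<otimes>\<^bsub>U\<^esub> u))"
  by (simp_all add: Fmod_def Udual_def matrix_elements_def)

lemma matrix_element_cls: "matrix_element (L m) l (L_proj m w) (cls x) = l (L_proj m (x * w))"
  by (simp add: matrix_element_def presentsD(6)[OF presents_L])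

lemma matrix_elementE:
  assumes "g \<in> matrix_elements"
  obtains m l w where "g \<in> extensional (carrier U)" "\<And>x. g (cls x) = l (L_proj m (x * w))"
    "\<And>x y. l (L_proj m (x + y)) = l (L_proj m x) + l (L_proj m y)" "\<And>c x. l (L_proj m (c *\<^sub>k x)) = c * l (L_proj m x)"
    "\<And>u. cls u \<odot>\<^bsub>Udual\<^esub> g \<in> matrix_elements"
proof -
  obtain m l v where g: "g = matrix_element (L m) l v" "dominant_integral m" "finite_dimensional (L m)"
    "l \<in> klinear_forms (L m)" "v \<in> carrier (L m)" using assms unfolding matrix_elements_def by blast
  note P = presentsD[OF presents_L[of m]]
  obtain w where w: "v = L_proj m w" using g(5) P(2) by auto
  have "g \<in> extensional (carrier U)" by (simp add: g(1) matrix_element_def)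
  moreover have "g (cls x) = l (L_proj m (x * w))" for x by (simp add: g(1) w matrix_element_cls)
  moreover have "l (L_proj m (x + y)) = l (L_proj m x) + l (L_proj m y)" for x y
    using g(4) by (simp add: klinear_forms_def P(2) flip: P(4))
  moreover have "l (L_proj m (c *\<^sub>k x)) = c * l (L_proj m x)" for c x
    using g(4) by (simp add: klinear_forms_def P(2) flip: P(7))
  moreover have "cls u \<odot>\<^bsub>Udual\<^esub> g \<in> matrix_elements" for u
  proof -
    have eq: "cls u \<odot>\<^bsub>Udual\<^esub> g = matrix_element (L m) l (L_proj m (u * w))"
      by (rule ext) (auto simp: Udual_simps g(1) w matrix_element_def P(6) mult.assoc simp flip: cls_mult elim!: carrier_UE)
    show ?thesis unfolding matrix_elements_def
      by (intro CollectI exI conjI, rule eq) (simp_all add: g P(2))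
  qed
  ultimately show ?thesis by (rule that)
qed

lemma Udual_ksubspace_carrier: "klinear_forms Ureg \<in> ksubspaces Udual"
proof -
  have lin: "g \<in> extensional (carrier U)" "g (cls (x + y)) = g (cls x) + g (cls y)" "g (cls (c *\<^sub>k x)) = c * g (cls x)"
    if "g \<in> klinear_forms Ureg" for g x y c using that unfolding klinear_Ureg_iff by blast+
  have "(\<lambda>x\<in>carrier U. 0) \<in> klinear_forms Ureg" by (simp add: klinear_Ureg_iff)
  moreover have "(\<lambda>x\<in>carrier U. g x + h x) \<in> klinear_forms Ureg"
    if "g \<in> klinear_forms Ureg" "h \<in> klinear_forms Ureg" for g h
    unfolding klinear_Ureg_iff using lin[OF that(1)] lin[OF that(2)] by (simp add: algebra_simps)
  moreover have "(\<lambda>x\<in>carrier U. g (x \<otimes>\<^bsub>U\<^esub> scal c)) \<in> klinear_forms Ureg"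
    if "g \<in> klinear_forms Ureg" for g c
    unfolding klinear_Ureg_iff using lin[OF that]
    by (simp add: scal_eq smul_add_right algebra_simps flip: cls_mult)
  ultimately show ?thesis by (simp add: ksubspaces_def Udual_simps)
qed

lemma Fmod_linear:
  assumes "g \<in> carrier Fmod"
  shows "g \<in> extensional (carrier U)" "g (cls (x + y)) = g (cls x) + g (cls y)" "g (cls (c *\<^sub>k x)) = c * g (cls x)"
    "g (cls 0) = 0"
proof -
  have "matrix_elements \<subseteq> klinear_forms Ureg"
  proof
    fix g assume "g \<in> matrix_elements"
    then show "g \<in> klinear_forms Ureg"
      by (rule matrix_elementE) (simp add: klinear_Ureg_iff distrib_right)
  qed
  then have "carrier Fmod \<subseteq> klinear_forms Ureg"
    unfolding Fmod_simps by (rule kspan_minimal[OF Udual_ksubspace_carrier])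
  with assms have "g \<in> klinear_forms Ureg" by blast
  then show 1: "g \<in> extensional (carrier U)" "g (cls (x + y)) = g (cls x) + g (cls y)" "g (cls (c *\<^sub>k x)) = c * g (cls x)" for x y c
    unfolding klinear_Ureg_iff by blast+
  show "g (cls 0) = 0" using 1(3)[of 0 0] by simp
qed

lemma Fmod_eqI:
  assumes "g \<in> extensional (carrier U)" "h \<in> extensional (carrier U)" "\<And>x. g (cls x) = h (cls x)"
  shows "g = h"
  by (rule extensionalityI[OF assms(1,2)]) (auto elim!: carrier_UE simp: assms(3))

lemma Fmod_add_cls: "(g \<oplus>\<^bsub>Fmod\<^esub> h) (cls x) = g (cls x) + h (cls x)" by (simp add: Fmod_simps)
lemma Fmod_zero_cls: "\<zero>\<^bsub>Fmod\<^esub> (cls x) = 0" by (simp add: Fmod_simps)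
lemma Fmod_smult_cls: "(cls u \<odot>\<^bsub>Fmod\<^esub> g) (cls x) = g (cls (x * u))" by (simp add: Fmod_simps cls_mult)
lemma Fmod_scal_cls: "g \<in> carrier Fmod \<Longrightarrow> (scal c \<odot>\<^bsub>Fmod\<^esub> g) (cls x) = c * g (cls x)"
  unfolding scal_eq Fmod_smult_cls by (simp add: Fmod_linear(3))

lemma Fmod_zero_closed: "\<zero>\<^bsub>Fmod\<^esub> \<in> carrier Fmod"
  using kspan_zero[of Udual matrix_elements] by (simp add: Fmod_simps Udual_simps)

lemma Fmod_add_closed: "g \<in> carrier Fmod \<Longrightarrow> h \<in> carrier Fmod \<Longrightarrow> g \<oplus>\<^bsub>Fmod\<^esub> h \<in> carrier Fmod"
  using kspan_add[of g Udual matrix_elements h] by (simp add: Fmod_simps Udual_simps)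

lemma Fmod_scal_closed: "g \<in> carrier Fmod \<Longrightarrow> scal c \<odot>\<^bsub>Fmod\<^esub> g \<in> carrier Fmod"
  using kspan_smul[of g Udual matrix_elements c] by (simp add: Fmod_simps Udual_simps)

text \<open>It suffices to translate a matrix element: applying u just replaces the vector v by
  uv.\<close>

lemma Fmod_smult_closed: "g \<in> carrier Fmod \<Longrightarrow> cls u \<odot>\<^bsub>Fmod\<^esub> g \<in> carrier Fmod"
proof -
  let ?W = "{g \<in> carrier Fmod. cls u \<odot>\<^bsub>Fmod\<^esub> g \<in> carrier Fmod}"
  have ext: "\<And>g h u. g \<oplus>\<^bsub>Fmod\<^esub> h \<in> extensional (carrier U)" "\<And>g u. u \<odot>\<^bsub>Fmod\<^esub> g \<in> extensional (carrier U)"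
    "\<zero>\<^bsub>Fmod\<^esub> \<in> extensional (carrier U)"
    by (simp_all add: Fmod_simps)
  have add: "cls u \<odot>\<^bsub>Fmod\<^esub> (g \<oplus>\<^bsub>Fmod\<^esub> h) = (cls u \<odot>\<^bsub>Fmod\<^esub> g) \<oplus>\<^bsub>Fmod\<^esub> (cls u \<odot>\<^bsub>Fmod\<^esub> h)" for g h
    by (rule Fmod_eqI[OF ext(2) ext(1)]) (simp add: Fmod_smult_cls Fmod_add_cls)
  have smul: "cls u \<odot>\<^bsub>Fmod\<^esub> (scal c \<odot>\<^bsub>Fmod\<^esub> g) = scal c \<odot>\<^bsub>Fmod\<^esub> (cls u \<odot>\<^bsub>Fmod\<^esub> g)" for g c
    by (rule Fmod_eqI[OF ext(2) ext(2)]) (simp add: scal_eq Fmod_smult_cls)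
  have zero: "cls u \<odot>\<^bsub>Fmod\<^esub> \<zero>\<^bsub>Fmod\<^esub> = \<zero>\<^bsub>Fmod\<^esub>"
    by (rule Fmod_eqI[OF ext(2) ext(3)]) (simp add: Fmod_smult_cls Fmod_zero_cls)
  have ops: "\<zero>\<^bsub>Udual\<^esub> = \<zero>\<^bsub>Fmod\<^esub>" "\<And>g h. g \<oplus>\<^bsub>Udual\<^esub> h = g \<oplus>\<^bsub>Fmod\<^esub> h" "\<And>u g. u \<odot>\<^bsub>Udual\<^esub> g = u \<odot>\<^bsub>Fmod\<^esub> g"
    by (simp_all add: Fmod_simps Udual_simps)
  have sub: "carrier Fmod \<subseteq> klinear_forms Ureg"
    using Fmod_linear by (auto simp: klinear_Ureg_iff)
  have "?W \<in> ksubspaces Udual"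
    unfolding ksubspaces_def ops mem_Collect_eq Udual_simps(1)
    using sub by (auto simp: add smul zero Fmod_zero_closed Fmod_add_closed Fmod_scal_closed)
  moreover have "matrix_elements \<subseteq> ?W"
  proof
    fix g assume g: "g \<in> matrix_elements"
    then have "cls u \<odot>\<^bsub>Udual\<^esub> g \<in> matrix_elements" by (rule matrix_elementE)
    from kspan_base[OF this, of Udual] kspan_base[OF g, of Udual]
    show "g \<in> ?W" by (simp add: ops Fmod_simps(1))
  qed
  ultimately have "carrier Fmod \<subseteq> ?W" unfolding Fmod_simps(1) by (rule kspan_minimal)
  then show "g \<in> carrier Fmod \<Longrightarrow> cls u \<odot>\<^bsub>Fmod\<^esub> g \<in> carrier Fmod" by blast
qed

lemma f_span_degree_bound:
  "y \<in> f_span \<Longrightarrow> \<exists>n. \<forall>ks. length ks \<ge> n \<longrightarrow> eword ks * y \<in> verma_kernel l"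
proof (induction rule: f_span_induct)
  case zero
  show ?case using left_idealD(1)[OF verma_kernel_left_ideal] by simp
next
  case (word c js)
  have "eword ks * fword js \<in> verma_kernel l" if "length ks \<ge> Suc (length js)" for ks
    using eword_lowers_degree[OF f_degree_fword, of js ks l] that by simp
  then show ?case using left_idealD(4)[OF verma_kernel_left_ideal] by (intro exI[of _ "Suc (length js)"]) simp
next
  case (add x y)
  then obtain m n where "\<forall>ks. length ks \<ge> m \<longrightarrow> eword ks * x \<in> verma_kernel l" "\<forall>ks. length ks \<ge> n \<longrightarrow> eword ks * y \<in> verma_kernel l"
    by blast
  then show ?case using left_idealD(2)[OF verma_kernel_left_ideal]
    by (intro exI[of _ "max m n"]) (simp add: distrib_left)
qed

text \<open>In a matrix element the e-word acts on the vector before z does. A fixed vector of a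
  highest weight module has bounded degree in the f_i, so long e-words kill it and the bound is
  independent of z.\<close>

lemma Fmod_nilpotent:
  assumes "g \<in> carrier Fmod"
  shows "\<exists>n. \<forall>ks z. length ks \<ge> n \<longrightarrow> g (cls (z * eword ks)) = 0"
proof -
  let ?W = "{g \<in> klinear_forms Ureg. \<exists>n. \<forall>ks z. length ks \<ge> n \<longrightarrow> g (cls (z * eword ks)) = 0}"
  have "?W \<in> ksubspaces Udual"
    unfolding ksubspaces_def
  proof (rule CollectI, intro conjI ballI allI)
    show "?W \<subseteq> carrier Udual" by (auto simp: Udual_simps)
    show "\<zero>\<^bsub>Udual\<^esub> \<in> ?W"
      using Udual_ksubspace_carrier unfolding ksubspaces_def mem_Collect_eq by (simp add: Udual_simps)
  next
    fix g h assume "g \<in> ?W" "h \<in> ?W"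
    then obtain m n where gh: "g \<in> klinear_forms Ureg" "h \<in> klinear_forms Ureg"
      and mn: "\<forall>ks z. length ks \<ge> m \<longrightarrow> g (cls (z * eword ks)) = 0" "\<forall>ks z. length ks \<ge> n \<longrightarrow> h (cls (z * eword ks)) = 0"
      by blast
    have "g \<oplus>\<^bsub>Udual\<^esub> h \<in> klinear_forms Ureg"
      using Udual_ksubspace_carrier gh unfolding ksubspaces_def mem_Collect_eq by blast
    moreover have "\<forall>ks z. length ks \<ge> max m n \<longrightarrow> (g \<oplus>\<^bsub>Udual\<^esub> h) (cls (z * eword ks)) = 0"
      using mn by (simp add: Udual_simps)
    ultimately show "g \<oplus>\<^bsub>Udual\<^esub> h \<in> ?W" by blast
  next
    fix c g assume "g \<in> ?W"
    then obtain n where g: "g \<in> klinear_forms Ureg" and n: "\<forall>ks z. length ks \<ge> n \<longrightarrow> g (cls (z * eword ks)) = 0" by blast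
    have "scal c \<odot>\<^bsub>Udual\<^esub> g \<in> klinear_forms Ureg"
      using Udual_ksubspace_carrier g unfolding ksubspaces_def mem_Collect_eq by blast
    moreover have "\<forall>ks z. length ks \<ge> n \<longrightarrow> (scal c \<odot>\<^bsub>Udual\<^esub> g) (cls (z * eword ks)) = 0"
      using n g by (simp add: Udual_simps scal_eq klinear_Ureg_iff flip: cls_mult)
    ultimately show "scal c \<odot>\<^bsub>Udual\<^esub> g \<in> ?W" by blast
  qed
  moreover have "matrix_elements \<subseteq> ?W"
  proof
    fix g assume g: "g \<in> matrix_elements"
    then have lin: "g \<in> klinear_forms Ureg"
      using kspan_base[of g] Fmod_linear[of g] unfolding klinear_Ureg_iff Fmod_simps(1) by blast
    obtain m l w where "g \<in> extensional (carrier U)" and val: "\<And>x. g (cls x) = l (L_proj m (x * w))"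
      and "\<And>x y. l (L_proj m (x + y)) = l (L_proj m x) + l (L_proj m y)"
      and lin': "\<And>c x. l (L_proj m (c *\<^sub>k x)) = c * l (L_proj m x)"
      and "\<And>u. cls u \<odot>\<^bsub>Udual\<^esub> g \<in> matrix_elements"
      using g by (rule matrix_elementE) (rule that)
    note K = left_idealD[OF radical_left_ideal[of m]]
    obtain y where y: "y \<in> f_span" "w - y \<in> verma_kernel m" using verma_f_span[of w m] by (elim bexE)
    obtain n where n: "\<forall>ks. length ks \<ge> n \<longrightarrow> eword ks * y \<in> verma_kernel m" using f_span_degree_bound[OF y(1)] by blast
    have "g (cls (z * eword ks)) = 0" if ks: "length ks \<ge> n" for ks z
    proof -
      have 1: "w - y \<in> radical m" "eword ks * y \<in> radical m" using y(2) n ks verma_kernel_radical by blast+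
      have "z * eword ks * (w - y) + z * (eword ks * y) \<in> radical m"
        by (rule K(2)[OF K(3)[OF 1(1)] K(3)[OF 1(2)]])
      then have "L_proj m (z * eword ks * w) = L_proj m (0 *\<^sub>k 0)"
        unfolding presentsD(3)[OF presents_L] by (simp add: right_diff_distrib mult.assoc)
      then show ?thesis unfolding val using lin'[of 0 0] by (simp add: mult.assoc)
    qed
    then show "g \<in> ?W" using lin by blast
  qed
  ultimately have "carrier Fmod \<subseteq> ?W" unfolding Fmod_simps(1) by (rule kspan_minimal)
  then show ?thesis using assms by blast
qed

end

subsection \<open>Tensor products and the comultiplication\<close>

text \<open>The tensor square of the free algebra is modelled as the monoid algebra of pairs of words.\<close>

definition left_factor :: "'i falg \<Rightarrow> 'i gen list \<times> 'i gen list \<Rightarrow>\<^sub>0 kk" where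
  "left_factor = free_hom (\<lambda>c. c *\<^sub>k 1) (\<lambda>g. Poly_Mapping.single ([g], []) 1)"

definition right_factor :: "'i falg \<Rightarrow> 'i gen list \<times> 'i gen list \<Rightarrow>\<^sub>0 kk" where
  "right_factor = free_hom (\<lambda>c. c *\<^sub>k 1) (\<lambda>g. Poly_Mapping.single ([], [g]) 1)"

lemma left_factor_simps:
  "left_factor (x + y) = left_factor x + left_factor y"
  "left_factor (x - y) = left_factor x - left_factor y"
  "left_factor (x * y) = left_factor x * left_factor y"
  "left_factor (c *\<^sub>k x) = c *\<^sub>k left_factor x"
  "left_factor 1 = 1" "left_factor 0 = 0"
  "left_factor (x ^ n) = left_factor x ^ n"
  "left_factor (qad \<delta> b E G m) = qad \<delta> b (left_factor E) (left_factor G) m"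
  unfolding left_factor_def
  by (simp_all add: single_embedding.free_hom_add single_embedding.free_hom_diff single_embedding.free_hom_mult
    single_embedding.free_hom_smul single_embedding.free_hom_1 single_embedding.free_hom_0
    single_embedding.free_hom_power free_hom_qad)

lemma right_factor_simps:
  "right_factor (x + y) = right_factor x + right_factor y"
  "right_factor (x - y) = right_factor x - right_factor y"
  "right_factor (x * y) = right_factor x * right_factor y"
  "right_factor (c *\<^sub>k x) = c *\<^sub>k right_factor x"
  "right_factor 1 = 1" "right_factor 0 = 0"
  "right_factor (x ^ n) = right_factor x ^ n"
  "right_factor (qad \<delta> b E G m) = qad \<delta> b (right_factor E) (right_factor G) m"
  unfolding right_factor_def
  by (simp_all add: single_embedding.free_hom_add single_embedding.free_hom_diff single_embedding.free_hom_mult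
    single_embedding.free_hom_smul single_embedding.free_hom_1 single_embedding.free_hom_0
    single_embedding.free_hom_power free_hom_qad)

lemma one_pair: "(1 :: 'g list \<times> 'h list \<Rightarrow>\<^sub>0 kk) = Poly_Mapping.single ([], []) 1"
  by (simp add: zero_list_def zero_prod_def flip: single_one)

lemma left_factor_word: "left_factor (word u) = Poly_Mapping.single (u, []) 1"
proof -
  have "prod_list (map (\<lambda>g. Poly_Mapping.single ([g], []) 1) u) = (Poly_Mapping.single (u, []) 1 :: 'a gen list \<times> 'a gen list \<Rightarrow>\<^sub>0 kk)"
    by (induction u) (simp_all add: one_pair mult_single plus_list_def)
  then show ?thesis by (simp add: left_factor_def single_embedding.free_hom_word)
qed

lemma right_factor_word: "right_factor (word u) = Poly_Mapping.single ([], u) 1"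
proof -
  have "prod_list (map (\<lambda>g. Poly_Mapping.single ([], [g]) 1) u) = (Poly_Mapping.single ([], u) 1 :: 'a gen list \<times> 'a gen list \<Rightarrow>\<^sub>0 kk)"
    by (induction u) (simp_all add: one_pair mult_single plus_list_def)
  then show ?thesis by (simp add: right_factor_def single_embedding.free_hom_word)
qed

lemma factors_word: "left_factor (word u) * right_factor (word v) = Poly_Mapping.single (u, v) 1"
  by (simp add: left_factor_word right_factor_word mult_single plus_list_def)

lemma factors_commute: "right_factor y * left_factor x = left_factor x * right_factor y"
proof (induction x rule: free_algebra_induct)
  case (word c u)
  show ?case
  proof (induction y rule: free_algebra_induct)
    case (word b v)
    show ?case
      by (simp add: left_factor_simps right_factor_simps left_factor_word right_factor_word mult_single plus_list_def mult.commute)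
  qed (simp add: right_factor_simps distrib_left distrib_right)
qed (simp add: left_factor_simps distrib_left distrib_right)

lemma factors_commute_left: "right_factor y * (left_factor x * z) = left_factor x * (right_factor y * z)"
  by (simp only: mult.assoc[symmetric] factors_commute)

definition comult_gen :: "('i::finite \<Rightarrow> 'i \<Rightarrow> int) \<Rightarrow> 'i gen \<Rightarrow> 'i gen list \<times> 'i gen list \<Rightarrow>\<^sub>0 kk" where
  "comult_gen a g = (case g of GT i \<Rightarrow> left_factor (gen (GT i)) * right_factor (gen (GT i))
     | GTinv i \<Rightarrow> left_factor (gen (GTinv i)) * right_factor (gen (GTinv i))
     | GE i \<Rightarrow> left_factor (gen (GE i)) + left_factor (gen_K a i) * right_factor (gen (GE i))
     | GF i \<Rightarrow> left_factor (gen (GF i)) * right_factor (gen_Kinv a i) + right_factor (gen (GF i)))"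

definition free_comult :: "('i::finite \<Rightarrow> 'i \<Rightarrow> int) \<Rightarrow> 'i falg \<Rightarrow> 'i gen list \<times> 'i gen list \<Rightarrow>\<^sub>0 kk" where
  "free_comult a = free_hom (\<lambda>c. c *\<^sub>k 1) (comult_gen a)"

lemma free_comult_simps:
  "free_comult a (x + y) = free_comult a x + free_comult a y"
  "free_comult a (x - y) = free_comult a x - free_comult a y"
  "free_comult a (x * y) = free_comult a x * free_comult a y"
  "free_comult a (c *\<^sub>k x) = c *\<^sub>k free_comult a x"
  "free_comult a 1 = 1" "free_comult a 0 = 0" "free_comult a (gen g) = comult_gen a g"
  "free_comult a (x ^ n) = free_comult a x ^ n"
  "free_comult a (prod_list (map h js)) = prod_list (map (\<lambda>j. free_comult a (h j)) js)"
  "free_comult a (qad \<delta> b E G m) = qad \<delta> b (free_comult a E) (free_comult a G) m"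
  unfolding free_comult_def
  by (simp_all add: single_embedding.free_hom_add single_embedding.free_hom_diff single_embedding.free_hom_mult
    single_embedding.free_hom_smul single_embedding.free_hom_1 single_embedding.free_hom_0 single_embedding.free_hom_gen
    single_embedding.free_hom_power single_embedding.free_hom_prod_list free_hom_qad)

lemma free_comult_tmon: "free_comult a (tmon n) = left_factor (tmon n) * right_factor (tmon n)"
proof -
  have pow: "free_comult a (gen g) ^ m = left_factor (gen g ^ m) * right_factor (gen g ^ m)"
    if "comult_gen a g = left_factor (gen g) * right_factor (gen g)" for g m
    by (induction m) (simp_all add: free_comult_simps that left_factor_simps(3,5) right_factor_simps(3,5) factors_commute_left mult.assoc)
  have "free_comult a (gen_T_power j m) = left_factor (gen_T_power j m) * right_factor (gen_T_power j m)" for j m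
    using pow[of "GT j"] pow[of "GTinv j"]
    by (simp add: gen_T_power_def free_comult_simps comult_gen_def)
  then have "free_comult a (prod_list (map (\<lambda>j. gen_T_power j (n j)) js))
     = left_factor (prod_list (map (\<lambda>j. gen_T_power j (n j)) js)) * right_factor (prod_list (map (\<lambda>j. gen_T_power j (n j)) js))" for js
    by (induction js) (simp_all add: free_comult_simps left_factor_simps(3,5) right_factor_simps(3,5) factors_commute_left mult.assoc)
  then show ?thesis by (simp add: tmon_def)
qed

section \<open>Tensor products of modules\<close>

context quantum_datum
begin

definition umodule :: "('i ualg, 'v) module \<Rightarrow> bool" where
  "umodule V \<longleftrightarrow> (\<forall>v\<in>carrier V. \<forall>v'\<in>carrier V. v \<oplus>\<^bsub>V\<^esub> v' \<in> carrier V) \<and>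
     (\<forall>x. \<forall>v\<in>carrier V. cls x \<odot>\<^bsub>V\<^esub> v \<in> carrier V) \<and>
     (\<forall>x. \<forall>v\<in>carrier V. \<forall>v'\<in>carrier V. cls x \<odot>\<^bsub>V\<^esub> (v \<oplus>\<^bsub>V\<^esub> v') = (cls x \<odot>\<^bsub>V\<^esub> v) \<oplus>\<^bsub>V\<^esub> (cls x \<odot>\<^bsub>V\<^esub> v')) \<and>
     (\<forall>x y. \<forall>v\<in>carrier V. cls (x + y) \<odot>\<^bsub>V\<^esub> v = (cls x \<odot>\<^bsub>V\<^esub> v) \<oplus>\<^bsub>V\<^esub> (cls y \<odot>\<^bsub>V\<^esub> v)) \<and>
     (\<forall>x y. \<forall>v\<in>carrier V. cls (x * y) \<odot>\<^bsub>V\<^esub> v = cls x \<odot>\<^bsub>V\<^esub> (cls y \<odot>\<^bsub>V\<^esub> v)) \<and>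
     (\<forall>v\<in>carrier V. cls 1 \<odot>\<^bsub>V\<^esub> v = v)"

lemma umoduleD:
  assumes "umodule V"
  shows "v \<in> carrier V \<Longrightarrow> v' \<in> carrier V \<Longrightarrow> v \<oplus>\<^bsub>V\<^esub> v' \<in> carrier V"
    "v \<in> carrier V \<Longrightarrow> cls x \<odot>\<^bsub>V\<^esub> v \<in> carrier V"
    "v \<in> carrier V \<Longrightarrow> v' \<in> carrier V \<Longrightarrow> cls x \<odot>\<^bsub>V\<^esub> (v \<oplus>\<^bsub>V\<^esub> v') = (cls x \<odot>\<^bsub>V\<^esub> v) \<oplus>\<^bsub>V\<^esub> (cls x \<odot>\<^bsub>V\<^esub> v')"
    "v \<in> carrier V \<Longrightarrow> cls (x + y) \<odot>\<^bsub>V\<^esub> v = (cls x \<odot>\<^bsub>V\<^esub> v) \<oplus>\<^bsub>V\<^esub> (cls y \<odot>\<^bsub>V\<^esub> v)"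
    "v \<in> carrier V \<Longrightarrow> cls (x * y) \<odot>\<^bsub>V\<^esub> v = cls x \<odot>\<^bsub>V\<^esub> (cls y \<odot>\<^bsub>V\<^esub> v)"
    "v \<in> carrier V \<Longrightarrow> cls 1 \<odot>\<^bsub>V\<^esub> v = v"
    "v \<in> carrier V \<Longrightarrow> scal c \<odot>\<^bsub>V\<^esub> v \<in> carrier V"
    "v \<in> carrier V \<Longrightarrow> cls x \<odot>\<^bsub>V\<^esub> (scal c \<odot>\<^bsub>V\<^esub> v) = scal c \<odot>\<^bsub>V\<^esub> (cls x \<odot>\<^bsub>V\<^esub> v)"
    "v \<in> carrier V \<Longrightarrow> cls (c *\<^sub>k x) \<odot>\<^bsub>V\<^esub> v = scal c \<odot>\<^bsub>V\<^esub> (cls x \<odot>\<^bsub>V\<^esub> v)"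
proof -
  note V = assms[unfolded umodule_def]
  show A: "v \<in> carrier V \<Longrightarrow> v' \<in> carrier V \<Longrightarrow> v \<oplus>\<^bsub>V\<^esub> v' \<in> carrier V"
    "v \<in> carrier V \<Longrightarrow> cls x \<odot>\<^bsub>V\<^esub> v \<in> carrier V"
    "v \<in> carrier V \<Longrightarrow> v' \<in> carrier V \<Longrightarrow> cls x \<odot>\<^bsub>V\<^esub> (v \<oplus>\<^bsub>V\<^esub> v') = (cls x \<odot>\<^bsub>V\<^esub> v) \<oplus>\<^bsub>V\<^esub> (cls x \<odot>\<^bsub>V\<^esub> v')"
    "v \<in> carrier V \<Longrightarrow> cls (x + y) \<odot>\<^bsub>V\<^esub> v = (cls x \<odot>\<^bsub>V\<^esub> v) \<oplus>\<^bsub>V\<^esub> (cls y \<odot>\<^bsub>V\<^esub> v)"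
    "v \<in> carrier V \<Longrightarrow> cls (x * y) \<odot>\<^bsub>V\<^esub> v = cls x \<odot>\<^bsub>V\<^esub> (cls y \<odot>\<^bsub>V\<^esub> v)"
    "v \<in> carrier V \<Longrightarrow> cls 1 \<odot>\<^bsub>V\<^esub> v = v" for v v' x y
    using V by simp_all
  show "v \<in> carrier V \<Longrightarrow> scal c \<odot>\<^bsub>V\<^esub> v \<in> carrier V"
    "v \<in> carrier V \<Longrightarrow> cls x \<odot>\<^bsub>V\<^esub> (scal c \<odot>\<^bsub>V\<^esub> v) = scal c \<odot>\<^bsub>V\<^esub> (cls x \<odot>\<^bsub>V\<^esub> v)"
    "v \<in> carrier V \<Longrightarrow> cls (c *\<^sub>k x) \<odot>\<^bsub>V\<^esub> v = scal c \<odot>\<^bsub>V\<^esub> (cls x \<odot>\<^bsub>V\<^esub> v)"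
    unfolding scal_eq by (simp_all add: A(2) flip: A(5))
qed

lemma umodule_presents: "presents V \<rho> K \<Longrightarrow> umodule V"
  unfolding umodule_def by (auto simp: presentsD distrib_left distrib_right mult.assoc)

lemma umodule_Ureg: "umodule Ureg" by (rule umodule_presents[OF presents_Ureg])
lemma umodule_L: "umodule (L l)" by (rule umodule_presents[OF presents_L])

lemma umodule_Fmod: "umodule Fmod"
proof -
  have ext: "\<And>g h. g \<oplus>\<^bsub>Fmod\<^esub> h \<in> extensional (carrier U)" "\<And>g u. u \<odot>\<^bsub>Fmod\<^esub> g \<in> extensional (carrier U)"
    by (simp_all add: Fmod_simps)
  show ?thesis
    unfolding umodule_def
    by (auto simp: Fmod_smult_closed Fmod_add_closed intro!: Fmod_eqI ext simp: Fmod_linear Fmod_smult_cls Fmod_add_cls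
        distrib_left mult.assoc)
qed

lemma formal_add: "P \<in> formal V W \<Longrightarrow> Q \<in> formal V W \<Longrightarrow> P + Q \<in> formal V W"
  using keys_add[of P Q] by (auto simp: formal_def)

lemma formal_minus: "P \<in> formal V W \<Longrightarrow> - P \<in> formal V W" by (simp add: formal_def)

lemma formal_diff: "P \<in> formal V W \<Longrightarrow> Q \<in> formal V W \<Longrightarrow> P - Q \<in> formal V W"
  using formal_add[of P V W "- Q"] formal_minus[of Q V W] by simp

lemma formal_zero: "0 \<in> formal V W" by (simp add: formal_def)

lemma formal_single: "v \<in> carrier V \<Longrightarrow> w \<in> carrier W \<Longrightarrow> Poly_Mapping.single (v, w) c \<in> formal V W"
  by (simp add: formal_def)

lemma formal_induct [consumes 1, case_names zero single add]:
  assumes "P \<in> formal V W" "R 0" "\<And>v w c. v \<in> carrier V \<Longrightarrow> w \<in> carrier W \<Longrightarrow> R (Poly_Mapping.single (v, w) c)"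
    and "\<And>P Q. P \<in> formal V W \<Longrightarrow> Q \<in> formal V W \<Longrightarrow> R P \<Longrightarrow> R Q \<Longrightarrow> R (P + Q)"
  shows "R P"
  by (rule poly_mapping_span_induct[of P "carrier V \<times> carrier W" R]) (use assms in \<open>auto simp: formal_def\<close>)

lemma formal_act_add_left: "formal_act V W (P + P') Q = formal_act V W P Q + formal_act V W P' Q"
proof -
  have "formal_act V W P Q = (\<Sum>k\<in>Poly_Mapping.keys P. (\<lambda>(x, y) b. \<Sum>(v, w)\<in>Poly_Mapping.keys Q.
       Poly_Mapping.single (x \<odot>\<^bsub>V\<^esub> v, y \<odot>\<^bsub>W\<^esub> w) (b * Poly_Mapping.lookup Q (v, w))) k (Poly_Mapping.lookup P k))" for P
    unfolding formal_act_def by (intro sum.cong) auto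
  then show ?thesis
    by (simp only:) (rule setsum_keys_plus_distrib, auto simp: distrib_right single_add sum.distrib split_beta)
qed

lemma formal_act_add_right: "formal_act V W P (Q + Q') = formal_act V W P Q + formal_act V W P Q'"
proof -
  define h where "h z k b = Poly_Mapping.single (fst z \<odot>\<^bsub>V\<^esub> fst k, snd z \<odot>\<^bsub>W\<^esub> snd k) (Poly_Mapping.lookup P z * b)" for z k b
  have "formal_act V W P Q = (\<Sum>z\<in>Poly_Mapping.keys P. \<Sum>k\<in>Poly_Mapping.keys Q. h z k (Poly_Mapping.lookup Q k))" for Q
    by (simp add: formal_act_def h_def case_prod_unfold)
  moreover have "(\<Sum>k\<in>Poly_Mapping.keys (Q + Q'). h z k (Poly_Mapping.lookup (Q + Q') k))
     = (\<Sum>k\<in>Poly_Mapping.keys Q. h z k (Poly_Mapping.lookup Q k)) + (\<Sum>k\<in>Poly_Mapping.keys Q'. h z k (Poly_Mapping.lookup Q' k))" for z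
    by (rule setsum_keys_plus_distrib) (auto simp: h_def distrib_left single_add)
  ultimately show ?thesis by (simp only: sum.distrib)
qed

lemma formal_act_zero [simp]: "formal_act V W 0 Q = 0" "formal_act V W P 0 = 0"
  by (simp_all add: formal_act_def)

lemma formal_act_minus_left: "formal_act V W (- P) Q = - formal_act V W P Q"
  using formal_act_add_left[of V W P "- P" Q] by (simp add: eq_neg_iff_add_eq_0 add.commute)
lemma formal_act_minus_right: "formal_act V W P (- Q) = - formal_act V W P Q"
  using formal_act_add_right[of V W P Q "- Q"] by (simp add: eq_neg_iff_add_eq_0 add.commute)
lemma formal_act_diff_left: "formal_act V W (P - P') Q = formal_act V W P Q - formal_act V W P' Q"
  using formal_act_add_left[of V W P "- P'" Q] by (simp add: formal_act_minus_left)
lemma formal_act_diff_right: "formal_act V W P (Q - Q') = formal_act V W P Q - formal_act V W P Q'"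
  using formal_act_add_right[of V W P Q "- Q'"] by (simp add: formal_act_minus_right)

lemma formal_act_single:
  "formal_act V W (Poly_Mapping.single (x, y) c) (Poly_Mapping.single (v, w) b)
     = Poly_Mapping.single (x \<odot>\<^bsub>V\<^esub> v, y \<odot>\<^bsub>W\<^esub> w) (c * b)"
  by (cases "c = 0"; cases "b = 0") (simp_all add: formal_act_def)

lemma bilinear_rels_minus: "P \<in> bilinear_rels V W \<Longrightarrow> - P \<in> bilinear_rels V W"
proof (induction rule: bilinear_rels.induct)
  case (add_left v v' w c)
  from bilinear_rels.add_left[OF this, of "- c"] show ?case by (simp add: single_uminus algebra_simps)
next
  case (add_right v w w' c)
  from bilinear_rels.add_right[OF this, of "- c"] show ?case by (simp add: single_uminus algebra_simps)
next
  case (scale_left v w b c)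
  from bilinear_rels.scale_left[OF this, of b "- c"] show ?case by (simp add: single_uminus algebra_simps)
next
  case (scale_right v w b c)
  from bilinear_rels.scale_right[OF this, of b "- c"] show ?case by (simp add: single_uminus algebra_simps)
next
  case (add P Q)
  then have "- P + - Q \<in> bilinear_rels V W" by (intro bilinear_rels.add)
  then show ?case by (simp add: add.commute)
qed (simp add: bilinear_rels.zero)

lemma bilinear_rels_diff: "P \<in> bilinear_rels V W \<Longrightarrow> Q \<in> bilinear_rels V W \<Longrightarrow> P - Q \<in> bilinear_rels V W"
  using bilinear_rels.add[of P V W "- Q"] bilinear_rels_minus[of Q V W] by simp

lemma bilinear_rels_formal:
  assumes "umodule V" "umodule W"
  shows "P \<in> bilinear_rels V W \<Longrightarrow> P \<in> formal V W"
  by (induction rule: bilinear_rels.induct)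
    (use assms in \<open>auto intro!: formal_add formal_diff formal_zero formal_single umoduleD\<close>)

lemma formal_act_closed:
  assumes V: "umodule V" and W: "umodule W" and "P \<in> formal Ureg Ureg" "Q \<in> formal V W"
  shows "formal_act V W P Q \<in> formal V W"
  using assms(3)
proof (induction rule: formal_induct)
  case (single x y c)
  then obtain x' y' where xy: "x = cls x'" "y = cls y'" by (auto elim!: carrier_UE)
  from assms(4) show ?case
  proof (induction rule: formal_induct)
    case (single v w b)
    then show ?case unfolding formal_act_single xy by (intro formal_single umoduleD(2)[OF V] umoduleD(2)[OF W])
  qed (simp_all add: formal_zero formal_add formal_act_add_right)
qed (simp_all add: formal_zero formal_add formal_act_add_left)

lemma formal_act_rels_right:
  assumes V: "umodule V" and W: "umodule W" and P: "P \<in> formal Ureg Ureg" and Q: "Q \<in> bilinear_rels V W"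
  shows "formal_act V W P Q \<in> bilinear_rels V W"
  using P
proof (induction rule: formal_induct)
  case (single x y c)
  then obtain x' y' where xy: "x = cls x'" "y = cls y'" by (auto elim!: carrier_UE)
  note VD = umoduleD[OF V] and WD = umoduleD[OF W]
  from Q show ?case
  proof (induction rule: bilinear_rels.induct)
    case (add_left v v' w b)
    then show ?case unfolding formal_act_diff_right formal_act_single xy VD(3)[OF add_left(1,2)]
      by (intro bilinear_rels.add_left VD WD)
  next
    case (add_right v w w' b)
    then show ?case unfolding formal_act_diff_right formal_act_single xy WD(3)[OF add_right(2,3)]
      by (intro bilinear_rels.add_right VD WD)
  next
    case (scale_left v w b b')
    then show ?case unfolding formal_act_diff_right formal_act_single xy VD(8)[OF scale_left(1)] mult.assoc[symmetric]
      by (intro bilinear_rels.scale_left VD WD)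
  next
    case (scale_right v w b b')
    then show ?case unfolding formal_act_diff_right formal_act_single xy WD(8)[OF scale_right(2)] mult.assoc[symmetric]
      by (intro bilinear_rels.scale_right VD WD)
  qed (simp_all add: bilinear_rels.zero bilinear_rels.add formal_act_add_right)
qed (simp_all add: bilinear_rels.zero bilinear_rels.add formal_act_add_left)

lemma formal_act_rels_left:
  assumes V: "umodule V" and W: "umodule W" and P: "P \<in> bilinear_rels Ureg Ureg" and Q: "Q \<in> formal V W"
  shows "formal_act V W P Q \<in> bilinear_rels V W"
  using Q
proof (induction rule: formal_induct)
  case (single v w c)
  note VD = umoduleD[OF V] and WD = umoduleD[OF W]
  from P show ?case
  proof (induction rule: bilinear_rels.induct)
    case (add_left x x' y b)
    then obtain u u' z where xy: "x = cls u" "x' = cls u'" "y = cls z" by (auto elim!: carrier_UE)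
    show ?case
      using single unfolding formal_act_diff_left formal_act_single xy Ureg_simps cls_add[symmetric] VD(4)[OF single(1)]
      by (intro bilinear_rels.add_left VD WD)
  next
    case (add_right x y y' b)
    then obtain u z z' where xy: "x = cls u" "y = cls z" "y' = cls z'" by (auto elim!: carrier_UE)
    show ?case
      using single unfolding formal_act_diff_left formal_act_single xy Ureg_simps cls_add[symmetric] WD(4)[OF single(2)]
      by (intro bilinear_rels.add_right VD WD)
  next
    case (scale_left x y b b')
    then obtain u z where xy: "x = cls u" "y = cls z" by (auto elim!: carrier_UE)
    have m: "b' * b * c = b' * c * b" by simp
    show ?case
      using single unfolding formal_act_diff_left formal_act_single xy Ureg_simps cls_smul[symmetric] VD(9)[OF single(1)] m
      by (intro bilinear_rels.scale_left VD WD)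
  next
    case (scale_right x y b b')
    then obtain u z where xy: "x = cls u" "y = cls z" by (auto elim!: carrier_UE)
    have m: "b' * b * c = b' * c * b" by simp
    show ?case
      using single unfolding formal_act_diff_left formal_act_single xy Ureg_simps cls_smul[symmetric] WD(9)[OF single(2)] m
      by (intro bilinear_rels.scale_right VD WD)
  qed (simp_all add: bilinear_rels.zero bilinear_rels.add formal_act_add_left)
qed (simp_all add: bilinear_rels.zero bilinear_rels.add formal_act_add_right)

lemma tcls_eq_iff: "tcls V W P = tcls V W Q \<longleftrightarrow> P - Q \<in> bilinear_rels V W"
proof
  assume "tcls V W P = tcls V W Q"
  moreover have "P \<in> tcls V W P" unfolding tcls_def using bilinear_rels.zero by (intro image_eqI[of _ _ 0]) auto
  ultimately obtain r where "r \<in> bilinear_rels V W" "P = Q + r" by (auto simp: tcls_def)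
  then show "P - Q \<in> bilinear_rels V W" by simp
next
  have sub: "tcls V W P \<subseteq> tcls V W Q" if "P - Q \<in> bilinear_rels V W" for P Q
  proof
    fix R assume "R \<in> tcls V W P"
    then obtain r where r: "r \<in> bilinear_rels V W" "R = P + r" by (auto simp: tcls_def)
    have "R = Q + ((P - Q) + r)" by (simp add: r(2))
    then show "R \<in> tcls V W Q" unfolding tcls_def using bilinear_rels.add[OF that r(1)] by blast
  qed
  assume PQ: "P - Q \<in> bilinear_rels V W"
  from bilinear_rels_minus[OF PQ] have "Q - P \<in> bilinear_rels V W" by simp
  then show "tcls V W P = tcls V W Q" using sub PQ by blast
qed

lemma tcls_self: "P \<in> tcls V W P"
  unfolding tcls_def using bilinear_rels.zero by (intro image_eqI[of _ _ 0]) auto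

lemma tclsE: assumes "Q \<in> tcls V W P" obtains r where "r \<in> bilinear_rels V W" "Q = P + r"
  using assms by (auto simp: tcls_def)

lemma UN_const: "(\<And>x. x \<in> S \<Longrightarrow> g x = c) \<Longrightarrow> x0 \<in> S \<Longrightarrow> (\<Union>x\<in>S. g x) = c"
  by blast

lemma tensor_add_tcls: "tensor_add V W (tcls V W P) (tcls V W Q) = tcls V W (P + Q)"
  unfolding tensor_add_def
proof (rule UN_const[OF _ tcls_self], rule UN_const[OF _ tcls_self])
  fix P' Q' assume "P' \<in> tcls V W P" "Q' \<in> tcls V W Q"
  then obtain r s where "r \<in> bilinear_rels V W" "s \<in> bilinear_rels V W" "P' = P + r" "Q' = Q + s"
    by (auto elim!: tclsE)
  then show "tcls V W (P' + Q') = tcls V W (P + Q)"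
    unfolding tcls_eq_iff using bilinear_rels.add[of r V W s] by simp
qed

lemma tensor_act_tcls:
  assumes V: "umodule V" and W: "umodule W" and P: "P \<in> formal Ureg Ureg" and Q: "Q \<in> formal V W"
  shows "tensor_act V W (tcls Ureg Ureg P) (tcls V W Q) = tcls V W (formal_act V W P Q)"
  unfolding tensor_act_def
proof (rule UN_const[OF _ tcls_self], rule UN_const[OF _ tcls_self])
  fix P' Q' assume "P' \<in> tcls Ureg Ureg P" "Q' \<in> tcls V W Q"
  then obtain r s where rs: "r \<in> bilinear_rels Ureg Ureg" "s \<in> bilinear_rels V W" "P' = P + r" "Q' = Q + s"
    by (auto elim!: tclsE)
  have "formal_act V W P' Q' - formal_act V W P Q = formal_act V W P s + (formal_act V W r Q + formal_act V W r s)"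
    by (simp add: rs formal_act_add_left formal_act_add_right)
  also have "\<dots> \<in> bilinear_rels V W"
    using bilinear_rels_formal[OF V W rs(2)]
    by (intro bilinear_rels.add formal_act_rels_left[OF V W] formal_act_rels_right[OF V W] P Q rs)
  finally show "tcls V W (formal_act V W P' Q') = tcls V W (formal_act V W P Q)" by (simp add: tcls_eq_iff)
qed

lemma bilinear_rels_eq_tcls: "bilinear_rels V W = tcls V W 0" by (auto simp: tcls_def)

end

section \<open>Existence of the comultiplication\<close>

context quantum_datum
begin

text \<open>Compares formal tensors with the algebra on pairs of words, where the calculus of
  two-sided ideals and q-commutators is available.\<close>

definition push :: "('i gen list \<times> 'i gen list \<Rightarrow>\<^sub>0 kk) \<Rightarrow> ('i ualg \<times> 'i ualg \<Rightarrow>\<^sub>0 kk)" where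
  "push Z = (\<Sum>w\<in>Poly_Mapping.keys Z. Poly_Mapping.single (cls (word (fst w)), cls (word (snd w))) (Poly_Mapping.lookup Z w))"

lemma push_add: "push (Y + Z) = push Y + push Z"
  unfolding push_def
  by (rule setsum_keys_plus_distrib[where f = "\<lambda>w c. Poly_Mapping.single (cls (word (fst w)), cls (word (snd w))) c"])
    (simp_all add: single_add)

lemma push_single: "push (Poly_Mapping.single w c) = Poly_Mapping.single (cls (word (fst w)), cls (word (snd w))) c"
  by (cases "c = 0") (simp_all add: push_def)

lemma push_0 [simp]: "push 0 = 0" by (simp add: push_def)
lemma push_minus: "push (- Z) = - push Z"
  using push_add[of Z "- Z"] by (simp add: eq_neg_iff_add_eq_0 add.commute)
lemma push_diff: "push (Y - Z) = push Y - push Z"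
  using push_add[of Y "- Z"] by (simp add: push_minus)

lemma push_formal: "push Z \<in> formal Ureg Ureg"
  by (induction Z rule: poly_mapping_additive_induct) (simp_all add: push_single push_add formal_add formal_single)

lemma formal_act_push: "formal_act Ureg Ureg (push Y) (push Z) = push (Y * Z)"
proof (induction Y rule: poly_mapping_additive_induct)
  case (single m c)
  show ?case
    by (induction Z rule: poly_mapping_additive_induct)
      (simp_all add: push_single push_add formal_act_single formal_act_add_right mult_single distrib_left
        plus_list_def word_append cls_mult)
qed (simp add: push_add formal_act_add_left distrib_right)

definition rels2 :: "('i gen list \<times> 'i gen list \<Rightarrow>\<^sub>0 kk) set" where
  "rels2 = {Z. push Z \<in> bilinear_rels Ureg Ureg}"

lemma rels2_ideal: "two_sided_ideal rels2"
  by standard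
    (simp_all add: rels2_def bilinear_rels.zero bilinear_rels.add push_add push_formal
      formal_act_rels_left[OF umodule_Ureg umodule_Ureg] formal_act_rels_right[OF umodule_Ureg umodule_Ureg]
      flip: formal_act_push)

interpretation R2: two_sided_ideal rels2 by (rule rels2_ideal)

definition tens_proj :: "('i gen list \<times> 'i gen list \<Rightarrow>\<^sub>0 kk) \<Rightarrow> ('i ualg, 'i ualg) tens" where
  "tens_proj Z = tcls Ureg Ureg (push Z)"

lemma UU_simps:
  "carrier UU = tcls Ureg Ureg ` formal Ureg Ureg" "\<one>\<^bsub>UU\<^esub> = tensU \<one>\<^bsub>U\<^esub> \<one>\<^bsub>U\<^esub>"
  "x \<oplus>\<^bsub>UU\<^esub> y = tensor_add Ureg Ureg x y" "x \<otimes>\<^bsub>UU\<^esub> y = tensor_act Ureg Ureg x y"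
  by (simp_all add: UU_def)

lemma tens_proj_closed: "tens_proj Z \<in> carrier UU" by (simp add: tens_proj_def UU_simps push_formal)
lemma tens_proj_add: "tens_proj (Y + Z) = tens_proj Y \<oplus>\<^bsub>UU\<^esub> tens_proj Z"
  by (simp add: tens_proj_def UU_simps tensor_add_tcls push_add)
lemma tens_proj_mult: "tens_proj (Y * Z) = tens_proj Y \<otimes>\<^bsub>UU\<^esub> tens_proj Z"
  by (simp add: tens_proj_def UU_simps tensor_act_tcls[OF umodule_Ureg umodule_Ureg] push_formal formal_act_push)
lemma tens_proj_eq_iff: "tens_proj Y = tens_proj Z \<longleftrightarrow> R2.cong Y Z"
  unfolding R2.cong_def by (simp add: tens_proj_def tcls_eq_iff rels2_def push_diff)

text \<open>A pair of classes of arbitrary elements is not literally in the image of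
  \<open>push\<close>, whose pairs come from single words; bilinearity makes up the
  difference.\<close>

lemma push_factors: "push (c *\<^sub>k (left_factor x * right_factor y)) - Poly_Mapping.single (cls x, cls y) c \<in> bilinear_rels Ureg Ureg"
proof (induction x rule: free_algebra_induct)
  case (word b u)
  show ?case
  proof (induction y rule: free_algebra_induct)
    case (word b' v)
    have "push (c *\<^sub>k (left_factor (b *\<^sub>k word u) * right_factor (b' *\<^sub>k word v)))
       = Poly_Mapping.single (cls (word u), cls (word v)) (c * b' * b)"
      by (simp add: left_factor_simps right_factor_simps factors_word smul_single push_single ac_simps)
    moreover have "Poly_Mapping.single (scal b \<otimes>\<^bsub>U\<^esub> cls (word u), scal b' \<otimes>\<^bsub>U\<^esub> cls (word v)) c
       - Poly_Mapping.single (scal b \<otimes>\<^bsub>U\<^esub> cls (word u), cls (word v)) (c * b') \<in> bilinear_rels Ureg Ureg"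
      using bilinear_rels.scale_right[of "scal b \<otimes>\<^bsub>U\<^esub> cls (word u)" Ureg "cls (word v)" Ureg b' c] by simp
    moreover have "Poly_Mapping.single (scal b \<otimes>\<^bsub>U\<^esub> cls (word u), cls (word v)) (c * b')
       - Poly_Mapping.single (cls (word u), cls (word v)) (c * b' * b) \<in> bilinear_rels Ureg Ureg"
      using bilinear_rels.scale_left[of "cls (word u)" Ureg "cls (word v)" Ureg b "c * b'"] by simp
    ultimately show ?case
      using bilinear_rels_minus[OF bilinear_rels.add] unfolding cls_smul by fastforce
  next
    case (add y y')
    have 1: "Poly_Mapping.single (cls (b *\<^sub>k word u), cls y \<oplus>\<^bsub>U\<^esub> cls y') c - Poly_Mapping.single (cls (b *\<^sub>k word u), cls y) c
       - Poly_Mapping.single (cls (b *\<^sub>k word u), cls y') c \<in> bilinear_rels Ureg Ureg"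
      using bilinear_rels.add_right[of "cls (b *\<^sub>k word u)" Ureg "cls y" Ureg "cls y'" c] by simp
    from bilinear_rels_diff[OF bilinear_rels.add[OF add] 1] show ?case
      by (simp only: right_factor_simps distrib_left smul_add_right push_add cls_add) (simp add: algebra_simps)
  qed
next
  case (add x x')
  have 1: "Poly_Mapping.single (cls x \<oplus>\<^bsub>U\<^esub> cls x', cls y) c - Poly_Mapping.single (cls x, cls y) c
     - Poly_Mapping.single (cls x', cls y) c \<in> bilinear_rels Ureg Ureg"
    using bilinear_rels.add_left[of "cls x" Ureg "cls x'" "cls y" Ureg c] by simp
  from bilinear_rels_diff[OF bilinear_rels.add[OF add] 1] show ?case
    by (simp only: left_factor_simps distrib_right smul_add_right push_add cls_add) (simp add: algebra_simps)
qed

lemma tensU_eq: "tensU (cls x) (cls y) = tens_proj (left_factor x * right_factor y)"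
  using bilinear_rels_minus[OF push_factors[of 1 x y]]
  by (simp add: pure_tensor_def tens_proj_def tcls_eq_iff)

lemma tens_proj_1: "tens_proj 1 = \<one>\<^bsub>UU\<^esub>"
  using tensU_eq[of 1 1] by (simp add: UU_simps cls_1 left_factor_simps right_factor_simps)

lemma tens_proj_surj: assumes "z \<in> carrier UU" obtains Z where "z = tens_proj Z"
proof -
  obtain P where P: "P \<in> formal Ureg Ureg" "z = tcls Ureg Ureg P" using assms by (auto simp: UU_simps)
  from P(1) have "\<exists>Z. push Z - P \<in> bilinear_rels Ureg Ureg"
  proof (induction rule: formal_induct)
    case zero
    show ?case by (intro exI[of _ 0]) (simp add: bilinear_rels.zero)
  next
    case (single v w c)
    then show ?case using push_factors by (auto elim!: carrier_UE)
  next
    case (add P Q)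
    then obtain Y Z where "push Y - P \<in> bilinear_rels Ureg Ureg" "push Z - Q \<in> bilinear_rels Ureg Ureg" by blast
    from bilinear_rels.add[OF this] show ?case by (intro exI[of _ "Y + Z"]) (simp add: push_add algebra_simps)
  qed
  then obtain Z where "push Z - P \<in> bilinear_rels Ureg Ureg" by blast
  then have "z = tens_proj Z" using P(2) by (simp add: tens_proj_def) (metis tcls_eq_iff)
  then show ?thesis by (rule that)
qed

text \<open>Associativity is inherited along the surjection \<open>tens_proj\<close>. The monoid
  laws are what \<open>alg_hom_unique\<close> asks of the target.\<close>

lemma monoid_UU: "Group.monoid UU"
  by (rule monoidI)
    (auto elim!: tens_proj_surj simp: mult.assoc tens_proj_closed simp flip: tens_proj_mult tens_proj_1)

lemma left_factor_cong: "x \<doteq> y \<Longrightarrow> R2.cong (left_factor x) (left_factor y)"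
  and right_factor_cong: "x \<doteq> y \<Longrightarrow> R2.cong (right_factor x) (right_factor y)"
proof -
  assume "x \<doteq> y"
  then have "cls x = cls y" by (simp add: cls_eq_iff)
  then have "tens_proj (left_factor x * right_factor 1) = tens_proj (left_factor y * right_factor 1)"
    "tens_proj (left_factor 1 * right_factor x) = tens_proj (left_factor 1 * right_factor y)"
    unfolding tensU_eq[symmetric] by simp_all
  then show "R2.cong (left_factor x) (left_factor y)" "R2.cong (right_factor x) (right_factor y)"
    by (simp_all add: tens_proj_eq_iff left_factor_simps right_factor_simps)
qed

lemma left_factor_qcommute: "I.qcommute s x y \<Longrightarrow> R2.qcommute s (left_factor x) (left_factor y)"
  and right_factor_qcommute: "I.qcommute s x y \<Longrightarrow> R2.qcommute s (right_factor x) (right_factor y)"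
  unfolding I.qcommute_def R2.qcommute_def
  by (drule left_factor_cong, simp add: left_factor_simps) (drule right_factor_cong, simp add: right_factor_simps)

lemma factors_qcommute: "R2.qcommute 0 (left_factor x) (right_factor y)" "R2.qcommute 0 (right_factor y) (left_factor x)"
  by (simp_all add: R2.qcommute_def factors_commute)

lemma free_comult_T_conj:
  assumes "R2.qcommute s (left_factor (gen (GT i)) * right_factor (gen (GT i))) z"
  shows "R2.cong (comult_gen a (GT i) * z * comult_gen a (GTinv i)) (qpow s *\<^sub>k z)"
proof -
  let ?t = "left_factor (gen (GT i)) * right_factor (gen (GT i))" and ?t' = "left_factor (gen (GTinv i)) * right_factor (gen (GTinv i))"
  have "?t * ?t' = left_factor (gen (GT i) * gen (GTinv i)) * right_factor (gen (GT i) * gen (GTinv i))"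
    by (simp add: left_factor_simps right_factor_simps mult.assoc factors_commute_left)
  also have "R2.cong \<dots> (left_factor 1 * right_factor 1)"
    by (intro R2.cong_mult left_factor_cong right_factor_cong I.T_inv)
  finally have inv: "R2.cong (?t * ?t') 1" by (simp add: left_factor_simps right_factor_simps)
  have "R2.cong (?t * z * ?t') ((qpow s *\<^sub>k (z * ?t)) * ?t')"
    using assms by (intro R2.cong_mult_right) (simp add: R2.qcommute_def)
  also have "\<dots> = qpow s *\<^sub>k (z * (?t * ?t'))" by (simp add: mult.assoc)
  also have "R2.cong \<dots> (qpow s *\<^sub>k (z * 1))" by (intro R2.cong_smul R2.cong_mult_left inv)
  finally show ?thesis by (simp add: comult_gen_def)
qed

lemma free_comult_relator:
  assumes "r \<in> relators" shows "free_comult a r \<in> rels2"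
  using assms
proof (cases rule: relator_cases)
  case (TT' i)
  have "R2.cong (left_factor (gen (GT i) * gen (GTinv i)) * right_factor (gen (GT i) * gen (GTinv i))) (left_factor 1 * right_factor 1)"
    by (intro R2.cong_mult left_factor_cong right_factor_cong I.T_inv)
  with TT' show ?thesis
    by (simp add: R2.cong_def free_comult_simps comult_gen_def left_factor_simps right_factor_simps mult.assoc factors_commute_left)
next
  case (T'T i)
  have "R2.cong (left_factor (gen (GTinv i) * gen (GT i)) * right_factor (gen (GTinv i) * gen (GT i))) (left_factor 1 * right_factor 1)"
    by (intro R2.cong_mult left_factor_cong right_factor_cong I.T_inv)
  with T'T show ?thesis
    by (simp add: R2.cong_def free_comult_simps comult_gen_def left_factor_simps right_factor_simps mult.assoc factors_commute_left)
next
  case (TT i j)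
  have "R2.cong (left_factor (gen (GT i) * gen (GT j)) * right_factor (gen (GT i) * gen (GT j)))
     (left_factor (gen (GT j) * gen (GT i)) * right_factor (gen (GT j) * gen (GT i)))"
    by (intro R2.cong_mult left_factor_cong right_factor_cong I.T_comm)
  with TT show ?thesis
    by (simp add: R2.cong_def free_comult_simps comult_gen_def left_factor_simps right_factor_simps mult.assoc factors_commute_left)
next
  case (TE i j)
  define s where "s = (if i = j then d i else 0)"
  let ?t1 = "left_factor (gen (GT i))" and ?t2 = "right_factor (gen (GT i))"
  have E: "I.qcommute s (gen (GT i)) (gen (GE j))" unfolding s_def by (rule I.T_E)
  have "R2.qcommute (s + 0) (?t1 * ?t2) (left_factor (gen (GE j)))"
    by (intro R2.qcommute_mult_left left_factor_qcommute E factors_qcommute)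
  moreover have "R2.qcommute ((0 + 0) + (0 + s)) (?t1 * ?t2) (left_factor (gen_K a j) * right_factor (gen (GE j)))"
    unfolding gen_K_eq
    by (intro R2.qcommute_mult_right R2.qcommute_mult_left left_factor_qcommute right_factor_qcommute T_tmon_commute E factors_qcommute)
  ultimately have "R2.qcommute s (?t1 * ?t2) (comult_gen a (GE j))"
    using R2.qcommute_add_right by (simp add: comult_gen_def)
  from free_comult_T_conj[OF this] show ?thesis
    unfolding TE s_def[symmetric] by (simp add: R2.cong_def free_comult_simps)
next
  case (TF i j)
  define s where "s = - (if i = j then d i else 0)"
  let ?t1 = "left_factor (gen (GT i))" and ?t2 = "right_factor (gen (GT i))"
  have F: "I.qcommute s (gen (GT i)) (gen (GF j))" unfolding s_def by (rule I.T_F)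
  have "R2.qcommute (0 + s) (?t1 * ?t2) (right_factor (gen (GF j)))"
    by (intro R2.qcommute_mult_left right_factor_qcommute F factors_qcommute)
  moreover have "R2.qcommute ((s + 0) + (0 + 0)) (?t1 * ?t2) (left_factor (gen (GF j)) * right_factor (gen_Kinv a j))"
    unfolding gen_K_eq
    by (intro R2.qcommute_mult_right R2.qcommute_mult_left left_factor_qcommute right_factor_qcommute T_tmon_commute F factors_qcommute)
  ultimately have "R2.qcommute s (?t1 * ?t2) (comult_gen a (GF j))"
    using R2.qcommute_add_right by (simp add: comult_gen_def)
  from free_comult_T_conj[OF this] show ?thesis
    unfolding TF s_def[symmetric] by (simp add: R2.cong_def free_comult_simps)
next
  case (EF i j)
  let ?b = "d i * of_int (a i j)"
  define H where "H = (if i = j then I.EF_coeff i *\<^sub>k (gen_K a i - gen_Kinv a i) else 0)"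
  let ?l = left_factor and ?r = right_factor
  let ?E = "gen (GE i)" and ?F = "gen (GF j)" and ?K = "gen_K a i" and ?K' = "gen_Kinv a j"
  have 1: "R2.cong (?l (?E * ?F - ?F * ?E) * ?r ?K') (?l H * ?r ?K')"
    unfolding H_def by (intro R2.cong_mult_right left_factor_cong I.E_F)
  have 2: "R2.cong (?l ?K * ?r (?E * ?F - ?F * ?E)) (?l ?K * ?r H)"
    unfolding H_def by (intro R2.cong_mult_left right_factor_cong I.E_F)
  have KF: "?K * ?F \<doteq> qpow (- ?b) *\<^sub>k (?F * ?K)" using I.K_F[of i j] by (simp add: I.qcommute_def)
  have KE: "?K' * ?E \<doteq> qpow (- ?b) *\<^sub>k (?E * ?K')"
    using I.Kinv_E[of j i] by (simp add: I.qcommute_def symmetrized[of i j])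
  \<comment> \<open>The cross terms are exchanged by one commutation in each factor; both produce
    the same power of q, by the symmetry of d_i a_ij, and so they cancel.\<close>
  have "R2.cong (?l (?K * ?F) * ?r (?E * ?K')) (?l (qpow (- ?b) *\<^sub>k (?F * ?K)) * ?r (?E * ?K'))"
    by (intro R2.cong_mult_right left_factor_cong KF)
  also have "\<dots> = ?l (?F * ?K) * ?r (qpow (- ?b) *\<^sub>k (?E * ?K'))"
    by (simp add: left_factor_simps right_factor_simps)
  also have "R2.cong \<dots> (?l (?F * ?K) * ?r (?K' * ?E))"
    by (intro R2.cong_mult_left right_factor_cong I.cong_sym[OF KE])
  finally have 3: "R2.cong (?l (?K * ?F) * ?r (?E * ?K') - ?l (?F * ?K) * ?r (?K' * ?E)) 0"
    by (simp add: R2.cong_def)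
  have "free_comult a (?E * ?F) - free_comult a (?F * ?E)
     = ?l (?E * ?F - ?F * ?E) * ?r ?K' + ?l ?K * ?r (?E * ?F - ?F * ?E)
       + (?l (?K * ?F) * ?r (?E * ?K') - ?l (?F * ?K) * ?r (?K' * ?E))"
    by (simp add: free_comult_simps comult_gen_def left_factor_simps right_factor_simps algebra_simps
        factors_commute factors_commute_left)
  also have "R2.cong \<dots> (?l H * ?r ?K' + ?l ?K * ?r H + 0)"
    by (intro R2.cong_add 1 2 3)
  \<comment> \<open>In H \<otimes> k_i^{-1} + k_i \<otimes> H the mixed terms k_i \<otimes> k_i^{-1}
    cancel.\<close>
  also have "\<dots> = free_comult a H"
  proof (cases "i = j")
    case True
    have "free_comult a H = I.EF_coeff i *\<^sub>k (?l (gen_K a i) * ?r (gen_K a i) - ?l (gen_Kinv a i) * ?r (gen_Kinv a i))"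
      using True unfolding H_def gen_K_eq by (simp add: free_comult_simps free_comult_tmon)
    then show ?thesis
      using True by (simp add: H_def left_factor_simps right_factor_simps smul_diff_right algebra_simps)
  qed (simp add: H_def free_comult_simps left_factor_simps right_factor_simps)
  finally show ?thesis
    unfolding EF H_def[symmetric] by (simp add: R2.cong_def free_comult_simps)
next
  case (SE i j)
  let ?N = "serre_exponent i j"
  let ?l = left_factor and ?r = right_factor
  have mem: "qad (d i) (a i j) (gen (GE i)) (gen (GE j)) ?N \<in> relator_ideal" (is "?x \<in> _")
    using qad_eq_serre[OF SE(1), of GE] serre_mem(1)[OF SE(1)] I.smul_mem by auto
  have KE: "R2.qcommute (d i * of_int (a i k) + 0) (?l (gen_K a i) * ?r (gen (GE i))) (?l (gen (GE k)))" for i k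
    by (intro R2.qcommute_mult_left left_factor_qcommute I.K_E factors_qcommute)
  \<comment> \<open>With p = e_i \<otimes> 1 and y = k_i \<otimes> e_i the Serre polynomial is
    additive. The first part is a Serre element in the left factor, the second one in the right
    factor up to powers of k.\<close>
  have sum: "R2.cong (qad (d i) (a i j) (?l (gen (GE i)) + ?l (gen_K a i) * ?r (gen (GE i)))
      (?l (gen (GE j)) + ?l (gen_K a j) * ?r (gen (GE j))) ?N)
      (qad (d i) (a i j) (?l (gen (GE i))) (?l (gen (GE j))) ?N
       + qad (d i) (a i j) (?l (gen_K a i) * ?r (gen (GE i))) (?l (gen_K a j) * ?r (gen (GE j))) ?N)"
    using KE[of i i] KE[of i j] KE[of j i] symmetrized[of i j] serre_exponent[OF SE(1)]
    by (intro R2.qad_sum) (simp_all add: mult.commute)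
  have "?x \<doteq> 0" using mem by (simp add: I.cong_0_iff)
  then have l: "?l ?x \<in> rels2" and r: "?r ?x \<in> rels2"
    using left_factor_cong[of ?x 0] right_factor_cong[of ?x 0]
    by (simp_all add: R2.cong_0_iff left_factor_simps(6) right_factor_simps(6))
  obtain s where s: "R2.cong (qad (d i) (a i j) (?l (gen_K a i) * ?r (gen (GE i))) (?l (gen_K a j) * ?r (gen (GE j))) ?N)
     (qpow s *\<^sub>k (?l (gen_K a i) ^ ?N * ?l (gen_K a j) * qad (d i) (a i j) (?r (gen (GE i))) (?r (gen (GE j))) ?N))"
    using R2.qad_scale[OF factors_qcommute(1) factors_qcommute(1) factors_qcommute(1) left_factor_qcommute[OF K_K_commute(1)]] by blast
  have "?l ?x + qpow s *\<^sub>k (?l (gen_K a i) ^ ?N * ?l (gen_K a j) * ?r ?x) \<in> rels2"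
    by (intro R2.add_mem l R2.smul_mem R2.mult_left_mem r)
  then have "qad (d i) (a i j) (?l (gen (GE i)) + ?l (gen_K a i) * ?r (gen (GE i)))
      (?l (gen (GE j)) + ?l (gen_K a j) * ?r (gen (GE j))) ?N \<in> rels2"
    using R2.cong_mem_iff[OF R2.cong_trans[OF sum R2.cong_add[OF R2.cong_refl s]]]
    by (simp add: left_factor_simps right_factor_simps)
  then show ?thesis
    unfolding SE serre_eq_qad[OF SE(1)] free_comult_simps comult_gen_def gen.case by (rule R2.smul_mem)
next
  case (SF i j)
  let ?N = "serre_exponent i j"
  let ?l = left_factor and ?r = right_factor
  have mem: "qad (d i) (a i j) (gen (GF i)) (gen (GF j)) ?N \<in> relator_ideal" (is "?x \<in> _")
    using qad_eq_serre[OF SF(1), of GF] serre_mem(2)[OF SF(1)] I.smul_mem by auto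
  have KF: "R2.qcommute (0 + d i * of_int (a i k)) (?l (gen (GF i)) * ?r (gen_Kinv a i)) (?r (gen (GF k)))" for i k
    by (intro R2.qcommute_mult_left right_factor_qcommute I.Kinv_F factors_qcommute)
  \<comment> \<open>The summands are taken in the opposite order: f_i \<otimes> k_i^{-1} passes 1
    \<otimes> f_k with the positive exponent d_i a_ik that \<open>qad_sum\<close> requires.\<close>
  have sum: "R2.cong (qad (d i) (a i j) (?r (gen (GF i)) + ?l (gen (GF i)) * ?r (gen_Kinv a i))
      (?r (gen (GF j)) + ?l (gen (GF j)) * ?r (gen_Kinv a j)) ?N)
      (qad (d i) (a i j) (?r (gen (GF i))) (?r (gen (GF j))) ?N
       + qad (d i) (a i j) (?l (gen (GF i)) * ?r (gen_Kinv a i)) (?l (gen (GF j)) * ?r (gen_Kinv a j)) ?N)"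
    using KF[of i i] KF[of i j] KF[of j i] symmetrized[of i j] serre_exponent[OF SF(1)]
    by (intro R2.qad_sum) (simp_all add: mult.commute)
  have "?x \<doteq> 0" using mem by (simp add: I.cong_0_iff)
  then have l: "?l ?x \<in> rels2" and r: "?r ?x \<in> rels2"
    using left_factor_cong[of ?x 0] right_factor_cong[of ?x 0]
    by (simp_all add: R2.cong_0_iff left_factor_simps(6) right_factor_simps(6))
  have comm: "?l (gen (GF i)) * ?r (gen_Kinv a i) = ?r (gen_Kinv a i) * ?l (gen (GF i))" for i
    by (simp add: factors_commute)
  obtain s where s: "R2.cong (qad (d i) (a i j) (?l (gen (GF i)) * ?r (gen_Kinv a i)) (?l (gen (GF j)) * ?r (gen_Kinv a j)) ?N)
     (qpow s *\<^sub>k (?r (gen_Kinv a i) ^ ?N * ?r (gen_Kinv a j) * qad (d i) (a i j) (?l (gen (GF i))) (?l (gen (GF j))) ?N))"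
    unfolding comm
    using R2.qad_scale[OF factors_qcommute(2) factors_qcommute(2) factors_qcommute(2) right_factor_qcommute[OF K_K_commute(2)]] by blast
  have "?r ?x + qpow s *\<^sub>k (?r (gen_Kinv a i) ^ ?N * ?r (gen_Kinv a j) * ?l ?x) \<in> rels2"
    by (intro R2.add_mem r R2.smul_mem R2.mult_left_mem l)
  then have "qad (d i) (a i j) (?r (gen (GF i)) + ?l (gen (GF i)) * ?r (gen_Kinv a i))
      (?r (gen (GF j)) + ?l (gen (GF j)) * ?r (gen_Kinv a j)) ?N \<in> rels2"
    using R2.cong_mem_iff[OF R2.cong_trans[OF sum R2.cong_add[OF R2.cong_refl s]]]
    by (simp add: left_factor_simps right_factor_simps)
  then show ?thesis
    unfolding SF serre_eq_qad[OF SF(1)] free_comult_simps comult_gen_def gen.case add.commute[of "?l _ * _"]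
    by (rule R2.smul_mem)
qed

lemma free_comult_cong: "x \<doteq> y \<Longrightarrow> R2.cong (free_comult a x) (free_comult a y)"
proof -
  assume xy: "x \<doteq> y"
  have "two_sided_ideal {x. free_comult a x \<in> rels2}"
    by standard (simp_all add: free_comult_simps R2.zero_mem R2.add_mem R2.mult_left_mem R2.mult_right_mem)
  then have "relator_ideal \<subseteq> {x. free_comult a x \<in> rels2}"
    using free_comult_relator by (intro relator_ideal_least) auto
  then show ?thesis using xy by (auto simp: I.cong_def R2.cong_def free_comult_simps(2)[symmetric])
qed

lemma comult_cls: "comult (cls x) = tens_proj (free_comult a x)"
proof -
  have scal: "tens_proj (c *\<^sub>k 1) = tensU (scal c) \<one>\<^bsub>U\<^esub>" for c
    by (simp add: scal_eq left_factor_simps right_factor_simps tensU_eq flip: cls_1)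
  obtain h where h: "h \<in> alg_homs U UU (\<lambda>c. tensU (scal c) \<one>\<^bsub>U\<^esub>)" "\<And>x. h (cls x) = tens_proj (free_comult a x)"
    by (rule hom_lift[of "\<lambda>x. tens_proj (free_comult a x)" UU "\<lambda>c. tensU (scal c) \<one>\<^bsub>U\<^esub>"])
      (simp_all add: tens_proj_eq_iff free_comult_cong tens_proj_closed free_comult_simps tens_proj_mult tens_proj_add tens_proj_1 scal)
  have vals: "h (t i) = tensU (t i) (t i)" "h (e i) = tensU (e i) \<one>\<^bsub>U\<^esub> \<oplus>\<^bsub>UU\<^esub> tensU (k i) (e i)"
    "h (f i) = tensU (f i) (kinv i) \<oplus>\<^bsub>UU\<^esub> tensU \<one>\<^bsub>U\<^esub> (f i)" for i
    by (simp_all add: h t_def e_def f_def k_def kinv_def free_comult_simps comult_gen_def tensU_eq left_factor_simps right_factor_simps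
      flip: cls_1 tens_proj_add)
  have "comult = h"
    unfolding comult_def
  proof (rule the_equality)
    fix h' assume "h' \<in> alg_homs U UU (\<lambda>c. tensU (scal c) \<one>\<^bsub>U\<^esub>) \<and>
     (\<forall>i. h' (t i) = tensU (t i) (t i) \<and>
          h' (e i) = tensU (e i) \<one>\<^bsub>U\<^esub> \<oplus>\<^bsub>UU\<^esub> tensU (k i) (e i) \<and>
          h' (f i) = tensU (f i) (kinv i) \<oplus>\<^bsub>UU\<^esub> tensU \<one>\<^bsub>U\<^esub> (f i))"
    then show "h' = h"
      by (intro alg_hom_unique[OF monoid_UU _ h(1)]) (auto simp: vals)
  qed (auto simp: h(1) vals)
  then show ?thesis by (simp add: h)
qed

end

section \<open>The tensor product as a module\<close>

context quantum_datum
begin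

lemma formal_act_assoc:
  assumes V: "umodule V" and W: "umodule W" and P: "P \<in> formal V W"
  shows "formal_act V W (push Y) (formal_act V W (push Z) P) = formal_act V W (push (Y * Z)) P"
  using P
proof (induction rule: formal_induct)
  case (single v w c)
  note vw = single
  show ?case
  proof (induction Y rule: poly_mapping_additive_induct)
    case (single m b)
    show ?case
      by (induction Z rule: poly_mapping_additive_induct)
        (simp_all add: push_single push_add formal_act_single formal_act_add_right formal_act_add_left mult_single distrib_left
          plus_list_def word_append umoduleD(5)[OF V vw(1)] umoduleD(5)[OF W vw(2)] mult.assoc)
  qed (simp add: push_add formal_act_add_left distrib_right)
qed (simp_all add: formal_act_add_right)

lemma formal_act_one:
  assumes V: "umodule V" and W: "umodule W" and P: "P \<in> formal V W"
  shows "formal_act V W (push 1) P = P"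
  using P
proof (induction rule: formal_induct)
  case (single v w c)
  then show ?case
    using umoduleD(6)[OF V single(1)] umoduleD(6)[OF W single(2)]
    by (simp add: one_pair push_single formal_act_single)
qed (simp_all add: formal_act_add_right)

lemma tensor_module_simps:
  "carrier (tensor_module V W) = tcls V W ` formal V W" "\<zero>\<^bsub>tensor_module V W\<^esub> = tcls V W 0"
  "x \<oplus>\<^bsub>tensor_module V W\<^esub> y = tensor_add V W x y"
  by (simp_all add: tensor_module_def bilinear_rels_eq_tcls)

lemma tensor_module_act:
  assumes "umodule V" "umodule W" "P \<in> formal V W"
  shows "cls x \<odot>\<^bsub>tensor_module V W\<^esub> tcls V W P = tcls V W (formal_act V W (push (free_comult a x)) P)"
  using tensor_act_tcls[OF assms(1,2) push_formal assms(3)]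
  by (simp add: tensor_module_def comult_cls tens_proj_def)

lemma umodule_tensor:
  assumes V: "umodule V" and W: "umodule W"
  shows "umodule (tensor_module V W)"
proof -
  note act = tensor_module_act[OF V W] and closed = formal_act_closed[OF V W push_formal]
  show ?thesis
    unfolding umodule_def tensor_module_simps
    by (auto simp: act closed tensor_add_tcls formal_add formal_act_add_right formal_act_add_left push_add
        free_comult_simps formal_act_assoc[OF V W] formal_act_one[OF V W])
qed

subsection \<open>Separating functionals on the tensor product\<close>

definition pair_L :: "'i weight \<Rightarrow> 'i falg \<Rightarrow> 'i irrvec \<Rightarrow> kk" where
  "pair_L l u v = vev l (u * (SOME x. v = L_proj l x))"

lemma pair_L_proj: "pair_L l u (L_proj l x) = vev l (u * x)"
proof -
  have "L_proj l x = L_proj l (SOME y. L_proj l x = L_proj l y)" by (rule someI[of _ x]) simp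
  then have "x - (SOME y. L_proj l x = L_proj l y) \<in> radical l"
    unfolding presentsD(3)[OF presents_L] .
  then show ?thesis by (simp add: pair_L_def radical_def right_diff_distrib vev_diff)
qed

lemma carrier_LE: assumes "v \<in> carrier (L l)" obtains x where "v = L_proj l x"
  using assms presentsD(2)[OF presents_L[of l]] by auto

lemma pair_L_highest: "v \<in> carrier (L l) \<Longrightarrow> highest_functional l (\<lambda>u. pair_L l u v)"
  by (erule carrier_LE) (simp add: pair_L_proj highest_functional_vev)

definition tval :: "'i weight \<Rightarrow> 'i falg \<Rightarrow> 'i falg \<Rightarrow> ('i irrvec \<times> 'i ufun \<Rightarrow>\<^sub>0 kk) \<Rightarrow> kk" where
  "tval l u z P = lin_ext (\<lambda>c. c) (\<lambda>k. pair_L l u (fst k) * snd k (cls z)) P"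

lemma tval_add: "tval l u z (P + Q) = tval l u z P + tval l u z Q"
  unfolding tval_def by (rule lin_ext_add) auto
lemma tval_0 [simp]: "tval l u z 0 = 0" by (simp add: tval_def)
lemma tval_diff: "tval l u z (P - Q) = tval l u z P - tval l u z Q"
  using tval_add[of l u z "P - Q" Q] by simp
lemma tval_single: "tval l u z (Poly_Mapping.single (v, g) c) = c * (pair_L l u v * g (cls z))"
  by (simp add: tval_def lin_ext_single)

lemma tval_rels: "P \<in> bilinear_rels (L l) Fmod \<Longrightarrow> tval l u z P = 0"
proof (induction rule: bilinear_rels.induct)
  case (add_left v v' w c)
  then obtain x x' where "v = L_proj l x" "v' = L_proj l x'" by (auto elim!: carrier_LE)
  then show ?case
    by (simp add: tval_diff tval_single presentsD(4)[OF presents_L] pair_L_proj distrib_left distrib_right vev_add)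
next
  case (add_right v w w' c)
  then show ?case by (simp add: tval_diff tval_single Fmod_add_cls distrib_left)
next
  case (scale_left v w b c)
  then obtain x where "v = L_proj l x" by (auto elim!: carrier_LE)
  then show ?case by (simp add: tval_diff tval_single presentsD(7)[OF presents_L] pair_L_proj vev_smul)
next
  case (scale_right v w b c)
  then show ?case by (simp add: tval_diff tval_single Fmod_scal_cls)
qed (simp_all add: tval_add)

lemma highest_functional_0: "highest_functional l (\<lambda>u. 0)"
  by (simp add: highest_functional_def)
lemma highest_functional_add: "highest_functional l h \<Longrightarrow> highest_functional l h' \<Longrightarrow> highest_functional l (\<lambda>u. h u + h' u)"
  unfolding highest_functional_def by (auto simp: algebra_simps)
lemma highest_functional_scale: "highest_functional l h \<Longrightarrow> highest_functional l (\<lambda>u. c * h u)"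
  unfolding highest_functional_def by (auto simp: algebra_simps)

lemma tval_highest: "P \<in> formal (L l) Fmod \<Longrightarrow> highest_functional l (\<lambda>u. tval l u z P)"
proof (induction rule: formal_induct)
  case (single v g c)
  from highest_functional_scale[OF pair_L_highest[OF single(1)], of "c * g (cls z)"]
  show ?case by (simp add: tval_single ac_simps)
qed (simp_all add: tval_add highest_functional_0 highest_functional_add)

lemma tval_right:
  assumes "P \<in> formal (L l) Fmod"
  shows "tval l u (z + z') P = tval l u z P + tval l u z' P" "tval l u (c *\<^sub>k z) P = c * tval l u z P"
    "z \<doteq> z' \<Longrightarrow> tval l u z P = tval l u z' P"
proof -
  show "tval l u (z + z') P = tval l u z P + tval l u z' P"
    using assms by (induction rule: formal_induct) (simp_all add: tval_single tval_add Fmod_linear algebra_simps)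
  show "tval l u (c *\<^sub>k z) P = c * tval l u z P"
    using assms by (induction rule: formal_induct) (simp_all add: tval_single tval_add Fmod_linear algebra_simps)
  show "tval l u z P = tval l u z' P" if "z \<doteq> z'"
  proof -
    have "cls z = cls z'" using that by (simp add: cls_eq_iff)
    then show ?thesis by (simp add: tval_def)
  qed
qed

text \<open>The module elements act before the pairing with u and the evaluation at z, so they
  appear as right factors of both arguments.\<close>

lemma tval_act:
  assumes P: "P \<in> formal (L l) Fmod"
  shows "tval l u z (formal_act (L l) Fmod (push (left_factor x * right_factor y)) P) = tval l (u * x) (z * y) P"
proof -
  have hf: "tval l (u + u') z P = tval l u z P + tval l u' z P" "tval l (c *\<^sub>k u) z P = c * tval l u z P" for u u' z c
    using tval_highest[OF P, of z] by (simp_all add: highest_functional_def)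
  have words: "tval l u z (formal_act (L l) Fmod (push (Poly_Mapping.single (w, w') c)) P) = c * tval l (u * word w) (z * word w') P" for w w' c
    using P
  proof (induction rule: formal_induct)
    case (single v g b)
    obtain x' where "v = L_proj l x'" using single(1) by (rule carrier_LE)
    then show ?case
      by (simp add: push_single formal_act_single tval_single presentsD(6)[OF presents_L] pair_L_proj Fmod_smult_cls mult.assoc)
  qed (simp_all add: formal_act_add_right tval_add algebra_simps)
  show ?thesis
  proof (induction x rule: free_algebra_induct)
    case (word c w)
    show ?case
    proof (induction y rule: free_algebra_induct)
      case (word c' w')
      have "left_factor (c *\<^sub>k word w) * right_factor (c' *\<^sub>k word w') = Poly_Mapping.single (w, w') (c * c')"
        by (simp add: left_factor_simps right_factor_simps factors_word smul_single mult.commute)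
      then show ?case by (simp add: words hf tval_right[OF P])
    qed (simp add: right_factor_simps distrib_left push_add formal_act_add_left tval_add tval_right[OF P])
  qed (simp add: left_factor_simps distrib_left distrib_right push_add formal_act_add_left tval_add hf)
qed

lemma pair_L_separates:
  assumes "v \<in> carrier (L l)" "\<And>u. pair_L l u v = 0" shows "v = L_proj l 0"
proof -
  obtain x where x: "v = L_proj l x" using assms(1) by (rule carrier_LE)
  then have "x \<in> radical l" using assms(2) by (simp add: pair_L_proj radical_def)
  then show ?thesis unfolding x presentsD(3)[OF presents_L] by simp
qed

lemma rels_zero_left: "g \<in> carrier Fmod \<Longrightarrow> Poly_Mapping.single (L_proj l 0, g) c \<in> bilinear_rels (L l) Fmod"
  using bilinear_rels.scale_left[of "L_proj l 0" "L l" g Fmod 0 c] presentsD(2,7)[OF presents_L[of l]] by simp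

lemma rels_zero_right: "v \<in> carrier (L l) \<Longrightarrow> Poly_Mapping.single (v, \<zero>\<^bsub>Fmod\<^esub>) c \<in> bilinear_rels (L l) Fmod"
proof -
  have "scal 0 \<odot>\<^bsub>Fmod\<^esub> \<zero>\<^bsub>Fmod\<^esub> = \<zero>\<^bsub>Fmod\<^esub>"
    by (rule Fmod_eqI) (simp_all add: Fmod_scal_cls Fmod_zero_closed Fmod_zero_cls, simp_all add: Fmod_simps)
  then show "v \<in> carrier (L l) \<Longrightarrow> ?thesis"
    using bilinear_rels.scale_right[of v "L l" "\<zero>\<^bsub>Fmod\<^esub>" Fmod 0 c] Fmod_zero_closed by simp
qed

text \<open>Lists of pure tensors with coefficient 1: their length is the induction measure for the
  elimination, and repeated pairs do no harm.\<close>

abbreviation fsum :: "('i irrvec \<times> 'i ufun) list \<Rightarrow> ('i irrvec \<times> 'i ufun \<Rightarrow>\<^sub>0 kk)" where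
  "fsum ps \<equiv> (\<Sum>p\<leftarrow>ps. Poly_Mapping.single p 1)"

lemma rels_sum_right:
  assumes "v \<in> carrier (L l)" "set hs \<subseteq> carrier Fmod" "g \<in> carrier Fmod" "\<And>z. g (cls z) = (\<Sum>h\<leftarrow>hs. h (cls z))"
  shows "Poly_Mapping.single (v, g) 1 - fsum (map (Pair v) hs) \<in> bilinear_rels (L l) Fmod"
  using assms(2-)
proof (induction hs arbitrary: g)
  case Nil
  have "g = \<zero>\<^bsub>Fmod\<^esub>"
    by (rule Fmod_eqI) (use Nil Fmod_linear(1) in \<open>simp_all add: Fmod_zero_cls Fmod_zero_closed\<close>)
  then show ?case using rels_zero_right[OF assms(1)] by simp
next
  case (Cons h hs)
  define g' where "g' = foldr (\<lambda>h g. h \<oplus>\<^bsub>Fmod\<^esub> g) hs \<zero>\<^bsub>Fmod\<^esub>"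
  have g': "g' \<in> carrier Fmod" "g' (cls z) = (\<Sum>h\<leftarrow>hs. h (cls z))" for z
  proof -
    have "set hs \<subseteq> carrier Fmod" using Cons.prems by simp
    then show "g' \<in> carrier Fmod" "g' (cls z) = (\<Sum>h\<leftarrow>hs. h (cls z))"
      unfolding g'_def by (induction hs) (simp_all add: Fmod_zero_closed Fmod_add_closed Fmod_zero_cls Fmod_add_cls)
  qed
  have h: "h \<in> carrier Fmod" using Cons.prems by simp
  have g: "g = h \<oplus>\<^bsub>Fmod\<^esub> g'"
    by (rule Fmod_eqI)
      (use Cons.prems g' h Fmod_linear(1)[OF Cons.prems(2)] Fmod_linear(1)[OF Fmod_add_closed[OF h g'(1)]] in \<open>simp_all add: Fmod_add_cls\<close>)
  have 1: "Poly_Mapping.single (v, g) 1 - Poly_Mapping.single (v, h) 1 - Poly_Mapping.single (v, g') 1 \<in> bilinear_rels (L l) Fmod"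
    unfolding g by (rule bilinear_rels.add_right[OF assms(1) h g'(1)])
  have 2: "Poly_Mapping.single (v, g') 1 - fsum (map (Pair v) hs) \<in> bilinear_rels (L l) Fmod"
    using Cons.prems g' by (intro Cons.IH) simp_all
  from bilinear_rels.add[OF 1 2] show ?case by (simp add: algebra_simps)
qed

text \<open>Gaussian elimination. If some u0 pairs nontrivially with the first vector v, the
  equations at u0 express its partner g through the other functions; substituting shortens the sum
  by one term. If no such u0 exists, v is zero because the radical has been divided out.\<close>

lemma fsum_separated:
  assumes "set ps \<subseteq> carrier (L l) \<times> carrier Fmod" "\<And>u z. (\<Sum>p\<leftarrow>ps. pair_L l u (fst p) * snd p (cls z)) = 0"
  shows "fsum ps \<in> bilinear_rels (L l) Fmod"
  using assms
proof (induction "length ps" arbitrary: ps)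
  case 0
  then show ?case by (simp add: bilinear_rels.zero)
next
  case (Suc n)
  obtain p qs where p: "ps = p # qs" "length qs = n" using Suc.hyps(2) by (cases ps) simp_all
  obtain v g where "p = (v, g)" by (cases p)
  with p have ps: "ps = (v, g) # qs" "length qs = n" by simp_all
  have vg: "v \<in> carrier (L l)" "g \<in> carrier Fmod" "set qs \<subseteq> carrier (L l) \<times> carrier Fmod"
    using Suc.prems(1) by (auto simp: ps)
  have sum0: "pair_L l u v * g (cls z) + (\<Sum>p\<leftarrow>qs. pair_L l u (fst p) * snd p (cls z)) = 0" for u z
    using Suc.prems(2)[of u z] by (simp add: ps)
  show ?case
  proof (cases "\<forall>u. pair_L l u v = 0")
    case True
    then have v: "v = L_proj l 0" using pair_L_separates[OF vg(1)] by blast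
    have "fsum qs \<in> bilinear_rels (L l) Fmod"
      using Suc.hyps(1)[of qs] ps(2) vg(3) sum0 True by simp
    from bilinear_rels.add[OF rels_zero_left[OF vg(2), of l 1] this] show ?thesis by (simp add: ps v)
  next
    case False
    then obtain u0 where u0: "pair_L l u0 v \<noteq> 0" by blast
    \<comment> \<open>Chosen so that g is the sum of \<open>c w\<close> times h over the remaining
      pairs (w, h), as read off from the equations at \<open>u0\<close>.\<close>
    define c where "c w = - (pair_L l u0 w / pair_L l u0 v)" for w
    define qs' where "qs' = map (\<lambda>p. (fst p \<oplus>\<^bsub>L l\<^esub> (scal (c (fst p)) \<odot>\<^bsub>L l\<^esub> v), snd p)) qs"
    note LD = umoduleD[OF umodule_L[of l]]
    obtain x where x: "v = L_proj l x" using vg(1) by (rule carrier_LE)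
    have pair: "pair_L l u (w \<oplus>\<^bsub>L l\<^esub> (scal b \<odot>\<^bsub>L l\<^esub> v)) = pair_L l u w + b * pair_L l u v" if w: "w \<in> carrier (L l)" for u w b
    proof -
      obtain y where y: "w = L_proj l y" using w by (rule carrier_LE)
      show ?thesis unfolding x y
        by (simp add: presentsD(4,7)[OF presents_L] pair_L_proj distrib_left vev_add vev_smul)
    qed
    have gval: "g (cls z) = (\<Sum>p\<leftarrow>qs. c (fst p) * snd p (cls z))" for z
    proof -
      have "pair_L l u0 v * g (cls z) = - (\<Sum>p\<leftarrow>qs. pair_L l u0 (fst p) * snd p (cls z))"
        using sum0[of u0 z] by (simp add: eq_neg_iff_add_eq_0)
      also have "\<dots> = pair_L l u0 v * (\<Sum>p\<leftarrow>qs. c (fst p) * snd p (cls z))"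
        using u0 by (simp add: c_def sum_list_const_mult[symmetric] uminus_sum_list_map[unfolded comp_def] field_simps)
      finally show ?thesis using u0 by simp
    qed
    have qs': "set qs' \<subseteq> carrier (L l) \<times> carrier Fmod" "length qs' = n"
      using vg ps(2) LD(1,7) by (auto simp: qs'_def)
    have "(\<Sum>p\<leftarrow>qs'. pair_L l u (fst p) * snd p (cls z)) = 0" for u z
    proof -
      have "(\<Sum>p\<leftarrow>qs'. pair_L l u (fst p) * snd p (cls z))
         = (\<Sum>p\<leftarrow>qs. pair_L l u (fst p) * snd p (cls z) + pair_L l u v * (c (fst p) * snd p (cls z)))"
        unfolding qs'_def map_map comp_def
        by (intro arg_cong[of _ _ sum_list] map_cong refl) (use vg(3) pair in \<open>auto simp: algebra_simps\<close>)
      also have "\<dots> = (\<Sum>p\<leftarrow>qs. pair_L l u (fst p) * snd p (cls z)) + pair_L l u v * g (cls z)"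
        by (simp add: sum_list_addf sum_list_const_mult gval)
      finally show ?thesis using sum0[of u z] by (simp add: add.commute)
    qed
    then have IH: "fsum qs' \<in> bilinear_rels (L l) Fmod" using Suc.hyps(1)[of qs'] qs' by simp
    \<comment> \<open>The multiple of v added to w is transferred to the second factor, where these
      terms add up to g.\<close>
    have move: "Poly_Mapping.single (w \<oplus>\<^bsub>L l\<^esub> (scal b \<odot>\<^bsub>L l\<^esub> v), h) 1 - Poly_Mapping.single (w, h) 1
        - Poly_Mapping.single (v, scal b \<odot>\<^bsub>Fmod\<^esub> h) 1 \<in> bilinear_rels (L l) Fmod"
      if "w \<in> carrier (L l)" "h \<in> carrier Fmod" for w h b
    proof -
      have 1: "Poly_Mapping.single (w \<oplus>\<^bsub>L l\<^esub> (scal b \<odot>\<^bsub>L l\<^esub> v), h) 1 - Poly_Mapping.single (w, h) 1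
          - Poly_Mapping.single (scal b \<odot>\<^bsub>L l\<^esub> v, h) 1 \<in> bilinear_rels (L l) Fmod"
        by (intro bilinear_rels.add_left that LD vg)
      have 2: "Poly_Mapping.single (scal b \<odot>\<^bsub>L l\<^esub> v, h) 1 - Poly_Mapping.single (v, h) (1 * b) \<in> bilinear_rels (L l) Fmod"
        by (intro bilinear_rels.scale_left that vg)
      have 3: "Poly_Mapping.single (v, scal b \<odot>\<^bsub>Fmod\<^esub> h) 1 - Poly_Mapping.single (v, h) (1 * b) \<in> bilinear_rels (L l) Fmod"
        by (intro bilinear_rels.scale_right that vg)
      from bilinear_rels.add[OF 1 bilinear_rels_diff[OF 2 3]] show ?thesis by simp
    qed
    have A: "fsum qs' - fsum qs - fsum (map (Pair v) (map (\<lambda>p. scal (c (fst p)) \<odot>\<^bsub>Fmod\<^esub> snd p) qs)) \<in> bilinear_rels (L l) Fmod"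
      unfolding qs'_def using vg(3)
    proof (induction qs)
      case Nil
      show ?case by (simp add: bilinear_rels.zero)
    next
      case (Cons p qs)
      obtain w h where p: "p = (w, h)" by (cases p)
      have "w \<in> carrier (L l)" "h \<in> carrier Fmod" using Cons.prems by (auto simp: p)
      from bilinear_rels.add[OF move[OF this, of "c w"] Cons.IH] Cons.prems show ?case
        by (simp add: p algebra_simps)
    qed
    have B: "Poly_Mapping.single (v, g) 1 - fsum (map (Pair v) (map (\<lambda>p. scal (c (fst p)) \<odot>\<^bsub>Fmod\<^esub> snd p) qs)) \<in> bilinear_rels (L l) Fmod"
    proof (rule rels_sum_right[OF vg(1) _ vg(2)])
      show "set (map (\<lambda>p. scal (c (fst p)) \<odot>\<^bsub>Fmod\<^esub> snd p) qs) \<subseteq> carrier Fmod"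
        using vg(3) Fmod_scal_closed by auto
      have "(\<Sum>p\<leftarrow>qs. c (fst p) * snd p (cls z)) = (\<Sum>p\<leftarrow>qs. (scal (c (fst p)) \<odot>\<^bsub>Fmod\<^esub> snd p) (cls z))" for z
        by (intro arg_cong[of _ _ sum_list] map_cong refl) (use vg(3) Fmod_scal_cls in auto)
      then show "g (cls z) = (\<Sum>h\<leftarrow>map (\<lambda>p. scal (c (fst p)) \<odot>\<^bsub>Fmod\<^esub> snd p) qs. h (cls z))" for z
        by (simp add: gval comp_def)
    qed
    from bilinear_rels.add[OF bilinear_rels_diff[OF IH A] B] show ?thesis by (simp add: ps algebra_simps)
  qed
qed

lemma formal_fsum:
  "P \<in> formal (L l) Fmod \<Longrightarrow> \<exists>ps. set ps \<subseteq> carrier (L l) \<times> carrier Fmod \<and> P - fsum ps \<in> bilinear_rels (L l) Fmod"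
proof (induction rule: formal_induct)
  case zero
  show ?case by (intro exI[of _ "[]"]) (simp add: bilinear_rels.zero)
next
  case (single v g c)
  have "Poly_Mapping.single (scal c \<odot>\<^bsub>L l\<^esub> v, g) 1 - Poly_Mapping.single (v, g) (1 * c) \<in> bilinear_rels (L l) Fmod"
    by (rule bilinear_rels.scale_left[OF single])
  from bilinear_rels_minus[OF this] umoduleD(7)[OF umodule_L single(1)] single(2)
  show ?case by (intro exI[of _ "[(scal c \<odot>\<^bsub>L l\<^esub> v, g)]"]) simp
next
  case (add P Q)
  then obtain ps qs where "set ps \<subseteq> carrier (L l) \<times> carrier Fmod" "P - fsum ps \<in> bilinear_rels (L l) Fmod"
    "set qs \<subseteq> carrier (L l) \<times> carrier Fmod" "Q - fsum qs \<in> bilinear_rels (L l) Fmod" by blast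
  then show ?case using bilinear_rels.add[of "P - fsum ps" "L l" Fmod "Q - fsum qs"]
    by (intro exI[of _ "ps @ qs"]) (simp add: algebra_simps)
qed

lemma tval_separates:
  assumes P: "P \<in> formal (L l) Fmod" and 0: "\<And>u z. tval l u z P = 0"
  shows "P \<in> bilinear_rels (L l) Fmod"
proof -
  obtain ps where ps: "set ps \<subseteq> carrier (L l) \<times> carrier Fmod" "P - fsum ps \<in> bilinear_rels (L l) Fmod"
    using formal_fsum[OF P] by blast
  have "tval l u z (fsum ps) = (\<Sum>p\<leftarrow>ps. pair_L l u (fst p) * snd p (cls z))" for u z
    by (induction ps) (simp_all add: tval_add tval_def lin_ext_single lin_ext_add)
  moreover have "tval l u z (fsum ps) = 0" for u z
    using tval_rels[OF ps(2), of u z] 0 by (simp add: tval_diff)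
  ultimately have "fsum ps \<in> bilinear_rels (L l) Fmod" using fsum_separated[OF ps(1)] by simp
  from bilinear_rels.add[OF ps(2) this] show ?thesis by simp
qed

subsection \<open>Coordinates on the tensor product\<close>

definition tz :: "'i weight \<Rightarrow> 'i LFvec \<Rightarrow> 'i falg \<Rightarrow> 'i falg \<Rightarrow> kk" where
  "tz l Z u z = tval l u z (SOME P. P \<in> Z)"

lemma tz_tcls: "tz l (tcls (L l) Fmod P) u z = tval l u z P"
proof -
  have "(SOME Q. Q \<in> tcls (L l) Fmod P) \<in> tcls (L l) Fmod P" using tcls_self by (rule someI)
  then obtain r where "r \<in> bilinear_rels (L l) Fmod" "(SOME Q. Q \<in> tcls (L l) Fmod P) = P + r" by (rule tclsE)
  then show ?thesis by (simp add: tz_def tval_add tval_rels)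
qed

lemma LF_E: assumes "Z \<in> carrier (LF l)" obtains P where "Z = tcls (L l) Fmod P" "P \<in> formal (L l) Fmod"
  using assms by (auto simp: tensor_module_simps)

text \<open>Henceforth every identity in the tensor product is checked on coordinates, and
  representatives no longer appear in the arguments about homomorphisms.\<close>

lemma tz_inj:
  assumes "Z \<in> carrier (LF l)" "Z' \<in> carrier (LF l)" "\<And>u z. tz l Z u z = tz l Z' u z"
  shows "Z = Z'"
proof -
  obtain P where P: "Z = tcls (L l) Fmod P" "P \<in> formal (L l) Fmod" using assms(1) by (rule LF_E)
  obtain P' where P': "Z' = tcls (L l) Fmod P'" "P' \<in> formal (L l) Fmod" using assms(2) by (rule LF_E)
  have "P - P' \<in> bilinear_rels (L l) Fmod"
    using assms(3) by (intro tval_separates formal_diff P P') (simp add: P P' tz_tcls tval_diff)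
  then show ?thesis by (simp add: P P' tcls_eq_iff)
qed

lemma umodule_LF: "umodule (LF l)" by (rule umodule_tensor[OF umodule_L umodule_Fmod])

lemmas LF_D = umoduleD[OF umodule_LF]

lemma LF_zero_closed: "\<zero>\<^bsub>LF l\<^esub> \<in> carrier (LF l)"
  by (auto simp: tensor_module_simps formal_zero)

lemma tz_zero: "tz l \<zero>\<^bsub>LF l\<^esub> u z = 0" by (simp add: tensor_module_simps tz_tcls)

lemma tz_add:
  assumes "Z \<in> carrier (LF l)" "Z' \<in> carrier (LF l)"
  shows "tz l (Z \<oplus>\<^bsub>LF l\<^esub> Z') u z = tz l Z u z + tz l Z' u z"
proof -
  obtain P where P: "Z = tcls (L l) Fmod P" "P \<in> formal (L l) Fmod" using assms(1) by (rule LF_E)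
  obtain P' where P': "Z' = tcls (L l) Fmod P'" "P' \<in> formal (L l) Fmod" using assms(2) by (rule LF_E)
  show ?thesis by (simp add: P P' tensor_module_simps tensor_add_tcls tz_tcls tval_add)
qed

lemma tz_highest: "Z \<in> carrier (LF l) \<Longrightarrow> highest_functional l (\<lambda>u. tz l Z u z)"
  by (erule LF_E) (simp add: tz_tcls tval_highest)

lemma tz_left:
  assumes "Z \<in> carrier (LF l)"
  shows "tz l Z (u + u') z = tz l Z u z + tz l Z u' z" "tz l Z (c *\<^sub>k u) z = c * tz l Z u z" "u \<doteq> u' \<Longrightarrow> tz l Z u z = tz l Z u' z"
    "tz l Z (gen (GF i) * u) z = 0" "tz l Z (tmon n * u) z = tchar l n * tz l Z u z" "tz l Z (- u) z = - tz l Z u z"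
proof -
  have h: "highest_functional l (\<lambda>u. tz l Z u z)" by (rule tz_highest[OF assms])
  then show "tz l Z (u + u') z = tz l Z u z + tz l Z u' z" "tz l Z (c *\<^sub>k u) z = c * tz l Z u z" "u \<doteq> u' \<Longrightarrow> tz l Z u z = tz l Z u' z"
    "tz l Z (gen (GF i) * u) z = 0" "tz l Z (tmon n * u) z = tchar l n * tz l Z u z"
    unfolding highest_functional_def by blast+
  have "tz l Z ((- 1) *\<^sub>k u) z = (- 1) * tz l Z u z" using h unfolding highest_functional_def by blast
  then show "tz l Z (- u) z = - tz l Z u z" by simp
qed

lemma tz_right:
  assumes "Z \<in> carrier (LF l)"
  shows "tz l Z u (z + z') = tz l Z u z + tz l Z u z'" "tz l Z u (c *\<^sub>k z) = c * tz l Z u z" "z \<doteq> z' \<Longrightarrow> tz l Z u z = tz l Z u z'"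
  using assms by (auto elim!: LF_E simp: tz_tcls tval_right intro: tval_right(3))

lemma LF_act:
  assumes "P \<in> formal (L l) Fmod"
  shows "cls x \<odot>\<^bsub>LF l\<^esub> tcls (L l) Fmod P = tcls (L l) Fmod (formal_act (L l) Fmod (push (free_comult a x)) P)"
  by (rule tensor_module_act[OF umodule_L umodule_Fmod assms])

lemma tz_E: "Z \<in> carrier (LF l) \<Longrightarrow> tz l (cls (gen (GE i)) \<odot>\<^bsub>LF l\<^esub> Z) u z = tz l Z (u * gen (GE i)) z + tz l Z (u * gen_K a i) (z * gen (GE i))"
proof (erule LF_E)
  fix P assume P: "P \<in> formal (L l) Fmod" "Z = tcls (L l) Fmod P"
  show ?thesis
    using tval_act[OF P(1), of u z "gen (GE i)" 1] tval_act[OF P(1), of u z "gen_K a i" "gen (GE i)"]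
    by (simp add: P(2) LF_act[OF P(1)] tz_tcls free_comult_simps comult_gen_def push_add formal_act_add_left tval_add right_factor_simps)
qed

lemma tz_F: "Z \<in> carrier (LF l) \<Longrightarrow> tz l (cls (gen (GF i)) \<odot>\<^bsub>LF l\<^esub> Z) u z = tz l Z (u * gen (GF i)) (z * gen_Kinv a i) + tz l Z u (z * gen (GF i))"
proof (erule LF_E)
  fix P assume P: "P \<in> formal (L l) Fmod" "Z = tcls (L l) Fmod P"
  show ?thesis
    using tval_act[OF P(1), of u z "gen (GF i)" "gen_Kinv a i"] tval_act[OF P(1), of u z 1 "gen (GF i)"]
    by (simp add: P(2) LF_act[OF P(1)] tz_tcls free_comult_simps comult_gen_def push_add formal_act_add_left tval_add left_factor_simps)
qed

lemma tz_tmon: "Z \<in> carrier (LF l) \<Longrightarrow> tz l (cls (tmon n) \<odot>\<^bsub>LF l\<^esub> Z) u z = tz l Z (u * tmon n) (z * tmon n)"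
proof (erule LF_E)
  fix P assume P: "P \<in> formal (L l) Fmod" "Z = tcls (L l) Fmod P"
  show ?thesis by (simp add: P(2) LF_act[OF P(1)] tz_tcls free_comult_tmon tval_act[OF P(1)])
qed

lemma tz_scal: "Z \<in> carrier (LF l) \<Longrightarrow> tz l (scal c \<odot>\<^bsub>LF l\<^esub> Z) u z = c * tz l Z u z"
proof -
  assume Z: "Z \<in> carrier (LF l)"
  from Z show ?thesis
  proof (rule LF_E)
    fix P assume P: "Z = tcls (L l) Fmod P" "P \<in> formal (L l) Fmod"
    have "tz l (scal c \<odot>\<^bsub>LF l\<^esub> Z) u z = tval l u z (formal_act (L l) Fmod (push (left_factor (c *\<^sub>k 1) * right_factor 1)) P)"
      by (simp add: P(1) scal_eq LF_act[OF P(2)] tz_tcls free_comult_simps left_factor_simps right_factor_simps)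
    also have "\<dots> = tval l (c *\<^sub>k u) z P" unfolding tval_act[OF P(2)] by simp
    also have "\<dots> = c * tz l Z u z" using tz_left(2)[OF Z, of c u z] by (simp add: P(1) tz_tcls)
    finally show ?thesis .
  qed
qed

lemma pure_tensor_closed: "v \<in> carrier (L l) \<Longrightarrow> g \<in> carrier Fmod \<Longrightarrow> pure_tensor (L l) Fmod v g \<in> carrier (LF l)"
  by (simp add: pure_tensor_def tensor_module_simps formal_single)

lemma tz_pure_tensor: "tz l (pure_tensor (L l) Fmod v g) u z = pair_L l u v * g (cls z)"
  by (simp add: pure_tensor_def tz_tcls tval_single)

end

lemma sum_list_zero: "(\<And>p. p \<in> set ps \<Longrightarrow> h p = (0::'a::comm_monoid_add)) \<Longrightarrow> (\<Sum>p\<leftarrow>ps. h p) = 0"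
  by (induction ps) simp_all

text \<open>A vector \<open>G\<close> orthogonal to everything that is orthogonal to the space \<open>Y\<close> lies in \<open>Y\<close>; the list
  \<open>ps\<close> gives such a representation with coefficients that are linear in \<open>G\<close>. The linearity is needed
  since \<open>G\<close> will depend on an element of \<open>U\<close>.\<close>

lemma orthogonal_projection_exists:
  fixes Y :: "('x \<Rightarrow> 'k::field) set"
  assumes "finite S" "\<And>y y' c. y \<in> Y \<Longrightarrow> y' \<in> Y \<Longrightarrow> (\<lambda>x. y x + c * y' x) \<in> Y"
  shows "\<exists>ps. set (map fst ps) \<subseteq> Y \<and>
    (\<forall>G. (\<forall>c. (\<forall>y\<in>Y. (\<Sum>x\<in>S. c x * y x) = 0) \<longrightarrow> (\<Sum>x\<in>S. c x * G x) = 0) \<longrightarrow>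
      (\<forall>x\<in>S. G x = (\<Sum>p\<leftarrow>ps. fst p x * (\<Sum>x'\<in>S. snd p x' * G x'))))"
  using assms
proof (induction S arbitrary: Y rule: finite_induct)
  case empty
  show ?case by (intro exI[of _ "[]"]) simp
next
  case (insert s S)
  have upd: "(\<Sum>x\<in>insert s S. (c(s := b)) x * G x) = b * G s + (\<Sum>x\<in>S. c x * G x)" for b :: 'k and c G
  proof -
    have "(\<Sum>x\<in>S. (c(s := b)) x * G x) = (\<Sum>x\<in>S. c x * G x)"
      using insert.hyps by (intro sum.cong) auto
    then show ?thesis using insert.hyps by simp
  qed
  show ?case
  proof (cases "\<forall>y\<in>Y. y s = 0")
    case True
    from insert.IH[OF insert.prems] obtain ps where ps: "set (map fst ps) \<subseteq> Y"
      "\<And>G. (\<forall>c. (\<forall>y\<in>Y. (\<Sum>x\<in>S. c x * y x) = 0) \<longrightarrow> (\<Sum>x\<in>S. c x * G x) = 0) \<Longrightarrow>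
         (\<forall>x\<in>S. G x = (\<Sum>p\<leftarrow>ps. fst p x * (\<Sum>x'\<in>S. snd p x' * G x')))" by blast
    define qs where "qs = map (\<lambda>p. (fst p, (snd p)(s := 0))) ps"
    have "\<forall>x\<in>insert s S. G x = (\<Sum>p\<leftarrow>qs. fst p x * (\<Sum>x'\<in>insert s S. snd p x' * G x'))"
      if G: "\<forall>c. (\<forall>y\<in>Y. (\<Sum>x\<in>insert s S. c x * y x) = 0) \<longrightarrow> (\<Sum>x\<in>insert s S. c x * G x) = 0" for G
    proof -
      have "(\<Sum>x\<in>S. c x * G x) = 0" if c: "\<forall>y\<in>Y. (\<Sum>x\<in>S. c x * y x) = 0" for c
        using G[rule_format, of "c(s := 0)"] c unfolding upd by simp
      then have G': "\<forall>x\<in>S. G x = (\<Sum>p\<leftarrow>ps. fst p x * (\<Sum>x'\<in>S. snd p x' * G x'))" by (intro ps(2)) blast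
      have qs: "(\<Sum>p\<leftarrow>qs. fst p x * (\<Sum>x'\<in>insert s S. snd p x' * G x')) = (\<Sum>p\<leftarrow>ps. fst p x * (\<Sum>x'\<in>S. snd p x' * G x'))" for x
        unfolding qs_def map_map comp_def fst_conv snd_conv upd by simp
      \<comment> \<open>The coordinate functional at s is orthogonal to Y in this case.\<close>
      have "G s = 0"
        using G[rule_format, of "(\<lambda>_. 0)(s := 1)"] True unfolding upd by simp
      moreover have "(\<Sum>p\<leftarrow>ps. fst p s * (\<Sum>x'\<in>S. snd p x' * G x')) = 0"
        using ps(1) True by (intro sum_list_zero) auto
      ultimately show ?thesis using G' by (simp only: qs) simp
    qed
    moreover have "set (map fst qs) \<subseteq> Y" using ps(1) by (auto simp: qs_def)
    ultimately show ?thesis by blast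
  next
    case False
    then obtain y0 where y0: "y0 \<in> Y" "y0 s \<noteq> 0" by blast
    let ?Y = "{y \<in> Y. y s = 0}"
    have "(\<lambda>x. y x + c * y' x) \<in> ?Y" if "y \<in> ?Y" "y' \<in> ?Y" for y y' c
      using that insert.prems by auto
    from insert.IH[of ?Y, OF this] obtain ps where ps: "set (map fst ps) \<subseteq> ?Y"
      "\<And>G. (\<forall>c. (\<forall>y\<in>?Y. (\<Sum>x\<in>S. c x * y x) = 0) \<longrightarrow> (\<Sum>x\<in>S. c x * G x) = 0) \<Longrightarrow>
         (\<forall>x\<in>S. G x = (\<Sum>p\<leftarrow>ps. fst p x * (\<Sum>x'\<in>S. snd p x' * G x')))" by blast
    \<comment> \<open>The value at s is adjusted so that the extended functional is orthogonal to
      \<open>y0\<close>.\<close>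
    define e where "e c = c(s := - (\<Sum>x\<in>S. c x * y0 x) / y0 s)" for c :: "'x \<Rightarrow> 'k"
    define qs where "qs = (y0, (\<lambda>_. 0)(s := 1 / y0 s)) # map (\<lambda>p. (fst p, e (snd p))) ps"
    have e: "(\<Sum>x\<in>insert s S. e c x * G x) = (\<Sum>x\<in>S. c x * (G x - (G s / y0 s) * y0 x))" for c G
    proof -
      have "(\<Sum>x\<in>insert s S. e c x * G x) = (\<Sum>x\<in>S. c x * G x) - (G s / y0 s) * (\<Sum>x\<in>S. c x * y0 x)"
        unfolding e_def upd by simp
      also have "\<dots> = (\<Sum>x\<in>S. c x * (G x - (G s / y0 s) * y0 x))"
        by (simp add: sum_distrib_left sum_subtractf[symmetric] algebra_simps)
      finally show ?thesis .
    qed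
    have "\<forall>x\<in>insert s S. G x = (\<Sum>p\<leftarrow>qs. fst p x * (\<Sum>x'\<in>insert s S. snd p x' * G x'))"
      if G: "\<forall>c. (\<forall>y\<in>Y. (\<Sum>x\<in>insert s S. c x * y x) = 0) \<longrightarrow> (\<Sum>x\<in>insert s S. c x * G x) = 0" for G
    proof -
      define G' where "G' x = G x - (G s / y0 s) * y0 x" for x
      have "(\<Sum>x\<in>S. c x * G' x) = 0" if c: "\<forall>y\<in>?Y. (\<Sum>x\<in>S. c x * y x) = 0" for c
      proof -
        have "(\<Sum>x\<in>insert s S. e c x * y x) = 0" if y: "y \<in> Y" for y
        proof -
          have "(\<lambda>x. y x + (- (y s / y0 s)) * y0 x) \<in> ?Y"
            by (intro CollectI conjI insert.prems[OF y y0(1)]) (simp add: y0(2))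
          from bspec[OF c this] have "(\<Sum>x\<in>S. c x * (y x + (- (y s / y0 s)) * y0 x)) = 0" .
          then show ?thesis unfolding e by simp
        qed
        then have "(\<Sum>x\<in>insert s S. e c x * G x) = 0" using G by blast
        then show ?thesis unfolding e G'_def .
      qed
      then have G': "\<forall>x\<in>S. G' x = (\<Sum>p\<leftarrow>ps. fst p x * (\<Sum>x'\<in>S. snd p x' * G' x'))" by (intro ps(2)) blast
      have qs: "(\<Sum>p\<leftarrow>qs. fst p x * (\<Sum>x'\<in>insert s S. snd p x' * G x'))
         = y0 x * (G s / y0 s) + (\<Sum>p\<leftarrow>ps. fst p x * (\<Sum>x'\<in>S. snd p x' * G' x'))" for x
        unfolding qs_def list.map sum_list.Cons map_map comp_def fst_conv snd_conv e upd G'_def by simp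
      have "(\<Sum>p\<leftarrow>ps. fst p s * (\<Sum>x'\<in>S. snd p x' * G' x')) = 0"
        using ps(1) by (intro sum_list_zero) auto
      then have "G s = y0 s * (G s / y0 s) + (\<Sum>p\<leftarrow>ps. fst p s * (\<Sum>x'\<in>S. snd p x' * G' x'))" using y0(2) by simp
      moreover have "\<forall>x\<in>S. G x = y0 x * (G s / y0 s) + (\<Sum>p\<leftarrow>ps. fst p x * (\<Sum>x'\<in>S. snd p x' * G' x'))"
        using G' by (auto simp: G'_def algebra_simps)
      ultimately show ?thesis by (simp only: qs) blast
    qed
    moreover have "set (map fst qs) \<subseteq> Y" using ps(1) y0(1) by (auto simp: qs_def)
    ultimately show ?thesis by blast
  qed
qed

context quantum_datum
begin

subsection \<open>Leading coefficients\<close>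

definition lead :: "'i weight \<Rightarrow> 'i LFvec \<Rightarrow> 'i ufun" where
  "lead l Z = (\<lambda>y\<in>carrier U. tz l Z 1 (SOME z. y = cls z))"

lemma lead_cls: "Z \<in> carrier (LF l) \<Longrightarrow> lead l Z (cls z) = tz l Z 1 z"
proof -
  assume Z: "Z \<in> carrier (LF l)"
  have "cls z = cls (SOME y. cls z = cls y)" by (rule someI[of _ z]) simp
  then have "(SOME y. cls z = cls y) \<doteq> z" by (simp add: cls_eq_iff I.cong_sym)
  then show ?thesis using tz_right(3)[OF Z] by (simp add: lead_def)
qed

lemma lead_unique: "Z \<in> carrier (LF l) \<Longrightarrow> g \<in> carrier Fmod \<Longrightarrow> (\<And>z. g (cls z) = tz l Z 1 z) \<Longrightarrow> g = lead l Z"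
  by (rule Fmod_eqI) (simp_all add: Fmod_linear(1) lead_cls, simp add: lead_def)

definition word_root :: "'i list \<Rightarrow> 'i weight" where
  "word_root js = (\<chi> i. of_nat (count_list js i))"

lemma word_weight_root: "word_weight n js = (\<Sum>i\<in>UNIV. of_int (n i) * (d i * word_root js $ i))"
proof (induction js)
  case Nil
  show ?case by (simp add: word_root_def)
next
  case (Cons j js)
  have "(\<Sum>i\<in>UNIV. of_int (n i) * (d i * word_root (j # js) $ i))
     = (\<Sum>i\<in>UNIV. of_int (n i) * (d i * word_root js $ i) + (if i = j then of_int (n j) * d j else 0))"
    by (intro sum.cong) (auto simp: word_root_def algebra_simps)
  also have "\<dots> = word_weight n js + of_int (n j) * d j" by (simp add: sum.distrib Cons)
  finally show ?case by simp
qed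

lemma tchar_word_root: "tchar (l - word_root js) n = qpow (- word_weight n js) * tchar l n"
  by (simp add: tchar_def word_weight_root right_diff_distrib sum_subtractf flip: qpow_add)

lemma L_proj_weight: "L_proj l (c *\<^sub>k fword js) \<in> wt_space (L l) (l - word_root js)"
proof -
  note P = presentsD[OF presents_L[of l]]
  have "s \<odot>\<^bsub>L l\<^esub> L_proj l (c *\<^sub>k fword js) = scal (qchar (l - word_root js) s) \<odot>\<^bsub>L l\<^esub> L_proj l (c *\<^sub>k fword js)"
    if s': "s \<in> Tgroup" for s
  proof -
    obtain n where s: "s = cls (tmon n)" using Tgroup_tmon[OF s'] by blast
    let ?q = "qpow (- word_weight n js)"
    have 1: "tmon n * fword js - ?q *\<^sub>k (fword js * tmon n) \<in> verma_kernel l"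
      using I.tmon_fword[of n js] relator_ideal_verma by (auto simp: I.qcommute_def I.cong_def)
    have 2: "?q *\<^sub>k (fword js * tmon n - tchar l n *\<^sub>k fword js) \<in> verma_kernel l"
      by (intro left_idealD(4)[OF verma_kernel_left_ideal] verma_tmon_scalar)
    have "(tmon n * fword js - ?q *\<^sub>k (fword js * tmon n)) + ?q *\<^sub>k (fword js * tmon n - tchar l n *\<^sub>k fword js) \<in> verma_kernel l"
      by (rule left_idealD(2)[OF verma_kernel_left_ideal 1 2])
    then have "tmon n * fword js - (?q * tchar l n) *\<^sub>k fword js \<in> verma_kernel l"
      by (simp only: smul_diff_right smul_smul) simp
    from left_idealD(4)[OF verma_kernel_left_ideal this, of c]
    have "tmon n * (c *\<^sub>k fword js) - (?q * tchar l n) *\<^sub>k (c *\<^sub>k fword js) \<in> verma_kernel l"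
      by (simp add: smul_diff_right mult.commute)
    then have "L_proj l (tmon n * (c *\<^sub>k fword js)) = L_proj l ((?q * tchar l n) *\<^sub>k (c *\<^sub>k fword js))"
      unfolding P(3) using verma_kernel_radical by blast
    then show ?thesis unfolding s P(6) qchar_tmon tchar_word_root P(7) .
  qed
  then show ?thesis unfolding wt_space_def P(2) by blast
qed

lemma wt_less_word_root: "js \<noteq> [] \<Longrightarrow> wt_less (l - word_root js) l"
proof -
  assume js: "js \<noteq> []"
  have "word_root js = (\<Sum>i\<in>UNIV. of_nat (count_list js i) *s simple_root i)"
    by (simp add: vec_eq_iff word_root_def simple_root_def axis_def if_distrib[of "(*) _"] cong: if_cong)
  then have "word_root js \<in> root_cone" unfolding root_cone_def by blast
  moreover have "word_root js $ hd js \<noteq> 0" using js by (cases js) (simp_all add: word_root_def)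
  then have "word_root js \<noteq> 0" by auto
  ultimately show ?thesis by (simp add: wt_less_def wt_le_def)
qed

text \<open>On a vector of weight m the pairing with 1 satisfies q^{d_i l_i} x = q^{d_i m_i} x for
  its value x, comparing t_i on both sides; hence x = 0 if some l_i differs from m_i.\<close>

lemma lower_part_tz: "r \<in> lower_part l \<Longrightarrow> r \<in> carrier (LF l) \<and> (\<forall>z. tz l r 1 z = 0)"
proof -
  let ?W = "{r \<in> carrier (LF l). \<forall>z. tz l r 1 z = 0}"
  have "?W \<in> ksubspaces (LF l)"
    unfolding ksubspaces_def
    by (auto simp: LF_zero_closed tz_zero tz_add tz_scal LF_D(1,7))
  moreover have "{pure_tensor (L l) Fmod v g | m v g. wt_less m l \<and> v \<in> wt_space (L l) m \<and> g \<in> carrier Fmod} \<subseteq> ?W"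
  proof clarify
    fix m v g assume m: "wt_less m l" and v: "v \<in> wt_space (L l) m" and g: "g \<in> carrier Fmod"
    have vL: "v \<in> carrier (L l)" using v by (simp add: wt_space_def)
    then obtain x where x: "v = L_proj l x" by (rule carrier_LE)
    have "m \<noteq> l" using m by (simp add: wt_less_def)
    then obtain i where i: "m $ i \<noteq> l $ i" by (auto simp: vec_eq_iff)
    have q: "qchar m (t i) = qpow (d i * m $ i)" for m
      using qchar_cls[of "gen (GT i)" m] vev_T_right[of m 1 i]
      by (simp add: t_def gen_in_word_span)
    have "t i \<odot>\<^bsub>L l\<^esub> v = scal (qchar m (t i)) \<odot>\<^bsub>L l\<^esub> v" using v T_in_Tgroup by (auto simp: wt_space_def)
    then have "L_proj l (gen (GT i) * x) = L_proj l (qpow (d i * m $ i) *\<^sub>k x)"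
      unfolding q x unfolding t_def presentsD(6,7)[OF presents_L] .
    then have "pair_L l 1 (L_proj l (gen (GT i) * x)) = pair_L l 1 (L_proj l (qpow (d i * m $ i) *\<^sub>k x))" by simp
    then have "qpow (d i * l $ i) * vev l x = qpow (d i * m $ i) * vev l x"
      by (simp add: pair_L_proj vev_T_left vev_smul)
    then have "vev l x = 0" using i by simp
    then show "pure_tensor (L l) Fmod v g \<in> carrier (LF l) \<and> (\<forall>z. tz l (pure_tensor (L l) Fmod v g) 1 z = 0)"
      using pure_tensor_closed[OF vL g] by (simp add: tz_pure_tensor x pair_L_proj)
  qed
  ultimately have "lower_part l \<subseteq> ?W" unfolding lower_part_def by (rule kspan_minimal)
  then show "r \<in> lower_part l \<Longrightarrow> r \<in> carrier (LF l) \<and> (\<forall>z. tz l r 1 z = 0)" by blast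
qed

lemma lower_part_closed:
  "\<zero>\<^bsub>LF l\<^esub> \<in> lower_part l" "r \<in> lower_part l \<Longrightarrow> r' \<in> lower_part l \<Longrightarrow> r \<oplus>\<^bsub>LF l\<^esub> r' \<in> lower_part l"
  unfolding lower_part_def by (auto intro: kspan_zero kspan_add)

abbreviation leading_form :: "'i weight \<Rightarrow> 'i LFvec \<Rightarrow> bool" where
  "leading_form l Z \<equiv> \<exists>g\<in>carrier Fmod. \<exists>r\<in>lower_part l. Z = pure_tensor (L l) Fmod (L_vec l) g \<oplus>\<^bsub>LF l\<^esub> r"

lemma L_proj_closed: "L_proj l x \<in> carrier (L l)"
  unfolding presentsD(2)[OF presents_L] by simp

lemma L_vec_closed: "L_vec l \<in> carrier (L l)"
  unfolding L_vec_eq presentsD(2)[OF presents_L] by simp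

lemma leading_form_add:
  assumes "leading_form l Z" "leading_form l Z'" shows "leading_form l (Z \<oplus>\<^bsub>LF l\<^esub> Z')"
proof -
  let ?p = "pure_tensor (L l) Fmod (L_vec l)"
  obtain g r where g: "g \<in> carrier Fmod" "r \<in> lower_part l" "Z = ?p g \<oplus>\<^bsub>LF l\<^esub> r" using assms(1) by blast
  obtain g' r' where g': "g' \<in> carrier Fmod" "r' \<in> lower_part l" "Z' = ?p g' \<oplus>\<^bsub>LF l\<^esub> r'" using assms(2) by blast
  note closed = pure_tensor_closed[OF L_vec_closed[of l]] g g' Fmod_add_closed[OF g(1) g'(1)]
    conjunct1[OF lower_part_tz[OF g(2)]] conjunct1[OF lower_part_tz[OF g'(2)]]
    conjunct1[OF lower_part_tz[OF lower_part_closed(2)[OF g(2) g'(2)]]] LF_D(1)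
  have "Z \<oplus>\<^bsub>LF l\<^esub> Z' = ?p (g \<oplus>\<^bsub>Fmod\<^esub> g') \<oplus>\<^bsub>LF l\<^esub> (r \<oplus>\<^bsub>LF l\<^esub> r')"
    by (rule tz_inj[where l=l]) (simp_all add: closed tz_add tz_pure_tensor Fmod_add_cls algebra_simps)
  then show ?thesis using closed lower_part_closed(2) by blast
qed

text \<open>First tensor factors are represented by f-words: the empty word contributes to the
  leading term and every other word lies in a strictly lower weight space.\<close>

lemma leading_form_exists: "Z \<in> carrier (LF l) \<Longrightarrow> leading_form l Z"
proof -
  note P = presentsD[OF presents_L[of l]]
  let ?p = "pure_tensor (L l) Fmod"
  have lf0: "leading_form l \<zero>\<^bsub>LF l\<^esub>"
  proof (intro bexI)
    show "\<zero>\<^bsub>LF l\<^esub> = ?p (L_vec l) \<zero>\<^bsub>Fmod\<^esub> \<oplus>\<^bsub>LF l\<^esub> \<zero>\<^bsub>LF l\<^esub>"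
      by (rule tz_inj[where l=l])
        (simp_all add: LF_zero_closed LF_D(1) pure_tensor_closed L_vec_closed Fmod_zero_closed tz_zero tz_add tz_pure_tensor Fmod_zero_cls)
  qed (simp_all add: lower_part_closed Fmod_zero_closed)
  have pure: "leading_form l (?p (L_proj l y) g)" if y: "y \<in> f_span" and g: "g \<in> carrier Fmod" for y g
    using y
  proof (induction rule: f_span_induct)
    case zero
    have "?p (L_proj l 0) g = \<zero>\<^bsub>LF l\<^esub>"
      by (rule tz_inj[where l=l]) (simp_all add: LF_zero_closed pure_tensor_closed L_proj_closed g tz_zero tz_pure_tensor pair_L_proj)
    then show ?case using lf0 by simp
  next
    case (word c js)
    show ?case
    proof (cases "js = []")
      case True
      have "?p (L_proj l (c *\<^sub>k fword js)) g = ?p (L_vec l) (scal c \<odot>\<^bsub>Fmod\<^esub> g) \<oplus>\<^bsub>LF l\<^esub> \<zero>\<^bsub>LF l\<^esub>"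
        by (rule tz_inj[where l=l])
          (simp_all add: True L_vec_eq LF_zero_closed LF_D(1) pure_tensor_closed L_proj_closed g Fmod_scal_closed Fmod_scal_cls
            tz_zero tz_add tz_pure_tensor pair_L_proj vev_smul)
      then show ?thesis using Fmod_scal_closed[OF g] lower_part_closed(1) by blast
    next
      case False
      have low: "?p (L_proj l (c *\<^sub>k fword js)) g \<in> lower_part l"
        unfolding lower_part_def
        by (rule kspan_base) (use wt_less_word_root[OF False] L_proj_weight g in blast)
      have "?p (L_proj l (c *\<^sub>k fword js)) g = ?p (L_vec l) \<zero>\<^bsub>Fmod\<^esub> \<oplus>\<^bsub>LF l\<^esub> ?p (L_proj l (c *\<^sub>k fword js)) g"
        by (rule tz_inj[where l=l])
          (simp_all add: LF_D(1) pure_tensor_closed L_proj_closed g L_vec_closed Fmod_zero_closed tz_add tz_pure_tensor Fmod_zero_cls)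
      then show ?thesis using low Fmod_zero_closed by blast
    qed
  next
    case (add x y)
    have "?p (L_proj l (x + y)) g = ?p (L_proj l x) g \<oplus>\<^bsub>LF l\<^esub> ?p (L_proj l y) g"
      by (rule tz_inj[where l=l])
        (simp_all add: LF_D(1) pure_tensor_closed L_proj_closed g tz_add tz_pure_tensor pair_L_proj distrib_left distrib_right vev_add)
    then show ?case using leading_form_add[OF add(3,4)] by simp
  qed
  have "leading_form l (tcls (L l) Fmod Q)" if "Q \<in> formal (L l) Fmod" for Q
    using that
  proof (induction rule: formal_induct)
    case zero
    show ?case using lf0 by (simp add: tensor_module_simps)
  next
    case (single v g c)
    obtain x where x: "v = L_proj l x" using single(1) by (rule carrier_LE)
    obtain y where y: "y \<in> f_span" "x - y \<in> verma_kernel l" using verma_f_span[of x l] by (elim bexE)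
    have "v = L_proj l y" unfolding x P(3) using y(2) verma_kernel_radical by blast
    moreover have "tcls (L l) Fmod (Poly_Mapping.single (L_proj l y, g) c) = ?p (L_proj l y) (scal c \<odot>\<^bsub>Fmod\<^esub> g)"
      by (rule tz_inj[where l=l])
        (simp_all add: tensor_module_simps formal_single L_proj_closed single pure_tensor_closed[simplified tensor_module_simps]
          Fmod_scal_closed tz_tcls tval_single tz_pure_tensor Fmod_scal_cls)
    ultimately show ?case using pure[OF y(1) Fmod_scal_closed[OF single(2)]] by simp
  next
    case (add P Q)
    then show ?case using leading_form_add[OF add(3,4)] by (simp add: tensor_module_simps tensor_add_tcls)
  qed
  then show "Z \<in> carrier (LF l) \<Longrightarrow> leading_form l Z" by (auto elim: LF_E)
qed

lemma leading_coeff_iff: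
  assumes "\<phi> (L_vec l) \<in> carrier (LF l)"
  shows "leading_coeff l \<phi> g \<longleftrightarrow> g = lead l (\<phi> (L_vec l))"
proof -
  have unique: "g = lead l (\<phi> (L_vec l))" if lc: "leading_coeff l \<phi> g" for g
  proof -
    obtain r where g: "g \<in> carrier Fmod" and r: "r \<in> lower_part l" "\<phi> (L_vec l) = pure_tensor (L l) Fmod (L_vec l) g \<oplus>\<^bsub>LF l\<^esub> r"
      using lc by (auto simp: leading_coeff_def)
    have "g (cls z) = tz l (\<phi> (L_vec l)) 1 z" for z
      unfolding r(2) using lower_part_tz[OF r(1)] pure_tensor_closed[OF L_vec_closed g]
      by (simp add: tz_add tz_pure_tensor L_vec_eq pair_L_proj)
    with g show ?thesis by (intro lead_unique[OF assms])
  qed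
  obtain g' where "leading_coeff l \<phi> g'"
    using leading_form_exists[OF assms] unfolding leading_coeff_def by blast
  with unique show ?thesis by blast
qed

text \<open>\<open>lead\<close> is a mere function given by coordinates; that it belongs to F
  follows from the decomposition with a coefficient in F.\<close>

lemma lead_closed: "Z \<in> carrier (LF l) \<Longrightarrow> lead l Z \<in> carrier Fmod"
proof -
  assume Z: "Z \<in> carrier (LF l)"
  obtain g r where g: "g \<in> carrier Fmod" "r \<in> lower_part l" "Z = pure_tensor (L l) Fmod (L_vec l) g \<oplus>\<^bsub>LF l\<^esub> r"
    using leading_form_exists[OF Z] by blast
  have "g (cls z) = tz l Z 1 z" for z
    unfolding g(3) using lower_part_tz[OF g(2)] pure_tensor_closed[OF L_vec_closed g(1)]
    by (simp add: tz_add tz_pure_tensor L_vec_eq pair_L_proj)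
  from lead_unique[OF Z g(1) this] g(1) show ?thesis by simp
qed

lemma Theta_eq: "\<phi> (L_vec l) \<in> carrier (LF l) \<Longrightarrow> Theta l \<phi> = lead l (\<phi> (L_vec l))"
  unfolding Theta_def by (rule the_equality) (simp_all add: leading_coeff_iff)

subsection \<open>Invariant vectors of the function algebra\<close>

text \<open>The character of weight 0 is trivial, so weight 0 means invariance under right
  translation by the torus.\<close>

lemma F0_iff: "g \<in> F0 \<longleftrightarrow> g \<in> carrier Fmod \<and> (\<forall>n z. g (cls (z * tmon n)) = g (cls z))"
proof -
  have q: "qchar 0 (cls (tmon n)) = 1" for n by (simp add: qchar_tmon tchar_def)
  have ext: "u \<odot>\<^bsub>Fmod\<^esub> g \<in> extensional (carrier U)" for u g by (simp add: Fmod_simps)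
  have act: "cls (tmon n) \<odot>\<^bsub>Fmod\<^esub> g = scal (qchar 0 (cls (tmon n))) \<odot>\<^bsub>Fmod\<^esub> g \<longleftrightarrow> (\<forall>z. g (cls (z * tmon n)) = g (cls z))"
    if g: "g \<in> carrier Fmod" for n
  proof
    assume "cls (tmon n) \<odot>\<^bsub>Fmod\<^esub> g = scal (qchar 0 (cls (tmon n))) \<odot>\<^bsub>Fmod\<^esub> g"
    then have "(cls (tmon n) \<odot>\<^bsub>Fmod\<^esub> g) (cls z) = (scal 1 \<odot>\<^bsub>Fmod\<^esub> g) (cls z)" for z by (simp add: q)
    then show "\<forall>z. g (cls (z * tmon n)) = g (cls z)" by (simp add: Fmod_smult_cls Fmod_scal_cls g)
  next
    assume "\<forall>z. g (cls (z * tmon n)) = g (cls z)"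
    then show "cls (tmon n) \<odot>\<^bsub>Fmod\<^esub> g = scal (qchar 0 (cls (tmon n))) \<odot>\<^bsub>Fmod\<^esub> g"
      unfolding q by (intro Fmod_eqI ext) (simp add: Fmod_smult_cls Fmod_scal_cls g)
  qed
  show ?thesis
  proof
    assume "g \<in> F0"
    then have g: "g \<in> carrier Fmod" and s: "\<forall>s\<in>Tgroup. s \<odot>\<^bsub>Fmod\<^esub> g = scal (qchar 0 s) \<odot>\<^bsub>Fmod\<^esub> g"
      by (simp_all add: F0_def wt_space_def)
    have T: "g (cls (z * gen (GT i))) = g (cls z)" for z i
    proof -
      have "gen (GT i) = tmon (\<lambda>j. if j = i then 1 else 0)" by (simp only: tmon_single gen_T_power_1)
      then show ?thesis using act[OF g] s T_in_Tgroup[of i] by (metis t_def)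
    qed
    have Tinv: "g (cls (z * gen (GTinv i))) = g (cls z)" for z i
    proof -
      have "cls (z * gen (GTinv i) * gen (GT i)) = cls (z * 1)"
        unfolding cls_eq_iff mult.assoc by (intro I.cong_mult_left I.T_inv)
      then show ?thesis using T[of "z * gen (GTinv i)" i] by simp
    qed
    have "g (cls (z * gen h ^ m)) = g (cls z)" if "\<And>z. g (cls (z * gen h)) = g (cls z)" for z h m
      using that by (induction m arbitrary: z) (simp_all add: mult.assoc[symmetric])
    then have "g (cls (z * gen_T_power i m)) = g (cls z)" for z i m
      using T Tinv by (simp add: gen_T_power_def)
    then have "g (cls (z * prod_list (map (\<lambda>j. gen_T_power j (n j)) js))) = g (cls z)" for z n js
      by (induction js arbitrary: z) (simp_all add: mult.assoc[symmetric])
    then show "g \<in> carrier Fmod \<and> (\<forall>n z. g (cls (z * tmon n)) = g (cls z))" using g by (simp add: tmon_def)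
  next
    assume g: "g \<in> carrier Fmod \<and> (\<forall>n z. g (cls (z * tmon n)) = g (cls z))"
    have "s \<odot>\<^bsub>Fmod\<^esub> g = scal (qchar 0 s) \<odot>\<^bsub>Fmod\<^esub> g" if "s \<in> Tgroup" for s
      using Tgroup_tmon[OF that] act g by auto
    then show "g \<in> F0" using g by (simp add: F0_def wt_space_def)
  qed
qed

lemma Kpos_eq: "Kpos l = cls ` {x \<in> e_span. \<forall>ms. vev l (free_antipode a x * fword ms) = 0}"
proof -
  have f: "(\<forall>y\<in>f_span. vev l (free_antipode a x * y) = 0) \<longleftrightarrow> (\<forall>ms. vev l (free_antipode a x * fword ms) = 0)" for x
  proof
    assume ms: "\<forall>ms. vev l (free_antipode a x * fword ms) = 0"
    have "vev l (free_antipode a x * y) = 0" if "y \<in> f_span" for y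
      using that by (induction rule: f_span_induct) (simp_all add: ms vev_smul distrib_left vev_add)
    then show "\<forall>y\<in>f_span. vev l (free_antipode a x * y) = 0" by blast
  qed (use fword_in_f_span in blast)
  have "Kpos l = {v \<in> cls ` e_span. \<forall>y\<in>f_span. pi_form l v (cls y) = 0}"
    unfolding Kpos_def Upos_eq Uneg_eq by simp
  also have "\<dots> = cls ` {x \<in> e_span. \<forall>y\<in>f_span. pi_form l (cls x) (cls y) = 0}" by auto
  finally show ?thesis unfolding pi_form_cls f .
qed

lemma annihilated_iff:
  "g \<in> carrier Fmod \<Longrightarrow> cls u \<odot>\<^bsub>Fmod\<^esub> g = \<zero>\<^bsub>Fmod\<^esub> \<longleftrightarrow> (\<forall>z. g (cls (z * u)) = 0)"
proof
  assume "cls u \<odot>\<^bsub>Fmod\<^esub> g = \<zero>\<^bsub>Fmod\<^esub>"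
  then have "(cls u \<odot>\<^bsub>Fmod\<^esub> g) (cls z) = \<zero>\<^bsub>Fmod\<^esub> (cls z)" for z by simp
  then show "\<forall>z. g (cls (z * u)) = 0" by (simp only: Fmod_smult_cls Fmod_zero_cls) simp
next
  assume "\<forall>z. g (cls (z * u)) = 0"
  then show "cls u \<odot>\<^bsub>Fmod\<^esub> g = \<zero>\<^bsub>Fmod\<^esub>"
    by (intro Fmod_eqI) (simp_all only: Fmod_smult_cls Fmod_zero_cls, simp_all add: Fmod_simps)
qed

lemma F0_annihilated_iff:
  "g \<in> F0_annihilated (Kneg l \<union> Kpos l) \<longleftrightarrow> g \<in> F0 \<and>
     (\<forall>y\<in>f_span \<inter> radical l. \<forall>z. g (cls (z * y)) = 0) \<and>
     (\<forall>x\<in>e_span. (\<forall>ms. vev l (free_antipode a x * fword ms) = 0) \<longrightarrow> (\<forall>z. g (cls (z * x)) = 0))"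
proof -
  have "g \<in> F0_annihilated (Kneg l \<union> Kpos l) \<longleftrightarrow> g \<in> F0 \<and>
     (\<forall>y\<in>f_span \<inter> radical l. cls y \<odot>\<^bsub>Fmod\<^esub> g = \<zero>\<^bsub>Fmod\<^esub>) \<and>
     (\<forall>x\<in>{x \<in> e_span. \<forall>ms. vev l (free_antipode a x * fword ms) = 0}. cls x \<odot>\<^bsub>Fmod\<^esub> g = \<zero>\<^bsub>Fmod\<^esub>)"
    unfolding F0_annihilated_def Kneg_eq Kpos_eq by (simp only: mem_Collect_eq ball_Un ball_simps)
  moreover have "g \<in> F0 \<Longrightarrow> g \<in> carrier Fmod" by (simp add: F0_iff)
  ultimately show ?thesis using annihilated_iff[of g] by auto
qed

end

context quantum_datum
begin

subsection \<open>The pairing on the tensor product\<close>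

lemma tz_act_add:
  "Z \<in> carrier (LF l) \<Longrightarrow> tz l (cls (x + y) \<odot>\<^bsub>LF l\<^esub> Z) u z = tz l (cls x \<odot>\<^bsub>LF l\<^esub> Z) u z + tz l (cls y \<odot>\<^bsub>LF l\<^esub> Z) u z"
  by (simp add: LF_D(2,4) tz_add)

lemma tz_act_smul: "Z \<in> carrier (LF l) \<Longrightarrow> tz l (cls (c *\<^sub>k x) \<odot>\<^bsub>LF l\<^esub> Z) u z = c * tz l (cls x \<odot>\<^bsub>LF l\<^esub> Z) u z"
proof -
  assume Z: "Z \<in> carrier (LF l)"
  have "cls (c *\<^sub>k x) \<odot>\<^bsub>LF l\<^esub> Z = scal c \<odot>\<^bsub>LF l\<^esub> (cls x \<odot>\<^bsub>LF l\<^esub> Z)"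
    using LF_D(5)[OF Z, of "c *\<^sub>k 1" x] by (simp add: scal_eq)
  then show ?thesis by (simp add: tz_scal LF_D(2)[OF Z])
qed

lemma act_cls_0: "Z \<in> carrier (LF l) \<Longrightarrow> cls 0 \<odot>\<^bsub>LF l\<^esub> Z = \<zero>\<^bsub>LF l\<^esub>"
  using tz_act_smul[of Z l 0 0] by (intro tz_inj[where l=l]) (simp_all add: LF_D(2) LF_zero_closed tz_zero)

definition vanishing :: "'i weight \<Rightarrow> 'i LFvec \<Rightarrow> 'i falg set" where
  "vanishing l Z = {x. cls x \<odot>\<^bsub>LF l\<^esub> Z = \<zero>\<^bsub>LF l\<^esub>}"

lemma vanishing_iff: "Z \<in> carrier (LF l) \<Longrightarrow> x \<in> vanishing l Z \<longleftrightarrow> (\<forall>u z. tz l (cls x \<odot>\<^bsub>LF l\<^esub> Z) u z = 0)"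
  unfolding vanishing_def using tz_inj[OF LF_D(2) LF_zero_closed] by (auto simp: tz_zero)

lemma vanishing_left_ideal:
  assumes Z: "Z \<in> carrier (LF l)" shows "left_ideal (vanishing l Z)"
proof -
  have "u * x \<in> vanishing l Z" if "x \<in> vanishing l Z" for u x
  proof -
    have "cls x \<odot>\<^bsub>LF l\<^esub> Z = cls 0 \<odot>\<^bsub>LF l\<^esub> Z" using that by (simp add: vanishing_def act_cls_0[OF Z])
    then have "cls (u * x) \<odot>\<^bsub>LF l\<^esub> Z = cls (u * 0) \<odot>\<^bsub>LF l\<^esub> Z" unfolding LF_D(5)[OF Z] by simp
    then show ?thesis by (simp add: vanishing_def act_cls_0[OF Z])
  qed
  moreover have "0 \<in> vanishing l Z" by (simp add: vanishing_def act_cls_0[OF Z])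
  ultimately show ?thesis unfolding left_ideal_def by (simp add: vanishing_iff[OF Z] tz_act_add[OF Z])
qed

text \<open>Since \<open>\<Delta> f\<^sub>i = f\<^sub>i \<otimes> k\<^sub>i\<^sup>-\<^sup>1 + 1 \<otimes> f\<^sub>i\<close> and the functional \<open>x \<mapsto> q\<^sup>\<lambda>((x)\<^sub>0)\<close> kills \<open>f\<^sub>i U\<close>, only
  the second tensor factor feels \<open>U\<^sup>-\<close>.\<close>

lemma tz_lower:
  assumes Z: "Z \<in> carrier (LF l)"
  shows "y \<in> f_span \<Longrightarrow> tz l (cls y \<odot>\<^bsub>LF l\<^esub> Z) 1 z = tz l Z 1 (z * y)"
proof (induction rule: f_span_induct)
  case zero
  show ?case using tz_right(2)[OF Z, where u = 1 and c = 0 and z = 1] by (simp add: act_cls_0[OF Z] tz_zero)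
next
  case (word c js)
  have "tz l (cls (fword js) \<odot>\<^bsub>LF l\<^esub> Z) 1 z = tz l Z 1 (z * fword js)" for z
  proof (induction js arbitrary: z)
    case Nil
    show ?case by (simp add: LF_D(6)[OF Z])
  next
    case (Cons j js)
    have "tz l (cls (fword (j # js)) \<odot>\<^bsub>LF l\<^esub> Z) 1 z = tz l (cls (gen (GF j)) \<odot>\<^bsub>LF l\<^esub> (cls (fword js) \<odot>\<^bsub>LF l\<^esub> Z)) 1 z"
      by (simp add: word_Cons LF_D(5)[OF Z])
    also have "\<dots> = tz l (cls (fword js) \<odot>\<^bsub>LF l\<^esub> Z) 1 (z * gen (GF j))"
      using tz_left(4)[OF LF_D(2)[OF Z], where u = 1] by (simp add: tz_F LF_D(2)[OF Z])
    also have "\<dots> = tz l Z 1 (z * fword (j # js))" by (simp add: Cons word_Cons mult.assoc)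
    finally show ?case .
  qed
  then show ?case by (simp add: tz_act_smul[OF Z] tz_right[OF Z])
next
  case (add x y)
  then show ?case by (simp add: tz_act_add[OF Z] tz_right[OF Z] distrib_left)
qed

text \<open>Dually, on a highest weight vector the action of \<open>U\<^sup>+\<close> on the second factor can be moved to
  the first one through the antipode.\<close>

lemma tz_raise:
  assumes Z: "Z \<in> carrier (LF l)" and E: "\<And>i. cls (gen (GE i)) \<odot>\<^bsub>LF l\<^esub> Z = \<zero>\<^bsub>LF l\<^esub>"
  shows "x \<in> e_span \<Longrightarrow> tz l Z (free_antipode a x) z = tz l Z 1 (z * x)"
proof (induction rule: e_span_induct)
  case zero
  show ?case using tz_right(2)[OF Z, where u = 1 and c = 0 and z = 1] tz_left(2)[OF Z, where u = 1 and c = 0 and z = z] by (simp add: free_antipode_0)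
next
  case (word c ks)
  have step: "tz l Z (u * free_antipode a (gen (GE i))) z = tz l Z u (z * gen (GE i))" for u z i
  proof -
    let ?S = "free_antipode a (gen (GE i))" and ?v = "u * gen_Kinv a i"
    have "?v * gen_K a i \<doteq> u * 1"
      unfolding gen_K_eq mult.assoc by (intro I.cong_mult_left I.tmon_inv)
    then have v: "?v * gen_K a i \<doteq> u" by simp
    have "tz l Z (?v * gen (GE i)) z = tz l Z (?v * (- (gen_K a i * ?S))) z"
      by (intro tz_left(3)[OF Z] I.cong_mult_left antipode_E)
    also have "\<dots> = - tz l Z (?v * gen_K a i * ?S) z" by (simp add: tz_left(6)[OF Z] mult.assoc)
    also have "\<dots> = - tz l Z (u * ?S) z" using tz_left(3)[OF Z I.cong_mult_right[OF v]] by simp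
    finally have "tz l Z (?v * gen (GE i)) z = - tz l Z (u * ?S) z" .
    moreover have "tz l Z (?v * gen_K a i) (z * gen (GE i)) = tz l Z u (z * gen (GE i))"
      by (rule tz_left(3)[OF Z v])
    moreover have "tz l Z (?v * gen (GE i)) z + tz l Z (?v * gen_K a i) (z * gen (GE i)) = 0"
      using tz_E[OF Z, of i ?v z] by (simp add: E tz_zero)
    ultimately show ?thesis by simp
  qed
  have "tz l Z (free_antipode a (eword ks)) z = tz l Z 1 (z * eword ks)" for z
  proof (induction ks arbitrary: z)
    case Nil
    show ?case by (simp add: free_antipode_1)
  next
    case (Cons k ks)
    then show ?case by (simp add: word_Cons free_antipode_mult step mult.assoc)
  qed
  then show ?case by (simp add: free_antipode_smul tz_left[OF Z] tz_right[OF Z])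
next
  case (add x y)
  then show ?case by (simp add: free_antipode_add tz_left[OF Z] tz_right[OF Z] distrib_left)
qed

text \<open>L(\<lambda>) is spanned by f-words applied to the highest weight vector, so the
  hypothesis makes the first factor of every pure tensor pair to zero.\<close>

lemma tz_antipode_zero:
  assumes Z: "Z \<in> carrier (LF l)" and x: "\<And>ms. vev l (free_antipode a x * fword ms) = 0"
  shows "tz l Z (free_antipode a x) z = 0"
proof -
  have f: "vev l (free_antipode a x * y) = 0" if "y \<in> f_span" for y
    using that by (induction rule: f_span_induct) (simp_all add: x vev_smul distrib_left vev_add)
  have v: "pair_L l (free_antipode a x) (L_proj l w) = 0" for w
  proof -
    obtain y where y: "y \<in> f_span" "w - y \<in> verma_kernel l" using verma_f_span[of w l] by (elim bexE)
    have "w - y \<in> radical l" using y(2) verma_kernel_radical by blast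
    then have "vev l (free_antipode a x * (w - y)) = 0" by (simp add: radical_def)
    then show ?thesis using f[OF y(1)] by (simp add: pair_L_proj right_diff_distrib vev_diff)
  qed
  have "tval l (free_antipode a x) z P = 0" if "P \<in> formal (L l) Fmod" for P
    using that by (induction rule: formal_induct) (auto elim!: carrier_LE simp: tval_single tval_add v)
  with Z show ?thesis by (auto elim!: LF_E simp: tz_tcls)
qed

text \<open>The elements \<open>e\<^sub>i\<close>, \<open>f\<^sub>i\<close> and \<open>t\<close> acting on the tensor product recover the pairing at \<open>ue\<^sub>i\<close>,
  \<open>uf\<^sub>i\<close> and \<open>ut\<close> from its values at \<open>u\<close>; so inside a submodule the pairing at \<open>u = 1\<close> determines
  everything.\<close>

lemma tz_determined:
  assumes closed: "\<And>Z Z'. (Z, Z') \<in> N \<Longrightarrow> Z \<in> carrier (LF l) \<and> Z' \<in> carrier (LF l)"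
    and act: "\<And>Z Z' x. (Z, Z') \<in> N \<Longrightarrow> (cls x \<odot>\<^bsub>LF l\<^esub> Z, cls x \<odot>\<^bsub>LF l\<^esub> Z') \<in> N"
    and one: "\<And>Z Z' z. (Z, Z') \<in> N \<Longrightarrow> tz l Z 1 z = tz l Z' 1 z"
    and ZZ': "(Z, Z') \<in> N"
  shows "Z = Z'"
proof -
  \<comment> \<open>Pairs of vectors, rather than single ones, let the same argument serve for the
    equality of two homomorphisms and for the vanishing of a submodule.\<close>
  define same where "same u \<longleftrightarrow> (\<forall>(Z, Z')\<in>N. \<forall>z. tz l Z u z = tz l Z' u z)" for u
  have tmon: "same (u * tmon n)" if u: "same u" for u n
    unfolding same_def
  proof clarify
    fix Z Z' z assume N: "(Z, Z') \<in> N"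
    note c = conjunct1[OF closed[OF N]] conjunct2[OF closed[OF N]]
    \<comment> \<open>Since t acts on both tensor factors, evaluating at z t^{-1} undoes its effect
      on the second one.\<close>
    have "z * tmon (\<lambda>j. - n j) * tmon n \<doteq> z * 1"
      unfolding mult.assoc by (intro I.cong_mult_left I.tmon_inv)
    then have z: "z * tmon (\<lambda>j. - n j) * tmon n \<doteq> z" by simp
    have "tz l (cls (tmon n) \<odot>\<^bsub>LF l\<^esub> Z) u (z * tmon (\<lambda>j. - n j)) = tz l (cls (tmon n) \<odot>\<^bsub>LF l\<^esub> Z') u (z * tmon (\<lambda>j. - n j))"
      using u act[OF N] by (auto simp: same_def)
    then show "tz l Z (u * tmon n) z = tz l Z' (u * tmon n) z"
      using tz_right(3)[OF c(1) z] tz_right(3)[OF c(2) z] by (simp add: tz_tmon c)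
  qed
  have "same u" for u
  proof (induction u rule: generator_induct_right)
    case one
    show ?case using assms(3) by (auto simp: same_def)
  next
    case (gen g u)
    show ?case
    proof (cases g)
      case (GT i)
      then show ?thesis
        using tmon[OF gen, of "\<lambda>j. if j = i then 1 else 0"] by (simp only: tmon_single gen_T_power_1)
    next
      case (GTinv i)
      then show ?thesis
        using tmon[OF gen, of "\<lambda>j. if j = i then - 1 else 0"] by (simp only: tmon_single gen_T_power_minus_1)
    next
      case (GE i)
      show ?thesis
        unfolding same_def
      proof clarify
        fix Z Z' z assume N: "(Z, Z') \<in> N"
        note c = conjunct1[OF closed[OF N]] conjunct2[OF closed[OF N]]
        have "tz l (cls (gen (GE i)) \<odot>\<^bsub>LF l\<^esub> Z) u z = tz l (cls (gen (GE i)) \<odot>\<^bsub>LF l\<^esub> Z') u z"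
          using gen act[OF N] by (auto simp: same_def)
        moreover have "tz l Z (u * gen_K a i) (z * gen (GE i)) = tz l Z' (u * gen_K a i) (z * gen (GE i))"
          using tmon[OF gen] N unfolding gen_K_eq same_def by blast
        ultimately show "tz l Z (u * gen g) z = tz l Z' (u * gen g) z" by (simp add: tz_E c GE)
      qed
    next
      case (GF i)
      show ?thesis
        unfolding same_def
      proof clarify
        fix Z Z' z assume N: "(Z, Z') \<in> N"
        note c = conjunct1[OF closed[OF N]] conjunct2[OF closed[OF N]]
        let ?z = "z * gen_K a i"
        have "?z * gen_Kinv a i \<doteq> z * 1"
          unfolding gen_K_eq mult.assoc by (intro I.cong_mult_left I.tmon_inv)
        then have z: "?z * gen_Kinv a i \<doteq> z" by simp
        have "tz l (cls (gen (GF i)) \<odot>\<^bsub>LF l\<^esub> Z) u ?z = tz l (cls (gen (GF i)) \<odot>\<^bsub>LF l\<^esub> Z') u ?z"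
          using gen act[OF N] by (auto simp: same_def)
        moreover have "tz l Z u (?z * gen (GF i)) = tz l Z' u (?z * gen (GF i))"
          using gen N by (auto simp: same_def)
        ultimately show "tz l Z (u * gen g) z = tz l Z' (u * gen g) z"
          using tz_right(3)[OF c(1) z] tz_right(3)[OF c(2) z] by (simp add: tz_F c GF)
      qed
    qed
  next
    case (smul c u)
    then show ?case using closed unfolding same_def by (fastforce simp: tz_left(2))
  next
    case (add u u')
    then show ?case using closed unfolding same_def by (fastforce simp: tz_left(1))
  qed
  then have "tz l Z u z = tz l Z' u z" for u z using ZZ' by (fastforce simp: same_def)
  then show ?thesis using closed[OF ZZ'] by (intro tz_inj[where l=l]) simp_all
qed

subsection \<open>The leading coefficient map\<close>

lemma HomLFD:
  assumes "\<phi> \<in> HomLF l"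
  shows "\<phi> (L_proj l x) \<in> carrier (LF l)" "\<phi> (L_proj l (u * x)) = cls u \<odot>\<^bsub>LF l\<^esub> \<phi> (L_proj l x)"
    "\<phi> (L_vec l) \<in> carrier (LF l)" "\<phi> (L_proj l x) = cls x \<odot>\<^bsub>LF l\<^esub> \<phi> (L_vec l)" "\<phi> \<in> extensional (carrier (L l))"
proof -
  have h: "\<phi> \<in> carrier (L l) \<rightarrow>\<^sub>E carrier (LF l)"
    "\<forall>u\<in>carrier U. \<forall>v\<in>carrier (L l). \<phi> (u \<odot>\<^bsub>L l\<^esub> v) = u \<odot>\<^bsub>LF l\<^esub> \<phi> v"
    using assms by (auto simp: HomLF_def module_homs_def)
  show 1: "\<phi> (L_proj l x) \<in> carrier (LF l)" for x using h(1) L_proj_closed by blast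
  show 2: "\<phi> (L_proj l (u * x)) = cls u \<odot>\<^bsub>LF l\<^esub> \<phi> (L_proj l x)" for u x
    using h(2) L_proj_closed[of l x] by (simp flip: presentsD(6)[OF presents_L])
  show "\<phi> (L_vec l) \<in> carrier (LF l)" using 1 by (simp add: L_vec_eq)
  show "\<phi> (L_proj l x) = cls x \<odot>\<^bsub>LF l\<^esub> \<phi> (L_vec l)" using 2[of x 1] by (simp add: L_vec_eq)
  show "\<phi> \<in> extensional (carrier (L l))" using h(1) by (simp add: PiE_def)
qed

lemma HomLF_radical:
  assumes "\<phi> \<in> HomLF l" "x \<in> radical l" shows "cls x \<odot>\<^bsub>LF l\<^esub> \<phi> (L_vec l) = \<zero>\<^bsub>LF l\<^esub>"
proof -
  have "L_proj l x = L_proj l 0" using assms(2) by (simp add: presentsD(3)[OF presents_L])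
  then have "cls x \<odot>\<^bsub>LF l\<^esub> \<phi> (L_vec l) = cls 0 \<odot>\<^bsub>LF l\<^esub> \<phi> (L_vec l)" by (simp flip: HomLFD(4)[OF assms(1)])
  then show ?thesis by (simp add: act_cls_0 HomLFD(3)[OF assms(1)])
qed

lemma Theta_cls: "\<phi> \<in> HomLF l \<Longrightarrow> Theta l \<phi> (cls z) = tz l (\<phi> (L_vec l)) 1 z"
  by (simp add: Theta_eq HomLFD(3) lead_cls)

lemma Theta_closed: "\<phi> \<in> HomLF l \<Longrightarrow> Theta l \<phi> \<in> carrier Fmod"
  by (simp add: Theta_eq HomLFD(3) lead_closed)

lemma Theta_annihilated:
  assumes \<phi>: "\<phi> \<in> HomLF l" shows "Theta l \<phi> \<in> F0_annihilated (Kneg l \<union> Kpos l)"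
proof -
  let ?Z = "\<phi> (L_vec l)"
  note Z = HomLFD(3)[OF \<phi>]
  have kill: "cls x \<odot>\<^bsub>LF l\<^esub> ?Z = \<zero>\<^bsub>LF l\<^esub>" if "x \<in> verma_kernel l" for x
    using HomLF_radical[OF \<phi>] that verma_kernel_radical by blast
  have E: "cls (gen (GE i)) \<odot>\<^bsub>LF l\<^esub> ?Z = \<zero>\<^bsub>LF l\<^esub>" for i
    using kill verma_kernel_E[of 1 i l] by simp
  \<comment> \<open>The vector has weight l, and pairing its first factor with 1 already accounts
    for q^l; the second factor is left with weight 0.\<close>
  have T: "tz l ?Z 1 (z * tmon n) = tz l ?Z 1 z" for n z
  proof -
    have "cls (tmon n - tchar l n *\<^sub>k 1) \<odot>\<^bsub>LF l\<^esub> ?Z = \<zero>\<^bsub>LF l\<^esub>"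
      using kill verma_tmon_scalar[of 1 n l] by simp
    then have "tz l (cls (tmon n - tchar l n *\<^sub>k 1) \<odot>\<^bsub>LF l\<^esub> ?Z) 1 z = 0" by (simp add: tz_zero)
    then have "tz l (cls (tmon n + (- tchar l n) *\<^sub>k 1) \<odot>\<^bsub>LF l\<^esub> ?Z) 1 z = 0" by simp
    then have "tz l ?Z (tmon n * 1) (z * tmon n) = tchar l n * tz l ?Z 1 z"
      unfolding tz_act_add[OF Z] tz_act_smul[OF Z] LF_D(6)[OF Z] tz_tmon[OF Z] by simp
    then show ?thesis unfolding tz_left(5)[OF Z] by simp
  qed
  have "tz l ?Z 1 (z * y) = 0" if "y \<in> f_span \<inter> radical l" for y z
    using tz_lower[OF Z, of y z] HomLF_radical[OF \<phi>, of y] that by (simp add: tz_zero)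
  moreover have "tz l ?Z 1 (z * x) = 0" if "x \<in> e_span" "\<forall>ms. vev l (free_antipode a x * fword ms) = 0" for x z
    using tz_raise[OF Z E that(1)] tz_antipode_zero[OF Z] that(2) by simp
  ultimately show ?thesis
    unfolding F0_annihilated_iff F0_iff Theta_cls[OF \<phi>] using Theta_closed[OF \<phi>] T by blast
qed

lemma Theta_inj: "inj_on (Theta l) (HomLF l)"
proof (rule inj_onI)
  fix \<phi> \<psi> assume \<phi>: "\<phi> \<in> HomLF l" and \<psi>: "\<psi> \<in> HomLF l" and eq: "Theta l \<phi> = Theta l \<psi>"
  let ?N = "{(\<phi> (L_proj l x), \<psi> (L_proj l x)) | x. True}"
  have lead: "tz l (\<phi> (L_vec l)) 1 z = tz l (\<psi> (L_vec l)) 1 z" for z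
    using Theta_cls[OF \<phi>, of z] Theta_cls[OF \<psi>, of z] eq by simp
  have "tz l (\<phi> (L_proj l x)) 1 z = tz l (\<psi> (L_proj l x)) 1 z" for x z
  proof -
    obtain y where y: "y \<in> f_span" "x - y \<in> verma_kernel l" using verma_f_span[of x l] by (elim bexE)
    have "L_proj l x = L_proj l y"
      unfolding presentsD(3)[OF presents_L] using y(2) verma_kernel_radical by blast
    then show ?thesis
      by (simp only: HomLFD(4)[OF \<phi>] HomLFD(4)[OF \<psi>] tz_lower[OF HomLFD(3)[OF \<phi>] y(1)] tz_lower[OF HomLFD(3)[OF \<psi>] y(1)] lead)
  qed
  then have one: "tz l Z 1 z = tz l Z' 1 z" if "(Z, Z') \<in> ?N" for Z Z' z using that by blast
  have act: "(cls u \<odot>\<^bsub>LF l\<^esub> Z, cls u \<odot>\<^bsub>LF l\<^esub> Z') \<in> ?N" if N: "(Z, Z') \<in> ?N" for Z Z' u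
  proof -
    obtain x where "Z = \<phi> (L_proj l x)" "Z' = \<psi> (L_proj l x)" using N by blast
    then have "cls u \<odot>\<^bsub>LF l\<^esub> Z = \<phi> (L_proj l (u * x))" "cls u \<odot>\<^bsub>LF l\<^esub> Z' = \<psi> (L_proj l (u * x))"
      by (simp_all add: HomLFD(2)[OF \<phi>] HomLFD(2)[OF \<psi>])
    then show ?thesis by blast
  qed
  have closed: "Z \<in> carrier (LF l) \<and> Z' \<in> carrier (LF l)" if "(Z, Z') \<in> ?N" for Z Z'
    using that HomLFD(1)[OF \<phi>] HomLFD(1)[OF \<psi>] by blast
  have "\<phi> (L_proj l x) = \<psi> (L_proj l x)" for x
    by (rule tz_determined[of ?N l, OF closed act one]) blast+
  then have "\<phi> v = \<psi> v" if "v \<in> carrier (L l)" for v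
    using that by (auto elim!: carrier_LE)
  then show "\<phi> = \<psi>" by (rule extensionalityI[OF HomLFD(5)[OF \<phi>] HomLFD(5)[OF \<psi>]])
qed

subsection \<open>Surjectivity\<close>

lemma LF_eqI:
  assumes Z: "Z \<in> carrier (LF l)" and Z': "Z' \<in> carrier (LF l)"
    and eq: "\<And>ks z. tz l Z (free_antipode a (eword ks)) z = tz l Z' (free_antipode a (eword ks)) z"
  shows "Z = Z'"
proof (rule tz_inj[OF Z Z'])
  fix u z
  have "highest_functional l (\<lambda>u. tz l Z u z + (- 1) * tz l Z' u z)"
    by (intro highest_functional_add highest_functional_scale tz_highest Z Z')
  from highest_functional_eq_0[OF this] eq show "tz l Z u z = tz l Z' u z" by simp
qed

text \<open>For fixed z the values g(z e-word) form a vector indexed by the words of length at most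
  n. A coefficient vector orthogonal to all rows \<eta>(y) is an element of the radical in U^+,
  hence kills g. So the vector lies in the span of these rows, and the linear formula for its
  coefficients turns them into values of translates of g.\<close>

lemma antipode_preimage_exists:
  assumes g: "g \<in> F0_annihilated (Kneg l \<union> Kpos l)"
  shows "\<exists>Z\<in>carrier (LF l). \<forall>ks z. tz l Z (free_antipode a (eword ks)) z = g (cls (z * eword ks))"
proof -
  have gF: "g \<in> carrier Fmod"
    and gpos: "\<And>x z. x \<in> e_span \<Longrightarrow> (\<And>ms. vev l (free_antipode a x * fword ms) = 0) \<Longrightarrow> g (cls (z * x)) = 0"
    using g unfolding F0_annihilated_iff F0_iff by blast+
  obtain n where n: "\<And>ks z. length ks \<ge> n \<Longrightarrow> g (cls (z * eword ks)) = 0" using Fmod_nilpotent[OF gF] by blast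
  define \<Omega> where "\<Omega> = {ks :: 'i list. length ks \<le> n}"
  have fin: "finite \<Omega>" using finite_lists_length_le[of "UNIV :: 'i set" n] by (simp add: \<Omega>_def)
  define W where "W = lspan {fword ms | ms :: 'i list. length ms \<le> n}"
  define \<eta> where "\<eta> y ks = vev l (free_antipode a (eword ks) * y)" for y :: "'i falg" and ks
  have \<eta>_add: "\<eta> (y + c *\<^sub>k y') = (\<lambda>ks. \<eta> y ks + c * \<eta> y' ks)" for y y' c
    by (simp add: \<eta>_def fun_eq_iff distrib_left vev_add vev_smul)
  \<comment> \<open>Outside \<Omega> both sides of the system vanish: here by orthogonality of
    different lengths, for g by the choice of n.\<close>
  have long: "\<eta> y ks = 0" if "y \<in> W" "ks \<notin> \<Omega>" for y ks
    using that(1) unfolding W_def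
  proof (induction rule: lspan.induct)
    case (step s y c)
    then show ?case
      using that(2) vev_antipode_fword[of ks _ l] by (auto simp: \<eta>_def \<Omega>_def distrib_left vev_add vev_smul)
  qed (simp add: \<eta>_def)
  have "\<exists>ps. set (map fst ps) \<subseteq> \<eta> ` W \<and>
    (\<forall>G. (\<forall>c. (\<forall>y\<in>\<eta> ` W. (\<Sum>x\<in>\<Omega>. c x * y x) = 0) \<longrightarrow> (\<Sum>x\<in>\<Omega>. c x * G x) = 0) \<longrightarrow>
      (\<forall>x\<in>\<Omega>. G x = (\<Sum>p\<leftarrow>ps. fst p x * (\<Sum>x'\<in>\<Omega>. snd p x' * G x'))))"
  proof (rule orthogonal_projection_exists[OF fin])
    fix y y' c assume "y \<in> \<eta> ` W" "y' \<in> \<eta> ` W"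
    then obtain x x' where x: "x \<in> W" "x' \<in> W" "y = \<eta> x" "y' = \<eta> x'" by blast
    have "x + c *\<^sub>k x' \<in> W" using x(1,2) unfolding W_def by (intro lspan_add lspan_smul)
    then show "(\<lambda>k. y k + c * y' k) \<in> \<eta> ` W" unfolding x(3,4) \<eta>_add[symmetric] by (rule imageI)
  qed
  then obtain ps where ps: "set (map fst ps) \<subseteq> \<eta> ` W"
    and proj: "\<forall>G. (\<forall>c. (\<forall>y\<in>\<eta> ` W. (\<Sum>x\<in>\<Omega>. c x * y x) = 0) \<longrightarrow> (\<Sum>x\<in>\<Omega>. c x * G x) = 0) \<longrightarrow>
      (\<forall>x\<in>\<Omega>. G x = (\<Sum>p\<leftarrow>ps. fst p x * (\<Sum>x'\<in>\<Omega>. snd p x' * G x')))" by (elim exE conjE)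
  \<comment> \<open>Reads a coefficient vector as an element of U^+, so that orthogonality becomes a
    statement about \<open>vev\<close> and the values of g become those of a translate.\<close>
  define comb where "comb c = (\<Sum>ks\<in>\<Omega>. c ks *\<^sub>k eword ks)" for c :: "'i list \<Rightarrow> kk"
  have comb_e: "comb c \<in> e_span" for c
    unfolding comb_def using fin
    by (induction \<Omega>) (simp_all add: word_span_zero word_span_add word_span_smul eword_in_e_span)
  have g_comb: "g (cls (z * comb c)) = (\<Sum>ks\<in>\<Omega>. c ks * g (cls (z * eword ks)))" for z c
  proof -
    have "g (cls (z * (\<Sum>ks\<in>S. c ks *\<^sub>k eword ks))) = (\<Sum>ks\<in>S. c ks * g (cls (z * eword ks)))" if "finite S" for S
      using that by (induction S) (simp_all add: Fmod_linear[OF gF] distrib_left)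
    then show ?thesis using fin by (simp add: comb_def)
  qed
  have vev_comb: "vev l (free_antipode a (comb c) * y) = (\<Sum>ks\<in>\<Omega>. c ks * \<eta> y ks)" for c y
  proof -
    have "vev l (free_antipode a (\<Sum>ks\<in>S. c ks *\<^sub>k eword ks) * y) = (\<Sum>ks\<in>S. c ks * \<eta> y ks)" if "finite S" for S
      using that
      by (induction S) (simp_all add: free_antipode_0 free_antipode_add free_antipode_smul distrib_right vev_add vev_smul \<eta>_def)
    then show ?thesis using fin by (simp add: comb_def)
  qed
  have g_proj: "g (cls (z * eword ks)) = (\<Sum>p\<leftarrow>ps. fst p ks * g (cls (z * comb (snd p))))" for z ks
  proof (cases "ks \<in> \<Omega>")
    case True
    have "\<forall>c. (\<forall>y\<in>\<eta> ` W. (\<Sum>x\<in>\<Omega>. c x * y x) = 0) \<longrightarrow> (\<Sum>ks\<in>\<Omega>. c ks * g (cls (z * eword ks))) = 0"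
    proof (intro allI impI)
      fix c assume c: "\<forall>y\<in>\<eta> ` W. (\<Sum>x\<in>\<Omega>. c x * y x) = 0"
      \<comment> \<open>Short f-words belong to W; longer ones are orthogonal to all words in
        \<Omega> by degree.\<close>
      have "vev l (free_antipode a (comb c) * fword ms) = 0" for ms
      proof (cases "length ms \<le> n")
        case True
        then have "fword ms \<in> W" unfolding W_def by (intro lspan_base) blast
        then show ?thesis unfolding vev_comb by (intro bspec[OF c] imageI)
      next
        case False
        then have "\<eta> (fword ms) ks = 0" if "ks \<in> \<Omega>" for ks
          using that vev_antipode_fword[of ks ms l] by (auto simp: \<eta>_def \<Omega>_def)
        then show ?thesis unfolding vev_comb by simp
      qed
      from gpos[OF comb_e this] show "(\<Sum>ks\<in>\<Omega>. c ks * g (cls (z * eword ks))) = 0" by (simp only: g_comb)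
    qed
    with spec[OF proj, of "\<lambda>ks. g (cls (z * eword ks))"] have "\<forall>ks\<in>\<Omega>. g (cls (z * eword ks)) = (\<Sum>p\<leftarrow>ps. fst p ks * (\<Sum>x\<in>\<Omega>. snd p x * g (cls (z * eword x))))"
      by (rule mp)
    then show ?thesis unfolding g_comb using True by (rule bspec)
  next
    case False
    have "fst p ks = 0" if "p \<in> set ps" for p
      using that ps long[OF _ False] by auto
    then have "(\<Sum>p\<leftarrow>ps. fst p ks * g (cls (z * comb (snd p)))) = 0" by (intro sum_list_zero) simp
    moreover have "g (cls (z * eword ks)) = 0" using False n by (simp add: \<Omega>_def)
    ultimately show ?thesis by simp
  qed
  have "\<exists>Q\<in>formal (L l) Fmod. \<forall>ks z. tval l (free_antipode a (eword ks)) z Q = (\<Sum>p\<leftarrow>ps. fst p ks * g (cls (z * comb (snd p))))"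
    using ps
  proof (induction ps)
    case Nil
    show ?case by (intro bexI[of _ 0]) (simp_all add: formal_zero)
  next
    case (Cons p ps)
    then obtain Q where Q: "Q \<in> formal (L l) Fmod"
      "\<And>ks z. tval l (free_antipode a (eword ks)) z Q = (\<Sum>p\<leftarrow>ps. fst p ks * g (cls (z * comb (snd p))))" by auto
    obtain y where y: "fst p = \<eta> y" using Cons.prems by auto
    \<comment> \<open>The summand y \<otimes> (translate of g) realizes the row \<eta>(y) with its
      coefficient, for all z simultaneously.\<close>
    let ?s = "Poly_Mapping.single (L_proj l y, cls (comb (snd p)) \<odot>\<^bsub>Fmod\<^esub> g) 1"
    have "?s + Q \<in> formal (L l) Fmod"
      by (intro formal_add formal_single Q(1) L_proj_closed Fmod_smult_closed gF)
    moreover have "tval l (free_antipode a (eword ks)) z (?s + Q) = (\<Sum>p\<leftarrow>p # ps. fst p ks * g (cls (z * comb (snd p))))" for ks z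
      by (simp add: tval_add tval_single Q(2) pair_L_proj y \<eta>_def Fmod_smult_cls)
    ultimately show ?case by blast
  qed
  then obtain Q where "Q \<in> formal (L l) Fmod"
    "\<And>ks z. tval l (free_antipode a (eword ks)) z Q = g (cls (z * eword ks))" unfolding g_proj[symmetric] by blast
  then show ?thesis by (intro bexI[of _ "tcls (L l) Fmod Q"]) (simp_all add: tz_tcls tensor_module_simps(1))
qed

text \<open>Both identities are tested on antipodes of e-words. For e_i the equation for the longer
  word e_i x is exactly what makes the two terms of the coproduct cancel; for the torus the powers
  of q from moving t past the word cancel because g has weight 0.\<close>

lemma antipode_preimage_highest:
  assumes Z: "Z \<in> carrier (LF l)" and g: "g \<in> F0"
    and S: "\<And>ks z. tz l Z (free_antipode a (eword ks)) z = g (cls (z * eword ks))"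
  shows "cls (gen (GE i)) \<odot>\<^bsub>LF l\<^esub> Z = \<zero>\<^bsub>LF l\<^esub>" "cls (tmon n) \<odot>\<^bsub>LF l\<^esub> Z = scal (tchar l n) \<odot>\<^bsub>LF l\<^esub> Z"
proof -
  have gF: "g \<in> carrier Fmod" and g0: "\<And>n z. g (cls (z * tmon n)) = g (cls z)" using g by (simp_all add: F0_iff)
  have move: "tz l Z (free_antipode a (eword ks) * (tmon n * u)) z
      = qpow (- word_weight n ks) * tchar l n * tz l Z (free_antipode a (eword ks) * u) z" for ks n u z
  proof -
    have "free_antipode a (eword ks) * tmon n \<doteq> qpow (- word_weight n ks) *\<^sub>k (tmon n * free_antipode a (eword ks))"
      using I.qcommute_flip[OF tmon_antipode_eword] by (simp add: I.qcommute_def)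
    from tz_left(3)[OF Z I.cong_mult_right[OF this, of u]] show ?thesis
      by (simp add: tz_left(2,5)[OF Z] mult.assoc)
  qed
  show "cls (gen (GE i)) \<odot>\<^bsub>LF l\<^esub> Z = \<zero>\<^bsub>LF l\<^esub>"
  proof (rule LF_eqI[OF LF_D(2)[OF Z] LF_zero_closed])
    fix ks z
    let ?A = "free_antipode a (eword ks)" and ?S = "free_antipode a (gen (GE i))"
    have "tz l Z (?A * gen (GE i)) z = tz l Z (?A * (- (gen_K a i * ?S))) z"
      by (intro tz_left(3)[OF Z] I.cong_mult_left antipode_E)
    also have "\<dots> = - tz l Z (?A * (gen_K a i * ?S)) z" by (simp add: tz_left(6)[OF Z])
    also have "\<dots> = - (qpow (- word_weight (\<lambda>j. a j i) ks) * tchar l (\<lambda>j. a j i) * tz l Z (?A * ?S) z)"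
      by (simp add: gen_K_eq move)
    also have "tz l Z (?A * ?S) z = tz l Z ?A (z * gen (GE i))"
      using S[of "i # ks" z] S[of ks "z * gen (GE i)"] by (simp add: word_Cons free_antipode_mult mult.assoc)
    finally have "tz l Z (?A * gen (GE i)) z + tz l Z (?A * gen_K a i) (z * gen (GE i)) = 0"
      using move[of ks "\<lambda>j. a j i" 1 "z * gen (GE i)"] by (simp add: gen_K_eq)
    then show "tz l (cls (gen (GE i)) \<odot>\<^bsub>LF l\<^esub> Z) ?A z = tz l \<zero>\<^bsub>LF l\<^esub> ?A z" by (simp add: tz_E[OF Z] tz_zero)
  qed
  show "cls (tmon n) \<odot>\<^bsub>LF l\<^esub> Z = scal (tchar l n) \<odot>\<^bsub>LF l\<^esub> Z"
  proof (rule LF_eqI[OF LF_D(2)[OF Z] LF_D(7)[OF Z]])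
    fix ks z
    let ?A = "free_antipode a (eword ks)" and ?w = "word_weight n ks"
    have "z * (tmon n * eword ks) \<doteq> z * (qpow ?w *\<^sub>k (eword ks * tmon n))"
      using I.tmon_eword[of n ks] by (intro I.cong_mult_left) (simp add: I.qcommute_def)
    then have "g (cls (z * tmon n * eword ks)) = g (cls (qpow ?w *\<^sub>k (z * eword ks * tmon n)))"
      by (simp add: cls_eq_iff[symmetric] mult.assoc)
    also have "\<dots> = qpow ?w * g (cls (z * eword ks))" by (simp only: Fmod_linear(3)[OF gF] g0)
    finally have "tz l Z ?A (z * tmon n) = qpow ?w * tz l Z ?A z" unfolding S .
    then show "tz l (cls (tmon n) \<odot>\<^bsub>LF l\<^esub> Z) ?A z = tz l (scal (tchar l n) \<odot>\<^bsub>LF l\<^esub> Z) ?A z"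
      using move[of ks n 1 "z * tmon n"] by (simp add: tz_tmon[OF Z] tz_scal[OF Z] flip: mult.assoc)
  qed
qed

lemma verma_kernel_vanishing:
  assumes Z: "Z \<in> carrier (LF l)" and E: "\<And>i. cls (gen (GE i)) \<odot>\<^bsub>LF l\<^esub> Z = \<zero>\<^bsub>LF l\<^esub>"
    and T: "\<And>n. cls (tmon n) \<odot>\<^bsub>LF l\<^esub> Z = scal (tchar l n) \<odot>\<^bsub>LF l\<^esub> Z"
  shows "verma_kernel l \<subseteq> vanishing l Z"
proof
  note V = left_idealD[OF vanishing_left_ideal[OF Z]]
  have "cls ` vanishing l Z \<in> ksubspaces Ureg" by (rule cls_image_ksubspace[OF V(1,2,4)])
  moreover have "{u \<otimes>\<^bsub>U\<^esub> e i | u i. u \<in> carrier U} \<union> {u \<otimes>\<^bsub>U\<^esub> (s \<ominus>\<^bsub>U\<^esub> scal (qchar l s)) | u s. u \<in> carrier U \<and> s \<in> Tgroup}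
      \<subseteq> cls ` vanishing l Z"
  proof (intro Un_least subsetI)
    fix v assume "v \<in> {u \<otimes>\<^bsub>U\<^esub> e i | u i. u \<in> carrier U}"
    then obtain u i where "v = cls (u * gen (GE i))" by (auto elim!: carrier_UE simp: e_def cls_mult)
    moreover have "u * gen (GE i) \<in> vanishing l Z" by (intro V(3)) (simp add: vanishing_def E)
    ultimately show "v \<in> cls ` vanishing l Z" by blast
  next
    fix v assume "v \<in> {u \<otimes>\<^bsub>U\<^esub> (s \<ominus>\<^bsub>U\<^esub> scal (qchar l s)) | u s. u \<in> carrier U \<and> s \<in> Tgroup}"
    then obtain u s where v: "v = cls u \<otimes>\<^bsub>U\<^esub> (s \<ominus>\<^bsub>U\<^esub> scal (qchar l s))" "s \<in> Tgroup" by (auto elim!: carrier_UE)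
    obtain n where s: "s = cls (tmon n)" using Tgroup_tmon[OF v(2)] by blast
    have "tmon n + (- tchar l n) *\<^sub>k 1 \<in> vanishing l Z"
      unfolding vanishing_iff[OF Z] tz_act_add[OF Z] tz_act_smul[OF Z] LF_D(6)[OF Z] T tz_scal[OF Z] by simp
    then have "u * (tmon n - tchar l n *\<^sub>k 1) \<in> vanishing l Z" by (intro V(3)) simp
    moreover have "v = cls (u * (tmon n - tchar l n *\<^sub>k 1))"
      unfolding v(1) s qchar_tmon scal_eq cls_mult cls_diff ..
    ultimately show "v \<in> cls ` vanishing l Z" by blast
  qed
  ultimately have sub: "verma_ideal l \<subseteq> cls ` vanishing l Z" unfolding verma_ideal_def by (rule kspan_minimal)
  fix x assume "x \<in> verma_kernel l"
  then obtain y where "cls x = cls y" "y \<in> vanishing l Z" using sub by (auto simp: verma_kernel_def)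
  then show "x \<in> vanishing l Z" by (simp add: vanishing_def)
qed

text \<open>Elements of the radical reduce modulo the Verma kernel to radical elements of U^-, and
  these act on the coordinate at 1 by right translation of g. So that coordinate vanishes on the
  whole submodule generated by the radical, and \<open>tz_determined\<close> extends this to all
  coordinates.\<close>

lemma radical_vanishing:
  assumes Z: "Z \<in> carrier (LF l)" and V: "verma_kernel l \<subseteq> vanishing l Z"
    and y: "\<And>y z. y \<in> f_span \<inter> radical l \<Longrightarrow> tz l Z 1 (z * y) = 0"
  shows "radical l \<subseteq> vanishing l Z"
proof
  let ?N = "{(cls x \<odot>\<^bsub>LF l\<^esub> Z, \<zero>\<^bsub>LF l\<^esub>) | x. x \<in> radical l}"
  note R = left_idealD[OF radical_left_ideal[of l]]
  have one: "tz l W 1 z = tz l W' 1 z" if N: "(W, W') \<in> ?N" for W W' z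
  proof -
    obtain x where x: "x \<in> radical l" "W = cls x \<odot>\<^bsub>LF l\<^esub> Z" "W' = \<zero>\<^bsub>LF l\<^esub>" using N by blast
    obtain v where v: "v \<in> f_span" "x - v \<in> verma_kernel l" using verma_f_span[of x l] by (elim bexE)
    have "x - v \<in> radical l" using v(2) verma_kernel_radical by blast
    from R(6)[OF x(1) this] v(1) have "v \<in> f_span \<inter> radical l" by simp
    then have "tz l (cls v \<odot>\<^bsub>LF l\<^esub> Z) 1 z = 0" using y tz_lower[OF Z v(1)] by simp
    moreover have "cls (x - v) \<odot>\<^bsub>LF l\<^esub> Z = \<zero>\<^bsub>LF l\<^esub>" using v(2) V by (auto simp: vanishing_def)
    ultimately show ?thesis using tz_act_add[OF Z, of "x - v" v 1 z] by (simp add: x tz_zero)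
  qed
  have act: "(cls u \<odot>\<^bsub>LF l\<^esub> W, cls u \<odot>\<^bsub>LF l\<^esub> W') \<in> ?N" if N: "(W, W') \<in> ?N" for W W' u
  proof -
    obtain x where x: "x \<in> radical l" "W = cls x \<odot>\<^bsub>LF l\<^esub> Z" "W' = \<zero>\<^bsub>LF l\<^esub>" using N by blast
    have "cls u \<odot>\<^bsub>LF l\<^esub> \<zero>\<^bsub>LF l\<^esub> = \<zero>\<^bsub>LF l\<^esub>"
      using LF_D(5)[OF Z, of u 0] by (simp add: act_cls_0[OF Z])
    then show ?thesis using R(3)[OF x(1), of u] unfolding x(2,3) LF_D(5)[OF Z, symmetric] by auto
  qed
  have closed: "W \<in> carrier (LF l) \<and> W' \<in> carrier (LF l)" if "(W, W') \<in> ?N" for W W'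
    using that LF_D(2)[OF Z] LF_zero_closed by blast
  fix x assume "x \<in> radical l"
  then have "(cls x \<odot>\<^bsub>LF l\<^esub> Z, \<zero>\<^bsub>LF l\<^esub>) \<in> ?N" by blast
  from tz_determined[of ?N l, OF closed act one this] show "x \<in> vanishing l Z" by (simp add: vanishing_def)
qed

lemma HomLF_of_vector:
  assumes Z: "Z \<in> carrier (LF l)" and V: "radical l \<subseteq> vanishing l Z"
  shows "\<exists>\<phi>\<in>HomLF l. \<phi> (L_vec l) = Z"
proof
  define \<phi> where "\<phi> = (\<lambda>v\<in>carrier (L l). cls (SOME x. v = L_proj l x) \<odot>\<^bsub>LF l\<^esub> Z)"
  note P = presentsD[OF presents_L[of l]]
  have \<phi>: "\<phi> (L_proj l x) = cls x \<odot>\<^bsub>LF l\<^esub> Z" for x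
  proof -
    let ?y = "SOME y. L_proj l x = L_proj l y"
    have "L_proj l x = L_proj l ?y" by (rule someI[of _ x]) simp
    then have "x - ?y \<in> vanishing l Z" unfolding P(3) using V by blast
    then have "tz l (cls (x - ?y) \<odot>\<^bsub>LF l\<^esub> Z) u z = 0" for u z by (simp add: vanishing_iff[OF Z])
    then have "tz l (cls x \<odot>\<^bsub>LF l\<^esub> Z) u z = tz l (cls ?y \<odot>\<^bsub>LF l\<^esub> Z) u z" for u z
      using tz_act_add[OF Z, of "x - ?y" ?y u z] by simp
    then have "cls x \<odot>\<^bsub>LF l\<^esub> Z = cls ?y \<odot>\<^bsub>LF l\<^esub> Z" by (rule tz_inj[OF LF_D(2)[OF Z] LF_D(2)[OF Z]])
    then show ?thesis by (simp add: \<phi>_def L_proj_closed)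
  qed
  show "\<phi> \<in> HomLF l"
    unfolding HomLF_def module_homs_def
  proof (intro CollectI conjI ballI)
    have "\<phi> v \<in> carrier (LF l)" if "v \<in> carrier (L l)" for v
      using that by (auto elim!: carrier_LE simp: \<phi> LF_D(2)[OF Z])
    then show "\<phi> \<in> carrier (L l) \<rightarrow>\<^sub>E carrier (LF l)" by (auto simp: \<phi>_def)
  next
    fix v w assume "v \<in> carrier (L l)" "w \<in> carrier (L l)"
    then show "\<phi> (v \<oplus>\<^bsub>L l\<^esub> w) = \<phi> v \<oplus>\<^bsub>LF l\<^esub> \<phi> w"
      by (auto elim!: carrier_LE simp: P(4) \<phi> LF_D(4)[OF Z])
  next
    fix u v assume "u \<in> carrier U" "v \<in> carrier (L l)"
    then show "\<phi> (u \<odot>\<^bsub>L l\<^esub> v) = u \<odot>\<^bsub>LF l\<^esub> \<phi> v"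
      by (auto elim!: carrier_LE carrier_UE simp: P(6) \<phi> LF_D(5)[OF Z])
  qed
  show "\<phi> (L_vec l) = Z" by (simp add: L_vec_eq \<phi> LF_D(6)[OF Z])
qed

lemma Theta_surj:
  assumes g: "g \<in> F0_annihilated (Kneg l \<union> Kpos l)"
  shows "\<exists>\<phi>\<in>HomLF l. Theta l \<phi> = g"
proof -
  have g0: "g \<in> F0" and gneg: "\<And>y z. y \<in> f_span \<inter> radical l \<Longrightarrow> g (cls (z * y)) = 0"
    using g unfolding F0_annihilated_iff by blast+
  obtain Z where Z: "Z \<in> carrier (LF l)" and S: "\<And>ks z. tz l Z (free_antipode a (eword ks)) z = g (cls (z * eword ks))"
    using antipode_preimage_exists[OF g] by blast
  have one: "tz l Z 1 z = g (cls z)" for z using S[of "[]" z] by (simp add: free_antipode_1)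
  have "verma_kernel l \<subseteq> vanishing l Z"
    by (rule verma_kernel_vanishing[OF Z antipode_preimage_highest[OF Z g0 S]])
  then have "radical l \<subseteq> vanishing l Z" by (rule radical_vanishing[OF Z]) (simp add: one gneg)
  from HomLF_of_vector[OF Z this] obtain \<phi> where \<phi>: "\<phi> \<in> HomLF l" "\<phi> (L_vec l) = Z" by blast
  have "g = lead l Z" using g0 by (intro lead_unique[OF Z]) (simp_all add: F0_iff one)
  then have "Theta l \<phi> = g" using Theta_eq[of \<phi> l, OF HomLFD(3)[OF \<phi>(1)]] by (simp add: \<phi>(2))
  with \<phi>(1) show ?thesis by blast
qed

lemma Theta_add:
  assumes \<phi>: "\<phi> \<in> HomLF l" and \<psi>: "\<psi> \<in> HomLF l"
  shows "Theta l (hom_add l \<phi> \<psi>) = Theta l \<phi> \<oplus>\<^bsub>Fmod\<^esub> Theta l \<psi>"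
proof -
  have v: "hom_add l \<phi> \<psi> (L_vec l) = \<phi> (L_vec l) \<oplus>\<^bsub>LF l\<^esub> \<psi> (L_vec l)"
    by (simp add: hom_add_def L_vec_closed)
  note Z = HomLFD(3)[OF \<phi>] HomLFD(3)[OF \<psi>]
  have c: "hom_add l \<phi> \<psi> (L_vec l) \<in> carrier (LF l)" unfolding v by (rule LF_D(1)[OF Z])
  show ?thesis
    unfolding Theta_eq[of "hom_add l \<phi> \<psi>", OF c]
    by (rule lead_unique[OF c, symmetric])
      (simp_all add: Fmod_add_closed Theta_closed \<phi> \<psi> Fmod_add_cls Theta_cls v tz_add[OF Z])
qed

lemma Theta_scale:
  assumes \<phi>: "\<phi> \<in> HomLF l"
  shows "Theta l (hom_scale l c \<phi>) = scal c \<odot>\<^bsub>Fmod\<^esub> Theta l \<phi>"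
proof -
  have v: "hom_scale l c \<phi> (L_vec l) = scal c \<odot>\<^bsub>LF l\<^esub> \<phi> (L_vec l)"
    by (simp add: hom_scale_def L_vec_closed)
  note Z = HomLFD(3)[OF \<phi>]
  have c: "hom_scale l c \<phi> (L_vec l) \<in> carrier (LF l)" unfolding v by (rule LF_D(7)[OF Z])
  show ?thesis
    unfolding Theta_eq[of "hom_scale l c \<phi>", OF c]
    by (rule lead_unique[OF c, symmetric])
      (simp_all add: Fmod_scal_closed Theta_closed \<phi> Fmod_scal_cls Theta_cls v tz_scal[OF Z])
qed

end

theorem theorem5:
  fixes a :: "'i::finite \<Rightarrow> 'i \<Rightarrow> int"
    and form :: "'i weight \<Rightarrow> 'i weight \<Rightarrow> rat"
    and lam :: "'i weight"
  assumes "quantum_datum a form"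
  shows
    "let H = quantum_datum.HomLF a form lam;
         \<Theta> = quantum_datum.Theta a form lam;
         F = quantum_datum.Fmod a form
     in (\<forall>\<phi>\<in>H. \<exists>!g. quantum_datum.leading_coeff a form lam \<phi> g) \<and>
        \<Theta> \<in> H \<rightarrow> quantum_datum.F0 a form \<and>
        (\<forall>\<phi>\<in>H. \<forall>\<psi>\<in>H. \<Theta> (quantum_datum.hom_add a form lam \<phi> \<psi>) = \<Theta> \<phi> \<oplus>\<^bsub>F\<^esub> \<Theta> \<psi>) \<and>
        (\<forall>c. \<forall>\<phi>\<in>H. \<Theta> (quantum_datum.hom_scale a form lam c \<phi>)
           = quantum_datum.scal a form c \<odot>\<^bsub>F\<^esub> \<Theta> \<phi>) \<and>
        inj_on \<Theta> H \<and>
        \<Theta> ` H = quantum_datum.F0_annihilated a form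
          (quantum_datum.Kneg a form lam \<union> quantum_datum.Kpos a form lam)"
proof -
  interpret quantum_datum a form by fact
  have "\<forall>\<phi>\<in>HomLF lam. \<exists>!g. leading_coeff lam \<phi> g" by (simp add: leading_coeff_iff HomLFD(3))
  moreover have "Theta lam \<in> HomLF lam \<rightarrow> F0"
    using Theta_annihilated by (fastforce simp: F0_annihilated_def)
  moreover have "Theta lam ` HomLF lam = F0_annihilated (Kneg lam \<union> Kpos lam)"
    using Theta_annihilated Theta_surj by blast
  ultimately show ?thesis unfolding Let_def using Theta_add Theta_scale Theta_inj by blast
qed

end
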